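(* Let $k$ be an algebraically closed field of prime characteristic $p$. Let $P$ be a $p$-subgroup of a finite group $G$, and let $\mathcal{F} = \mathcal{F}_P(G)$ be the fusion system of $G$ on $P$. Suppose that $\mathcal{F}$ is saturated and that $\mathcal{F} = \mathcal{F}_P(N_G(P))$. Suppose that, for every subgroup $Q$ of $P$, at least one of the following holds: (a) $N_P(Q) = QC_P(Q)$; (b) $C_G(Q)$ is $p$-nilpotent. Then the Scott module $\mathrm{Sc}(G,P)$ is Brauer indecomposable.
   Context: All modules over finite group algebras are finitely generated unitary left modules; $k$ also denotes the trivial module. $\mathrm{Res}^G_H$ denotes restriction from $kG$ to $kH$. A finite group is $p$-nilpotent if it has a normal subgroup of order prime to $p$ whose quotient is a $p$-group. Brauer construction: for a finite group $G$, a $kG$-module $M$ and a $p$-subgroup $Q$ of $G$, $M(Q) = M^Q / \sum_{R<Q}\mathrm{Tr}_R^Q(M^R)$, where $R$ runs over the proper subgroups of $Q$, $M^Q$ is the space of $Q$-fixed points and $\mathrm{Tr}^Q_R(m)=\sum_{x\in Q/R} xm$. It is a $kN_G(Q)$-module. A $p$-permutation $kG$-module is a $kG$-module that, for every $p$-subgroup $Q$ of $G$, has a $k$-basis permuted by $Q$ (equivalently, a direct summand of a permutation module). A $p$-permutation $kG$-module $M$ is called Brauer indecomposable if for every $p$-subgroup $Q$ of $G$ the $kC_G(Q)$-module $\mathrm{Res}^{N_G(Q)}_{C_G(Q)}(M(Q))$ is indecomposable or zero. Scott module: for a $p$-subgroup $P$ of a finite group $G$, $\mathrm{Sc}(G,P)$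 is the, up to isomorphism unique, indecomposable direct summand of the permutation module $kG/P=\mathrm{Ind}_P^G(k)$ that has the trivial $kG$-module as a quotient; it has $P$ as a vertex. Fusion system: for a $p$-subgroup $P$ of $G$ (not necessarily Sylow), $\mathcal{F}_P(G)$ is the category whose objects are the subgroups of $P$ and whose morphisms $Q\to R$ are the group homomorphisms $u\mapsto gug^{-1}$ for $g\in G$ with $gQg^{-1}\leq R$. Let $\mathcal{F}=\mathcal{F}_P(G)$ and write $\mathrm{Aut}_P(Q)$ for the group of automorphisms of $Q$ induced by conjugation by elements of $N_P(Q)$. A subgroup $Q\le P$ is fully automised if $\mathrm{Aut}_P(Q)$ is a Sylow $p$-subgroup of $\mathrm{Aut}_{\mathcal F}(Q)$; it is receptive if for every $R\le P$ and every isomorphism $\varphi:R\to Q$ in $\mathcal{F}$, $\varphi$ extends to a morphism $N_\varphi\to P$ in $\mathcal{F}$, where $N_\varphi=\{g\in N_P(R) : \varphi\circ c_g\circ\varphi^{-1}\in \mathrm{Aut}_P(Q)\}$ and $c_g$ is conjugation by $g$. $\mathcal{F}$ is saturated if every subgroup of $P$ is isomorphic in $\mathcal{F}$ to a subgroup of $P$ that is both fully automised and receptive. *)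

theory Defs
  imports
    "HOL-Algebra.Algebra"
    "HOL-Algebra.Left_Coset"
    "HOL-Algebra.Algebraic_Closure"
    "Jordan_Normal_Form.Missing_VectorSpace"
begin

definition ring_char :: "('a, 'b) ring_scheme \<Rightarrow> nat"
  where "ring_char R = Gcd {n :: nat. [n] \<cdot>\<^bsub>R\<^esub> \<one>\<^bsub>R\<^esub> = \<zero>\<^bsub>R\<^esub>}"

definition centralizer :: "('g, 'z) monoid_scheme \<Rightarrow> 'g set \<Rightarrow> 'g set"
  where "centralizer G Q = {g \<in> carrier G. \<forall>u\<in>Q. g \<otimes>\<^bsub>G\<^esub> u = u \<otimes>\<^bsub>G\<^esub> g}"

definition p_subgroup :: "nat \<Rightarrow> 'g set \<Rightarrow> ('g, 'z) monoid_scheme \<Rightarrow> bool"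
  where "p_subgroup p Q G \<longleftrightarrow> subgroup Q G \<and> (\<exists>n. card Q = p ^ n)"

definition sylow_subgroup :: "nat \<Rightarrow> 'g set \<Rightarrow> ('g, 'z) monoid_scheme \<Rightarrow> bool"
  where "sylow_subgroup p S G \<longleftrightarrow> subgroup S G \<and> card S = p ^ multiplicity p (order G)"

definition p_nilpotent :: "nat \<Rightarrow> ('g, 'z) monoid_scheme \<Rightarrow> bool"
  where "p_nilpotent p G \<longleftrightarrow>
    (\<exists>N. N \<lhd> G \<and> coprime (card N) p \<and> (\<exists>n. order (G Mod N) = p ^ n))"

text \<open>
  A fusion system on a group \<open>S\<close> is given by its morphism sets: \<open>F Q R\<close> is the set of morphisms
  from \<open>Q\<close> to \<open>R\<close>, as extensional functions on \<open>Q\<close>, and is empty unless \<open>Q\<close> and \<open>R\<close> are objects.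
  Composition is composition of maps. Two fusion systems on the same group are thus equal as
  categories iff they are equal as functions.
\<close>

type_synonym 'g fusion = "'g set \<Rightarrow> 'g set \<Rightarrow> ('g \<Rightarrow> 'g) set"

definition conj_map :: "('g, 'z) monoid_scheme \<Rightarrow> 'g set \<Rightarrow> 'g \<Rightarrow> 'g \<Rightarrow> 'g"
  where "conj_map G Q g = (\<lambda>u\<in>Q. g \<otimes>\<^bsub>G\<^esub> u \<otimes>\<^bsub>G\<^esub> inv\<^bsub>G\<^esub> g)"

definition fusion_system :: "('g, 'z) monoid_scheme \<Rightarrow> 'g set \<Rightarrow> 'g fusion"
  where "fusion_system G P Q R =
    (if subgroup Q (G\<lparr>carrier := P\<rparr>) \<and> subgroup R (G\<lparr>carrier := P\<rparr>)
     then {conj_map G Q g | g. g \<in> carrier G \<and> conj_map G Q g ` Q \<subseteq> R}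
     else {})"

definition fusion_iso :: "'g fusion \<Rightarrow> 'g set \<Rightarrow> 'g set \<Rightarrow> ('g \<Rightarrow> 'g) \<Rightarrow> bool"
  where "fusion_iso F Q R \<phi> \<longleftrightarrow> \<phi> \<in> F Q R \<and>
    (\<exists>\<psi>\<in>F R Q. compose Q \<psi> \<phi> = (\<lambda>u\<in>Q. u) \<and> compose R \<phi> \<psi> = (\<lambda>u\<in>R. u))"

definition fusion_aut :: "'g fusion \<Rightarrow> 'g set \<Rightarrow> ('g \<Rightarrow> 'g) set"
  where "fusion_aut F Q = {\<phi>. fusion_iso F Q Q \<phi>}"

definition conj_aut :: "('g, 'z) monoid_scheme \<Rightarrow> 'g set \<Rightarrow> ('g \<Rightarrow> 'g) set"
  where "conj_aut S Q = conj_map S Q ` normalizer S Q"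

definition fully_automised :: "nat \<Rightarrow> ('g, 'z) monoid_scheme \<Rightarrow> 'g fusion \<Rightarrow> 'g set \<Rightarrow> bool"
  where "fully_automised p S F Q \<longleftrightarrow>
    sylow_subgroup p (conj_aut S Q) (BijGroup Q\<lparr>carrier := fusion_aut F Q\<rparr>)"

text \<open>The subgroup usually written \<open>N\<^sub>\<phi>\<close>, for an isomorphism \<open>\<phi>\<close> from \<open>R\<close> to \<open>Q\<close>.\<close>

definition extension_domain ::
    "('g, 'z) monoid_scheme \<Rightarrow> 'g set \<Rightarrow> 'g set \<Rightarrow> ('g \<Rightarrow> 'g) \<Rightarrow> 'g set"
  where "extension_domain S R Q \<phi> = {g \<in> normalizer S R.
    compose Q \<phi> (compose Q (conj_map S R g) (inv_into R \<phi>)) \<in> conj_aut S Q}"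

definition receptive :: "('g, 'z) monoid_scheme \<Rightarrow> 'g fusion \<Rightarrow> 'g set \<Rightarrow> bool"
  where "receptive S F Q \<longleftrightarrow>
    (\<forall>R \<phi>. subgroup R S \<longrightarrow> fusion_iso F R Q \<phi> \<longrightarrow>
      (\<exists>\<psi>\<in>F (extension_domain S R Q \<phi>) (carrier S). \<forall>u\<in>R. \<psi> u = \<phi> u))"

definition saturated :: "nat \<Rightarrow> ('g, 'z) monoid_scheme \<Rightarrow> 'g fusion \<Rightarrow> bool"
  where "saturated p S F \<longleftrightarrow>
    (\<forall>Q. subgroup Q S \<longrightarrow>
      (\<exists>R \<phi>. subgroup R S \<and> fusion_iso F Q R \<phi> \<and> fully_automised p S F R \<and> receptive S F R))"

text \<open>
  A finitely generated left \<open>KG\<close>-module is a \<open>K\<close>-vector space \<open>M\<close> with a linear action \<open>\<rho>\<close> of \<open>G\<close>;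
  the \<open>KG\<close>-submodule generated by a set \<open>B\<close> is the \<open>K\<close>-span of the translates of \<open>B\<close>.
  The map \<open>\<rho>\<close> may be defined on more than \<open>G\<close> and \<open>carrier M\<close>, so restriction to a
  subgroup \<open>H\<close> leaves \<open>M\<close> and \<open>\<rho>\<close> unchanged and only replaces \<open>G\<close> by \<open>G\<lparr>carrier := H\<rparr>\<close>.
\<close>

locale group_module = vectorspace K M + G: group G
  for K :: "('k, 'y) ring_scheme" and G :: "('g, 'z) monoid_scheme"
    and M :: "('k, 'm, 'x) module_scheme" and \<rho> :: "'g \<Rightarrow> 'm \<Rightarrow> 'm" +
  assumes act_closed: "\<lbrakk>g \<in> carrier G; v \<in> carrier M\<rbrakk> \<Longrightarrow> \<rho> g v \<in> carrier M"
    and act_add: "\<lbrakk>g \<in> carrier G; v \<in> carrier M; w \<in> carrier M\<rbrakk>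
      \<Longrightarrow> \<rho> g (v \<oplus>\<^bsub>M\<^esub> w) = \<rho> g v \<oplus>\<^bsub>M\<^esub> \<rho> g w"
    and act_smult: "\<lbrakk>g \<in> carrier G; c \<in> carrier K; v \<in> carrier M\<rbrakk>
      \<Longrightarrow> \<rho> g (c \<odot>\<^bsub>M\<^esub> v) = c \<odot>\<^bsub>M\<^esub> \<rho> g v"
    and act_one: "v \<in> carrier M \<Longrightarrow> \<rho> \<one>\<^bsub>G\<^esub> v = v"
    and act_mult: "\<lbrakk>g \<in> carrier G; h \<in> carrier G; v \<in> carrier M\<rbrakk>
      \<Longrightarrow> \<rho> (g \<otimes>\<^bsub>G\<^esub> h) v = \<rho> g (\<rho> h v)"
    and finitely_generated:
      "\<exists>B. finite B \<and> B \<subseteq> carrier M \<and> gen_set (\<Union>g\<in>carrier G. \<rho> g ` B)"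

definition group_submodule ::
    "('k, 'y) ring_scheme \<Rightarrow> ('g, 'z) monoid_scheme \<Rightarrow> ('k, 'm, 'x) module_scheme
      \<Rightarrow> ('g \<Rightarrow> 'm \<Rightarrow> 'm) \<Rightarrow> 'm set \<Rightarrow> bool"
  where "group_submodule K G M \<rho> U \<longleftrightarrow>
    subspace K U M \<and> (\<forall>g\<in>carrier G. \<forall>u\<in>U. \<rho> g u \<in> U)"

definition is_direct_sum ::
    "('k, 'y) ring_scheme \<Rightarrow> ('g, 'z) monoid_scheme \<Rightarrow> ('k, 'm, 'x) module_scheme
      \<Rightarrow> ('g \<Rightarrow> 'm \<Rightarrow> 'm) \<Rightarrow> 'm set \<Rightarrow> 'm set \<Rightarrow> bool"
  where "is_direct_sum K G M \<rho> U V \<longleftrightarrow>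
    group_submodule K G M \<rho> U \<and> group_submodule K G M \<rho> V \<and>
    U \<inter> V = {\<zero>\<^bsub>M\<^esub>} \<and> U <+>\<^bsub>M\<^esub> V = carrier M"

definition indecomposable ::
    "('k, 'y) ring_scheme \<Rightarrow> ('g, 'z) monoid_scheme \<Rightarrow> ('k, 'm, 'x) module_scheme
      \<Rightarrow> ('g \<Rightarrow> 'm \<Rightarrow> 'm) \<Rightarrow> bool"
  where "indecomposable K G M \<rho> \<longleftrightarrow>
    group_module K G M \<rho> \<and> carrier M \<noteq> {\<zero>\<^bsub>M\<^esub>} \<and>
    (\<forall>U V. is_direct_sum K G M \<rho> U V \<longrightarrow> U = {\<zero>\<^bsub>M\<^esub>} \<or> V = {\<zero>\<^bsub>M\<^esub>})"

definition group_module_hom ::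
    "('k, 'y) ring_scheme \<Rightarrow> ('g, 'z) monoid_scheme
      \<Rightarrow> ('k, 'm, 'x) module_scheme \<Rightarrow> ('g \<Rightarrow> 'm \<Rightarrow> 'm)
      \<Rightarrow> ('k, 'n, 'w) module_scheme \<Rightarrow> ('g \<Rightarrow> 'n \<Rightarrow> 'n) \<Rightarrow> ('m \<Rightarrow> 'n) \<Rightarrow> bool"
  where "group_module_hom K G M \<rho> N \<sigma> f \<longleftrightarrow>
    mod_hom K M N f \<and> (\<forall>g\<in>carrier G. \<forall>v\<in>carrier M. f (\<rho> g v) = \<sigma> g (f v))"

text \<open>The ring fields \<open>mult\<close> and \<open>one\<close> of a module record carry no meaning.\<close>

definition trivial_module :: "('k, 'y) ring_scheme \<Rightarrow> ('k, 'k) module"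
  where "trivial_module K = \<lparr>carrier = carrier K, monoid.mult = (\<otimes>\<^bsub>K\<^esub>), one = \<one>\<^bsub>K\<^esub>,
    ring.zero = \<zero>\<^bsub>K\<^esub>, ring.add = (\<oplus>\<^bsub>K\<^esub>), smult = (\<otimes>\<^bsub>K\<^esub>)\<rparr>"

definition trivial_act :: "'g \<Rightarrow> 'm \<Rightarrow> 'm"
  where "trivial_act g v = v"

text \<open>
  The permutation module \<open>KG/P\<close>: a formal linear combination of left cosets is its coefficient
  function, and \<open>g\<close> sends the basis element \<open>C\<close> to \<open>gX\<close>.
\<close>

definition perm_module ::
    "('k, 'y) ring_scheme \<Rightarrow> ('g, 'z) monoid_scheme \<Rightarrow> 'g set \<Rightarrow> ('k, 'g set \<Rightarrow> 'k) module"
  where "perm_module K G P = ring.func_space K (lcosets\<^bsub>G\<^esub> P)"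

definition perm_act ::
    "('g, 'z) monoid_scheme \<Rightarrow> 'g set \<Rightarrow> 'g \<Rightarrow> ('g set \<Rightarrow> 'k) \<Rightarrow> 'g set \<Rightarrow> 'k"
  where "perm_act G P g f = (\<lambda>C\<in>lcosets\<^bsub>G\<^esub> P. f (inv\<^bsub>G\<^esub> g <#\<^bsub>G\<^esub> C))"

text \<open>The Scott module is determined up to isomorphism only, hence a predicate.\<close>

definition is_scott_module ::
    "('k, 'y) ring_scheme \<Rightarrow> ('g, 'z) monoid_scheme \<Rightarrow> 'g set \<Rightarrow> ('k, 'm, 'x) module_scheme
      \<Rightarrow> ('g \<Rightarrow> 'm \<Rightarrow> 'm) \<Rightarrow> bool"
  where "is_scott_module K G P M \<rho> \<longleftrightarrow>
    indecomposable K G M \<rho> \<and>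
    (\<exists>U V f. is_direct_sum K G (perm_module K G P) (perm_act G P) U V \<and>
      group_module_hom K G M \<rho> (perm_module K G P\<lparr>carrier := U\<rparr>) (perm_act G P) f \<and>
      bij_betw f (carrier M) U) \<and>
    (\<exists>f. group_module_hom K G M \<rho> (trivial_module K) trivial_act f \<and>
      f ` carrier M = carrier K)"

definition p_permutation_module ::
    "('k, 'y) ring_scheme \<Rightarrow> nat \<Rightarrow> ('g, 'z) monoid_scheme \<Rightarrow> ('k, 'm, 'x) module_scheme
      \<Rightarrow> ('g \<Rightarrow> 'm \<Rightarrow> 'm) \<Rightarrow> bool"
  where "p_permutation_module K p G M \<rho> \<longleftrightarrow>
    group_module K G M \<rho> \<and>
    (\<forall>Q. p_subgroup p Q G \<longrightarrow>
      (\<exists>B. vectorspace.basis K M B \<and> (\<forall>x\<in>Q. \<rho> x ` B = B)))"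

definition fixed_points :: "('k, 'm, 'x) module_scheme \<Rightarrow> ('g \<Rightarrow> 'm \<Rightarrow> 'm) \<Rightarrow> 'g set \<Rightarrow> 'm set"
  where "fixed_points M \<rho> Q = {v \<in> carrier M. \<forall>x\<in>Q. \<rho> x v = v}"

text \<open>On \<open>R\<close>-fixed points the summands do not depend on the chosen coset representatives.\<close>

definition rel_trace ::
    "('g, 'z) monoid_scheme \<Rightarrow> ('k, 'm, 'x) module_scheme \<Rightarrow> ('g \<Rightarrow> 'm \<Rightarrow> 'm)
      \<Rightarrow> 'g set \<Rightarrow> 'g set \<Rightarrow> 'm \<Rightarrow> 'm"
  where "rel_trace G M \<rho> R Q v =
    (\<Oplus>\<^bsub>M\<^esub>C\<in>lcosets\<^bsub>G\<lparr>carrier := Q\<rparr>\<^esub> R. \<rho> (SOME x. x \<in> C) v)"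

text \<open>The sum of the subspaces \<open>Tr\<^sub>R\<^sup>Q(M\<^sup>R)\<close> is the span of their union.\<close>

definition trace_sum ::
    "('k, 'y) ring_scheme \<Rightarrow> ('g, 'z) monoid_scheme \<Rightarrow> ('k, 'm, 'x) module_scheme
      \<Rightarrow> ('g \<Rightarrow> 'm \<Rightarrow> 'm) \<Rightarrow> 'g set \<Rightarrow> 'm set"
  where "trace_sum K G M \<rho> Q = module.span K M
    (\<Union>R\<in>{R. subgroup R G \<and> R \<subset> Q}. rel_trace G M \<rho> R Q ` fixed_points M \<rho> R)"

definition quotient_module :: "('k, 'm, 'x) module_scheme \<Rightarrow> 'm set \<Rightarrow> ('k, 'm set) module"
  where "quotient_module M U = \<lparr>carrier = a_rcosets\<^bsub>M\<^esub> U, monoid.mult = (\<lambda>C D. U), one = U,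
    ring.zero = U, ring.add = (<+>\<^bsub>M\<^esub>), smult = (\<lambda>c C. \<Union>v\<in>C. U +>\<^bsub>M\<^esub> c \<odot>\<^bsub>M\<^esub> v)\<rparr>"

definition brauer_module ::
    "('k, 'y) ring_scheme \<Rightarrow> ('g, 'z) monoid_scheme \<Rightarrow> ('k, 'm, 'x) module_scheme
      \<Rightarrow> ('g \<Rightarrow> 'm \<Rightarrow> 'm) \<Rightarrow> 'g set \<Rightarrow> ('k, 'm set) module"
  where "brauer_module K G M \<rho> Q =
    quotient_module (M\<lparr>carrier := fixed_points M \<rho> Q\<rparr>) (trace_sum K G M \<rho> Q)"

text \<open>Elements of the normalizer of \<open>Q\<close> permute the cosets that make up the Brauer module.\<close>

definition brauer_act :: "('g \<Rightarrow> 'm \<Rightarrow> 'm) \<Rightarrow> 'g \<Rightarrow> 'm set \<Rightarrow> 'm set"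
  where "brauer_act \<rho> g C = \<rho> g ` C"

definition brauer_indecomposable ::
    "('k, 'y) ring_scheme \<Rightarrow> nat \<Rightarrow> ('g, 'z) monoid_scheme \<Rightarrow> ('k, 'm, 'x) module_scheme
      \<Rightarrow> ('g \<Rightarrow> 'm \<Rightarrow> 'm) \<Rightarrow> bool"
  where "brauer_indecomposable K p G M \<rho> \<longleftrightarrow>
    p_permutation_module K p G M \<rho> \<and>
    (\<forall>Q. p_subgroup p Q G \<longrightarrow>
      carrier (brauer_module K G M \<rho> Q) = {\<zero>\<^bsub>brauer_module K G M \<rho> Q\<^esub>} \<or>
      indecomposable K (G\<lparr>carrier := centralizer G Q\<rparr>) (brauer_module K G M \<rho> Q) (brauer_act \<rho>))"

end

theory Submission
  imports Defs
begin

text \<open>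
The quotient \<open>f\<close> of the Scott module \<open>M\<close> onto \<open>k\<close> induces a functional \<open>fY\<close> on \<open>Y = M(Q)\<close>. Since \<open>N\<^sub>G(P)\<close>
controls fusion in \<open>P\<close>, it is the only \<open>C\<^sub>G(Q)\<close>-invariant functional on \<open>Y\<close> up to scalars. A relative trace
from \<open>Q\<close> to \<open>N = N\<^sub>G(Q)\<close> on \<open>Y\<close> that is killed by \<open>fY\<close> lifts to a relative trace on the indecomposable \<open>M\<close>, hence is
nilpotent. For \<open>H\<close> normal in \<open>N\<close> of index prime to \<open>p\<close>, split off a minimal \<open>H\<close>-summand of \<open>Y\<close> with \<open>fY \<noteq> 0\<close>. By induction
on larger \<open>p\<close>-subgroups a Sylow subgroup of \<open>H\<close> permutes a basis of the complement with stabilisers \<open>Q\<close>, so the projection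
to the complement is a relative trace; its average over \<open>N/H\<close> is nilpotent, but its \<open>N\<close>-conjugates agree
modulo the radical, so it vanishes. Take \<open>H = QC\<^sub>G(Q)\<close> in case (a). In case (b) take \<open>H = N\<close>; then the normal
\<open>p\<close>-complement of \<open>C\<^sub>G(Q)\<close> acts trivially, and a permutation basis of a second \<open>C\<^sub>G(Q)\<close>-summand would give a second
invariant functional.
\<close>

text \<open>Indecomposability of \<open>M\<close> is used in one form only: an endomorphism is
  bijective or nilpotent, and it is nilpotent as soon as \<open>f\<close> vanishes after it. The
  obstacle is that \<open>M(Q)\<close> has to be tested over \<open>C\<^sub>G(Q)\<close>, whereas
  only traces from \<open>Q\<close> to the whole of \<open>N\<close> lift to \<open>M\<close>. A
  projection that is merely \<open>H\<close>-equivariant must therefore be averaged over an index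
  prime to \<open>p\<close>. Saturation supplies this: some subgroup of \<open>P\<close> isomorphic
  to \<open>Q\<close> is fully automised, and as \<open>N\<^sub>G(P)\<close> controls fusion, the
  index statement can be carried back to \<open>Q\<close>: \<open>N\<^sub>P(Q)C\<^sub>G(Q)\<close>
  has index prime to \<open>p\<close> in \<open>N\<^sub>G(Q)\<close>. The same statement for
  \<open>Q = P\<close> allows the averaging that makes the functional unique. Where Krull-Schmidt
  would be quoted, orbits of a permutation basis are exchanged one at a time. The induction compares
  \<open>M(Q)\<close> with \<open>M(R)\<close> for \<open>R\<close> larger than \<open>Q\<close>.
  Iterated quotients would change the type of the vectors, so a decomposition of \<open>M(R)\<close>
  is expressed by two subspaces of \<open>M\<close> between the traces and the fixed
  vectors.\<close>

no_notation subset_mset (infix "<#" 50)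

section \<open>Actions of p-groups and sums modulo p\<close>

definition acts_on :: "('g, 'z) monoid_scheme \<Rightarrow> 'g set \<Rightarrow> 'i set \<Rightarrow> ('g \<Rightarrow> 'i \<Rightarrow> 'i) \<Rightarrow> bool"
 where "acts_on G S I act \<longleftrightarrow> (\<forall>g\<in>S. \<forall>i\<in>I. act g i \<in> I) \<and> (\<forall>i\<in>I. act \<one>\<^bsub>G\<^esub> i = i) \<and>
  (\<forall>g\<in>S. \<forall>h\<in>S. \<forall>i\<in>I. act (g \<otimes>\<^bsub>G\<^esub> h) i = act g (act h i))"

definition fixed_set :: "'g set \<Rightarrow> 'i set \<Rightarrow> ('g \<Rightarrow> 'i \<Rightarrow> 'i) \<Rightarrow> 'i set"
 where "fixed_set S I act = {i \<in> I. \<forall>g\<in>S. act g i = i}"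

text \<open>The bridge to the orbit-stabiliser theorem. \<open>acts_on\<close> leaves the maps
  unrestricted, so that \<open>\<rho>\<close> and left translation of cosets fit it directly,
  whereas \<open>group_action\<close> wants extensional bijections.\<close>

lemma (in group) acts_on_group_action:
 assumes "subgroup S G" "acts_on G S I act"
 shows "group_action (G(|carrier := S|)) I (\<lambda>g. restrict (act g) I)"
proof -
 interpret S: subgroup S G by fact
 interpret H: group "G(|carrier := S|)" using S.subgroup_is_group is_group by blast
 have cl: "act g i \<in> I" if "g \<in> S" "i \<in> I" for g i using assms that unfolding acts_on_def by blast
 have mu: "act (g \<otimes> h) i = act g (act h i)" if "g \<in> S" "h \<in> S" "i \<in> I" for g h i
  using assms that unfolding acts_on_def by blast
 have un: "act \<one> i = i" if "i \<in> I" for i using assms that unfolding acts_on_def by blast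
 have bij: "restrict (act g) I \<in> Bij I" if g: "g \<in> S" for g
 proof -
  have "bij_betw (act g) I I"
  proof (rule bij_betwI[where g = "act (inv g)"])
   show "act g \<in> I \<rightarrow> I" "act (inv g) \<in> I \<rightarrow> I" using cl g by auto
  next
   fix i assume "i \<in> I" then show "act (inv g) (act g i) = i"
    using mu[of "inv g" g i] g un by simp
  next
   fix i assume "i \<in> I" then show "act g (act (inv g) i) = i"
    using mu[of g "inv g" i] g un by simp
  qed
  then show ?thesis unfolding Bij_def
   by (simp add: bij_betw_cong[of I "restrict (act g) I" "act g"])
 qed
 have "(\<lambda>g. restrict (act g) I) \<in> hom (G(|carrier := S|)) (BijGroup I)"
 proof (rule homI)
  fix g assume "g \<in> carrier (G(|carrier := S|))"
  then show "restrict (act g) I \<in> carrier (BijGroup I)" using bij by (simp add: BijGroup_def)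
 next
  fix g h assume "g \<in> carrier (G(|carrier := S|))" "h \<in> carrier (G(|carrier := S|))"
  then have gh: "g \<in> S" "h \<in> S" by auto
  show "restrict (act (g \<otimes>\<^bsub>G(|carrier := S|)\<^esub> h)) I
    = restrict (act g) I \<otimes>\<^bsub>BijGroup I\<^esub> restrict (act h) I"
   using gh bij by (auto simp: BijGroup_def compose_def fun_eq_iff mu cl)
 qed
 then show ?thesis
  unfolding group_action_def group_hom_def group_hom_axioms_def
  using group_BijGroup H.is_group by blast
qed

text \<open>Orbit lengths divide \<open>p ^ n\<close>, and length 1 would mean a fixed point; so
  every orbit length is divisible by \<open>p\<close>.\<close>

lemma (in group) prime_dvd_card_acts_on:
 assumes p: "Factorial_Ring.prime (p::nat)" and S: "subgroup S G" "card S = p ^ n"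
  and act: "acts_on G S I act" and fin: "finite I" and nofix: "fixed_set S I act = {}"
 shows "p dvd card I"
proof -
 interpret S: subgroup S G by fact
 let ?H = "G(|carrier := S|)" and ?\<phi> = "\<lambda>g. restrict (act g) I"
 interpret A: group_action ?H I ?\<phi> by (rule acts_on_group_action[OF S(1) act])
 define r where "r = {(i, j). i \<in> I \<and> j \<in> orbit ?H ?\<phi> i}"
 have orb: "orbit ?H ?\<phi> i \<subseteq> I" if "i \<in> I" for i
  using that act unfolding orbit_def acts_on_def by auto
 have "equiv I r"
 proof (rule equivI)
  show "r \<subseteq> I \<times> I" using orb by (auto simp: r_def)
  show "refl_on I r" using A.orbit_refl by (simp add: r_def refl_on_def)
  show "sym r"
  proof (rule symI)
   fix i j assume "(i, j) \<in> r"
   then have "i \<in> I" "j \<in> I" "j \<in> orbit ?H ?\<phi> i" using orb by (auto simp: r_def)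
   then show "(j, i) \<in> r" using A.orbit_sym by (simp add: r_def)
  qed
  show "trans r"
  proof (rule transI)
   fix i j k assume ij: "(i, j) \<in> r" and jk: "(j, k) \<in> r"
   have "i \<in> I" "j \<in> I" "k \<in> I" "j \<in> orbit ?H ?\<phi> i" "k \<in> orbit ?H ?\<phi> j"
    using orb ij jk by (auto simp: r_def)
   then show "(i, k) \<in> r" using A.orbit_trans[of i j k] by (simp add: r_def)
  qed
 qed
 moreover have "p dvd card Z" if Z: "Z \<in> I // r" for Z
 proof -
  obtain i where i: "i \<in> I" "Z = orbit ?H ?\<phi> i"
  proof -
   from Z obtain i where i: "i \<in> I" "Z = r `` {i}" by (rule quotientE)
   have "r `` {i} = orbit ?H ?\<phi> i" unfolding r_def Image_def using i(1) by simp
   then show thesis using i that by simp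
  qed
  have "card Z * card (stabilizer ?H ?\<phi> i) = p ^ n"
   using A.orbit_stabilizer_theorem[OF i(1)] i(2) S(2) by (simp add: order_def)
  then have "card Z dvd p ^ n" by (metis dvd_triv_left)
  then obtain k where k: "card Z = p ^ k" using p divides_primepow_nat by blast
  have "card Z ~= 1"
  proof
   assume "card Z = 1"
   then obtain y where y: "Z = {y}" by (auto simp: card_1_singleton_iff)
   have "i \<in> Z" using i A.orbit_refl by simp
   have "act g i = i" if g: "g \<in> S" for g
   proof -
    have "?\<phi> g i \<in> Z" unfolding i(2) orbit_def using g by auto
    then show ?thesis using \<open>i \<in> Z\<close> y i(1) by simp
   qed
   then have "i \<in> fixed_set S I act" using i(1) unfolding fixed_set_def by blast
   then show False using nofix by blast
  qed
  then have "k ~= 0" using k by (intro notI) simp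
  then show ?thesis using k by (simp add: dvd_power)
 qed
 ultimately show ?thesis by (rule equiv_imp_dvd_card[OF fin])
qed

lemma (in abelian_monoid) finsum_fibres:
 assumes "finite A" "finite B" "h \<in> A \<rightarrow> B" "F \<in> A \<rightarrow> carrier G"
 shows "finsum G F A = (\<Oplus>b\<in>B. finsum G F {a \<in> A. h a = b})"
 using assms(1,3,4)
proof (induction A rule: finite_induct)
 case empty
 have "(\<Oplus>b\<in>B. finsum G F {a \<in> {}. h a = b}) = (\<Oplus>b\<in>B. \<zero>)" by (intro finsum_cong') auto
 then show ?case by simp
next
 case (insert a A)
 have Fc: "F \<in> A \<rightarrow> carrier G" "F a \<in> carrier G" "h a \<in> B" "h \<in> A \<rightarrow> B" using insert.prems by auto
 have cl: "finsum G F {x \<in> A. h x = b} \<in> carrier G" for b using Fc by (intro finsum_closed) auto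
 have eq: "finsum G F {x \<in> insert a A. h x = b} =
   (if b = h a then F a else \<zero>) \<oplus> finsum G F {x \<in> A. h x = b}" for b
 proof (cases "b = h a")
  case True
  have 1: "{x \<in> insert a A. h x = b} = insert a {x \<in> A. h x = b}" using True by auto
  have 2: "finsum G F (insert a {x \<in> A. h x = b}) = F a \<oplus> finsum G F {x \<in> A. h x = b}"
   using insert.hyps Fc by (intro finsum_insert) auto
  show ?thesis unfolding 1 2 using True by simp
 next
  case False
  have 1: "{x \<in> insert a A. h x = b} = {x \<in> A. h x = b}" using False by auto
  show ?thesis unfolding 1 using False cl[of b] by simp
 qed
 have "(\<Oplus>b\<in>B. finsum G F {x \<in> insert a A. h x = b}) =
   (\<Oplus>b\<in>B. (if b = h a then F a else \<zero>) \<oplus> finsum G F {x \<in> A. h x = b})"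
 proof (rule finsum_cong'[OF refl])
  show "(\<lambda>b. (if b = h a then F a else \<zero>) \<oplus> finsum G F {x \<in> A. h x = b}) \<in> B \<rightarrow> carrier G"
   using cl Fc by (intro Pi_I) auto
 qed (rule eq)
 also have "... = (\<Oplus>b\<in>B. (if b = h a then F a else \<zero>)) \<oplus> (\<Oplus>b\<in>B. finsum G F {x \<in> A. h x = b})"
 proof (rule finsum_addf)
  show "(\<lambda>b. if b = h a then F a else \<zero>) \<in> B \<rightarrow> carrier G" using Fc by (intro Pi_I) auto
  show "(\<lambda>b. finsum G F {x \<in> A. h x = b}) \<in> B \<rightarrow> carrier G" using cl by (intro Pi_I)
 qed
 also have "(\<Oplus>b\<in>B. (if b = h a then F a else \<zero>)) = F a"
  using add.finprod_singleton_swap[of "h a" B "\<lambda>_. F a"] Fc assms(2) by (simp add: Pi_def)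
 also have "(\<Oplus>b\<in>B. finsum G F {x \<in> A. h x = b}) = finsum G F A" using insert.IH Fc by simp
 also have "F a \<oplus> finsum G F A = finsum G F (insert a A)"
  by (rule finsum_insert[symmetric]) (use insert.hyps Fc in auto)
 finally show ?case by simp
qed

lemma (in abelian_monoid) finsum_swap:
 assumes "finite A" "finite B" "!!a b. a \<in> A ==> b \<in> B ==> F a b \<in> carrier G"
 shows "(\<Oplus>a\<in>A. \<Oplus>b\<in>B. F a b) = (\<Oplus>b\<in>B. \<Oplus>a\<in>A. F a b)"
 using assms(1,3)
proof (induction A rule: finite_induct)
 case empty then show ?case by simp
next
 case (insert a A)
 have 1: "(\<lambda>a. \<Oplus>b\<in>B. F a b) \<in> A \<rightarrow> carrier G" "(\<Oplus>b\<in>B. F a b) \<in> carrier G"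
   "!!b. b \<in> B ==> (\<lambda>a. F a b) \<in> A \<rightarrow> carrier G" "!!b. b \<in> B ==> F a b \<in> carrier G"
  using insert.prems by (auto intro!: finsum_closed)
 have "(\<Oplus>b\<in>B. \<Oplus>a\<in>insert a A. F a b) = (\<Oplus>b\<in>B. F a b \<oplus> (\<Oplus>a\<in>A. F a b))"
  using 1 insert.hyps insert.prems by (intro finsum_cong' refl) (auto intro!: finsum_closed)
 also have "... = (\<Oplus>b\<in>B. F a b) \<oplus> (\<Oplus>b\<in>B. \<Oplus>a\<in>A. F a b)"
  using 1 by (subst finsum_addf) (auto intro!: finsum_closed)
 finally show ?case using 1 insert by simp
qed

locale char_p_field = field K for K (structure) +
 fixes p :: nat
 assumes prime: "Factorial_Ring.prime p" and char: "[p] \<cdot> \<one> = \<zero>"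
begin

lemma nat_zero:
 assumes "p dvd n" "a \<in> carrier K" shows "[n] \<cdot> a = \<zero>"
proof -
 have "[p] \<cdot> a = [p] \<cdot> (\<one> \<otimes> a)" using assms by simp
 also have "... = ([p] \<cdot> \<one>) \<otimes> a" using assms by (subst add_pow_ldistr) auto
 finally have 0: "[p] \<cdot> a = \<zero>" using char assms by simp
 obtain m where "n = p * m" using assms by auto
 then show ?thesis using 0 assms add.nat_pow_pow[of a p m] by (metis add.nat_pow_one add.nat_pow_pow mult.commute)
qed

text \<open>Bezout gives \<open>n * x = p * y + 1\<close>, so \<open>n = 0\<close> in
  \<open>K\<close> would yield \<open>1 = 0\<close>.\<close>

lemma nat_nonzero:
 assumes "coprime n p" shows "[n] \<cdot> \<one> ~= \<zero>"
proof
 assume z: "[n] \<cdot> \<one> = \<zero>"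
 have "n ~= 0" using assms prime not_prime_1 by (metis coprime_0_left_iff is_unit_gcd nat_dvd_1_iff_1)
 then obtain x y where xy: "n * x = p * y + 1" using assms bezout_nat[of n p] by auto
 have "[(n * x)] \<cdot> \<one> = \<zero>" using z by (metis add.nat_pow_one add.nat_pow_pow mult.commute one_closed)
 moreover have "[(p * y + 1)] \<cdot> \<one> = [(p * y)] \<cdot> \<one> \<oplus> \<one>" using add.nat_pow_mult[of \<one> "p*y" 1] by simp
 ultimately show False using xy nat_zero[of "p * y" \<one>] by simp
qed

text \<open>Each fibre of \<open>F\<close> is an \<open>S\<close>-stable set without fixed points,
  so its size is divisible by \<open>p\<close> and its constant sum vanishes. Most of the later
  proofs that a vector lies in a trace subspace come down to this count.\<close>

lemma finsum_no_fixed: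
 assumes G: "group G" "subgroup S G" "card S = p ^ n"
  and act: "acts_on G S I act" and fin: "finite I" and nofix: "fixed_set S I act = {}"
  and F: "F \<in> I \<rightarrow> carrier K" "!!g i. g \<in> S ==> i \<in> I ==> F (act g i) = F i"
 shows "finsum K F I = \<zero>"
proof -
 have "finsum K F I = (\<Oplus>c\<in>F ` I. finsum K F {i \<in> I. F i = c})"
  using fin F by (intro finsum_fibres) auto
 also have "... = (\<Oplus>c\<in>F ` I. \<zero>)"
 proof (rule finsum_cong'[OF refl])
  fix c assume c: "c \<in> F ` I"
  let ?Z = "{i \<in> I. F i = c}"
  have "acts_on G S ?Z act" using act F unfolding acts_on_def by auto
  moreover have "fixed_set S ?Z act = {}" using nofix unfolding fixed_set_def by auto
  ultimately have "p dvd card ?Z"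
   using group.prime_dvd_card_acts_on[OF G(1) prime G(2,3), of ?Z act] fin by auto
  moreover have "finsum K F ?Z = finsum K (\<lambda>_. c) ?Z" using c F by (intro finsum_cong') auto
  moreover have "c \<in> carrier K" using c F by auto
  ultimately show "finsum K F ?Z = \<zero>" using nat_zero[of "card ?Z" c] add.finprod_const[of c ?Z] by presburger
 qed auto
 finally show ?thesis by simp
qed

text \<open>The indices that are not fixed form a stable set without fixed points, which contributes
  0.\<close>

lemma finsum_fixed_set:
 assumes G: "group G" "subgroup S G" "card S = p ^ n"
  and act: "acts_on G S I act" and fin: "finite I"
  and F: "F \<in> I \<rightarrow> carrier K" "!!g i. g \<in> S ==> i \<in> I ==> F (act g i) = F i"
 shows "finsum K F I = finsum K F (fixed_set S I act)"
proof -
 let ?J = "fixed_set S I act"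
 have J: "?J \<subseteq> I" by (auto simp: fixed_set_def)
 interpret S: subgroup S G by fact
 interpret G: group G by fact
 have "acts_on G S (I - ?J) act"
 proof -
  have "i \<in> ?J" if g: "g \<in> S" and i: "i \<in> I" and gi: "act g i \<in> ?J" for g i
  proof -
   have "act (inv\<^bsub>G\<^esub> g) (act g i) = act g i" using gi g by (simp add: fixed_set_def)
   moreover have "act (inv\<^bsub>G\<^esub> g \<otimes>\<^bsub>G\<^esub> g) i = act (inv\<^bsub>G\<^esub> g) (act g i)" "act \<one>\<^bsub>G\<^esub> i = i"
    using act g i S.m_inv_closed[OF g] unfolding acts_on_def by blast+
   ultimately have "act g i = i" using g by simp
   then show ?thesis using gi by simp
  qed
  then show ?thesis using act unfolding acts_on_def by auto
 qed
 moreover have "fixed_set S (I - ?J) act = {}" by (auto simp: fixed_set_def)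
 ultimately have 0: "finsum K F (I - ?J) = \<zero>"
  using G fin F by (intro finsum_no_fixed[of G S n _ act]) auto
 have "finsum K F I = finsum K F (?J \<union> (I - ?J))" using J by (simp add: Un_absorb1)
 also have "... = finsum K F ?J \<oplus> finsum K F (I - ?J)"
  using fin J F by (intro finsum_Un_disjoint) (auto intro: finite_subset)
 moreover have "finsum K F ?J \<in> carrier K" using J F by (intro finsum_closed) auto
 ultimately show ?thesis using 0 by simp
qed

end

section \<open>Left cosets and sums over them\<close>

text \<open>\<open>coset_sum\<close> is only meaningful for functions that are constant on the cosets of \<open>A\<close>.\<close>

definition cosets :: "('g, 'z) monoid_scheme \<Rightarrow> 'g set \<Rightarrow> 'g set \<Rightarrow> 'g set set"
 where "cosets G B A = (\<lambda>b. b <#\<^bsub>G\<^esub> A) ` B"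

definition coset_sum ::
  "('k, 'm, 'x) module_scheme \<Rightarrow> ('g, 'z) monoid_scheme \<Rightarrow> 'g set \<Rightarrow> 'g set \<Rightarrow> ('g \<Rightarrow> 'm) \<Rightarrow> 'm"
 where "coset_sum M G B A F = (\<Oplus>\<^bsub>M\<^esub>C\<in>cosets G B A. F (SOME x. x \<in> C))"

context group begin

lemma lcosets_eq_cosets: "lcosets\<^bsub>G(|carrier := B|)\<^esub> A = cosets G B A" "lcosets A = cosets G (carrier G) A"
 by (auto simp: LCOSETS_def cosets_def l_coset_def)

lemma cosets_rep:
 assumes "subgroup A G" "subgroup B G" "A \<subseteq> B" "C \<in> cosets G B A"
 shows "(SOME x. x \<in> C) \<in> C" "(SOME x. x \<in> C) \<in> B" "C = (SOME x. x \<in> C) <# A"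
  "!!x. x \<in> C ==> x \<in> B \<and> C = x <# A"
proof -
 obtain b where b: "b \<in> B" "C = b <# A" using assms(4) unfolding cosets_def by (rule imageE)
 have bG: "b \<in> carrier G" using subgroup.mem_carrier[OF assms(2) b(1)] .
 have "b \<in> C" unfolding b(2) using lcos_self[OF bG assms(1)] .
 then show 1: "(SOME x. x \<in> C) \<in> C" by (rule someI)
 show *: "x \<in> B \<and> C = x <# A" if x: "x \<in> C" for x
 proof
  obtain a where a: "a \<in> A" "x = b \<otimes> a" using x unfolding b(2) l_coset_def by blast
  then show "x \<in> B" using b(1) assms(3) subgroup.m_closed[OF assms(2)] by blast
  show "C = x <# A" unfolding b(2) using l_repr_independence[OF _ bG assms(1)] x b(2) by blast
 qed
 show "(SOME x. x \<in> C) \<in> B" "C = (SOME x. x \<in> C) <# A" using *[OF 1] by blast+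
qed

lemma l_coset_eq_iff:
 assumes A: "subgroup A G" and xy: "x \<in> carrier G" "y \<in> carrier G"
 shows "x <# A = y <# A \<longleftrightarrow> inv x \<otimes> y \<in> A"
proof
 assume "x <# A = y <# A"
 then have "y \<in> x <# A" using lcos_self[OF xy(2) A] by simp
 then obtain a where a: "a \<in> A" "y = x \<otimes> a" unfolding l_coset_def by blast
 then have "inv x \<otimes> y = a" using xy subgroup.mem_carrier[OF A a(1)] by (simp add: m_assoc[symmetric])
 then show "inv x \<otimes> y \<in> A" using a by simp
next
 assume a: "inv x \<otimes> y \<in> A"
 have "y = x \<otimes> (inv x \<otimes> y)" using xy by (simp add: m_assoc[symmetric])
 then have "y \<in> x <# A" using a unfolding l_coset_def by blast
 then show "x <# A = y <# A" using l_repr_independence[OF _ xy(1) A] by blast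
qed

lemma coset_sum_rep:
 assumes "subgroup A G" "subgroup B G" "A \<subseteq> B" "C \<in> cosets G B A" "x \<in> C"
  and "!!b a. b \<in> B ==> a \<in> A ==> F (b \<otimes> a) = F b"
 shows "F (SOME x. x \<in> C) = F x"
proof -
 have x: "x \<in> B" "C = x <# A" using cosets_rep(4)[OF assms(1-5)] by blast+
 have "(SOME x. x \<in> C) \<in> x <# A" using cosets_rep(1)[OF assms(1-4)] unfolding x(2)[symmetric] .
 then obtain a where "a \<in> A" "(SOME x. x \<in> C) = x \<otimes> a" unfolding l_coset_def by blast
 then show ?thesis using assms(6)[OF x(1)] by simp
qed

lemma cosets_left_bij:
 assumes "subgroup A G" "subgroup B G" "A \<subseteq> B" "g \<in> B"
 shows "bij_betw (\<lambda>C. g <# C) (cosets G B A) (cosets G B A)"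
proof -
 have sub: "B \<subseteq> carrier G" "A \<subseteq> carrier G"
  using subgroup.subset[OF assms(1)] subgroup.subset[OF assms(2)] by blast+
 have cl: "h <# C \<in> cosets G B A" if h: "h \<in> B" and C: "C \<in> cosets G B A" for h C
 proof -
  obtain b where b: "b \<in> B" "C = b <# A" using C by (auto simp: cosets_def)
  have "h \<in> carrier G" "b \<in> carrier G" using h b(1) sub(1) by blast+
  then have "h <# C = (h \<otimes> b) <# A" unfolding b(2) using sub(2) by (simp add: lcos_m_assoc)
  moreover have "h \<otimes> b \<in> B" using b(1) h subgroup.m_closed[OF assms(2)] by blast
  ultimately show ?thesis unfolding cosets_def by (rule image_eqI[where x = "h \<otimes> b"])
 qed
 have iv: "h <# (h' <# C) = C" if h: "h \<in> B" "h' \<in> B" "C \<in> cosets G B A" "h \<otimes> h' = \<one>" for h h' C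
 proof -
  have "C \<subseteq> carrier G" using cosets_rep(4)[OF assms(1-3) h(3)] sub(1) by blast
  moreover have "h \<in> carrier G" "h' \<in> carrier G" using h(1,2) sub(1) by blast+
  ultimately show ?thesis using lcos_m_assoc[of C h h'] lcos_mult_one[of C] h(4) by simp
 qed
 have g: "inv g \<in> B" "g \<in> carrier G"
  using subgroup.m_inv_closed[OF assms(2,4)] assms(4) sub(1) by blast+
 show ?thesis
 proof (rule bij_betwI[where g = "\<lambda>C. inv g <# C"])
  show "(<#) g \<in> cosets G B A \<rightarrow> cosets G B A" using cl[OF assms(4)] by (intro Pi_I)
  show "(<#) (inv g) \<in> cosets G B A \<rightarrow> cosets G B A" using cl[OF g(1)] by (intro Pi_I)
  show "inv g <# (g <# C) = C" if "C \<in> cosets G B A" for C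
   using iv[OF g(1) assms(4) that] g by simp
  show "g <# (inv g <# C) = C" if "C \<in> cosets G B A" for C
   using iv[OF assms(4) g(1) that] g by simp
 qed
qed

text \<open>Left translation by \<open>g\<close> permutes the cosets. This is what makes a relative
  trace fixed by, or equivariant under, the larger group.\<close>

lemma coset_sum_left:
 assumes "subgroup A G" "subgroup B G" "A \<subseteq> B" "g \<in> B" "abelian_monoid M"
  and F: "F \<in> B \<rightarrow> carrier M" "!!b a. b \<in> B ==> a \<in> A ==> F (b \<otimes> a) = F b"
 shows "coset_sum M G B A (\<lambda>x. F (g \<otimes> x)) = coset_sum M G B A F"
proof -
 interpret M: abelian_monoid M by fact
 note bij = cosets_left_bij[OF assms(1-4)]
 have rep: "(SOME x. x \<in> C) \<in> B" if "C \<in> cosets G B A" for C using cosets_rep(2)[OF assms(1-3) that] .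
 have "coset_sum M G B A F = (\<Oplus>\<^bsub>M\<^esub>C\<in>(\<lambda>C. g <# C) ` cosets G B A. F (SOME x. x \<in> C))"
  using bij unfolding coset_sum_def by (simp add: bij_betw_def)
 also have "... = (\<Oplus>\<^bsub>M\<^esub>C\<in>cosets G B A. F (SOME x. x \<in> g <# C))"
  using bij rep F by (intro M.finsum_reindex) (auto simp: bij_betw_def)
 also have "... = (\<Oplus>\<^bsub>M\<^esub>C\<in>cosets G B A. F (g \<otimes> (SOME x. x \<in> C)))"
 proof (rule M.finsum_cong'[OF refl])
  fix C assume C: "C \<in> cosets G B A"
  have "g \<otimes> (SOME x. x \<in> C) \<in> g <# C" using cosets_rep(1)[OF assms(1-3) C] by (auto simp: l_coset_def)
  moreover have "g <# C \<in> cosets G B A" using bij C by (auto simp: bij_betw_def)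
  ultimately show "F (SOME x. x \<in> g <# C) = F (g \<otimes> (SOME x. x \<in> C))"
   using coset_sum_rep[OF assms(1-3)] F by blast
 qed (use rep F assms subgroup.m_closed in fastforce)
 finally show ?thesis by (simp add: coset_sum_def)
qed

text \<open>Transitivity of relative traces. A coset of \<open>B\<close> splits into cosets of
  \<open>A\<close>, and translation by its representative identifies these with
  \<open>cosets G B A\<close>.\<close>

lemma coset_sum_tower:
 assumes "subgroup A G" "subgroup B G" "subgroup C G" "A \<subseteq> B" "B \<subseteq> C" "finite C" "abelian_monoid M"
  and F: "F \<in> C \<rightarrow> carrier M" "!!c a. c \<in> C ==> a \<in> A ==> F (c \<otimes> a) = F c"
 shows "coset_sum M G C A F = coset_sum M G C B (\<lambda>c. coset_sum M G B A (\<lambda>b. F (c \<otimes> b)))"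
proof -
 interpret M: abelian_monoid M by fact
 have AC: "A \<subseteq> C" using assms by blast
 have CG: "C \<subseteq> carrier G" using subgroup.subset[OF assms(3)] .
 have BG: "B \<subseteq> carrier G" and AG: "A \<subseteq> carrier G" using CG assms(4,5) by blast+
 let ?r = "\<lambda>Z. SOME x. x \<in> Z"
 have fin: "finite (cosets G C A)" "finite (cosets G C B)" using assms(6) by (auto simp: cosets_def)
 note rA = cosets_rep[OF assms(1,3) AC] and rB = cosets_rep[OF assms(2,3,5)]
  and rBA = cosets_rep[OF assms(1,2,4)]
 have mC: "c \<otimes> b \<in> C" if "c \<in> C" "b \<in> B" for c b
  using that assms(5) subgroup.m_closed[OF assms(3)] by blast
 have "coset_sum M G C A F = (\<Oplus>\<^bsub>M\<^esub>D\<in>cosets G C B. \<Oplus>\<^bsub>M\<^esub>Z\<in>{Z \<in> cosets G C A. ?r Z <# B = D}. F (?r Z))"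
  unfolding coset_sum_def
 proof (rule M.finsum_fibres[OF fin])
  show "(\<lambda>Z. ?r Z <# B) \<in> cosets G C A \<rightarrow> cosets G C B"
   using rA(2) unfolding cosets_def[of G C B] by blast
  show "(\<lambda>Z. F (?r Z)) \<in> cosets G C A \<rightarrow> carrier M" using rA(2) F(1) by blast
 qed
 also have "... = (\<Oplus>\<^bsub>M\<^esub>D\<in>cosets G C B. coset_sum M G B A (\<lambda>b. F (?r D \<otimes> b)))"
 proof (rule M.finsum_cong'[OF refl])
  show "(\<lambda>D. coset_sum M G B A (\<lambda>b. F (?r D \<otimes> b))) \<in> cosets G C B \<rightarrow> carrier M"
   unfolding coset_sum_def
  proof (intro Pi_I M.finsum_closed)
   fix D Z assume "D \<in> cosets G C B" "Z \<in> cosets G B A"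
   then show "F (?r D \<otimes> ?r Z) \<in> carrier M" using mC rB(2) rBA(2) F(1) by blast
  qed
  fix D assume D: "D \<in> cosets G C B"
  let ?c = "?r D"
  have c: "?c \<in> C" "D = ?c <# B" using rB(2,3)[OF D] by blast+
  have cG: "?c \<in> carrier G" using c CG by blast
  have cA: "?c <# (b <# A) = (?c \<otimes> b) <# A" if "b \<in> B" for b
   using that BG AG cG by (intro lcos_m_assoc) auto
  have img: "{Z \<in> cosets G C A. ?r Z <# B = D} = (\<lambda>Z. ?c <# Z) ` cosets G B A"
  proof (intro equalityI subsetI)
   fix Z assume "Z \<in> {Z \<in> cosets G C A. ?r Z <# B = D}"
   then have Z: "Z \<in> cosets G C A" "?r Z <# B = ?c <# B" using c(2) by simp_all
   have rG: "?r Z \<in> carrier G" using rA(2)[OF Z(1)] CG by blast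
   have b: "inv ?c \<otimes> ?r Z \<in> B" using Z(2) rG cG l_coset_eq_iff[OF assms(2)] by metis
   have "?c \<otimes> (inv ?c \<otimes> ?r Z) = ?r Z" using cG rG by (simp add: m_assoc[symmetric])
   then have "Z = ?c <# ((inv ?c \<otimes> ?r Z) <# A)" using cA[OF b] rA(3)[OF Z(1)] by simp
   moreover have "(inv ?c \<otimes> ?r Z) <# A \<in> cosets G B A" using b unfolding cosets_def by blast
   ultimately show "Z \<in> (\<lambda>Z. ?c <# Z) ` cosets G B A" by blast
  next
   fix Z assume "Z \<in> (\<lambda>Z. ?c <# Z) ` cosets G B A"
   then obtain b where b: "b \<in> B" "Z = ?c <# (b <# A)" unfolding cosets_def by blast
   then have Zb: "Z = (?c \<otimes> b) <# A" using cA by simp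
   then have Z: "Z \<in> cosets G C A" using mC[OF c(1) b(1)] unfolding cosets_def by blast
   have "?r Z \<in> (?c \<otimes> b) <# A" using rA(1)[OF Z] Zb by simp
   then obtain a where a: "a \<in> A" "?r Z = ?c \<otimes> b \<otimes> a" unfolding l_coset_def by blast
   have ab: "a \<in> B" "a \<in> carrier G" "b \<in> carrier G" using a(1) b(1) assms(4) BG by blast+
   have "inv ?c \<otimes> ?r Z = b \<otimes> a" unfolding a(2) using ab cG by (simp add: m_assoc[symmetric])
   then have "inv ?c \<otimes> ?r Z \<in> B" using subgroup.m_closed[OF assms(2) b(1) ab(1)] by simp
   moreover have "?r Z \<in> carrier G" using rA(2)[OF Z] CG by blast
   ultimately have "?c <# B = ?r Z <# B" using cG l_coset_eq_iff[OF assms(2)] by metis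
   then show "Z \<in> {Z \<in> cosets G C A. ?r Z <# B = D}" using Z c(2) by simp
  qed
  have inj: "inj_on (\<lambda>Z. ?c <# Z) (cosets G B A)"
  proof (rule inj_on_subset)
   show "inj_on (\<lambda>Z. ?c <# Z) (cosets G C A)"
    using cosets_left_bij[OF assms(1,3) AC c(1)] by (rule bij_betw_imp_inj_on)
   show "cosets G B A \<subseteq> cosets G C A" using assms(5) unfolding cosets_def by blast
  qed
  have "(\<Oplus>\<^bsub>M\<^esub>Z\<in>{Z \<in> cosets G C A. ?r Z <# B = D}. F (?r Z)) = (\<Oplus>\<^bsub>M\<^esub>Z\<in>cosets G B A. F (?r (?c <# Z)))"
   unfolding img
  proof (rule M.finsum_reindex[OF _ inj])
   show "(\<lambda>Z. F (?r Z)) \<in> (\<lambda>Z. ?c <# Z) ` cosets G B A \<rightarrow> carrier M"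
    unfolding img[symmetric] using rA(2) F(1) by blast
  qed
  also have "... = coset_sum M G B A (\<lambda>b. F (?c \<otimes> b))"
   unfolding coset_sum_def
  proof (rule M.finsum_cong'[OF refl])
   show "(\<lambda>Z. F (?c \<otimes> ?r Z)) \<in> cosets G B A \<rightarrow> carrier M"
    using mC[OF c(1)] rBA(2) F(1) by blast
   fix Z assume Z: "Z \<in> cosets G B A"
   have "?c <# Z \<in> cosets G C A" using Z img by blast
   moreover have "?c \<otimes> ?r Z \<in> ?c <# Z" using rBA(1)[OF Z] unfolding l_coset_def by blast
   ultimately show "F (?r (?c <# Z)) = F (?c \<otimes> ?r Z)"
    using coset_sum_rep[OF assms(1,3) AC _ _ F(2)] by blast
  qed
  finally show "(\<Oplus>\<^bsub>M\<^esub>Z\<in>{Z \<in> cosets G C A. ?r Z <# B = D}. F (?r Z)) = coset_sum M G B A (\<lambda>b. F (?c \<otimes> b))" .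
 qed
 finally show ?thesis by (simp add: coset_sum_def)
qed

lemma card_cosets:
 assumes "subgroup A G" "subgroup B G" "A \<subseteq> B" "finite B"
 shows "card (cosets G B A) * card A = card B"
proof -
 interpret H: group "G(|carrier := B|)" using assms subgroup.subgroup_is_group is_group by blast
 have "subgroup A (G(|carrier := B|))" using assms subgroup_incl by blast
 then show ?thesis using H.l_lagrange[of A] assms by (simp add: lcosets_eq_cosets order_def)
qed

end

section \<open>Linear algebra: projections, Fitting's lemma, bases and coordinates\<close>

lemma trivial_module_simps [simp]:
 "carrier (trivial_module K) = carrier K" "\<zero>\<^bsub>trivial_module K\<^esub> = \<zero>\<^bsub>K\<^esub>"
 "x \<oplus>\<^bsub>trivial_module K\<^esub> y = x \<oplus>\<^bsub>K\<^esub> y" "x \<odot>\<^bsub>trivial_module K\<^esub> y = x \<otimes>\<^bsub>K\<^esub> y"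
 by (simp_all add: trivial_module_def)

lemma trivial_finsum [simp]: "finsum (trivial_module K) F A = finsum K F A"
 by (simp add: finsum_def finprod_def trivial_module_def)

text \<open>Makes linear functionals a special case of \<open>module_hom\<close>, so that the lemmas
  on homomorphisms serve for them too.\<close>

lemma (in field) trivial_vectorspace: "vectorspace R (trivial_module R)"
 by (rule vs_criteria) (auto simp: field_axioms m_assoc l_distr r_distr a_ac intro!: bexI[of _ "\<ominus> _"] r_neg)

context vectorspace begin

abbreviation (input) addV (infixl "\<oplus>\<^sub>V" 65) where "v \<oplus>\<^sub>V w \<equiv> v \<oplus>\<^bsub>V\<^esub> w"
abbreviation (input) diffV (infixl "\<ominus>\<^sub>V" 65) where "v \<ominus>\<^sub>V w \<equiv> v \<ominus>\<^bsub>V\<^esub> w"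
abbreviation (input) smultV (infixl "\<odot>\<^sub>V" 70) where "c \<odot>\<^sub>V v \<equiv> c \<odot>\<^bsub>V\<^esub> v"
abbreviation (input) zeroV ("\<zero>\<^sub>V") where "\<zero>\<^sub>V \<equiv> \<zero>\<^bsub>V\<^esub>"


lemma vs_self: "vectorspace K V" ..

lemma subspaceI:
 assumes "U \<subseteq> carrier V" "\<zero>\<^sub>V \<in> U" "!!u v. u \<in> U ==> v \<in> U ==> u \<oplus>\<^sub>V v \<in> U"
  "!!c u. c \<in> carrier K ==> u \<in> U ==> c \<odot>\<^sub>V u \<in> U"
 shows "subspace K U V"
 using assms vs_self unfolding subspace_def submodule_def vectorspace_def by auto

lemma subspaceD:
 assumes "subspace K U V"
 shows "U \<subseteq> carrier V" "!!u. u \<in> U ==> u \<in> carrier V" "\<zero>\<^sub>V \<in> U"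
  "!!u v. u \<in> U ==> v \<in> U ==> u \<oplus>\<^sub>V v \<in> U"
  "!!c u. c \<in> carrier K ==> u \<in> U ==> c \<odot>\<^sub>V u \<in> U"
  "!!u. u \<in> U ==> \<ominus>\<^bsub>V\<^esub> u \<in> U" "!!u v. u \<in> U ==> v \<in> U ==> u \<ominus>\<^sub>V v \<in> U"
proof -
 interpret U: submodule K U V using assms by simp
 show 1: "U \<subseteq> carrier V" "!!u. u \<in> U ==> u \<in> carrier V" "\<zero>\<^sub>V \<in> U"
  and 2: "!!u v. u \<in> U ==> v \<in> U ==> u \<oplus>\<^sub>V v \<in> U"
  and 3: "!!c u. c \<in> carrier K ==> u \<in> U ==> c \<odot>\<^sub>V u \<in> U"
  using U.subset by auto
 show 4: "\<ominus>\<^bsub>V\<^esub> u \<in> U" if "u \<in> U" for u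
  using 3[of "\<ominus>\<^bsub>K\<^esub> \<one>\<^bsub>K\<^esub>" u] that 1(2)[OF that] by (simp add: smult_minus_1)
 show "u \<ominus>\<^sub>V v \<in> U" if "u \<in> U" "v \<in> U" for u v
  using 2 4 that by (simp add: a_minus_def)
qed

lemma subspace_finsum:
 assumes "subspace K U V" "F \<in> A \<rightarrow> U"
 shows "finsum V F A \<in> U"
 using assms(2)
proof (induction A rule: infinite_finite_induct)
 case (insert a A)
 then have "F \<in> A \<rightarrow> carrier V" "F a \<in> carrier V" using subspaceD(2)[OF assms(1)] by auto
 then show ?case using insert subspaceD(4)[OF assms(1)] by simp
qed (use subspaceD(3)[OF assms(1)] in auto)

lemma diff_eq_iff:
 assumes "x \<in> carrier V" "y \<in> carrier V" "z \<in> carrier V"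
 shows "x \<ominus>\<^sub>V y = z \<longleftrightarrow> x = z \<oplus>\<^sub>V y"
 using assms by (metis M.a_assoc a_minus_def M.add.inv_closed M.l_neg M.r_neg M.r_zero)

lemma diff_add_cancel [simp]:
 assumes "x \<in> carrier V" "y \<in> carrier V"
 shows "(x \<ominus>\<^sub>V y) \<oplus>\<^sub>V y = x" "y \<oplus>\<^sub>V (x \<ominus>\<^sub>V y) = x" "(x \<oplus>\<^sub>V y) \<ominus>\<^sub>V y = x" "x \<ominus>\<^sub>V x = \<zero>\<^sub>V"
 using assms diff_eq_iff[of x y "x \<ominus>\<^sub>V y"] diff_eq_iff[of "x \<oplus>\<^sub>V y" y x] M.a_comm
 by (auto simp: M.r_neg a_minus_def)

lemma diff_zero_iff: "x \<in> carrier V ==> y \<in> carrier V ==> x \<ominus>\<^sub>V y = \<zero>\<^sub>V \<longleftrightarrow> x = y"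
 by (subst diff_eq_iff) auto

lemma homI:
 assumes "!!v. v \<in> carrier V ==> h v \<in> carrier W"
  "!!v w. v \<in> carrier V ==> w \<in> carrier V ==> h (v \<oplus>\<^sub>V w) = h v \<oplus>\<^bsub>W\<^esub> h w"
  "!!c v. c \<in> carrier K ==> v \<in> carrier V ==> h (c \<odot>\<^sub>V v) = c \<odot>\<^bsub>W\<^esub> h v"
 shows "h \<in> module_hom K V W"
 using assms unfolding module_hom_def by auto

lemma homD:
 assumes "h \<in> module_hom K V W"
 shows "v \<in> carrier V ==> h v \<in> carrier W"
  "v \<in> carrier V ==> w \<in> carrier V ==> h (v \<oplus>\<^sub>V w) = h v \<oplus>\<^bsub>W\<^esub> h w"
  "c \<in> carrier K ==> v \<in> carrier V ==> h (c \<odot>\<^sub>V v) = c \<odot>\<^bsub>W\<^esub> h v"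
 using assms unfolding module_hom_def by auto

lemma hom_zero:
 assumes "vectorspace K W" "h \<in> module_hom K V W" shows "h \<zero>\<^sub>V = \<zero>\<^bsub>W\<^esub>"
proof -
 interpret W: vectorspace K W by fact
 interpret mod_hom K V W h using assms(2) by unfold_locales
 show ?thesis by simp
qed

lemma hom_diff:
 assumes "vectorspace K W" "h \<in> module_hom K V W" "v \<in> carrier V" "w \<in> carrier V"
 shows "h (v \<ominus>\<^sub>V w) = h v \<ominus>\<^bsub>W\<^esub> h w"
proof -
 interpret W: vectorspace K W by fact
 interpret mod_hom K V W h using assms(2) by unfold_locales
 show ?thesis using assms by simp
qed

lemma hom_finsum:
 assumes "vectorspace K W" "h \<in> module_hom K V W" "F \<in> A \<rightarrow> carrier V"
 shows "h (finsum V F A) = finsum W (\<lambda>a. h (F a)) A"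
proof -
 interpret W: vectorspace K W by fact
 show ?thesis using assms(3)
 proof (induction A rule: infinite_finite_induct)
  case (insert a A)
  then have F: "F \<in> A \<rightarrow> carrier V" "F a \<in> carrier V" by auto
  then have "(\<lambda>a. h (F a)) \<in> A \<rightarrow> carrier W" using homD(1)[OF assms(2)] by auto
  then show ?case using insert F homD[OF assms(2)] by simp
 qed (simp_all add: hom_zero[OF assms(1,2)])
qed

lemma hom_add:
 assumes "vectorspace K W" "h \<in> module_hom K V W" "k \<in> module_hom K V W"
 shows "(\<lambda>v. h v \<oplus>\<^bsub>W\<^esub> k v) \<in> module_hom K V W"
proof -
 interpret W: vectorspace K W by fact
 show ?thesis
  by (rule homI) (use homD[OF assms(2)] homD[OF assms(3)] in \<open>auto simp: W.M.a_ac W.smult_r_distr\<close>)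
qed

lemma hom_smult:
 assumes "vectorspace K W" "h \<in> module_hom K V W" "c \<in> carrier K"
 shows "(\<lambda>v. c \<odot>\<^bsub>W\<^esub> h v) \<in> module_hom K V W"
proof -
 interpret W: vectorspace K W by fact
 show ?thesis
  by (rule homI) (use homD[OF assms(2)] assms(3) in \<open>auto simp: W.smult_r_distr W.smult_assoc1[symmetric] m_comm\<close>)
qed

lemma hom_sub:
 assumes "vectorspace K W" "h \<in> module_hom K V W" "k \<in> module_hom K V W"
 shows "(\<lambda>v. h v \<ominus>\<^bsub>W\<^esub> k v) \<in> module_hom K V W"
proof -
 interpret W: vectorspace K W by fact
 have eq: "h v \<ominus>\<^bsub>W\<^esub> k v = h v \<oplus>\<^bsub>W\<^esub> (\<ominus>\<^bsub>K\<^esub> \<one>\<^bsub>K\<^esub>) \<odot>\<^bsub>W\<^esub> k v" if "v \<in> carrier V" for v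
  using that homD(1)[OF assms(3) that] by (simp add: W.smult_minus_1 a_minus_def)
 have m1: "\<ominus>\<^bsub>K\<^esub> \<one>\<^bsub>K\<^esub> \<in> carrier K" by simp
 note * = hom_add[OF assms(1,2) hom_smult[OF assms(1,3) m1]]
 show ?thesis
  by (rule homI) (use homD[OF *] eq homD(1)[OF assms(2)] homD(1)[OF assms(3)] in auto)
qed

lemma hom_id: "(\<lambda>v. v) \<in> module_hom K V V" by (rule homI) auto

lemma hom_finsum_fun:
 assumes "vectorspace K W" "!!a. a \<in> A ==> F a \<in> module_hom K V W"
 shows "(\<lambda>v. finsum W (\<lambda>a. F a v) A) \<in> module_hom K V W"
 using assms(2)
proof (induction A rule: infinite_finite_induct)
 interpret W: vectorspace K W by fact
 {
  case (insert a A)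
  have 1: "(\<lambda>v. F a v \<oplus>\<^bsub>W\<^esub> finsum W (\<lambda>a. F a v) A) \<in> module_hom K V W"
   using insert by (intro hom_add assms(1)) auto
  have 2: "finsum W (\<lambda>a. F a v) (insert a A) = F a v \<oplus>\<^bsub>W\<^esub> finsum W (\<lambda>a. F a v) A" if "v \<in> carrier V" for v
   using insert.hyps homD(1)[OF insert.prems that] by (intro W.finsum_insert) auto
  show ?case by (rule homI) (use homD[OF 1] 2 in auto)
 next
  case (infinite A)
  then show ?case by (intro homI) auto
 next
  case empty
  then show ?case by (intro homI) auto
 }
qed

lemma set_add_mem: "x \<in> U <+>\<^bsub>V\<^esub> W \<longleftrightarrow> (\<exists>u\<in>U. \<exists>w\<in>W. x = u \<oplus>\<^sub>V w)"
 by (auto simp: set_add_def set_mult_def)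

lemma complement_unique:
 assumes "subspace K U V" "subspace K W V" "U \<inter> W = {\<zero>\<^sub>V}"
  "u \<in> U" "u' \<in> U" "w \<in> W" "w' \<in> W" "u \<oplus>\<^sub>V w = u' \<oplus>\<^sub>V w'"
 shows "u = u'" "w = w'"
proof -
 have c: "u \<in> carrier V" "u' \<in> carrier V" "w \<in> carrier V" "w' \<in> carrier V"
  using assms subspaceD(2) by blast+
 have "u \<ominus>\<^sub>V u' = w' \<ominus>\<^sub>V w"
 proof -
  have "u = (u' \<oplus>\<^sub>V w') \<ominus>\<^sub>V w" using diff_eq_iff[of "u' \<oplus>\<^sub>V w'" w u] c assms(8) by simp
  also have "... = (w' \<ominus>\<^sub>V w) \<oplus>\<^sub>V u'" using c by (simp add: a_minus_def M.a_ac)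
  finally show ?thesis using c by (subst diff_eq_iff) auto
 qed
 moreover have "u \<ominus>\<^sub>V u' \<in> U" "w' \<ominus>\<^sub>V w \<in> W" using assms subspaceD(7) by blast+
 ultimately have "u \<ominus>\<^sub>V u' = \<zero>\<^sub>V" "w' \<ominus>\<^sub>V w = \<zero>\<^sub>V" using assms(3) by auto
 then show "u = u'" "w = w'" using c diff_zero_iff by auto
qed

text \<open>The decomposition of a vector is unique, so a mere choice of the component in
  \<open>U\<close> respects sums and multiples.\<close>

lemma complement_projection:
 assumes U: "subspace K U V" and W: "subspace K W V" and int: "U \<inter> W = {\<zero>\<^sub>V}"
  and sum: "U <+>\<^bsub>V\<^esub> W = carrier V"
 obtains e where "e \<in> module_hom K V V" "!!v. v \<in> carrier V ==> e v \<in> U"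
  "!!v. v \<in> carrier V ==> v \<ominus>\<^sub>V e v \<in> W" "!!u. u \<in> U ==> e u = u" "!!w. w \<in> W ==> e w = \<zero>\<^sub>V"
proof -
 define e where "e v = (SOME u. u \<in> U \<and> (\<exists>w\<in>W. v = u \<oplus>\<^sub>V w))" for v
 have ex: "e v \<in> U \<and> (\<exists>w\<in>W. v = e v \<oplus>\<^sub>V w)" if "v \<in> carrier V" for v
 proof -
  have "\<exists>u. u \<in> U \<and> (\<exists>w\<in>W. v = u \<oplus>\<^sub>V w)" using that sum set_add_mem[of v U W] by blast
  then show ?thesis unfolding e_def by (rule someI_ex)
 qed
 have eq: "e (u \<oplus>\<^sub>V w) = u" if "u \<in> U" "w \<in> W" for u w
 proof -
  have "u \<oplus>\<^sub>V w \<in> carrier V" using that subspaceD(2)[OF U] subspaceD(2)[OF W] by simp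
  then obtain w' where "e (u \<oplus>\<^sub>V w) \<in> U" "w' \<in> W" "u \<oplus>\<^sub>V w = e (u \<oplus>\<^sub>V w) \<oplus>\<^sub>V w'" using ex by blast
  then show ?thesis using complement_unique[OF U W int] that by metis
 qed
 show ?thesis
 proof
  show "e v \<in> U" if "v \<in> carrier V" for v using ex[OF that] by blast
  show "v \<ominus>\<^sub>V e v \<in> W" if v: "v \<in> carrier V" for v
  proof -
   obtain w where w: "w \<in> W" "v = e v \<oplus>\<^sub>V w" using ex[OF v] by blast
   have c: "e v \<in> carrier V" "w \<in> carrier V" using ex[OF v] subspaceD(2)[OF U] subspaceD(2)[OF W] w by auto
   have "v \<ominus>\<^sub>V e v = w" using diff_eq_iff[of v "e v" w] c v w(2) M.a_comm[OF c] by simp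
   then show ?thesis using w by simp
  qed
  show "e u = u" if "u \<in> U" for u
   using eq[OF that subspaceD(3)[OF W]] subspaceD(2)[OF U that] by simp
  show "e w = \<zero>\<^sub>V" if "w \<in> W" for w
   using eq[OF subspaceD(3)[OF U] that] subspaceD(2)[OF W that] by simp
  show "e \<in> module_hom K V V"
  proof (rule homI)
   show "e v \<in> carrier V" if "v \<in> carrier V" for v using ex[OF that] subspaceD(2)[OF U] by blast
   fix v v' assume v: "v \<in> carrier V" and v': "v' \<in> carrier V"
   obtain w w' where w: "w \<in> W" "v = e v \<oplus>\<^sub>V w" "w' \<in> W" "v' = e v' \<oplus>\<^sub>V w'" using ex[OF v] ex[OF v'] by blast
   have c: "e v \<in> carrier V" "w \<in> carrier V" "e v' \<in> carrier V" "w' \<in> carrier V" "e v \<in> U" "e v' \<in> U"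
    using ex[OF v] ex[OF v'] subspaceD(2)[OF U] subspaceD(2)[OF W] w by auto
   have "v \<oplus>\<^sub>V v' = (e v \<oplus>\<^sub>V w) \<oplus>\<^sub>V (e v' \<oplus>\<^sub>V w')" using w by simp
   also have "... = (e v \<oplus>\<^sub>V e v') \<oplus>\<^sub>V (w \<oplus>\<^sub>V w')" using c by (simp add: M.a_ac)
   finally show "e (v \<oplus>\<^sub>V v') = e v \<oplus>\<^sub>V e v'"
    using eq[of "e v \<oplus>\<^sub>V e v'" "w \<oplus>\<^sub>V w'"] c w subspaceD(4)[OF U] subspaceD(4)[OF W] by simp
  next
   fix a v assume a: "a \<in> carrier K" and v: "v \<in> carrier V"
   obtain w where w: "w \<in> W" "v = e v \<oplus>\<^sub>V w" using ex[OF v] by blast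
   have c: "e v \<in> carrier V" "w \<in> carrier V" "e v \<in> U"
    using ex[OF v] subspaceD(2)[OF U] subspaceD(2)[OF W] w by auto
   have "a \<odot>\<^sub>V v = a \<odot>\<^sub>V (e v \<oplus>\<^sub>V w)" using w(2) by simp
   also have "... = a \<odot>\<^sub>V e v \<oplus>\<^sub>V a \<odot>\<^sub>V w" using a c by (simp add: smult_r_distr)
   finally show "e (a \<odot>\<^sub>V v) = a \<odot>\<^sub>V e v"
    using eq[of "a \<odot>\<^sub>V e v" "a \<odot>\<^sub>V w"] c w a subspaceD(5)[OF U] subspaceD(5)[OF W] by simp
  qed
 qed
qed

lemma kernel_subspace:
 assumes "vectorspace K W" "h \<in> module_hom K V W"
 shows "subspace K {v \<in> carrier V. h v = \<zero>\<^bsub>W\<^esub>} V"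
proof -
 interpret W: vectorspace K W by fact
 show ?thesis using homD[OF assms(2)] hom_zero[OF assms]
  by (intro subspaceI) auto
qed

lemma image_subspace:
 assumes "vectorspace K W" "h \<in> module_hom K V W" "subspace K U V"
 shows "subspace K (h ` U) W"
proof -
 interpret W: vectorspace K W by fact
 note U = subspaceD[OF assms(3)]
 show ?thesis
 proof (rule W.subspaceI)
  show "h ` U \<subseteq> carrier W" using homD(1)[OF assms(2)] U(2) by blast
  show "\<zero>\<^bsub>W\<^esub> \<in> h ` U" using hom_zero[OF assms(1,2)] U(3) by (metis image_eqI)
  fix x y assume "x \<in> h ` U" "y \<in> h ` U"
  then obtain u v where "u \<in> U" "v \<in> U" "x = h u" "y = h v" by blast
  then have "x \<oplus>\<^bsub>W\<^esub> y = h (u \<oplus>\<^sub>V v)" "u \<oplus>\<^sub>V v \<in> U" using homD(2)[OF assms(2)] U(2,4) by auto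
  then show "x \<oplus>\<^bsub>W\<^esub> y \<in> h ` U" by blast
 next
  fix c x assume c: "c \<in> carrier K" and "x \<in> h ` U"
  then obtain u where "u \<in> U" "x = h u" by blast
  then have "c \<odot>\<^bsub>W\<^esub> x = h (c \<odot>\<^sub>V u)" "c \<odot>\<^sub>V u \<in> U" using homD(3)[OF assms(2) c] U(2,5) c by auto
  then show "c \<odot>\<^bsub>W\<^esub> x \<in> h ` U" by blast
 qed
qed

lemma subspace_carrier: "subspace K (carrier V) V" by (rule subspaceI) auto

text \<open>One vector from each step, taken outside the previous subspace, gives \<open>k\<close>
  independent vectors.\<close>

lemma strict_chain_bound:
 assumes fd: "fin_dim" and W: "!!i. i \<le> k ==> subspace K (W i) V" "!!i. i < k ==> W i \<subset> W (Suc i)"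
 shows "k \<le> dim"
proof -
 have "\<exists>A. A \<subseteq> W j \<and> lin_indpt A \<and> finite A \<and> card A = j" if "j \<le> k" for j
  using that
 proof (induction j)
  case 0
  have "lin_indpt {}" by (simp add: lin_dep_def)
  then show ?case by (intro exI[of _ "{}"]) auto
 next
  case (Suc j)
  then obtain A where A: "A \<subseteq> W j" "lin_indpt A" "finite A" "card A = j" by auto
  note Wj = subspaceD[OF W(1)[of j]] and WS = subspaceD[OF W(1)[of "Suc j"]]
  obtain w where w: "w \<in> W (Suc j)" "w \<notin> W j" using W(2)[of j] Suc.prems by auto
  have AV: "A \<subseteq> carrier V" using A(1) Wj(1) Suc.prems by auto
  have "span A \<subseteq> W j" using A(1) W(1)[of j] Suc.prems by (intro span_is_subset) auto
  then have "w \<notin> span A" "w \<notin> A" using w A by auto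
  moreover have "w \<in> carrier V" using w WS Suc.prems by auto
  ultimately have "lin_indpt (A \<union> {w})" using lin_dep_iff_in_span[OF AV A(2)] by blast
  moreover have "A \<union> {w} \<subseteq> W (Suc j)" using A w W(2)[of j] Suc.prems by auto
  moreover have "card (A \<union> {w}) = Suc j" using A \<open>w \<notin> A\<close> by simp
  ultimately show ?case using A(3) by (intro exI[of _ "A \<union> {w}"]) auto
 qed
 then obtain A where A: "A \<subseteq> W k" "lin_indpt A" "finite A" "card A = k" by blast
 then show ?thesis using li_le_dim(2)[OF fd _ A(2)] subspaceD(1)[OF W(1)[of k]] by auto
qed

text \<open>The first terms of an infinite descending chain, read backwards, would be an ascending
  chain that is too long. This will provide minimal summands.\<close>

lemma subspace_wf:
 assumes fd: "fin_dim"
 shows "wf {(U, W). subspace K U V \<and> subspace K W V \<and> U \<subset> W}"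
 unfolding wf_iff_no_infinite_down_chain
proof
 assume "\<exists>f. \<forall>i. (f (Suc i), f i) \<in> {(U, W). subspace K U V \<and> subspace K W V \<and> U \<subset> W}"
 then obtain f where f: "!!i. subspace K (f i) V" "!!i. f (Suc i) \<subset> f i" by blast
 have "Suc dim \<le> dim"
 proof (rule strict_chain_bound[OF fd, where W = "\<lambda>i. f (Suc dim - i)"])
  fix i assume "i < Suc dim"
  then have "Suc dim - i = Suc (Suc dim - Suc i)" by simp
  then show "f (Suc dim - i) \<subset> f (Suc dim - Suc i)" using f(2)[of "Suc dim - Suc i"] by metis
 qed (rule f)
 then show False by simp
qed

lemma hom_funpow:
 assumes "h \<in> module_hom K V V" shows "h ^^ n \<in> module_hom K V V"
proof (induction n)
 case 0 then show ?case using hom_id by (simp add: id_def)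
next
 case (Suc n)
 show ?case by (rule homI) (use homD[OF assms] homD[OF Suc] in auto)
qed

text \<open>In finite dimension the kernels and the images of the powers of \<open>h\<close> become
  stationary; from there on kernel and image are complementary.\<close>

lemma fitting:
 assumes fd: "fin_dim" and h: "h \<in> module_hom K V V"
 obtains n where "0 < n" "{v \<in> carrier V. (h ^^ n) v = \<zero>\<^sub>V} \<inter> (h ^^ n) ` carrier V = {\<zero>\<^sub>V}"
  "{v \<in> carrier V. (h ^^ n) v = \<zero>\<^sub>V} <+>\<^bsub>V\<^esub> (h ^^ n) ` carrier V = carrier V"
proof -
 let ?k = "\<lambda>n. {v \<in> carrier V. (h ^^ n) v = \<zero>\<^sub>V}" and ?i = "\<lambda>n. (h ^^ n) ` carrier V"
 note hn = hom_funpow[OF h]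
 have ks: "subspace K (?k n) V" and ims: "subspace K (?i n) V" for n
  using kernel_subspace[OF vs_self hn] image_subspace[OF vs_self hn subspace_carrier] by auto
 have kmono: "?k n \<subseteq> ?k (Suc n)" for n using hom_zero[OF vs_self h] by auto
 have imono: "?i (Suc n) \<subseteq> ?i n" for n
 proof
  fix x assume "x \<in> ?i (Suc n)"
  then obtain v where "v \<in> carrier V" "x = (h ^^ n) (h v)" by (auto simp: funpow_swap1)
  then show "x \<in> ?i n" using homD(1)[OF h] by blast
 qed
 have ex: "\<exists>n. ?k (Suc n) = ?k n"
 proof (rule ccontr)
  assume "\<not> ?thesis"
  then have "Suc dim \<le> dim"
   using kmono by (intro strict_chain_bound[OF fd, where W = ?k] ks) blast+
  then show False by simp
 qed
 then obtain a where a: "?k (Suc a) = ?k a" by blast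
 have kst: "?k (a + j) = ?k a" for j
 proof (induction j)
  case (Suc j)
  have "v \<in> ?k a" if "v \<in> ?k (a + Suc j)" for v
  proof -
   have "(h ^^ (a + j)) (h v) = \<zero>\<^sub>V" using that by (simp add: funpow_swap1)
   then have "h v \<in> ?k (a + j)" using that homD(1)[OF h] by simp
   then have "h v \<in> ?k a" using Suc by simp
   then have "v \<in> ?k (Suc a)" using that by (simp add: funpow_swap1)
   then show ?thesis unfolding a .
  qed
  moreover have "?k a \<subseteq> ?k (a + Suc j)" using Suc kmono[of "a + j"] by simp
  ultimately show ?case by blast
 qed simp
 have ex': "\<exists>n. ?i (Suc n) = ?i n"
 proof (rule ccontr)
  assume no: "\<not> ?thesis"
  have "Suc dim \<le> dim"
  proof (rule strict_chain_bound[OF fd, where W = "\<lambda>j. ?i (Suc dim - j)"])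
   fix i assume "i < Suc dim"
   then have "Suc dim - i = Suc (Suc dim - Suc i)" by simp
   then show "?i (Suc dim - i) \<subset> ?i (Suc dim - Suc i)" using imono[of "Suc dim - Suc i"] no by (metis psubsetI)
  qed (rule ims)
  then show False by simp
 qed
 then obtain b where b: "?i (Suc b) = ?i b" by blast
 have ist: "?i (b + j) = ?i b" for j
 proof (induction j)
  case (Suc j)
  have "?i (b + Suc j) = h ` ?i (b + j)" by (simp add: image_comp)
  also have "... = h ` ?i b" using Suc by simp
  also have "... = ?i (Suc b)" by (simp add: image_comp)
  finally show ?case using b by simp
 qed simp
 \<comment> \<open>Large enough for the kernels (from \<open>a\<close> on) and the images (from
   \<open>b\<close> on), and positive, so that one factor \<open>h\<close> can later be split off
   from \<open>h ^^ n\<close>.\<close>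
 define n where "n = Suc (a + b)"
 have n1: "n = a + Suc b" "n + n = a + (Suc b + n)" "n = b + Suc a" "n + n = b + (Suc a + n)"
  by (simp_all add: n_def)
 have k2: "?k (n + n) = ?k n" using kst[of "Suc b"] kst[of "Suc b + n"] n1(1,2) by metis
 have i2: "?i (n + n) = ?i n" using ist[of "Suc a"] ist[of "Suc a + n"] n1(3,4) by metis
 show thesis
 proof
  show "0 < n" by (simp add: n_def)
  show "?k n \<inter> ?i n = {\<zero>\<^sub>V}"
  proof
   show "?k n \<inter> ?i n \<subseteq> {\<zero>\<^sub>V}"
   proof
    fix x assume x: "x \<in> ?k n \<inter> ?i n"
    then obtain v where v: "v \<in> carrier V" "x = (h ^^ n) v" by blast
    then have "v \<in> ?k (n + n)" using x by (simp add: funpow_add)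
    then show "x \<in> {\<zero>\<^sub>V}" using k2 v by auto
   qed
   show "{\<zero>\<^sub>V} \<subseteq> ?k n \<inter> ?i n" using subspaceD(3)[OF ks] subspaceD(3)[OF ims] by blast
  qed
  show "?k n <+>\<^bsub>V\<^esub> ?i n = carrier V"
  proof (intro equalityI subsetI)
   fix x assume "x \<in> ?k n <+>\<^bsub>V\<^esub> ?i n"
   then show "x \<in> carrier V" using subspaceD(2)[OF ks] subspaceD(2)[OF ims] unfolding set_add_mem by blast
  next
   fix x assume x: "x \<in> carrier V"
   then have "(h ^^ n) x \<in> ?i (n + n)" using i2 by blast
   then obtain u where u: "u \<in> carrier V" "(h ^^ n) x = (h ^^ n) ((h ^^ n) u)" by (auto simp: funpow_add)
   let ?y = "(h ^^ n) u"
   have y: "?y \<in> carrier V" using homD(1)[OF hn u(1)] .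
   have "(h ^^ n) (x \<ominus>\<^sub>V ?y) = \<zero>\<^sub>V"
    using hom_diff[OF vs_self hn x y] u homD(1)[OF hn] x y by simp
   then have "x \<ominus>\<^sub>V ?y \<in> ?k n" using x y by simp
   moreover have "x = (x \<ominus>\<^sub>V ?y) \<oplus>\<^sub>V ?y" using x y by simp
   ultimately show "x \<in> ?k n <+>\<^bsub>V\<^esub> ?i n" unfolding set_add_mem using u(1) by blast
  qed
 qed
qed

text \<open>Injectivity makes the Fitting kernel trivial, so the image of a positive power of
  \<open>h\<close> is already everything.\<close>

lemma injective_imp_surjective:
 assumes fd: "fin_dim" and h: "h \<in> module_hom K V V"
  and inj: "!!v. v \<in> carrier V ==> h v = \<zero>\<^sub>V ==> v = \<zero>\<^sub>V"
 shows "bij_betw h (carrier V) (carrier V)"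
proof -
 obtain n where n0: "0 < n" and n: "{v \<in> carrier V. (h ^^ n) v = \<zero>\<^sub>V} <+>\<^bsub>V\<^esub> (h ^^ n) ` carrier V = carrier V"
  by (rule fitting[OF fd h])
 have ker: "v = \<zero>\<^sub>V" if "v \<in> carrier V" "(h ^^ j) v = \<zero>\<^sub>V" for j v
  using that(2)
 proof (induction j)
  case (Suc j)
  then have "h ((h ^^ j) v) = \<zero>\<^sub>V" by simp
  then have "(h ^^ j) v = \<zero>\<^sub>V" using inj homD(1)[OF hom_funpow[OF h] that(1)] by blast
  then show ?case by (rule Suc.IH)
 qed simp
 have surj: "x \<in> h ` carrier V" if x: "x \<in> carrier V" for x
 proof -
  obtain u' w' where u': "u' \<in> carrier V" "(h ^^ n) u' = \<zero>\<^sub>V" "w' \<in> carrier V" "x = u' \<oplus>\<^sub>V (h ^^ n) w'"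
   using n x unfolding set_eq_iff set_add_mem by blast
  have x': "x = (h ^^ n) w'" using ker[OF u'(1,2)] u' homD(1)[OF hom_funpow[OF h] u'(3)] by simp
  obtain m where "n = Suc m" using n0 by (cases n) auto
  then have "x = h ((h ^^ m) w')" using x' by simp
  then show ?thesis using homD(1)[OF hom_funpow[OF h] u'(3)] by blast
 qed
 show ?thesis
 proof (rule bij_betwI')
  fix x y assume xy: "x \<in> carrier V" "y \<in> carrier V"
  show "(h x = h y) = (x = y)"
  proof
   assume "h x = h y"
   then have "h (x \<ominus>\<^sub>V y) = \<zero>\<^sub>V" using hom_diff[OF vs_self h xy] homD(1)[OF h] xy by simp
   then have "x \<ominus>\<^sub>V y = \<zero>\<^sub>V" using inj xy by simp
   then show "x = y" using xy diff_zero_iff by simp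
  qed simp
 next
  fix x assume "x \<in> carrier V" then show "h x \<in> carrier V" using homD(1)[OF h] by simp
 next
  fix y assume "y \<in> carrier V" then show "\<exists>x\<in>carrier V. y = h x" using surj by blast
 qed
qed

end

text \<open>Extensionality on \<open>B\<close> makes the coefficient family unique as a function, as
  \<open>THE\<close> requires.\<close>

definition (in vectorspace) coord :: "'c set \<Rightarrow> 'c \<Rightarrow> 'c \<Rightarrow> 'a"
 where "coord B v = (THE a. a \<in> B \<rightarrow>\<^sub>E carrier K \<and> lincomb a B = v)"

context vectorspace begin

context
 fixes B
 assumes fin: "finite B" and B: "basis B"
begin

lemma basis_carrier: "b \<in> B ==> b \<in> carrier V" using B by (auto simp: basis_def)

lemma coord_lincomb:
 assumes "v \<in> carrier V"
 shows "coord B v \<in> B \<rightarrow>\<^sub>E carrier K \<and> lincomb (coord B v) B = v"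
proof -
 have "\<exists>!a. a \<in> B \<rightarrow>\<^sub>E carrier K \<and> lincomb a B = v"
  using basis_criterion[OF fin] B assms unfolding basis_def by blast
 then show ?thesis unfolding coord_def by (rule theI')
qed

lemma coord_closed: "v \<in> carrier V ==> b \<in> B ==> coord B v b \<in> carrier K"
 using coord_lincomb by auto

lemma coord_sum: "v \<in> carrier V ==> (\<Oplus>\<^bsub>V\<^esub>b\<in>B. coord B v b \<odot>\<^sub>V b) = v"
 using coord_lincomb by (simp add: lincomb_def)

lemma coord_unique:
 assumes "a \<in> B \<rightarrow> carrier K" "b \<in> B"
 shows "coord B (\<Oplus>\<^bsub>V\<^esub>b\<in>B. a b \<odot>\<^sub>V b) b = a b"
proof -
 let ?v = "\<Oplus>\<^bsub>V\<^esub>b\<in>B. a b \<odot>\<^sub>V b" and ?a = "restrict a B"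
 have v: "?v \<in> carrier V" using assms basis_carrier by (intro M.finsum_closed) auto
 have a: "?a \<in> B \<rightarrow>\<^sub>E carrier K \<and> lincomb ?a B = ?v"
  unfolding lincomb_def using assms basis_carrier by (auto intro!: M.finsum_cong')
 have "\<exists>!a. a \<in> B \<rightarrow>\<^sub>E carrier K \<and> lincomb a B = ?v"
  using basis_criterion[OF fin] B v unfolding basis_def by blast
 then have "?a = coord B ?v" using a coord_lincomb[OF v] by blast
 then show ?thesis using assms(2) by (metis restrict_apply')
qed

lemma coord_hom:
 assumes b: "b \<in> B"
 shows "(\<lambda>v. coord B v b) \<in> module_hom K V (trivial_module K)"
proof (rule homI)
 show "coord B v b \<in> carrier (trivial_module K)" if "v \<in> carrier V" for v
  using coord_closed[OF that b] by simp
 fix v w assume v: "v \<in> carrier V" and w: "w \<in> carrier V"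
 have "v \<oplus>\<^sub>V w = (\<Oplus>\<^bsub>V\<^esub>b\<in>B. coord B v b \<odot>\<^sub>V b) \<oplus>\<^sub>V (\<Oplus>\<^bsub>V\<^esub>b\<in>B. coord B w b \<odot>\<^sub>V b)"
  using v w by (simp add: coord_sum)
 also have "... = (\<Oplus>\<^bsub>V\<^esub>b\<in>B. coord B v b \<odot>\<^sub>V b \<oplus>\<^sub>V coord B w b \<odot>\<^sub>V b)"
  using v w coord_closed basis_carrier by (subst M.finsum_addf) auto
 also have "... = (\<Oplus>\<^bsub>V\<^esub>b\<in>B. (coord B v b \<oplus>\<^bsub>K\<^esub> coord B w b) \<odot>\<^sub>V b)"
  using v w coord_closed basis_carrier by (intro M.finsum_cong') (auto simp: smult_l_distr)
 finally show "coord B (v \<oplus>\<^sub>V w) b = coord B v b \<oplus>\<^bsub>trivial_module K\<^esub> coord B w b"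
  using coord_unique[OF _ b, of "\<lambda>b. coord B v b \<oplus>\<^bsub>K\<^esub> coord B w b"] v w coord_closed by simp
next
 fix c v assume c: "c \<in> carrier K" and v: "v \<in> carrier V"
 have "c \<odot>\<^sub>V v = c \<odot>\<^sub>V (\<Oplus>\<^bsub>V\<^esub>b\<in>B. coord B v b \<odot>\<^sub>V b)" using v by (simp add: coord_sum)
 also have "... = (\<Oplus>\<^bsub>V\<^esub>b\<in>B. c \<odot>\<^sub>V (coord B v b \<odot>\<^sub>V b))"
  using hom_finsum[OF vs_self hom_smult[OF vs_self hom_id c], of "\<lambda>b. coord B v b \<odot>\<^sub>V b" B]
   v coord_closed basis_carrier by auto
 also have "... = (\<Oplus>\<^bsub>V\<^esub>b\<in>B. (c \<otimes>\<^bsub>K\<^esub> coord B v b) \<odot>\<^sub>V b)"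
  using c v coord_closed basis_carrier by (intro M.finsum_cong') (auto simp: smult_assoc1)
 finally show "coord B (c \<odot>\<^sub>V v) b = c \<odot>\<^bsub>trivial_module K\<^esub> coord B v b"
  using coord_unique[OF _ b, of "\<lambda>b. c \<otimes>\<^bsub>K\<^esub> coord B v b"] c v coord_closed by simp
qed

lemma coord_basis:
 assumes "b \<in> B" "b' \<in> B"
 shows "coord B b' b = (if b = b' then \<one>\<^bsub>K\<^esub> else \<zero>\<^bsub>K\<^esub>)"
proof -
 let ?a = "\<lambda>b. if b = b' then \<one>\<^bsub>K\<^esub> else \<zero>\<^bsub>K\<^esub>"
 have "(\<Oplus>\<^bsub>V\<^esub>b\<in>B. ?a b \<odot>\<^sub>V b) = (\<Oplus>\<^bsub>V\<^esub>b\<in>B. if b = b' then b else \<zero>\<^sub>V)"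
  using basis_carrier by (intro M.finsum_cong') auto
 also have "... = b'"
  using M.add.finprod_singleton_swap[of b' B "\<lambda>b. b"] assms fin basis_carrier by (simp add: Pi_def)
 finally show ?thesis using coord_unique[of ?a b] assms by auto
qed

lemma coord_eqI:
 assumes "v \<in> carrier V" "w \<in> carrier V" "!!b. b \<in> B ==> coord B v b = coord B w b"
 shows "v = w"
proof -
 have "v = (\<Oplus>\<^bsub>V\<^esub>b\<in>B. coord B v b \<odot>\<^sub>V b)" using assms by (simp add: coord_sum)
 also have "... = (\<Oplus>\<^bsub>V\<^esub>b\<in>B. coord B w b \<odot>\<^sub>V b)"
  using assms coord_closed basis_carrier by (intro M.finsum_cong') auto
 finally show ?thesis using assms by (simp add: coord_sum)
qed

lemma basis_hom:
 assumes W: "vectorspace K W" and d: "!!b. b \<in> B ==> d b \<in> carrier W"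
 obtains h where "h \<in> module_hom K V W" "!!b. b \<in> B ==> h b = d b"
  "!!v. h v = (\<Oplus>\<^bsub>W\<^esub>b\<in>B. coord B v b \<odot>\<^bsub>W\<^esub> d b)"
proof -
 interpret W: vectorspace K W by fact
 define h where "h v = (\<Oplus>\<^bsub>W\<^esub>b\<in>B. coord B v b \<odot>\<^bsub>W\<^esub> d b)" for v
 show ?thesis
 proof
  show "h v = (\<Oplus>\<^bsub>W\<^esub>b\<in>B. coord B v b \<odot>\<^bsub>W\<^esub> d b)" for v by (simp add: h_def)
  have 1: "(\<lambda>v. coord B v b \<odot>\<^bsub>W\<^esub> d b) \<in> module_hom K V W" if b: "b \<in> B" for b
   by (rule homI)
    (use d b coord_closed homD(2,3)[OF coord_hom[OF b]] in \<open>auto simp: W.smult_l_distr W.smult_assoc1\<close>)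
  show "h \<in> module_hom K V W" unfolding h_def by (rule hom_finsum_fun[OF W 1])
  show "h b = d b" if b: "b \<in> B" for b
  proof -
   have "h b = (\<Oplus>\<^bsub>W\<^esub>b'\<in>B. if b' = b then d b' else \<zero>\<^bsub>W\<^esub>)"
    unfolding h_def using d b by (intro W.M.finsum_cong') (auto simp: coord_basis)
   also have "... = d b" using W.M.add.finprod_singleton_swap[of b B d] b fin d by (simp add: Pi_def)
   finally show ?thesis .
  qed
 qed
qed

lemma hom_expand:
 assumes W: "vectorspace K W" and h: "h \<in> module_hom K V W" and v: "v \<in> carrier V"
 shows "h v = (\<Oplus>\<^bsub>W\<^esub>b\<in>B. coord B v b \<odot>\<^bsub>W\<^esub> h b)"
proof -
 interpret W: vectorspace K W by fact
 have "h v = h (\<Oplus>\<^bsub>V\<^esub>b\<in>B. coord B v b \<odot>\<^sub>V b)" using v by (simp add: coord_sum)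
 also have "... = (\<Oplus>\<^bsub>W\<^esub>b\<in>B. h (coord B v b \<odot>\<^sub>V b))"
  using v coord_closed basis_carrier by (intro hom_finsum[OF W h]) auto
 also have "... = (\<Oplus>\<^bsub>W\<^esub>b\<in>B. coord B v b \<odot>\<^bsub>W\<^esub> h b)"
  using v coord_closed basis_carrier homD[OF h] by (intro W.M.finsum_cong') auto
 finally show ?thesis .
qed

lemma hom_ext_basis:
 assumes W: "vectorspace K W" and h: "h \<in> module_hom K V W" "k \<in> module_hom K V W"
  and eq: "!!b. b \<in> B ==> h b = k b" and v: "v \<in> carrier V"
 shows "h v = k v"
proof -
 interpret W: vectorspace K W by fact
 show ?thesis unfolding hom_expand[OF W h(1) v] hom_expand[OF W h(2) v]
  using eq coord_closed[OF v] homD(1)[OF h(2)] basis_carrier by (intro W.M.finsum_cong') auto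
qed

end

text \<open>Applying \<open>c b\<close> to any linear combination of \<open>B\<close> returns the
  coefficient at \<open>b\<close>, so expansions are unique. Bases of quotients and of summands are
  obtained in this way.\<close>

lemma basisI_dual:
 assumes fin: "finite B" and B: "B \<subseteq> carrier V"
  and c: "!!b. b \<in> B ==> c b \<in> module_hom K V (trivial_module K)"
  "!!b b'. b \<in> B ==> b' \<in> B ==> c b b' = (if b = b' then \<one>\<^bsub>K\<^esub> else \<zero>\<^bsub>K\<^esub>)"
  and sum: "!!v. v \<in> carrier V ==> (\<Oplus>\<^bsub>V\<^esub>b\<in>B. c b v \<odot>\<^sub>V b) = v"
 shows "basis B"
 unfolding basis_criterion[OF fin B]
proof (intro allI impI)
 fix v assume v: "v \<in> carrier V"
 have cc: "c b v \<in> carrier K" if "b \<in> B" for b using homD(1)[OF c(1)[OF that] v] by simp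
 show "\<exists>!a. a \<in> B \<rightarrow>\<^sub>E carrier K \<and> lincomb a B = v"
 proof (rule ex1I[of _ "restrict (\<lambda>b. c b v) B"])
  have "lincomb (restrict (\<lambda>b. c b v) B) B = (\<Oplus>\<^bsub>V\<^esub>b\<in>B. c b v \<odot>\<^sub>V b)"
   unfolding lincomb_def using B cc by (intro M.finsum_cong') auto
  then show "restrict (\<lambda>b. c b v) B \<in> B \<rightarrow>\<^sub>E carrier K \<and> lincomb (restrict (\<lambda>b. c b v) B) B = v"
   using sum[OF v] cc by auto
 next
  fix a assume a: "a \<in> B \<rightarrow>\<^sub>E carrier K \<and> lincomb a B = v"
  have "c b v = a b" if b: "b \<in> B" for b
  proof -
   have "c b v = c b (\<Oplus>\<^bsub>V\<^esub>b'\<in>B. a b' \<odot>\<^sub>V b')" using a by (simp add: lincomb_def)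
   also have "... = (\<Oplus>\<^bsub>K\<^esub>b'\<in>B. c b (a b' \<odot>\<^sub>V b'))"
    using hom_finsum[OF trivial_vectorspace c(1)[OF b], of "\<lambda>b'. a b' \<odot>\<^sub>V b'" B] a B by auto
   also have "... = (\<Oplus>\<^bsub>K\<^esub>b'\<in>B. if b' = b then a b' else \<zero>\<^bsub>K\<^esub>)"
   proof (rule R.finsum_cong'[OF refl])
    show "(\<lambda>b'. if b' = b then a b' else \<zero>\<^bsub>K\<^esub>) \<in> B \<rightarrow> carrier K" using a by auto
    fix b' assume b': "b' \<in> B"
    then have "a b' \<in> carrier K" "b' \<in> carrier V" using a B by auto
    then show "c b (a b' \<odot>\<^sub>V b') = (if b' = b then a b' else \<zero>\<^bsub>K\<^esub>)"
     using homD(3)[OF c(1)[OF b]] c(2)[OF b b'] by (cases "b' = b") auto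
   qed
   also have "... = a b" using R.add.finprod_singleton_swap[of b B a] b fin a by auto
   finally show ?thesis .
  qed
  then show "a = restrict (\<lambda>b. c b v) B" using a by (auto simp: fun_eq_iff PiE_def extensional_def)
 qed
qed

end

section \<open>Modules of a finite group in characteristic p and bases permuted by a
  subgroup\<close>

locale modular_rep = group_module K G M \<rho> + char_p_field K p
 for K :: "('k, 'y) ring_scheme" (structure) and G :: "('g, 'z) monoid_scheme"
  and M :: "('k, 'm, 'x) module_scheme" and \<rho> :: "'g \<Rightarrow> 'm \<Rightarrow> 'm" and p :: nat +
 assumes finite_group: "finite (carrier G)"
begin

abbreviation (input) multG (infixl "\<star>" 70) where "x \<star> y \<equiv> x \<otimes>\<^bsub>G\<^esub> y"
abbreviation (input) "iG \<equiv> m_inv G"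
abbreviation (input) l_cosetG (infixl "<#\<^sub>G" 60) where "x <#\<^sub>G C \<equiv> x <#\<^bsub>G\<^esub> C"
abbreviation (input) oneG ("\<one>\<^sub>G") where "\<one>\<^sub>G \<equiv> \<one>\<^bsub>G\<^esub>"
abbreviation (input) addM (infixl "\<oplus>\<^sub>M" 65) where "v \<oplus>\<^sub>M w \<equiv> v \<oplus>\<^bsub>M\<^esub> w"
abbreviation (input) diffM (infixl "\<ominus>\<^sub>M" 65) where "v \<ominus>\<^sub>M w \<equiv> v \<ominus>\<^bsub>M\<^esub> w"
abbreviation (input) smultM (infixl "\<odot>\<^sub>M" 70) where "c \<odot>\<^sub>M v \<equiv> c \<odot>\<^bsub>M\<^esub> v"
abbreviation (input) zeroM ("\<zero>\<^sub>M") where "\<zero>\<^sub>M \<equiv> \<zero>\<^bsub>M\<^esub>"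
abbreviation (input) "dirsum S \<equiv> is_direct_sum K (G(|carrier := S|)) M \<rho>"
abbreviation (input) "fixM \<equiv> fixed_points M \<rho>"
abbreviation (input) "trM \<equiv> trace_sum K G M \<rho>"


lemma act_hom: "g \<in> carrier G ==> \<rho> g \<in> module_hom K M M"
 by (rule homI) (auto simp: act_closed act_add act_smult)

lemma act_inv:
 assumes "g \<in> carrier G" "v \<in> carrier M"
 shows "\<rho> (iG g) (\<rho> g v) = v" "\<rho> g (\<rho> (iG g) v) = v"
 using act_mult[of "iG g" g v] act_mult[of g "iG g" v] assms act_one by auto

lemma act_inj: "g \<in> carrier G ==> v \<in> carrier M ==> w \<in> carrier M ==> \<rho> g v = \<rho> g w ==> v = w"
 using act_inv(1) by metis

lemma act_zero: "g \<in> carrier G ==> \<rho> g \<zero>\<^sub>M = \<zero>\<^sub>M"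
 using hom_zero[OF vs_self act_hom] .

lemma fin_dim: fin_dim
proof -
 obtain B where B: "finite B" "B \<subseteq> carrier M" "gen_set (\<Union>g\<in>carrier G. \<rho> g ` B)"
  using finitely_generated by blast
 then have "finite (\<Union>g\<in>carrier G. \<rho> g ` B)" using finite_group by blast
 moreover have "(\<Union>g\<in>carrier G. \<rho> g ` B) \<subseteq> carrier M" using act_closed B(2) by blast
 ultimately show ?thesis using B(3) unfolding fin_dim_def by blast
qed

lemma basis_finite: "basis B ==> finite B"
 using fin_dim_li_fin[OF fin_dim] by (auto simp: basis_def)

definition perm_basis :: "'g set \<Rightarrow> 'm set \<Rightarrow> bool"
 where "perm_basis S B \<longleftrightarrow> basis B \<and> (\<forall>x\<in>S. \<rho> x ` B = B)"

lemma perm_basisD: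
 assumes "perm_basis S B"
 shows "basis B" "finite B" "!!b. b \<in> B ==> b \<in> carrier M" "!!g b. g \<in> S ==> b \<in> B ==> \<rho> g b \<in> B"
proof -
 show "basis B" "finite B" "!!b. b \<in> B ==> b \<in> carrier M"
  using assms basis_finite unfolding perm_basis_def basis_def by blast+
 show "\<rho> g b \<in> B" if "g \<in> S" "b \<in> B" for g b
  using assms that unfolding perm_basis_def by blast
qed

lemma perm_basis_acts_on:
 assumes "subgroup S G" "perm_basis S B" shows "acts_on G S B \<rho>"
 using perm_basisD[OF assms(2)] subgroup.mem_carrier[OF assms(1)] act_one act_mult unfolding acts_on_def by auto

text \<open>\<open>\<rho> g\<close> permutes \<open>B\<close> injectively, so the coefficient of
  \<open>\<rho> g v\<close> at \<open>\<rho> g b\<close> can only come from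
  \<open>b\<close>.\<close>

lemma coord_act:
 assumes S: "subgroup S G" and B: "perm_basis S B" and g: "g \<in> S" and v: "v \<in> carrier M" and b: "b \<in> B"
 shows "coord B (\<rho> g v) (\<rho> g b) = coord B v b"
proof -
 note Bb = perm_basisD[OF B]
 have gG: "g \<in> carrier G" using subgroup.mem_carrier[OF S g] .
 have cb: "coord B v b \<in> carrier K" if "b \<in> B" for b using coord_closed[OF Bb(2,1) v that] .
 have gb: "\<rho> g b \<in> B" using Bb(4)[OF g b] .
 have "coord B (\<rho> g v) (\<rho> g b) = (\<Oplus>b'\<in>B. coord B v b' \<otimes> coord B (\<rho> g b') (\<rho> g b))"
 proof -
  have h: "(\<lambda>v. coord B (\<rho> g v) (\<rho> g b)) \<in> module_hom K M (trivial_module K)"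
   by (rule homI)
    (use homD[OF act_hom[OF gG]] homD[OF coord_hom[OF Bb(2,1) gb]] in auto)
  show ?thesis using hom_expand[OF Bb(2,1) trivial_vectorspace h v] by simp
 qed
 also have "... = (\<Oplus>b'\<in>B. if b' = b then coord B v b' else \<zero>)"
 proof (rule R.finsum_cong'[OF refl])
  show "(\<lambda>b'. if b' = b then coord B v b' else \<zero>) \<in> B \<rightarrow> carrier K" using cb by auto
  fix b' assume b': "b' \<in> B"
  have "\<rho> g b' = \<rho> g b \<longleftrightarrow> b' = b" using act_inj[OF gG Bb(3)[OF b'] Bb(3)[OF b]] by auto
  then show "coord B v b' \<otimes> coord B (\<rho> g b') (\<rho> g b) = (if b' = b then coord B v b' else \<zero>)"
   using coord_basis[OF Bb(2,1) gb Bb(4)[OF g b']] cb[OF b'] by auto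
 qed
 also have "... = coord B v b" using R.add.finprod_singleton_swap[of b B "coord B v"] b Bb(2) cb by auto
 finally show ?thesis .
qed

lemma coord_fixed:
 assumes "subgroup S G" "perm_basis S B" "g \<in> S" "v \<in> fixM S" "b \<in> B"
 shows "coord B v (\<rho> g b) = coord B v b"
 using coord_act[OF assms(1-3) _ assms(5), of v] assms(3,4) by (simp add: fixed_points_def)

lemma fixedI_coord:
 assumes S: "subgroup S G" and B: "perm_basis S B" and v: "v \<in> carrier M"
  and c: "!!g b. g \<in> S ==> b \<in> B ==> coord B v (\<rho> g b) = coord B v b"
 shows "v \<in> fixM S"
proof -
 note Bb = perm_basisD[OF B]
 have "\<rho> g v = v" if g: "g \<in> S" for g
 proof (rule coord_eqI[OF Bb(2,1) _ v])
  have gG: "g \<in> carrier G" using subgroup.mem_carrier[OF S g] .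
  show "\<rho> g v \<in> carrier M" using act_closed[OF gG v] .
  fix b assume b: "b \<in> B"
  have g': "iG g \<in> S" using subgroup.m_inv_closed[OF S g] .
  have b': "\<rho> (iG g) b \<in> B" using Bb(4)[OF g' b] .
  have "\<rho> g (\<rho> (iG g) b) = b" using act_inv(2)[OF gG Bb(3)[OF b]] .
  then show "coord B (\<rho> g v) b = coord B v b"
   using coord_act[OF S B g v b'] c[OF g' b] by simp
 qed
 then show ?thesis using v by (simp add: fixed_points_def)
qed

text \<open>At a fixed basis element the coefficients of the summands are constant on
  \<open>S\<close>-orbits of indices, so modulo \<open>p\<close> only the fixed indices
  count.\<close>

lemma coord_fixed_sum:
 assumes S: "subgroup S G" "card S = p ^ n" and B: "perm_basis S B"
  and I: "finite I" "acts_on G S I act"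
  and s: "!!i. i \<in> I ==> s i \<in> carrier K" "!!g i. g \<in> S ==> i \<in> I ==> s (act g i) = s i"
  and d: "!!i. i \<in> I ==> d i \<in> carrier M" "!!g i. g \<in> S ==> i \<in> I ==> d (act g i) = \<rho> g (d i)"
  and b: "b \<in> fixed_set S B \<rho>"
 shows "coord B (\<Oplus>\<^bsub>M\<^esub>i\<in>I. s i \<odot>\<^sub>M d i) b = (\<Oplus>i\<in>fixed_set S I act. s i \<otimes> coord B (d i) b)"
proof -
 note Bb = perm_basisD[OF B]
 have bB: "b \<in> B" and bf: "!!g. g \<in> S ==> \<rho> g b = b" using b by (auto simp: fixed_set_def)
 note h = coord_hom[OF Bb(2,1) bB]
 have "coord B (\<Oplus>\<^bsub>M\<^esub>i\<in>I. s i \<odot>\<^sub>M d i) b = (\<Oplus>i\<in>I. coord B (s i \<odot>\<^sub>M d i) b)"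
  using hom_finsum[OF trivial_vectorspace h, of "\<lambda>i. s i \<odot>\<^sub>M d i" I] s d by auto
 also have "... = (\<Oplus>i\<in>I. s i \<otimes> coord B (d i) b)"
  using s d homD[OF h] by (intro R.finsum_cong') auto
 also have "... = (\<Oplus>i\<in>fixed_set S I act. s i \<otimes> coord B (d i) b)"
 proof (rule finsum_fixed_set[OF G.is_group S I(2,1)])
  show "(\<lambda>i. s i \<otimes> coord B (d i) b) \<in> I \<rightarrow> carrier K" using s d homD(1)[OF h] by auto
  fix g i assume gi: "g \<in> S" "i \<in> I"
  have "coord B (\<rho> g (d i)) (\<rho> g b) = coord B (d i) b"
   using coord_act[OF S(1) B gi(1) d(1)[OF gi(2)] bB] .
  then show "s (act g i) \<otimes> coord B (d (act g i)) b = s i \<otimes> coord B (d i) b"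
   using s(2)[OF gi] d(2)[OF gi] bf[OF gi(1)] by simp
 qed
 finally show ?thesis .
qed

text \<open>Count the finite additive subgroup spanned by an orbit.\<close>

lemma nonzero_fixed_point:
 assumes S: "subgroup S G" "card S = p ^ n" and Z: "subspace K Z M" "!!g z. g \<in> S ==> z \<in> Z ==> \<rho> g z \<in> Z"
  and v: "v \<in> Z" "v ~= \<zero>\<^sub>M"
 obtains z where "z \<in> Z" "z ~= \<zero>\<^sub>M" "z \<in> fixM S"
proof -
 note Zs = subspaceD[OF Z(1)]
 have vM: "v \<in> carrier M" using Zs(2) v(1) .
 have SG: "g \<in> carrier G" if "g \<in> S" for g using subgroup.mem_carrier[OF S(1) that] .
 have finS: "finite S" using finite_subset[OF subgroup.subset[OF S(1)] finite_group] .
 have p0: "0 < p" using prime by (simp add: prime_gt_0_nat)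
 have gv: "\<rho> g v \<in> carrier M" if "g \<in> S" for g using act_closed[OF SG[OF that] vM] .
 have npow: "[m] \<cdot>\<^bsub>M\<^esub> x = ([m] \<cdot> \<one>) \<odot>\<^sub>M x" if "x \<in> carrier M" for m :: nat and x
  using that by (induction m) (simp_all add: smult_l_distr)
 \<comment> \<open>Combinations of the translates of \<open>v\<close> with coefficients in the prime
   field, written as natural numbers. Reduction modulo \<open>p\<close> shows that there are
   finitely many of them, even if \<open>K\<close> is infinite.\<close>
 define \<phi> where "\<phi> c = (\<Oplus>\<^bsub>M\<^esub>g\<in>S. ([(c g :: nat)] \<cdot> \<one>) \<odot>\<^sub>M \<rho> g v)" for c
 have term_closed: "([(m :: nat)] \<cdot> \<one>) \<odot>\<^sub>M \<rho> g v \<in> carrier M" if "g \<in> S" for g m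
  using gv[OF that] by simp
 have \<phi>c: "\<phi> c \<in> carrier M" for c unfolding \<phi>_def using term_closed by (intro M.finsum_closed) auto
 have modp: "[(m mod p)] \<cdot> \<one> = [m] \<cdot> \<one>" for m :: nat
 proof -
  have "[m] \<cdot> \<one> = [(m mod p + p * (m div p))] \<cdot> \<one>" by simp
  also have "... = [(m mod p)] \<cdot> \<one> \<oplus> [(p * (m div p))] \<cdot> \<one>"
   by (rule R.add.nat_pow_mult[symmetric]) simp
  finally show ?thesis using nat_zero[of "p * (m div p)" \<one>] by simp
 qed
 have \<phi>mod: "\<phi> (\<lambda>g\<in>S. c g mod p) = \<phi> c" for c
  unfolding \<phi>_def using term_closed modp by (intro M.finsum_cong') auto
 define V0 where "V0 = \<phi> ` (S \<rightarrow>\<^sub>E {..<p})"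
 have inV0: "\<phi> c \<in> V0" for c
 proof -
  have "(\<lambda>g\<in>S. c g mod p) \<in> S \<rightarrow>\<^sub>E {..<p}" using p0 by auto
  then show ?thesis unfolding V0_def using \<phi>mod[of c] by (metis image_eqI)
 qed
 have finV0: "finite V0" unfolding V0_def using finS by (intro finite_imageI finite_PiE) auto
 have V0M: "V0 \<subseteq> carrier M" unfolding V0_def using \<phi>c by blast
 have V0Z: "V0 \<subseteq> Z"
 proof -
  have "\<phi> c \<in> Z" for c unfolding \<phi>_def using Zs(5) Z(2) v(1) by (intro subspace_finsum[OF Z(1)]) auto
  then show ?thesis unfolding V0_def by blast
 qed
 have add: "\<phi> c \<oplus>\<^sub>M \<phi> d = \<phi> (\<lambda>g. c g + d g)" for c d
 proof -
  have "\<phi> c \<oplus>\<^sub>M \<phi> d = (\<Oplus>\<^bsub>M\<^esub>g\<in>S. ([(c g)] \<cdot> \<one>) \<odot>\<^sub>M \<rho> g v \<oplus>\<^sub>M ([(d g)] \<cdot> \<one>) \<odot>\<^sub>M \<rho> g v)"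
   unfolding \<phi>_def using term_closed by (intro M.finsum_addf[symmetric]) auto
  also have "... = \<phi> (\<lambda>g. c g + d g)" unfolding \<phi>_def
  proof (rule M.finsum_cong'[OF refl])
   show "(\<lambda>g. ([(c g + d g)] \<cdot> \<one>) \<odot>\<^sub>M \<rho> g v) \<in> S \<rightarrow> carrier M" using term_closed by auto
   fix g assume "g \<in> S"
   then show "([(c g)] \<cdot> \<one>) \<odot>\<^sub>M \<rho> g v \<oplus>\<^sub>M ([(d g)] \<cdot> \<one>) \<odot>\<^sub>M \<rho> g v = ([(c g + d g)] \<cdot> \<one>) \<odot>\<^sub>M \<rho> g v"
    using gv R.add.nat_pow_mult[of \<one> "c g" "d g"] by (simp add: smult_l_distr[symmetric])
  qed
  finally show ?thesis .
 qed
 \<comment> \<open>\<open>p - 1\<close> plays the role of minus one for natural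
   coefficients.\<close>
 have neg: "\<ominus>\<^bsub>M\<^esub> \<phi> c = \<phi> (\<lambda>g. (p - 1) * c g)" for c
 proof -
  have "\<phi> (\<lambda>g. (p - 1) * c g) \<oplus>\<^sub>M \<phi> c = \<phi> (\<lambda>g. (p - 1) * c g + c g)" by (rule add)
  also have "(\<lambda>g. (p - 1) * c g + c g) = (\<lambda>g. p * c g)" using p0 by (auto simp: algebra_simps)
  also have "\<phi> (\<lambda>g. p * c g) = (\<Oplus>\<^bsub>M\<^esub>g\<in>S. \<zero>\<^sub>M)"
   unfolding \<phi>_def
  proof (rule M.finsum_cong'[OF refl])
   fix g assume "g \<in> S"
   then show "([(p * c g)] \<cdot> \<one>) \<odot>\<^sub>M \<rho> g v = \<zero>\<^sub>M"
    using nat_zero[of "p * c g" \<one>] gv by simp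
  qed auto
  finally have "\<phi> (\<lambda>g. (p - 1) * c g) \<oplus>\<^sub>M \<phi> c = \<zero>\<^sub>M" by simp
  then show ?thesis using \<phi>c by (intro M.minus_equality) auto
 qed
 let ?A = "add_monoid M"
 have V0A: "subgroup V0 ?A"
 proof (rule M.add.subgroupI)
  show "V0 \<subseteq> carrier M" using V0M by simp
  show "V0 ~= {}" using inV0 by blast
  show "\<ominus>\<^bsub>M\<^esub> a \<in> V0" if a: "a \<in> V0" for a
  proof -
   obtain c where "a = \<phi> c" using a by (auto simp: V0_def)
   then show ?thesis using neg[of c] inV0 by simp
  qed
  show "a \<oplus>\<^sub>M b \<in> V0" if a: "a \<in> V0" and b: "b \<in> V0" for a b
  proof -
   obtain c d where "a = \<phi> c" "b = \<phi> d" using a b by (auto simp: V0_def)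
   then show ?thesis using add[of c d] inV0 by simp
  qed
 qed
 have vV0: "v \<in> V0"
 proof -
  let ?c = "\<lambda>g. if g = \<one>\<^sub>G then 1 else 0 :: nat"
  have "\<phi> ?c = (\<Oplus>\<^bsub>M\<^esub>g\<in>S. if g = \<one>\<^sub>G then \<rho> g v else \<zero>\<^sub>M)"
   unfolding \<phi>_def using gv by (intro M.finsum_cong') auto
  also have "... = v"
   using M.add.finprod_singleton_swap[of "\<one>\<^sub>G" S "\<lambda>g. \<rho> g v"] subgroup.one_closed[OF S(1)] finS gv
    act_one[OF vM] by auto
  finally show ?thesis using inV0 by metis
 qed
 \<comment> \<open>\<open>v\<close> has additive order \<open>p\<close>, so Lagrange applies in the
   finite additive group \<open>V0\<close>.\<close>
 have "p dvd card V0"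
 proof -
  let ?H = "?A(|carrier := V0|)"
  interpret H: group ?H using M.add.subgroup_imp_group[OF V0A] .
  have pow: "v [^]\<^bsub>?H\<^esub> m = [m] \<cdot>\<^bsub>M\<^esub> v" for m :: nat
   by (induction m) (simp_all add: add_pow_def)
  have "v [^]\<^bsub>?H\<^esub> p = \<one>\<^bsub>?H\<^esub>" unfolding pow using npow[OF vM, of p] char vM by simp
  then have "H.ord v dvd p" using H.pow_eq_id[of v p] vV0 by simp
  moreover have "H.ord v ~= 1" using H.ord_eq_1[of v] vV0 v(2) by simp
  ultimately have "H.ord v = p" using prime by (auto simp: prime_nat_iff)
  moreover have "H.ord v dvd card V0" using H.ord_dvd_group_order[of v] vV0 finV0 by (simp add: order_def)
  ultimately show ?thesis by simp
 qed
 have actV0: "\<rho> h x \<in> V0" if h: "h \<in> S" and x: "x \<in> V0" for h x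
 proof -
  obtain c where c: "x = \<phi> c" using x by (auto simp: V0_def)
  have hG: "h \<in> carrier G" using SG[OF h] .
  let ?d = "\<lambda>g. c (iG h \<star> g)"
  have bij: "inj_on (\<lambda>g. h \<star> g) S" "(\<lambda>g. h \<star> g) ` S = S"
  proof -
   show "inj_on (\<lambda>g. h \<star> g) S" using SG h by (intro inj_onI) (metis G.l_cancel)
   then show "(\<lambda>g. h \<star> g) ` S = S"
    using subgroup.m_closed[OF S(1) h] finS by (intro endo_inj_surj) auto
  qed
  have "\<rho> h x = (\<Oplus>\<^bsub>M\<^esub>g\<in>S. \<rho> h (([(c g)] \<cdot> \<one>) \<odot>\<^sub>M \<rho> g v))"
   unfolding c \<phi>_def using term_closed by (intro hom_finsum[OF vs_self act_hom[OF hG]]) auto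
  also have "... = (\<Oplus>\<^bsub>M\<^esub>g\<in>S. ([(?d (h \<star> g))] \<cdot> \<one>) \<odot>\<^sub>M \<rho> (h \<star> g) v)"
  proof (rule M.finsum_cong'[OF refl])
   show "(\<lambda>g. ([(?d (h \<star> g))] \<cdot> \<one>) \<odot>\<^sub>M \<rho> (h \<star> g) v) \<in> S \<rightarrow> carrier M"
    using term_closed subgroup.m_closed[OF S(1) h] by auto
   fix g assume g: "g \<in> S"
   have "iG h \<star> (h \<star> g) = g" using hG SG[OF g] by (simp add: G.m_assoc[symmetric])
   then show "\<rho> h (([(c g)] \<cdot> \<one>) \<odot>\<^sub>M \<rho> g v) = ([(?d (h \<star> g))] \<cdot> \<one>) \<odot>\<^sub>M \<rho> (h \<star> g) v"
    using hG SG[OF g] gv[OF g] vM by (simp add: act_smult act_mult)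
  qed
  also have "... = \<phi> ?d" unfolding \<phi>_def
   using M.finsum_reindex[of "\<lambda>g. ([(?d g)] \<cdot> \<one>) \<odot>\<^sub>M \<rho> g v" "\<lambda>g. h \<star> g" S] bij term_closed by auto
  finally show ?thesis using inV0 by simp
 qed
 let ?Y = "V0 - {\<zero>\<^sub>M}"
 have z0: "\<zero>\<^sub>M \<in> V0" using subgroup.one_closed[OF V0A] by simp
 have acts: "acts_on G S ?Y \<rho>"
  unfolding acts_on_def
 proof (intro conjI ballI)
  fix g i assume g: "g \<in> S" and i: "i \<in> ?Y"
  have "\<rho> g i ~= \<zero>\<^sub>M"
   using act_inj[OF SG[OF g], of i "\<zero>\<^sub>M"] act_zero[OF SG[OF g]] i V0M by auto
  then show "\<rho> g i \<in> ?Y" using actV0[OF g] i by simp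
 next
  fix i assume "i \<in> ?Y" then show "\<rho> \<one>\<^sub>G i = i" using act_one V0M by blast
 next
  fix g h i assume "g \<in> S" "h \<in> S" "i \<in> ?Y"
  then show "\<rho> (g \<star> h) i = \<rho> g (\<rho> h i)" using act_mult SG V0M by blast
 qed
 \<comment> \<open>Otherwise \<open>p\<close> would divide both the size of \<open>V0\<close> and
   that size minus one.\<close>
 have "fixed_set S ?Y \<rho> ~= {}"
 proof
  assume "fixed_set S ?Y \<rho> = {}"
  then have "p dvd card ?Y" using G.prime_dvd_card_acts_on[OF prime S acts] finV0 by simp
  moreover have "card V0 = Suc (card ?Y)" using card.remove[OF finV0 z0] .
  ultimately have "p dvd 1" using \<open>p dvd card V0\<close>
   by (metis Suc_eq_plus1 dvd_add_right_iff)
  then show False using prime by simp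
 qed
 then obtain z where "z \<in> V0" "z ~= \<zero>\<^sub>M" "!!g. g \<in> S ==> \<rho> g z = z" by (auto simp: fixed_set_def)
 then show thesis using that[of z] V0Z V0M by (auto simp: fixed_points_def)
qed

end

section \<open>Exchanging orbits in a permutation basis; trace subspaces\<close>

context modular_rep begin

definition equivariant :: "'g set \<Rightarrow> ('m \<Rightarrow> 'm) \<Rightarrow> bool"
 where "equivariant S h \<longleftrightarrow> (\<forall>g\<in>S. \<forall>v\<in>carrier M. h (\<rho> g v) = \<rho> g (h v))"

text \<open>The trace subspace seen through one permutation basis: \<open>trace_sum_eq\<close>
  identifies it with \<open>trace_sum\<close>, so for a p-subgroup it does not depend on
  \<open>B\<close>.\<close>

definition negl :: "'g set \<Rightarrow> 'm set \<Rightarrow> 'm set"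
 where "negl S B = {v \<in> fixM S. \<forall>b\<in>fixed_set S B \<rho>. coord B v b = \<zero>}"

lemma is_direct_sumD:
 assumes "dirsum S U W"
 shows "subspace K U M" "subspace K W M" "!!g u. g \<in> S ==> u \<in> U ==> \<rho> g u \<in> U"
  "!!g w. g \<in> S ==> w \<in> W ==> \<rho> g w \<in> W" "U \<inter> W = {\<zero>\<^sub>M}" "U <+>\<^bsub>M\<^esub> W = carrier M"
 using assms unfolding is_direct_sum_def group_submodule_def by auto

lemma is_direct_sumI:
 assumes "subspace K U M" "subspace K W M" "!!g u. g \<in> S ==> u \<in> U ==> \<rho> g u \<in> U"
  "!!g w. g \<in> S ==> w \<in> W ==> \<rho> g w \<in> W" "U \<inter> W = {\<zero>\<^sub>M}" "U <+>\<^bsub>M\<^esub> W = carrier M"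
 shows "dirsum S U W"
 using assms unfolding is_direct_sum_def group_submodule_def by auto

lemma is_direct_sum_commute:
 assumes "dirsum S U W"
 shows "dirsum S W U"
proof (rule is_direct_sumI)
 note d = is_direct_sumD[OF assms]
 show "W \<inter> U = {\<zero>\<^sub>M}" using d(5) by blast
 show "W <+>\<^bsub>M\<^esub> U = carrier M"
  unfolding d(6)[symmetric] set_eq_iff set_add_mem
  using subspaceD(2)[OF d(1)] subspaceD(2)[OF d(2)] M.a_comm by metis
qed (use is_direct_sumD[OF assms] in auto)

lemma direct_sum_projection:
 assumes S: "S \<subseteq> carrier G" and ds: "dirsum S U W"
 obtains e where "e \<in> module_hom K M M" "!!v. v \<in> carrier M ==> e v \<in> U"
  "!!v. v \<in> carrier M ==> v \<ominus>\<^sub>M e v \<in> W" "!!u. u \<in> U ==> e u = u" "!!w. w \<in> W ==> e w = \<zero>\<^sub>M"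
  "equivariant S e"
proof -
 note d = is_direct_sumD[OF ds]
 obtain e where e: "e \<in> module_hom K M M" "!!v. v \<in> carrier M ==> e v \<in> U"
  "!!v. v \<in> carrier M ==> v \<ominus>\<^sub>M e v \<in> W" "!!u. u \<in> U ==> e u = u" "!!w. w \<in> W ==> e w = \<zero>\<^sub>M"
 proof (rule complement_projection[OF d(1,2,5,6)], goal_cases)
  case (1 e)
  show ?case by (rule 1(1)[of e, OF 1(2-6)])
 qed
 have "e (\<rho> g v) = \<rho> g (e v)" if g: "g \<in> S" and v: "v \<in> carrier M" for g v
 proof -
  have gG: "g \<in> carrier G" using g S by blast
  let ?w = "v \<ominus>\<^sub>M e v"
  have c: "e v \<in> carrier M" "?w \<in> carrier M" using homD(1)[OF e(1) v] v by auto
  have "\<rho> g v = \<rho> g (e v \<oplus>\<^sub>M ?w)" using v c(1) by simp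
  also have "... = \<rho> g (e v) \<oplus>\<^sub>M \<rho> g ?w" using act_add[OF gG c] .
  finally have "e (\<rho> g v) = e (\<rho> g (e v)) \<oplus>\<^sub>M e (\<rho> g ?w)"
   using homD(2)[OF e(1)] act_closed[OF gG c(1)] act_closed[OF gG c(2)] by simp
  also have "e (\<rho> g (e v)) = \<rho> g (e v)" using e(4) d(3)[OF g e(2)[OF v]] by simp
  also have "e (\<rho> g ?w) = \<zero>\<^sub>M" using e(5) d(4)[OF g e(3)[OF v]] by simp
  finally show ?thesis using act_closed[OF gG c(1)] by simp
 qed
 then have "equivariant S e" by (simp add: equivariant_def)
 then show thesis using that[of e] e by blast
qed

text \<open>Let \<open>\<theta>\<close> be \<open>e\<close> on the orbit and the identity on the
  rest of the basis. If it had a kernel, the p-group \<open>S\<close> would fix a nonzero vector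
  there. Its coefficients on the orbit equal one constant, which the assumption \<open>nz\<close>
  forces to be 0; but then \<open>\<theta>\<close> fixes that vector. So \<open>\<theta>\<close> is
  an automorphism and carries \<open>B\<close> to the new basis.\<close>

lemma exchange_step:
 assumes S: "subgroup S G" "card S = p ^ n" and B: "perm_basis S B" and b1: "b1 \<in> B"
  and e: "e \<in> module_hom K M M" "equivariant S e"
  and nz: "coord B (e (\<Oplus>\<^bsub>M\<^esub>b\<in>(\<lambda>g. \<rho> g b1) ` S. b)) b1 ~= \<zero>"
 shows "perm_basis S ((B - (\<lambda>g. \<rho> g b1) ` S) \<union> e ` (\<lambda>g. \<rho> g b1) ` S)"
proof -
 note Bb = perm_basisD[OF B]
 let ?O = "(\<lambda>g. \<rho> g b1) ` S"
 have SG: "g \<in> carrier G" if "g \<in> S" for g using subgroup.mem_carrier[OF S(1) that] .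
 have OB: "?O \<subseteq> B" using Bb(4) b1 by blast
 have Ost: "\<rho> g b \<in> ?O \<longleftrightarrow> b \<in> ?O" if g: "g \<in> S" and b: "b \<in> B" for g b
 proof
  assume "b \<in> ?O"
  then obtain h where h: "h \<in> S" "b = \<rho> h b1" by blast
  then have "\<rho> g b = \<rho> (g \<star> h) b1" using act_mult[OF SG[OF g] SG[OF h(1)] Bb(3)[OF b1]] by simp
  then show "\<rho> g b \<in> ?O" using subgroup.m_closed[OF S(1) g h(1)] by blast
 next
  assume "\<rho> g b \<in> ?O"
  then obtain h where h: "h \<in> S" "\<rho> g b = \<rho> h b1" by blast
  have g': "iG g \<in> S" using subgroup.m_inv_closed[OF S(1) g] .
  have "b = \<rho> (iG g) (\<rho> h b1)" using act_inv(1)[OF SG[OF g] Bb(3)[OF b]] h(2) by simp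
  also have "... = \<rho> (iG g \<star> h) b1" using act_mult[OF SG[OF g'] SG[OF h(1)] Bb(3)[OF b1]] by simp
  finally show "b \<in> ?O" using subgroup.m_closed[OF S(1) g' h(1)] by blast
 qed
 define d where "d b = (if b \<in> ?O then e b else b)" for b
 have dM: "d b \<in> carrier M" if "b \<in> B" for b using homD(1)[OF e(1)] Bb(3)[OF that] by (simp add: d_def)
 obtain \<theta> where \<theta>: "\<theta> \<in> module_hom K M M" "!!b. b \<in> B ==> \<theta> b = d b"
  "!!v. \<theta> v = (\<Oplus>\<^bsub>M\<^esub>b\<in>B. coord B v b \<odot>\<^sub>M d b)"
  using basis_hom[OF Bb(2,1) vs_self, of d] dM by blast
 have \<theta>S: "\<theta> (\<rho> g v) = \<rho> g (\<theta> v)" if g: "g \<in> S" and v: "v \<in> carrier M" for g v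
 proof (rule hom_ext_basis[OF Bb(2,1) vs_self _ _ _ v])
  note ah = act_hom[OF SG[OF g]]
  show "(\<lambda>v. \<theta> (\<rho> g v)) \<in> module_hom K M M" "(\<lambda>v. \<rho> g (\<theta> v)) \<in> module_hom K M M"
   by (rule homI, use homD[OF ah] homD[OF \<theta>(1)] in auto)+
  fix b assume b: "b \<in> B"
  have "e (\<rho> g b) = \<rho> g (e b)" using e(2) g Bb(3)[OF b] unfolding equivariant_def by blast
  then show "\<theta> (\<rho> g b) = \<rho> g (\<theta> b)"
   using \<theta>(2)[OF b] \<theta>(2)[OF Bb(4)[OF g b]] Ost[OF g b] by (simp add: d_def)
 qed
 have inj: "v = \<zero>\<^sub>M" if v: "v \<in> carrier M" "\<theta> v = \<zero>\<^sub>M" for v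
 proof (rule ccontr)
  assume vn: "v ~= \<zero>\<^sub>M"
  let ?Z = "{v \<in> carrier M. \<theta> v = \<zero>\<^sub>M}"
  have Z: "subspace K ?Z M" by (rule kernel_subspace[OF vs_self \<theta>(1)])
  have Zs: "\<rho> g z \<in> ?Z" if "g \<in> S" "z \<in> ?Z" for g z
   using that \<theta>S[of g z] act_closed[OF SG] act_zero[OF SG] by auto
  have vZ: "v \<in> ?Z" using v by simp
  obtain z where z: "z \<in> ?Z" "z ~= \<zero>\<^sub>M" "z \<in> fixM S"
   by (rule nonzero_fixed_point[OF S Z Zs vZ vn])
  have zM: "z \<in> carrier M" using z by simp
  define c where "c = coord B z b1"
  have cK: "c \<in> carrier K" unfolding c_def using coord_closed[OF Bb(2,1) zM b1] .
  have zc: "coord B z b = c" if "b \<in> ?O" for b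
   using that coord_fixed[OF S(1) B _ z(3) b1] unfolding c_def by auto
  note h1 = coord_hom[OF Bb(2,1) b1]
  have finO: "finite ?O" using OB Bb(2) finite_subset by blast
  \<comment> \<open>Only the orbit of \<open>b1\<close> contributes to this coefficient: the other
    basis elements are left alone by \<open>\<theta>\<close> and differ from
    \<open>b1\<close>.\<close>
  have "\<zero> = coord B (\<theta> z) b1" using z hom_zero[OF trivial_vectorspace h1] by simp
  also have "... = (\<Oplus>b\<in>B. coord B (coord B z b \<odot>\<^sub>M d b) b1)"
   unfolding \<theta>(3)
   using hom_finsum[OF trivial_vectorspace h1, of "\<lambda>b. coord B z b \<odot>\<^sub>M d b" B]
    coord_closed[OF Bb(2,1) zM] dM by auto
  also have "... = (\<Oplus>b\<in>B. coord B z b \<otimes> coord B (d b) b1)"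
   using homD[OF h1] coord_closed[OF Bb(2,1) zM] dM by (intro R.finsum_cong') auto
  also have "... = (\<Oplus>b\<in>?O. c \<otimes> coord B (e b) b1)"
  proof (rule R.add.finprod_mono_neutral_cong_right[OF Bb(2) OB])
   have b1O: "b1 \<in> ?O" using subgroup.one_closed[OF S(1)] act_one[OF Bb(3)[OF b1]] by force
   fix b assume b: "b \<in> B - ?O"
   then have "d b = b" "b ~= b1" using b1O by (auto simp: d_def)
   then show "coord B z b \<otimes> coord B (d b) b1 = \<zero>"
    using b coord_basis[OF Bb(2,1) b1, of b] coord_closed[OF Bb(2,1) zM] by auto
  next
   fix b assume b: "b \<in> ?O"
   then show "coord B z b \<otimes> coord B (d b) b1 = c \<otimes> coord B (e b) b1" using zc[OF b] by (simp add: d_def)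
  next
   show "(\<lambda>b. coord B z b \<otimes> coord B (d b) b1) \<in> B \<rightarrow> carrier K"
    using coord_closed[OF Bb(2,1) zM] coord_closed[OF Bb(2,1) dM b1] by auto
  qed
  also have "... = c \<otimes> (\<Oplus>b\<in>?O. coord B (e b) b1)"
   using homD(1)[OF e(1)] Bb(3) OB coord_closed[OF Bb(2,1) _ b1]
   by (intro R.finsum_rdistr[symmetric] finO cK) blast
  also have "(\<Oplus>b\<in>?O. coord B (e b) b1) = coord B (e (\<Oplus>\<^bsub>M\<^esub>b\<in>?O. b)) b1"
  proof -
   have O: "(\<lambda>b. b) \<in> ?O \<rightarrow> carrier M" using OB Bb(3) by blast
   then have eO: "e \<in> ?O \<rightarrow> carrier M" using homD(1)[OF e(1)] by blast
   show ?thesis unfolding hom_finsum[OF vs_self e(1) O]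
    using hom_finsum[OF trivial_vectorspace h1, of e ?O] eO by simp
  qed
  finally have "c \<otimes> coord B (e (\<Oplus>\<^bsub>M\<^esub>b\<in>?O. b)) b1 = \<zero>" by simp
  moreover have "coord B (e (\<Oplus>\<^bsub>M\<^esub>b\<in>?O. b)) b1 \<in> carrier K"
  proof -
   have "(\<Oplus>\<^bsub>M\<^esub>b\<in>?O. b) \<in> carrier M" using OB Bb(3) by (intro M.finsum_closed) blast
   then show ?thesis using coord_closed[OF Bb(2,1) _ b1] homD(1)[OF e(1)] by blast
  qed
  ultimately have c0: "c = \<zero>" using nz integral cK by blast
  have "\<theta> z = (\<Oplus>\<^bsub>M\<^esub>b\<in>B. coord B z b \<odot>\<^sub>M b)"
   unfolding \<theta>(3)
  proof (rule M.finsum_cong'[OF refl])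
   show "(\<lambda>b. coord B z b \<odot>\<^sub>M b) \<in> B \<rightarrow> carrier M" using coord_closed[OF Bb(2,1) zM] Bb(3) by auto
   fix b assume b: "b \<in> B"
   show "coord B z b \<odot>\<^sub>M d b = coord B z b \<odot>\<^sub>M b"
   proof (cases "b \<in> ?O")
    case True then show ?thesis using zc[OF True] c0 dM[OF b] Bb(3)[OF b] by simp
   next
    case False then show ?thesis by (simp add: d_def)
   qed
  qed
  then have "\<theta> z = z" using coord_sum[OF Bb(2,1) zM] by simp
  then show False using z by simp
 qed
 have bij: "bij_betw \<theta> (carrier M) (carrier M)" by (rule injective_imp_surjective[OF fin_dim \<theta>(1) inj])
 have lin: "linear_map K M M \<theta>"
  using vs_self \<theta>(1) unfolding linear_map_def mod_hom_def mod_hom_axioms_def vectorspace_def by blast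
 have "basis (\<theta> ` B)"
  using linear_map.linear_inj_image_is_basis[OF lin _ _ Bb(1) fin_dim] bij unfolding bij_betw_def by blast
 moreover have "\<rho> x ` \<theta> ` B = \<theta> ` B" if x: "x \<in> S" for x
 proof -
  have "\<rho> x ` \<theta> ` B = \<theta> ` \<rho> x ` B" using \<theta>S[OF x] Bb(3) by (force simp: image_iff)
  also have "\<rho> x ` B = B" using B x unfolding perm_basis_def by blast
  finally show ?thesis .
 qed
 moreover have "\<theta> ` B = (B - ?O) \<union> e ` ?O"
 proof -
  have "\<theta> ` B = d ` B" using \<theta>(2) by (intro image_cong) auto
  also have "... = d ` (B - ?O) \<union> d ` ?O" using OB by blast
  also have "d ` (B - ?O) = B - ?O" by (force simp: d_def)
  also have "d ` ?O = e ` ?O" by (intro image_cong) (auto simp: d_def)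
  finally show ?thesis .
 qed
 ultimately show ?thesis unfolding perm_basis_def by auto
qed

text \<open>One of the two projections of an orbit sum has a nonzero coefficient, so that the orbit can be
 exchanged for its image under this projection.\<close>

lemma perm_basis_split:
 assumes S: "subgroup S G" "card S = p ^ n" and B: "perm_basis S B"
  and ds: "dirsum S U W"
 obtains B' where "perm_basis S B'" "B' \<subseteq> U \<union> W"
proof -
 note d = is_direct_sumD[OF ds]
 have SsG: "S \<subseteq> carrier G" using subgroup.subset[OF S(1)] .
 obtain e where e: "e \<in> module_hom K M M" "!!v. v \<in> carrier M ==> e v \<in> U"
  "!!v. v \<in> carrier M ==> v \<ominus>\<^sub>M e v \<in> W" "equivariant S e"
  by (rule direct_sum_projection[OF SsG ds]) blast
 define e' where "e' v = v \<ominus>\<^sub>M e v" for v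
 have e'h: "e' \<in> module_hom K M M" unfolding e'_def by (rule hom_sub[OF vs_self hom_id e(1)])
 have e'S: "equivariant S e'"
  unfolding equivariant_def
 proof (intro ballI)
  fix g v assume g: "g \<in> S" and v: "v \<in> carrier M"
  have gG: "g \<in> carrier G" using g SsG by blast
  show "e' (\<rho> g v) = \<rho> g (e' v)"
   using e(4) g v hom_diff[OF vs_self act_hom[OF gG] v homD(1)[OF e(1) v]]
   unfolding equivariant_def e'_def by simp
 qed
 have e'W: "e' v \<in> W" if "v \<in> carrier M" for v unfolding e'_def using e(3)[OF that] .
 \<comment> \<open>Induction on the number of basis elements outside \<open>U \<union> W\<close>.
   The orbit to be exchanged lies wholly outside, its image inside.\<close>
 have "\<exists>B'. perm_basis S B' \<and> B' \<subseteq> U \<union> W"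
  using B
 proof (induction "card (B - (U \<union> W))" arbitrary: B rule: less_induct)
  case less
  note Bb = perm_basisD[OF less.prems]
  show ?case
  proof (cases "B \<subseteq> U \<union> W")
   case True then show ?thesis using less.prems by blast
  next
   case False
   then obtain b1 where b1: "b1 \<in> B" "b1 \<notin> U \<union> W" by blast
   let ?O = "(\<lambda>g. \<rho> g b1) ` S"
   let ?s = "\<Oplus>\<^bsub>M\<^esub>b\<in>?O. b"
   have OB: "?O \<subseteq> B" using Bb(4) b1 by blast
   have finO: "finite ?O" using OB Bb(2) finite_subset by blast
   have b1O: "b1 \<in> ?O" using subgroup.one_closed[OF S(1)] act_one[OF Bb(3)[OF b1(1)]] by force
   have sM: "?s \<in> carrier M" using OB Bb(3) by (intro M.finsum_closed) blast
   note h1 = coord_hom[OF Bb(2,1) b1(1)]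
   have OUW: "?O \<inter> (U \<union> W) = {}"
   proof -
    have "\<rho> g b1 \<notin> U \<union> W" if g: "g \<in> S" for g
    proof
     have gG: "g \<in> carrier G" using g SsG by blast
     assume "\<rho> g b1 \<in> U \<union> W"
     then have "\<rho> (iG g) (\<rho> g b1) \<in> U \<union> W"
      using d(3,4)[OF subgroup.m_inv_closed[OF S(1) g]] by blast
     then show False using b1(2) act_inv(1)[OF gG Bb(3)[OF b1(1)]] by simp
    qed
    then show ?thesis by blast
   qed
   have step: ?thesis if x: "x \<in> module_hom K M M" "equivariant S x"
    "!!v. v \<in> carrier M ==> x v \<in> U \<union> W" "coord B (x ?s) b1 ~= \<zero>" for x
   proof -
    let ?B' = "(B - ?O) \<union> x ` ?O"
    have pb: "perm_basis S ?B'" by (rule exchange_step[OF S less.prems b1(1) x(1,2,4)])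
    have "x ` ?O \<subseteq> U \<union> W" using x(3) OB Bb(3) by blast
    then have "?B' - (U \<union> W) \<subseteq> (B - (U \<union> W)) - {b1}" using b1O by blast
    then have "card (?B' - (U \<union> W)) \<le> card ((B - (U \<union> W)) - {b1})"
     by (rule card_mono[rotated]) (simp add: Bb(2))
    also have "... < card (B - (U \<union> W))"
     by (rule card_Diff1_less) (use b1 Bb(2) in auto)
    finally show ?thesis by (rule less.hyps[OF _ pb])
   qed
   \<comment> \<open>\<open>e\<close> and \<open>e'\<close> add up to the identity, and the orbit
     sum has coefficient 1 at \<open>b1\<close>.\<close>
   have "coord B (e ?s) b1 ~= \<zero> \<or> coord B (e' ?s) b1 ~= \<zero>"
   proof (rule ccontr)
    assume no: "\<not> ?thesis"
    have es: "e ?s \<in> carrier M" "e' ?s \<in> carrier M" using homD(1)[OF e(1) sM] homD(1)[OF e'h sM] by auto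
    have "?s = e' ?s \<oplus>\<^sub>M e ?s" unfolding e'_def using sM es(1) by simp
    then have "coord B ?s b1 = coord B (e' ?s) b1 \<oplus> coord B (e ?s) b1"
     using homD(2)[OF h1 es(2) es(1)] by simp
    then have "coord B ?s b1 = \<zero>" using no by simp
    moreover have "coord B ?s b1 = (\<Oplus>b\<in>?O. if b = b1 then \<one> else \<zero>)"
    proof -
     have "(\<lambda>b. b) \<in> ?O \<rightarrow> carrier M" using OB Bb(3) by blast
     then have "coord B ?s b1 = (\<Oplus>b\<in>?O. coord B b b1)"
      using hom_finsum[OF trivial_vectorspace h1] by simp
     also have "... = (\<Oplus>b\<in>?O. if b = b1 then \<one> else \<zero>)"
     proof (rule R.finsum_cong'[OF refl])
      fix b assume "b \<in> ?O"
      then have "b \<in> B" using OB by blast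
      then show "coord B b b1 = (if b = b1 then \<one> else \<zero>)"
       using coord_basis[OF Bb(2,1) b1(1)] by simp
     qed simp
     finally show ?thesis .
    qed
    moreover have "... = \<one>"
     using R.add.finprod_singleton_swap[of b1 ?O "\<lambda>_. \<one>"] b1O finO by simp
    ultimately show False by simp
   qed
   then show ?thesis using step[OF e(1,4)] step[OF e'h e'S] e(2) e'W by blast
  qed
 qed
 then show thesis using that by blast
qed

text \<open>Every basis element is either kept or killed by \<open>e\<close>.\<close>

lemma projection_expand:
 assumes B: "basis B" "B \<subseteq> U \<union> W" and e: "e \<in> module_hom K M M"
  "!!u. u \<in> U ==> e u = u" "!!w. w \<in> W ==> e w = \<zero>\<^sub>M" and v: "v \<in> carrier M"
 shows "e v = (\<Oplus>\<^bsub>M\<^esub>b\<in>B \<inter> U. coord B v b \<odot>\<^sub>M b)"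
proof -
 note fB = basis_finite[OF B(1)]
 note bc = basis_carrier[OF fB B(1)] and cc = coord_closed[OF fB B(1) v]
 have "e v = (\<Oplus>\<^bsub>M\<^esub>b\<in>B. coord B v b \<odot>\<^sub>M e b)" by (rule hom_expand[OF fB B(1) vs_self e(1) v])
 also have "... = (\<Oplus>\<^bsub>M\<^esub>b\<in>B \<inter> U. coord B v b \<odot>\<^sub>M b)"
 proof (rule M.add.finprod_mono_neutral_cong_right[OF fB])
  show "B \<inter> U \<subseteq> B" by blast
  show "coord B v b \<odot>\<^sub>M e b = \<zero>\<^sub>M" if "b \<in> B - B \<inter> U" for b
   using that e(3) B(2) cc by auto
  show "coord B v b \<odot>\<^sub>M e b = coord B v b \<odot>\<^sub>M b" if "b \<in> B \<inter> U" for b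
   using that e(2) by simp
  show "(\<lambda>b. coord B v b \<odot>\<^sub>M e b) \<in> B \<rightarrow> carrier M" using cc bc homD(1)[OF e(1)] by auto
 qed
 finally show ?thesis .
qed

lemma fixed_points_subspace:
 assumes "S \<subseteq> carrier G" shows "subspace K (fixM S) M"
proof (rule subspaceI)
 have g: "g \<in> carrier G" if "g \<in> S" for g using that assms by blast
 show "fixM S \<subseteq> carrier M" by (auto simp: fixed_points_def)
 show "\<zero>\<^sub>M \<in> fixM S" using act_zero[OF g] by (simp add: fixed_points_def)
 show "u \<oplus>\<^sub>M v \<in> fixM S" if "u \<in> fixM S" "v \<in> fixM S" for u v
  using that act_add[OF g] by (simp add: fixed_points_def)
 show "c \<odot>\<^sub>M u \<in> fixM S" if "c \<in> carrier K" "u \<in> fixM S" for c u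
  using that act_smult[OF g] by (simp add: fixed_points_def)
qed

lemma negl_subspace:
 assumes "subgroup S G" "perm_basis S B" shows "subspace K (negl S B) M"
proof -
 note Bb = perm_basisD[OF assms(2)]
 note F = subspaceD[OF fixed_points_subspace[OF subgroup.subset[OF assms(1)]]]
 have h: "(\<lambda>v. coord B v b) \<in> module_hom K M (trivial_module K)" if "b \<in> fixed_set S B \<rho>" for b
  using that by (intro coord_hom[OF Bb(2,1)]) (simp add: fixed_set_def)
 show ?thesis
 proof (rule subspaceI)
  show "negl S B \<subseteq> carrier M" using F(1) unfolding negl_def by blast
  show "\<zero>\<^sub>M \<in> negl S B" using F(3) hom_zero[OF trivial_vectorspace h] by (simp add: negl_def)
  show "u \<oplus>\<^sub>M v \<in> negl S B" if "u \<in> negl S B" "v \<in> negl S B" for u v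
   using that F(2,4) homD(2)[OF h] by (simp add: negl_def)
  show "c \<odot>\<^sub>M u \<in> negl S B" if "c \<in> carrier K" "u \<in> negl S B" for c u
   using that F(2,5) homD(3)[OF h] by (simp add: negl_def)
 qed
qed

lemma rel_trace_eq: "rel_trace G M \<rho> R Q v = coset_sum M G Q R (\<lambda>x. \<rho> x v)"
 by (simp add: rel_trace_def coset_sum_def G.lcosets_eq_cosets)

text \<open>The index of a proper subgroup of a p-group is divisible by \<open>p\<close>, and at a
  \<open>Q\<close>-fixed basis element all translates of \<open>v\<close> have the same
  coefficient.\<close>

lemma rel_trace_props:
 assumes Q: "subgroup Q G" "card Q = p ^ n" and B: "perm_basis Q B"
  and R: "subgroup R G" "R \<subset> Q" and v: "v \<in> fixM R"
 shows "rel_trace G M \<rho> R Q v \<in> carrier M" "rel_trace G M \<rho> R Q v \<in> negl Q B"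
proof -
 note Bb = perm_basisD[OF B]
 have RQ: "R \<subseteq> Q" using R by blast
 have QG: "g \<in> carrier G" if "g \<in> Q" for g using subgroup.mem_carrier[OF Q(1) that] .
 have finQ: "finite Q" using finite_subset[OF subgroup.subset[OF Q(1)] finite_group] .
 have vM: "v \<in> carrier M" using v by (simp add: fixed_points_def)
 have rep: "(SOME x. x \<in> C) \<in> Q" if "C \<in> cosets G Q R" for C using G.cosets_rep(2)[OF R(1) Q(1) RQ that] .
 have cl: "\<rho> x v \<in> carrier M" if "x \<in> Q" for x using act_closed[OF QG[OF that] vM] .
 have inv: "\<rho> (b \<star> a) v = \<rho> b v" if "b \<in> Q" "a \<in> R" for a b
  using that RQ v act_mult[OF QG QG vM] by (auto simp: fixed_points_def)
 let ?t = "coset_sum M G Q R (\<lambda>x. \<rho> x v)"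
 have tM: "?t \<in> carrier M" unfolding coset_sum_def using rep cl by (intro M.finsum_closed) blast
 have fx: "\<rho> g ?t = ?t" if g: "g \<in> Q" for g
 proof -
  have "\<rho> g ?t = (\<Oplus>\<^bsub>M\<^esub>C\<in>cosets G Q R. \<rho> g (\<rho> (SOME x. x \<in> C) v))"
   unfolding coset_sum_def using rep cl by (intro hom_finsum[OF vs_self act_hom[OF QG[OF g]]]) blast
  also have "... = coset_sum M G Q R (\<lambda>x. \<rho> (g \<star> x) v)"
   unfolding coset_sum_def
  proof (rule M.finsum_cong'[OF refl])
   show "(\<lambda>C. \<rho> (g \<star> (SOME x. x \<in> C)) v) \<in> cosets G Q R \<rightarrow> carrier M"
    using rep cl subgroup.m_closed[OF Q(1) g] by blast
   show "\<rho> g (\<rho> (SOME x. x \<in> C) v) = \<rho> (g \<star> (SOME x. x \<in> C)) v" if "C \<in> cosets G Q R" for C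
    using act_mult[OF QG[OF g] QG[OF rep[OF that]] vM] by simp
  qed
  also have "... = ?t"
   using cl inv by (intro G.coset_sum_left[OF R(1) Q(1) RQ g M.abelian_monoid_axioms, of "\<lambda>x. \<rho> x v"]) auto
  finally show ?thesis .
 qed
 have pc: "p dvd card (cosets G Q R)"
 proof -
  have e: "card (cosets G Q R) * card R = p ^ n" using G.card_cosets[OF R(1) Q(1) RQ finQ] Q(2) by simp
  then have "card (cosets G Q R) dvd p ^ n" by (metis dvd_triv_left)
  then obtain k where k: "card (cosets G Q R) = p ^ k" using prime divides_primepow_nat by blast
  have "card R < card Q" using psubset_card_mono[OF finQ R(2)] .
  then have "card (cosets G Q R) ~= 1" using e Q(2) by auto
  then have "k ~= 0" using k by (intro notI) simp
  then show ?thesis using k by (simp add: dvd_power)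
 qed
 have co: "coord B ?t b = \<zero>" if b: "b \<in> fixed_set Q B \<rho>" for b
 proof -
  have bB: "b \<in> B" and bf: "!!g. g \<in> Q ==> \<rho> g b = b" using b by (auto simp: fixed_set_def)
  note h = coord_hom[OF Bb(2,1) bB]
  have bK: "coord B v b \<in> carrier K" using coord_closed[OF Bb(2,1) vM bB] .
  have "coord B ?t b = (\<Oplus>C\<in>cosets G Q R. coord B (\<rho> (SOME x. x \<in> C) v) b)"
  proof -
   have "(\<lambda>C. \<rho> (SOME x. x \<in> C) v) \<in> cosets G Q R \<rightarrow> carrier M" using rep cl by blast
   from hom_finsum[OF trivial_vectorspace h this] show ?thesis unfolding coset_sum_def by simp
  qed
  also have "... = (\<Oplus>C\<in>cosets G Q R. coord B v b)"
  proof (rule R.finsum_cong'[OF refl])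
   show "(\<lambda>C. coord B v b) \<in> cosets G Q R \<rightarrow> carrier K" using bK by blast
   fix C assume "C \<in> cosets G Q R"
   then show "coord B (\<rho> (SOME x. x \<in> C) v) b = coord B v b"
    using coord_act[OF Q(1) B rep vM bB] bf[OF rep] by metis
  qed
  also have "... = [(card (cosets G Q R))] \<cdot> coord B v b" by (rule R.add.finprod_const[OF bK])
  also have "... = \<zero>" by (rule nat_zero[OF pc bK])
  finally show ?thesis .
 qed
 show "rel_trace G M \<rho> R Q v \<in> carrier M" "rel_trace G M \<rho> R Q v \<in> negl Q B"
  unfolding rel_trace_eq negl_def fixed_points_def using tM fx co by auto
qed

text \<open>This makes \<open>M(Q)\<close> computable: modulo traces exactly the
  \<open>Q\<close>-fixed elements of a permutation basis survive. For the inclusion of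
  \<open>negl\<close> in the traces, a basis element \<open>b\<close> in the support of
  \<open>v\<close> has a proper stabiliser \<open>R\<close>, and subtracting a multiple of the trace
  of \<open>b\<close> from \<open>R\<close> shrinks the support.\<close>

lemma trace_sum_eq:
 assumes Q: "subgroup Q G" "card Q = p ^ n" and B: "perm_basis Q B"
 shows "trM Q = negl Q B"
proof
 let ?T = "\<Union>R\<in>{R. subgroup R G \<and> R \<subset> Q}. rel_trace G M \<rho> R Q ` fixM R"
 note Bb = perm_basisD[OF B]
 note props = rel_trace_props[OF Q B]
 have QG: "g \<in> carrier G" if "g \<in> Q" for g using subgroup.mem_carrier[OF Q(1) that] .
 have T: "?T \<subseteq> carrier M" "?T \<subseteq> negl Q B" using props by blast+
 have N: "subspace K (negl Q B) M" by (rule negl_subspace[OF Q(1) B])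
 show "trM Q \<subseteq> negl Q B"
  unfolding trace_sum_def using span_is_subset[OF T(2)] N by simp
 have Ts: "subspace K (span ?T) M" by (rule span_is_subspace[OF T(1)])
 note Tsp = subspaceD[OF Ts] and Nsp = subspaceD[OF N]
 have "v \<in> span ?T" if "v \<in> negl Q B" for v
  using that
 proof (induction "card {b \<in> B. coord B v b ~= \<zero>}" arbitrary: v rule: less_induct)
  case less
  have vM: "v \<in> carrier M" using Nsp(2)[OF less.prems] .
  have vQ: "v \<in> fixM Q" using less.prems by (simp add: negl_def)
  show ?case
  proof (cases "\<exists>b\<in>B. coord B v b ~= \<zero>")
   case False
   have "v = \<zero>\<^sub>M"
    using False vM hom_zero[OF trivial_vectorspace coord_hom[OF Bb(2,1)]]
    by (intro coord_eqI[OF Bb(2,1)]) auto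
   then show ?thesis using Tsp(3) by simp
  next
   case True
   then obtain b where b: "b \<in> B" "coord B v b ~= \<zero>" by blast
   have bM: "b \<in> carrier M" using Bb(3)[OF b(1)] .
   define c where "c = coord B v b"
   have cK: "c \<in> carrier K" unfolding c_def using coord_closed[OF Bb(2,1) vM b(1)] .
   define R where "R = {g \<in> Q. \<rho> g b = b}"
   have R: "subgroup R G"
   proof (rule G.subgroupI)
    show "R \<subseteq> carrier G" using QG by (auto simp: R_def)
    show "R ~= {}" using subgroup.one_closed[OF Q(1)] act_one[OF bM] by (auto simp: R_def)
    show "iG a \<in> R" if a: "a \<in> R" for a
     using a subgroup.m_inv_closed[OF Q(1)] act_inv(1)[OF QG bM, of a] by (auto simp: R_def)
    show "a \<star> a' \<in> R" if "a \<in> R" "a' \<in> R" for a a'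
     using that subgroup.m_closed[OF Q(1)] act_mult[OF QG QG bM] by (auto simp: R_def)
   qed
   \<comment> \<open>As \<open>v\<close> lies in \<open>negl\<close>, a basis element with nonzero
     coefficient is not fixed by \<open>Q\<close>.\<close>
   have RQ: "R \<subset> Q"
   proof -
    have "b \<notin> fixed_set Q B \<rho>" using less.prems b by (auto simp: negl_def)
    then show ?thesis using b(1) by (auto simp: R_def fixed_set_def)
   qed
   have RQ': "R \<subseteq> Q" using RQ by blast
   have bR: "b \<in> fixM R" using bM by (auto simp: fixed_points_def R_def)
   let ?t = "rel_trace G M \<rho> R Q b"
   have t: "?t \<in> carrier M" "?t \<in> negl Q B" using props[OF R RQ bR] by auto
   have rep: "(SOME x. x \<in> C) \<in> Q" if "C \<in> cosets G Q R" for C using G.cosets_rep(2)[OF R Q(1) RQ' that] .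
   have ct: "coord B ?t b' = (\<Oplus>C\<in>cosets G Q R. if b' = \<rho> (SOME x. x \<in> C) b then \<one> else \<zero>)"
    if b': "b' \<in> B" for b'
   proof -
    have 1: "(\<lambda>C. \<rho> (SOME x. x \<in> C) b) \<in> cosets G Q R \<rightarrow> carrier M" using rep Bb(3,4) b(1) by blast
    have "coord B ?t b' = (\<Oplus>C\<in>cosets G Q R. coord B (\<rho> (SOME x. x \<in> C) b) b')"
     using hom_finsum[OF trivial_vectorspace coord_hom[OF Bb(2,1) b'] 1]
     unfolding rel_trace_eq coset_sum_def by simp
    also have "... = (\<Oplus>C\<in>cosets G Q R. if b' = \<rho> (SOME x. x \<in> C) b then \<one> else \<zero>)"
     using coord_basis[OF Bb(2,1) b' Bb(4)[OF rep b(1)]] by (intro R.finsum_cong') auto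
    finally show ?thesis .
   qed
   \<comment> \<open>Among the cosets of the stabiliser only \<open>R\<close> itself sends
     \<open>b\<close> to \<open>b\<close>.\<close>
   have tb: "coord B ?t b = \<one>"
   proof -
    have 1: "\<one>\<^sub>G <#\<^sub>G R = R" using G.lcos_mult_one[OF subgroup.subset[OF R]] .
    then have RC: "R \<in> cosets G Q R" using subgroup.one_closed[OF Q(1)] unfolding cosets_def by (metis image_eqI)
    have iff: "b = \<rho> (SOME x. x \<in> C) b \<longleftrightarrow> C = R" if C: "C \<in> cosets G Q R" for C
    proof
     assume "b = \<rho> (SOME x. x \<in> C) b"
     then have "(SOME x. x \<in> C) \<in> R" using rep[OF C] by (simp add: R_def)
     then have "R = (SOME x. x \<in> C) <#\<^sub>G R"
      using G.l_coset_eq_iff[OF R G.one_closed, of "SOME x. x \<in> C"] QG[OF rep[OF C]] 1 by simp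
     then show "C = R" using G.cosets_rep(3)[OF R Q(1) RQ' C] by simp
    next
     assume "C = R"
     then show "b = \<rho> (SOME x. x \<in> C) b" using G.cosets_rep(1)[OF R Q(1) RQ' C] by (simp add: R_def)
    qed
    have "coord B ?t b = (\<Oplus>C\<in>cosets G Q R. if C = R then \<one> else \<zero>)"
     unfolding ct[OF b(1)] using iff by (intro R.finsum_cong') auto
    also have "... = \<one>"
    proof -
     have "finite (cosets G Q R)"
      using finite_subset[OF subgroup.subset[OF Q(1)] finite_group] by (simp add: cosets_def)
     then show ?thesis using R.add.finprod_singleton_swap[OF RC, of "\<lambda>_. \<one>"] by simp
    qed
    finally show ?thesis .
   qed
   \<comment> \<open>The coefficients of the fixed vector \<open>v\<close> are constant on orbits,
     so the trace of \<open>b\<close> is supported inside the support of \<open>v\<close>.\<close>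
   have t0: "coord B ?t b' = \<zero>" if b': "b' \<in> B" "coord B v b' = \<zero>" for b'
   proof -
    have "b' ~= \<rho> (SOME x. x \<in> C) b" if "C \<in> cosets G Q R" for C
     using coord_fixed[OF Q(1) B rep[OF that] vQ b(1)] b(2) b'(2) by auto
    then have "coord B ?t b' = (\<Oplus>C\<in>cosets G Q R. \<zero>)"
     unfolding ct[OF b'(1)] by (intro R.finsum_cong') auto
    then show ?thesis by simp
   qed
   define w where "w = v \<ominus>\<^sub>M c \<odot>\<^sub>M ?t"
   have ctN: "c \<odot>\<^sub>M ?t \<in> negl Q B" using Nsp(5)[OF cK t(2)] .
   have wN: "w \<in> negl Q B" unfolding w_def using Nsp(7)[OF less.prems ctN] .
   have cw: "coord B w b' = coord B v b' \<ominus> c \<otimes> coord B ?t b'" if b': "b' \<in> B" for b'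
   proof -
    note h = coord_hom[OF Bb(2,1) b']
    have "coord B w b' = coord B v b' \<ominus>\<^bsub>trivial_module K\<^esub> coord B (c \<odot>\<^sub>M ?t) b'"
     unfolding w_def using hom_diff[OF trivial_vectorspace h vM Nsp(2)[OF ctN]] .
    moreover have "coord B (c \<odot>\<^sub>M ?t) b' = c \<otimes> coord B ?t b'" using homD(3)[OF h cK t(1)] by simp
    moreover have "\<ominus>\<^bsub>trivial_module K\<^esub> x = \<ominus> x" if "x \<in> carrier K" for x
     by (simp add: a_inv_def m_inv_def trivial_module_def)
    ultimately show ?thesis using coord_closed[OF Bb(2,1) t(1) b'] cK by (simp add: a_minus_def)
   qed
   have "coord B w b = \<zero>" using cw[OF b(1)] tb cK unfolding c_def by (simp add: R.r_neg a_minus_def)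
   moreover have "coord B w b' = \<zero>" if "b' \<in> B" "coord B v b' = \<zero>" for b'
    using cw[OF that(1)] t0[OF that] that cK by (simp add: a_minus_def)
   ultimately have "{b \<in> B. coord B w b ~= \<zero>} \<subset> {b \<in> B. coord B v b ~= \<zero>}" using b by blast
   then have "card {b \<in> B. coord B w b ~= \<zero>} < card {b \<in> B. coord B v b ~= \<zero>}"
    using Bb(2) by (intro psubset_card_mono) auto
   then have "w \<in> span ?T" using less.hyps wN by blast
   moreover have "?t \<in> span ?T"
   proof -
    have "?t \<in> ?T" using R RQ bR by blast
    then show ?thesis using in_own_span[OF T(1)] by blast
   qed
   moreover have "v = w \<oplus>\<^sub>M c \<odot>\<^sub>M ?t" unfolding w_def using vM Nsp(2)[OF ctN] by simp
   ultimately show ?thesis using Tsp(4)[OF _ Tsp(5)[OF cK]] by simp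
  qed
 qed
 then show "negl Q B \<subseteq> trM Q" unfolding trace_sum_def by blast
qed

text \<open>For an equivariant map the two parts of the Fitting decomposition are submodules, so one
  of them is 0.\<close>

lemma indecomposable_nilpotent_or_bij:
 assumes ind: "indecomposable K (G(|carrier := S|)) M \<rho>" and S: "S \<subseteq> carrier G"
  and x: "x \<in> module_hom K M M" "equivariant S x"
 shows "(\<exists>n. \<forall>v\<in>carrier M. (x ^^ n) v = \<zero>\<^sub>M) \<or> bij_betw x (carrier M) (carrier M)"
proof -
 obtain n where n0: "0 < n" and int: "{v \<in> carrier M. (x ^^ n) v = \<zero>\<^sub>M} \<inter> (x ^^ n) ` carrier M = {\<zero>\<^sub>M}"
  and sum: "{v \<in> carrier M. (x ^^ n) v = \<zero>\<^sub>M} <+>\<^bsub>M\<^esub> (x ^^ n) ` carrier M = carrier M"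
  by (rule fitting[OF fin_dim x(1)])
 note xn = hom_funpow[OF x(1)]
 have eq: "(x ^^ j) (\<rho> g v) = \<rho> g ((x ^^ j) v)" if "g \<in> S" "v \<in> carrier M" for j g v
  using that by (induction j) (use x(2) homD(1)[OF xn] in \<open>auto simp: equivariant_def\<close>)
 let ?k = "{v \<in> carrier M. (x ^^ n) v = \<zero>\<^sub>M}" and ?i = "(x ^^ n) ` carrier M"
 have "dirsum S ?k ?i"
 proof (rule is_direct_sumI[OF _ _ _ _ int sum])
  show "subspace K ?k M" by (rule kernel_subspace[OF vs_self xn])
  show "subspace K ?i M" by (rule image_subspace[OF vs_self xn subspace_carrier])
  show "\<rho> g u \<in> ?k" if "g \<in> S" "u \<in> ?k" for g u
   using that eq act_zero act_closed S by auto
  show "\<rho> g u \<in> ?i" if g: "g \<in> S" and u: "u \<in> ?i" for g u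
  proof -
   obtain v where v: "v \<in> carrier M" "u = (x ^^ n) v" using u by blast
   then have "\<rho> g u = (x ^^ n) (\<rho> g v)" using eq[OF g v(1)] by simp
   moreover have "\<rho> g v \<in> carrier M" using act_closed v(1) g S by blast
   ultimately show ?thesis by blast
  qed
 qed
 then consider "?k = {\<zero>\<^sub>M}" | "?i = {\<zero>\<^sub>M}" using ind unfolding indecomposable_def by blast
 then show ?thesis
 proof cases
  case 1
  obtain m where m: "n = Suc m" using n0 by (cases n) auto
  have "v = \<zero>\<^sub>M" if "v \<in> carrier M" "x v = \<zero>\<^sub>M" for v
  proof -
   have "(x ^^ n) v = (x ^^ m) (x v)" using m by (simp add: funpow_swap1)
   also have "... = \<zero>\<^sub>M" using that(2) hom_zero[OF vs_self xn] by simp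
   finally show ?thesis using 1 that(1) by blast
  qed
  then show ?thesis using injective_imp_surjective[OF fin_dim x(1)] by blast
 next
  case 2
  then show ?thesis by blast
 qed
qed

end

text \<open>Conjugation is injective, so it maps a finite \<open>Q\<close> onto itself as soon as it
  maps it into itself.\<close>

lemma (in group) normalizer_iff:
 assumes "Q \<subseteq> carrier G" "finite Q"
 shows "g \<in> normalizer G Q \<longleftrightarrow> g \<in> carrier G \<and> (\<forall>u\<in>Q. g \<otimes> u \<otimes> inv g \<in> Q)"
proof -
 have eq: "g <# Q #> inv g = (\<lambda>u. g \<otimes> u \<otimes> inv g) ` Q" if "g \<in> carrier G" for g
  using that assms by (auto simp: l_coset_def r_coset_def image_def)
 have inj: "inj_on (\<lambda>u. g \<otimes> u \<otimes> inv g) Q" if g: "g \<in> carrier G" for g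
 proof (rule inj_onI)
  fix u v assume uv: "u \<in> Q" "v \<in> Q" "g \<otimes> u \<otimes> inv g = g \<otimes> v \<otimes> inv g"
  then have "u \<in> carrier G" "v \<in> carrier G" using assms(1) by auto
  then show "u = v" using uv(3) g by simp
 qed
 have "g <# Q #> inv g = Q \<longleftrightarrow> (\<forall>u\<in>Q. g \<otimes> u \<otimes> inv g \<in> Q)" if g: "g \<in> carrier G" for g
  unfolding eq[OF g]
 proof
  assume "\<forall>u\<in>Q. g \<otimes> u \<otimes> inv g \<in> Q"
  then show "(\<lambda>u. g \<otimes> u \<otimes> inv g) ` Q = Q" using endo_inj_surj[OF assms(2) _ inj[OF g]] by blast
 qed blast
 then show ?thesis using assms(1) by (auto simp: normalizer_def stabilizer_def)
qed

section \<open>Quotient spaces\<close>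

context vectorspace begin

context
 fixes T
 assumes T: "subspace K T V"
begin

lemma coset_eq_iff:
 assumes "v \<in> carrier V" "w \<in> carrier V"
 shows "T +>\<^bsub>V\<^esub> v = T +>\<^bsub>V\<^esub> w \<longleftrightarrow> v \<ominus>\<^sub>V w \<in> T"
proof
 note Ts = subspaceD[OF T]
 assume "T +>\<^bsub>V\<^esub> v = T +>\<^bsub>V\<^esub> w"
 moreover have "v \<in> T +>\<^bsub>V\<^esub> v" unfolding a_r_coset_def' using Ts(3) assms(1) by force
 ultimately obtain t where t: "t \<in> T" "v = t \<oplus>\<^sub>V w" unfolding a_r_coset_def' by auto
 then have "v \<ominus>\<^sub>V w = t" using assms Ts(2)[OF t(1)] by simp
 then show "v \<ominus>\<^sub>V w \<in> T" using t by simp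
next
 note Ts = subspaceD[OF T]
 have *: "T +>\<^bsub>V\<^esub> v \<subseteq> T +>\<^bsub>V\<^esub> w" if "v \<in> carrier V" "w \<in> carrier V" "v \<ominus>\<^sub>V w \<in> T" for v w
 proof
  fix x assume "x \<in> T +>\<^bsub>V\<^esub> v"
  then obtain t where t: "t \<in> T" "x = t \<oplus>\<^sub>V v" unfolding a_r_coset_def' by auto
  have "x = (t \<oplus>\<^sub>V (v \<ominus>\<^sub>V w)) \<oplus>\<^sub>V w"
   using t(2) that(1,2) Ts(2)[OF t(1)] Ts(2)[OF that(3)] by (simp add: M.a_assoc)
  moreover have "t \<oplus>\<^sub>V (v \<ominus>\<^sub>V w) \<in> T" using Ts(4) t(1) that(3) by blast
  ultimately show "x \<in> T +>\<^bsub>V\<^esub> w" unfolding a_r_coset_def' by blast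
 qed
 assume vw: "v \<ominus>\<^sub>V w \<in> T"
 have "w \<ominus>\<^sub>V v = \<ominus>\<^bsub>V\<^esub> (v \<ominus>\<^sub>V w)" using assms by (simp add: a_minus_def M.minus_add M.a_comm)
 then have "w \<ominus>\<^sub>V v \<in> T" using Ts(6)[OF vw] by simp
 then show "T +>\<^bsub>V\<^esub> v = T +>\<^bsub>V\<^esub> w" using * assms vw by blast
qed

lemma quotient_carrier: "carrier (quotient_module V T) = (\<lambda>v. T +>\<^bsub>V\<^esub> v) ` carrier V"
 by (auto simp: quotient_module_def A_RCOSETS_def')

lemma quotient_add:
 assumes "v \<in> carrier V" "w \<in> carrier V"
 shows "(T +>\<^bsub>V\<^esub> v) \<oplus>\<^bsub>quotient_module V T\<^esub> (T +>\<^bsub>V\<^esub> w) = T +>\<^bsub>V\<^esub> (v \<oplus>\<^sub>V w)"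
proof -
 note Ts = subspaceD[OF T]
 have "(T +>\<^bsub>V\<^esub> v) <+>\<^bsub>V\<^esub> (T +>\<^bsub>V\<^esub> w) = T +>\<^bsub>V\<^esub> (v \<oplus>\<^sub>V w)"
 proof (intro equalityI subsetI)
  fix x assume "x \<in> (T +>\<^bsub>V\<^esub> v) <+>\<^bsub>V\<^esub> (T +>\<^bsub>V\<^esub> w)"
  then obtain a b where "a \<in> T +>\<^bsub>V\<^esub> v" "b \<in> T +>\<^bsub>V\<^esub> w" "x = a \<oplus>\<^sub>V b" unfolding set_add_mem by blast
  then obtain t u where t: "t \<in> T" "u \<in> T" "x = (t \<oplus>\<^sub>V v) \<oplus>\<^sub>V (u \<oplus>\<^sub>V w)" unfolding a_r_coset_def' by auto
  then have "x = (t \<oplus>\<^sub>V u) \<oplus>\<^sub>V (v \<oplus>\<^sub>V w)" using Ts(2) assms by (simp add: M.a_ac)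
  moreover have "t \<oplus>\<^sub>V u \<in> T" using Ts(4) t by blast
  ultimately show "x \<in> T +>\<^bsub>V\<^esub> (v \<oplus>\<^sub>V w)" unfolding a_r_coset_def' by blast
 next
  fix x assume "x \<in> T +>\<^bsub>V\<^esub> (v \<oplus>\<^sub>V w)"
  then obtain t where t: "t \<in> T" "x = t \<oplus>\<^sub>V (v \<oplus>\<^sub>V w)" unfolding a_r_coset_def' by auto
  then have "x = (t \<oplus>\<^sub>V v) \<oplus>\<^sub>V (\<zero>\<^sub>V \<oplus>\<^sub>V w)" using Ts(2) assms by (simp add: M.a_ac)
  moreover have "t \<oplus>\<^sub>V v \<in> T +>\<^bsub>V\<^esub> v" "\<zero>\<^sub>V \<oplus>\<^sub>V w \<in> T +>\<^bsub>V\<^esub> w"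
   unfolding a_r_coset_def' using t(1) Ts(3) by blast+
  ultimately show "x \<in> (T +>\<^bsub>V\<^esub> v) <+>\<^bsub>V\<^esub> (T +>\<^bsub>V\<^esub> w)" unfolding set_add_mem by blast
 qed
 then show ?thesis by (simp add: quotient_module_def)
qed

text \<open>The multiple in \<open>quotient_module\<close> is a union over all members of a coset;
  the point is that each member yields the same coset.\<close>

lemma quotient_smult:
 assumes "c \<in> carrier K" "v \<in> carrier V"
 shows "c \<odot>\<^bsub>quotient_module V T\<^esub> (T +>\<^bsub>V\<^esub> v) = T +>\<^bsub>V\<^esub> (c \<odot>\<^sub>V v)"
proof -
 note Ts = subspaceD[OF T]
 have "T +>\<^bsub>V\<^esub> (c \<odot>\<^sub>V x) = T +>\<^bsub>V\<^esub> (c \<odot>\<^sub>V v)" if x: "x \<in> T +>\<^bsub>V\<^esub> v" for x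
 proof -
  obtain t where t: "t \<in> T" "x = t \<oplus>\<^sub>V v" using x unfolding a_r_coset_def' by auto
  have ct: "c \<odot>\<^sub>V t \<in> T" using Ts(5) assms(1) t(1) by blast
  have "c \<odot>\<^sub>V x = c \<odot>\<^sub>V t \<oplus>\<^sub>V c \<odot>\<^sub>V v" using t Ts(2) assms by (simp add: smult_r_distr)
  then have "c \<odot>\<^sub>V x \<ominus>\<^sub>V c \<odot>\<^sub>V v = c \<odot>\<^sub>V t" using Ts(2)[OF ct] assms by simp
  then show ?thesis using ct assms t Ts(2) by (subst coset_eq_iff) auto
 qed
 moreover have "v \<in> T +>\<^bsub>V\<^esub> v" unfolding a_r_coset_def' using Ts(3) assms(2) by force
 ultimately have "(\<Union>x\<in>T +>\<^bsub>V\<^esub> v. T +>\<^bsub>V\<^esub> (c \<odot>\<^sub>V x)) = T +>\<^bsub>V\<^esub> (c \<odot>\<^sub>V v)" by blast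
 then show ?thesis by (simp add: quotient_module_def)
qed

lemma quotient_zero: "\<zero>\<^bsub>quotient_module V T\<^esub> = T +>\<^bsub>V\<^esub> \<zero>\<^sub>V"
proof -
 have "T +>\<^bsub>V\<^esub> \<zero>\<^sub>V = T" unfolding a_r_coset_def' using subspaceD(2)[OF T] by force
 then show ?thesis by (simp add: quotient_module_def)
qed

lemma quotient_vectorspace: "vectorspace K (quotient_module V T)"
proof (rule vs_criteria, goal_cases)
 case 1 show ?case by (rule field_axioms)
next
 case 4
 show ?case unfolding quotient_carrier
 proof (clarsimp simp: quotient_zero)
  fix v assume v: "v \<in> carrier V"
  show "\<exists>w\<in>carrier V. (T +>\<^bsub>V\<^esub> v) \<oplus>\<^bsub>quotient_module V T\<^esub> (T +>\<^bsub>V\<^esub> w) = T +>\<^bsub>V\<^esub> \<zero>\<^sub>V"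
   using v by (intro bexI[of _ "\<ominus>\<^bsub>V\<^esub> v"]) (auto simp: quotient_add M.r_neg)
 qed
qed (auto simp: quotient_carrier quotient_add quotient_smult quotient_zero M.a_ac smult_l_distr smult_r_distr smult_assoc1)

lemma quotient_hom: "(\<lambda>v. T +>\<^bsub>V\<^esub> v) \<in> module_hom K V (quotient_module V T)"
 by (rule homI) (auto simp: quotient_carrier quotient_add quotient_smult)

lemma quotient_kernel:
 assumes "v \<in> carrier V"
 shows "T +>\<^bsub>V\<^esub> v = \<zero>\<^bsub>quotient_module V T\<^esub> \<longleftrightarrow> v \<in> T"
proof -
 have "v \<ominus>\<^sub>V \<zero>\<^sub>V = v" using assms by (simp add: a_minus_def)
 then show ?thesis unfolding quotient_zero using coset_eq_iff[OF assms M.zero_closed] by simp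
qed

lemma quotient_induced:
 assumes W: "vectorspace K W" and h: "h \<in> module_hom K V W" "!!t. t \<in> T ==> h t = \<zero>\<^bsub>W\<^esub>"
 obtains h' where "h' \<in> module_hom K (quotient_module V T) W" "!!v. v \<in> carrier V ==> h' (T +>\<^bsub>V\<^esub> v) = h v"
proof -
 interpret W: vectorspace K W by fact
 interpret Q: vectorspace K "quotient_module V T" by (rule quotient_vectorspace)
 define h' where "h' C = h (SOME v. v \<in> carrier V \<and> C = T +>\<^bsub>V\<^esub> v)" for C
 have eq: "h' (T +>\<^bsub>V\<^esub> v) = h v" if v: "v \<in> carrier V" for v
 proof -
  let ?w = "SOME w. w \<in> carrier V \<and> T +>\<^bsub>V\<^esub> v = T +>\<^bsub>V\<^esub> w"
  have "\<exists>w. w \<in> carrier V \<and> T +>\<^bsub>V\<^esub> v = T +>\<^bsub>V\<^esub> w" using v by blast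
  then have w': "?w \<in> carrier V \<and> T +>\<^bsub>V\<^esub> v = T +>\<^bsub>V\<^esub> ?w" by (rule someI_ex)
  have w: "?w \<in> carrier V" using w' by (rule conjunct1)
  then have "v \<ominus>\<^sub>V ?w \<in> T" using coset_eq_iff[OF v w] conjunct2[OF w'] by blast
  then have "h v \<ominus>\<^bsub>W\<^esub> h ?w = \<zero>\<^bsub>W\<^esub>" unfolding hom_diff[OF W h(1) v w, symmetric] by (rule h(2))
  then have "h v = h ?w" using W.diff_zero_iff[OF homD(1)[OF h(1) v] homD(1)[OF h(1) w]] by blast
  then show ?thesis unfolding h'_def by (rule sym)
 qed
 have "h' \<in> module_hom K (quotient_module V T) W"
  by (rule Q.homI) (use homD[OF h(1)] eq in \<open>auto simp: quotient_carrier quotient_add quotient_smult\<close>)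
 then show thesis using that eq by blast
qed

end

end

section \<open>Conjugation of fixed vectors and trace subspaces\<close>

context modular_rep begin

definition conj_set :: "'g \<Rightarrow> 'g set \<Rightarrow> 'g set"
 where "conj_set g Q = (\<lambda>u. g \<star> u \<star> iG g) ` Q"

lemma conj_set_subgroup:
 assumes "subgroup Q G" "g \<in> carrier G"
 shows "subgroup (conj_set g Q) G" "card (conj_set g Q) = card Q"
proof -
 note Qs = subgroup.mem_carrier[OF assms(1)]
 show "subgroup (conj_set g Q) G"
 proof (rule G.subgroupI)
  show "conj_set g Q \<subseteq> carrier G" using Qs assms(2) by (auto simp: conj_set_def)
  show "conj_set g Q ~= {}" using subgroup.one_closed[OF assms(1)] by (auto simp: conj_set_def)
  show "iG a \<in> conj_set g Q" if "a \<in> conj_set g Q" for a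
  proof -
   obtain u where u: "u \<in> Q" "a = g \<star> u \<star> iG g" using \<open>a \<in> conj_set g Q\<close> by (auto simp: conj_set_def)
   then have "iG a = g \<star> iG u \<star> iG g" using Qs assms(2) by (simp add: G.inv_mult_group G.m_assoc)
   then show ?thesis using subgroup.m_inv_closed[OF assms(1) u(1)] by (auto simp: conj_set_def)
  qed
  show "a \<star> b \<in> conj_set g Q" if ab: "a \<in> conj_set g Q" "b \<in> conj_set g Q" for a b
  proof -
   obtain u v where u: "u \<in> Q" "a = g \<star> u \<star> iG g" "v \<in> Q" "b = g \<star> v \<star> iG g"
    using ab by (auto simp: conj_set_def)
   have uv: "u \<in> carrier G" "v \<in> carrier G" using Qs u by auto
   have "a \<star> b = g \<star> (u \<star> ((iG g \<star> g) \<star> (v \<star> iG g)))"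
    unfolding u using uv assms(2) by (simp only: G.m_assoc G.m_closed G.inv_closed)
   also have "... = g \<star> (u \<star> v) \<star> iG g" using uv assms(2) by (simp add: G.m_assoc)
   finally show ?thesis using subgroup.m_closed[OF assms(1) u(1,3)] by (auto simp: conj_set_def)
  qed
 qed
 have "inj_on (\<lambda>u. g \<star> u \<star> iG g) Q" using Qs assms(2) by (intro inj_onI) auto
 then show "card (conj_set g Q) = card Q" unfolding conj_set_def by (rule card_image)
qed

lemma conj_act:
 assumes "g \<in> carrier G" "u \<in> carrier G" "v \<in> carrier M"
 shows "\<rho> (g \<star> u \<star> iG g) (\<rho> g v) = \<rho> g (\<rho> u v)"
 using assms act_mult act_inv(1) act_closed by simp

lemma fixed_points_conj:
 assumes "Q \<subseteq> carrier G" "g \<in> carrier G" "v \<in> carrier M"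
 shows "\<rho> g v \<in> fixM (conj_set g Q) \<longleftrightarrow> v \<in> fixM Q"
proof -
 have "\<rho> (g \<star> u \<star> iG g) (\<rho> g v) = \<rho> g v \<longleftrightarrow> \<rho> u v = v" if "u \<in> Q" for u
 proof -
  have u: "u \<in> carrier G" using that assms by blast
  show ?thesis unfolding conj_act[OF assms(2) u assms(3)]
   using act_inj[OF assms(2) act_closed[OF u assms(3)] assms(3)] by auto
 qed
 then show ?thesis using act_closed[OF assms(2,3)] assms(3) by (auto simp: fixed_points_def conj_set_def)
qed

lemma image_basis:
 assumes B: "basis B" and g: "g \<in> carrier G"
 shows "basis (\<rho> g ` B)" "!!v b. v \<in> carrier M ==> b \<in> B ==> coord (\<rho> g ` B) (\<rho> g v) (\<rho> g b) = coord B v b"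
proof -
 note fB = basis_finite[OF B]
 note bc = basis_carrier[OF fB B]
 have lin: "linear_map K M M (\<rho> g)"
  using vs_self act_hom[OF g] unfolding linear_map_def mod_hom_def mod_hom_axioms_def vectorspace_def by blast
 have inj: "inj_on (\<rho> g) (carrier M)" using act_inj[OF g] by (intro inj_onI) blast
 have surj: "\<rho> g ` carrier M = carrier M"
 proof (intro equalityI subsetI)
  fix x assume "x \<in> carrier M"
  then show "x \<in> \<rho> g ` carrier M" using act_inv(2)[OF g] act_closed[of "iG g" x] g by (metis G.inv_closed image_eqI)
 qed (use act_closed[OF g] in blast)
 show gB: "basis (\<rho> g ` B)" by (rule linear_map.linear_inj_image_is_basis[OF lin inj surj B fin_dim])
 fix v b assume v: "v \<in> carrier M" and b: "b \<in> B"
 have cc: "coord B v b \<in> carrier K" if "b \<in> B" for b using coord_closed[OF fB B v that] .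
 have "\<rho> g v = (\<Oplus>\<^bsub>M\<^esub>b\<in>B. coord B v b \<odot>\<^sub>M \<rho> g b)" by (rule hom_expand[OF fB B vs_self act_hom[OF g] v])
 also have "... = (\<Oplus>\<^bsub>M\<^esub>b\<in>B. coord B v (\<rho> (iG g) (\<rho> g b)) \<odot>\<^sub>M \<rho> g b)"
  using act_inv(1)[OF g bc] cc act_closed[OF g bc] by (intro M.finsum_cong') auto
 also have "... = (\<Oplus>\<^bsub>M\<^esub>b'\<in>\<rho> g ` B. coord B v (\<rho> (iG g) b') \<odot>\<^sub>M b')"
  using act_inv(1)[OF g bc] cc act_closed[OF g bc] inj_on_subset[OF inj, of B] bc
  by (subst M.finsum_reindex) auto
 finally have "coord (\<rho> g ` B) (\<rho> g v) (\<rho> g b)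
   = coord (\<rho> g ` B) (\<Oplus>\<^bsub>M\<^esub>b'\<in>\<rho> g ` B. coord B v (\<rho> (iG g) b') \<odot>\<^sub>M b') (\<rho> g b)" by simp
 also have "... = coord B v (\<rho> (iG g) (\<rho> g b))"
  using act_inv(1)[OF g bc] cc b fB by (intro coord_unique[OF _ gB]) auto
 finally show "coord (\<rho> g ` B) (\<rho> g v) (\<rho> g b) = coord B v b" using act_inv(1)[OF g bc[OF b]] by simp
qed

text \<open>Proved through \<open>negl\<close> rather than by reindexing traces: the translate by
  \<open>g\<close> of a basis permuted by \<open>Q\<close> is permuted by the conjugate of
  \<open>Q\<close>, and coordinates are transported with it.\<close>

lemma trace_sum_conj:
 assumes Q: "subgroup Q G" "card Q = p ^ n" and B: "perm_basis Q B" and g: "g \<in> carrier G"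
 shows "trM (conj_set g Q) = \<rho> g ` trM Q"
proof -
 note Bb = perm_basisD[OF B]
 have QG: "Q \<subseteq> carrier G" using subgroup.subset[OF Q(1)] .
 note C = conj_set_subgroup[OF Q(1) g]
 have act: "\<rho> (g \<star> u \<star> iG g) (\<rho> g b) = \<rho> g (\<rho> u b)" if "u \<in> Q" "b \<in> carrier M" for u b
  using conj_act[OF g _ that(2)] that(1) QG by blast
 have pb: "perm_basis (conj_set g Q) (\<rho> g ` B)"
  unfolding perm_basis_def
 proof (intro conjI ballI image_basis(1)[OF Bb(1) g])
  fix x assume "x \<in> conj_set g Q"
  then obtain u where u: "u \<in> Q" "x = g \<star> u \<star> iG g" by (auto simp: conj_set_def)
  have "\<rho> x ` \<rho> g ` B = \<rho> g ` \<rho> u ` B"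
   unfolding image_image using act[OF u(1) Bb(3)] u(2) by (intro image_cong) auto
  also have "\<rho> u ` B = B" using B u(1) unfolding perm_basis_def by blast
  finally show "\<rho> x ` \<rho> g ` B = \<rho> g ` B" .
 qed
 have fs: "\<rho> g b \<in> fixed_set (conj_set g Q) (\<rho> g ` B) \<rho> \<longleftrightarrow> b \<in> fixed_set Q B \<rho>" if b: "b \<in> B" for b
  using fixed_points_conj[OF QG g Bb(3)[OF b]] b act_closed[OF g Bb(3)[OF b]] Bb(3)[OF b]
  by (auto simp: fixed_points_def fixed_set_def)
 have neg: "\<rho> g v \<in> negl (conj_set g Q) (\<rho> g ` B) \<longleftrightarrow> v \<in> negl Q B" if v: "v \<in> carrier M" for v
 proof -
  have "(\<forall>b'\<in>fixed_set (conj_set g Q) (\<rho> g ` B) \<rho>. coord (\<rho> g ` B) (\<rho> g v) b' = \<zero>)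
   \<longleftrightarrow> (\<forall>b\<in>fixed_set Q B \<rho>. coord B v b = \<zero>)"
  proof safe
   fix b assume all: "\<forall>b'\<in>fixed_set (conj_set g Q) (\<rho> g ` B) \<rho>. coord (\<rho> g ` B) (\<rho> g v) b' = \<zero>"
    and b: "b \<in> fixed_set Q B \<rho>"
   then have "b \<in> B" by (simp add: fixed_set_def)
   then show "coord B v b = \<zero>" using all fs b image_basis(2)[OF Bb(1) g v] by metis
  next
   fix b' assume all: "\<forall>b\<in>fixed_set Q B \<rho>. coord B v b = \<zero>"
    and b': "b' \<in> fixed_set (conj_set g Q) (\<rho> g ` B) \<rho>"
   then obtain b where "b \<in> B" "b' = \<rho> g b" by (auto simp: fixed_set_def)
   then show "coord (\<rho> g ` B) (\<rho> g v) b' = \<zero>" using all fs b' image_basis(2)[OF Bb(1) g v] by metis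
  qed
  then show ?thesis unfolding negl_def using fixed_points_conj[OF QG g v] by simp
 qed
 have T: "trM Q = negl Q B" by (rule trace_sum_eq[OF Q B])
 have T': "trM (conj_set g Q) = negl (conj_set g Q) (\<rho> g ` B)"
  using trace_sum_eq[OF C(1) _ pb] C(2) Q(2) by metis
 show ?thesis unfolding T T'
 proof (intro equalityI subsetI)
  fix x assume x: "x \<in> negl (conj_set g Q) (\<rho> g ` B)"
  then have xM: "x \<in> carrier M" by (simp add: negl_def fixed_points_def)
  have "\<rho> (iG g) x \<in> carrier M" using act_closed xM g by simp
  moreover have "\<rho> g (\<rho> (iG g) x) = x" using act_inv(2)[OF g xM] .
  ultimately show "x \<in> \<rho> g ` negl Q B" using neg x by (metis image_eqI)
 next
  fix x assume "x \<in> \<rho> g ` negl Q B"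
  then obtain v where "v \<in> negl Q B" "x = \<rho> g v" by blast
  then show "x \<in> negl (conj_set g Q) (\<rho> g ` B)" using neg by (auto simp: negl_def fixed_points_def)
 qed
qed

end

text \<open>In the expansion of \<open>\<phi> v\<close> along \<open>B\<close> the terms are
  constant on \<open>Q\<close>-orbits, so only \<open>Q\<close>-fixed basis elements count modulo
  \<open>p\<close>, and there \<open>v\<close> has coefficient 0. Hence invariant functionals
  descend to \<open>M(Q)\<close>.\<close>

lemma (in modular_rep) invariant_functional_negl:
 assumes Q: "subgroup Q G" "card Q = p ^ n" and B: "perm_basis Q B"
  and \<phi>: "\<phi> \<in> module_hom K M (trivial_module K)" "!!g v. g \<in> Q ==> v \<in> carrier M ==> \<phi> (\<rho> g v) = \<phi> v"
  and v: "v \<in> negl Q B"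
 shows "\<phi> v = \<zero>"
proof -
 note Bb = perm_basisD[OF B]
 have vM: "v \<in> carrier M" and vQ: "v \<in> fixM Q" and v0: "!!b. b \<in> fixed_set Q B \<rho> ==> coord B v b = \<zero>"
  using v by (auto simp: negl_def fixed_points_def)
 have cl: "coord B v b \<in> carrier K" "\<phi> b \<in> carrier K" if "b \<in> B" for b
  using coord_closed[OF Bb(2,1) vM that] homD(1)[OF \<phi>(1) Bb(3)[OF that]] by auto
 have "\<phi> v = (\<Oplus>b\<in>B. coord B v b \<otimes> \<phi> b)"
  using hom_expand[OF Bb(2,1) trivial_vectorspace \<phi>(1) vM] by simp
 also have "... = (\<Oplus>b\<in>fixed_set Q B \<rho>. coord B v b \<otimes> \<phi> b)"
  using cl coord_fixed[OF Q(1) B _ vQ] \<phi>(2) Bb(3)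
  by (intro finsum_fixed_set[OF G.is_group Q perm_basis_acts_on[OF Q(1) B] Bb(2)]) auto
 also have "... = (\<Oplus>b\<in>fixed_set Q B \<rho>. \<zero>)"
  using v0 cl by (intro R.finsum_cong') (auto simp: fixed_set_def)
 finally show ?thesis by simp
qed

section \<open>The Brauer quotient \<open>M(Q)\<close> of a p-permutation module\<close>

locale perm_rep = modular_rep +
 assumes has_perm: "!!S n. subgroup S G ==> card S = p ^ n ==> \<exists>B. perm_basis S B"

locale brauer_quot = perm_rep K G M \<rho> p
 for K :: "('k, 'y) ring_scheme" (structure) and G :: "('g, 'z) monoid_scheme"
  and M :: "('k, 'm, 'x) module_scheme" and \<rho> :: "'g \<Rightarrow> 'm \<Rightarrow> 'm" and p :: nat +
 fixes Q :: "'g set" and n :: nat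
 assumes Qsub: "subgroup Q G" and Qcard: "card Q = p ^ n"
begin

abbreviation "F \<equiv> fixM Q"
abbreviation "T \<equiv> trM Q"
abbreviation "Y \<equiv> brauer_module K G M \<rho> Q"
abbreviation (input) addY (infixl "\<oplus>\<^sub>Y" 65) where "v \<oplus>\<^sub>Y w \<equiv> v \<oplus>\<^bsub>Y\<^esub> w"
abbreviation (input) diffY (infixl "\<ominus>\<^sub>Y" 65) where "v \<ominus>\<^sub>Y w \<equiv> v \<ominus>\<^bsub>Y\<^esub> w"
abbreviation (input) smultY (infixl "\<odot>\<^sub>Y" 70) where "c \<odot>\<^sub>Y v \<equiv> c \<odot>\<^bsub>Y\<^esub> v"
abbreviation (input) zeroY ("\<zero>\<^sub>Y") where "\<zero>\<^sub>Y \<equiv> \<zero>\<^bsub>Y\<^esub>"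
abbreviation (input) "dirsumY S \<equiv> is_direct_sum K (G(|carrier := S|)) Y (brauer_act \<rho>)"
abbreviation "N \<equiv> normalizer G Q"
abbreviation "pr \<equiv> \<lambda>v. T +>\<^bsub>M\<^esub> v"

lemma QG: "Q \<subseteq> carrier G" and finQ: "finite Q"
 using subgroup.subset[OF Qsub] finite_subset[OF _ finite_group] by auto

lemma Nsub: "subgroup N G" by (rule G.normalizer_imp_subgroup[OF QG])

lemma NG: "g \<in> N ==> g \<in> carrier G" using subgroup.mem_carrier[OF Nsub] .

lemma N_conj: "g \<in> N ==> u \<in> Q ==> g \<star> u \<star> iG g \<in> Q"
 using G.normalizer_iff[OF QG finQ] by blast

lemma conj_set_N:
 assumes g: "g \<in> N" shows "conj_set g Q = Q"
proof -
 have "conj_set g Q \<subseteq> Q" using N_conj[OF g] by (auto simp: conj_set_def)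
 then show ?thesis using conj_set_subgroup(2)[OF Qsub NG[OF g]] finQ by (intro card_subset_eq) auto
qed

lemma QN: "Q \<subseteq> N"
proof
 fix x assume x: "x \<in> Q"
 have "x \<star> u \<star> iG x \<in> Q" if "u \<in> Q" for u
  using x that subgroup.m_closed[OF Qsub] subgroup.m_inv_closed[OF Qsub] by blast
 then show "x \<in> N" using x QG G.normalizer_iff[OF QG finQ] by blast
qed

lemma F_sub: "subspace K F M" by (rule fixed_points_subspace[OF QG])

lemma F_carrier: "v \<in> F ==> v \<in> carrier M" by (simp add: fixed_points_def)

lemma perm_basis_mono: "perm_basis S B ==> R \<subseteq> S ==> perm_basis R B"
 by (auto simp: perm_basis_def)

lemma T_eq: "perm_basis Q B ==> T = negl Q B" by (rule trace_sum_eq[OF Qsub Qcard])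

lemma T_sub: "subspace K T M" and TF: "T \<subseteq> F"
proof -
 obtain B where B: "perm_basis Q B" using has_perm[OF Qsub Qcard] by blast
 show "subspace K T M" unfolding T_eq[OF B] by (rule negl_subspace[OF Qsub B])
 show "T \<subseteq> F" unfolding T_eq[OF B] by (auto simp: negl_def)
qed

lemma F_act: "g \<in> N ==> v \<in> F ==> \<rho> g v \<in> F"
 using fixed_points_conj[OF QG NG F_carrier, of g v] conj_set_N[of g] by simp

lemma T_act: "g \<in> N ==> \<rho> g ` T = T"
proof -
 assume g: "g \<in> N"
 obtain B where B: "perm_basis Q B" using has_perm[OF Qsub Qcard] by blast
 show "\<rho> g ` T = T" using trace_sum_conj[OF Qsub Qcard B NG[OF g]] conj_set_N[OF g] by simp
qed

lemma F_vs: "vectorspace K (M(|carrier := F|))" by (rule subspace_is_vs[OF F_sub])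

lemma T_sub_F: "subspace K T (M(|carrier := F|))"
proof -
 interpret F: vectorspace K "M(|carrier := F|)" by (rule F_vs)
 show ?thesis using TF subspaceD[OF T_sub] by (intro F.subspaceI) auto
qed

lemma Y_def': "Y = quotient_module (M(|carrier := F|)) T" by (simp add: brauer_module_def)

lemma pr_def': "T +>\<^bsub>M(|carrier := F|)\<^esub> v = pr v" by (simp add: a_r_coset_def')

lemma Y_vs: "vectorspace K Y"
 unfolding Y_def' by (rule vectorspace.quotient_vectorspace[OF F_vs T_sub_F])

sublocale Y: vectorspace K Y by (rule Y_vs)

lemma pr_hom: "pr \<in> module_hom K (M(|carrier := F|)) Y"
 using vectorspace.quotient_hom[OF F_vs T_sub_F] unfolding Y_def' pr_def' .

lemma pr_closed: "v \<in> F ==> pr v \<in> carrier Y"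
 and pr_add: "v \<in> F ==> w \<in> F ==> pr (v \<oplus>\<^sub>M w) = pr v \<oplus>\<^sub>Y pr w"
 and pr_smult: "c \<in> carrier K ==> v \<in> F ==> pr (c \<odot>\<^sub>M v) = c \<odot>\<^sub>Y pr v"
 using vectorspace.homD[OF F_vs pr_hom] by auto

lemma Y_carrier: "carrier Y = pr ` F"
 using vectorspace.quotient_carrier[OF F_vs T_sub_F] unfolding Y_def' pr_def' by simp

lemma pr_surj: "y \<in> carrier Y ==> \<exists>v\<in>F. y = pr v" unfolding Y_carrier by blast

lemma pr_zero_iff: "v \<in> F ==> pr v = \<zero>\<^sub>Y \<longleftrightarrow> v \<in> T"
 using vectorspace.quotient_kernel[OF F_vs T_sub_F, of v] unfolding Y_def'[symmetric] pr_def' by simp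

lemma pr_diff:
 assumes "v \<in> F" "w \<in> F" shows "pr (v \<ominus>\<^sub>M w) = pr v \<ominus>\<^sub>Y pr w"
proof -
 have d: "v \<ominus>\<^sub>M w \<in> F" using subspaceD(7)[OF F_sub assms] .
 have "v = (v \<ominus>\<^sub>M w) \<oplus>\<^sub>M w" using assms F_carrier by simp
 then have "pr v = pr (v \<ominus>\<^sub>M w) \<oplus>\<^sub>Y pr w" using pr_add[OF d assms(2)] by simp
 then show ?thesis using Y.diff_eq_iff[of "pr v" "pr w" "pr (v \<ominus>\<^sub>M w)"] pr_closed assms d by metis
qed

lemma pr_eq_iff:
 assumes "v \<in> F" "w \<in> F" shows "pr v = pr w \<longleftrightarrow> v \<ominus>\<^sub>M w \<in> T"
 using pr_diff[OF assms] pr_zero_iff[OF subspaceD(7)[OF F_sub assms]] Y.diff_zero_iff pr_closed assms by metis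

lemma pr_finsum:
 assumes "h \<in> A \<rightarrow> F" shows "pr (finsum M h A) = finsum Y (\<lambda>a. pr (h a)) A"
 using assms
proof (induction A rule: infinite_finite_induct)
 case (insert a A)
 have h: "h \<in> A \<rightarrow> carrier M" "h a \<in> carrier M" "h a \<in> F" "h \<in> A \<rightarrow> F" using insert.prems F_carrier by auto
 have "finsum M h A \<in> F" using subspace_finsum[OF F_sub h(4)] .
 moreover have "(\<lambda>a. pr (h a)) \<in> A \<rightarrow> carrier Y" "pr (h a) \<in> carrier Y" using h pr_closed by auto
 ultimately show ?case using insert.hyps insert.IH h pr_add[OF h(3)] by simp
qed (use pr_zero_iff[OF subspaceD(3)[OF F_sub]] subspaceD(3)[OF T_sub] in simp_all)

lemma Y_induced:
 assumes W: "vectorspace K W" and closed: "!!v. v \<in> F ==> h v \<in> carrier W"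
  and add: "!!v w. v \<in> F ==> w \<in> F ==> h (v \<oplus>\<^sub>M w) = h v \<oplus>\<^bsub>W\<^esub> h w"
  and smult: "!!c v. c \<in> carrier K ==> v \<in> F ==> h (c \<odot>\<^sub>M v) = c \<odot>\<^bsub>W\<^esub> h v"
  and T: "!!t. t \<in> T ==> h t = \<zero>\<^bsub>W\<^esub>"
 obtains h' where "h' \<in> module_hom K Y W" "!!v. v \<in> F ==> h' (pr v) = h v"
proof -
 have h: "h \<in> module_hom K (M(|carrier := F|)) W"
  using closed add smult by (intro vectorspace.homI[OF F_vs]) auto
 obtain h' where "h' \<in> module_hom K Y W" "!!v. v \<in> carrier (M(|carrier := F|)) ==> h' (T +>\<^bsub>M(|carrier := F|)\<^esub> v) = h v"
  using vectorspace.quotient_induced[OF F_vs T_sub_F W h T] unfolding Y_def' by blast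
 then show thesis using that[of h'] unfolding pr_def' by simp
qed

lemma act_pr:
 assumes g: "g \<in> N" and v: "v \<in> F" shows "brauer_act \<rho> g (pr v) = pr (\<rho> g v)"
proof -
 have vM: "v \<in> carrier M" using F_carrier[OF v] .
 have "\<rho> g (t \<oplus>\<^sub>M v) = \<rho> g t \<oplus>\<^sub>M \<rho> g v" if "t \<in> T" for t
  using act_add[OF NG[OF g] subspaceD(2)[OF T_sub that] vM] .
 then have "\<rho> g ` pr v = pr' (\<rho> g v)" if "pr' = (\<lambda>v. (\<rho> g ` T) +>\<^bsub>M\<^esub> v)" for pr'
  unfolding that a_r_coset_def' by (auto simp: image_iff)
 then show ?thesis unfolding brauer_act_def T_act[OF g] by blast
qed

text \<open>The coordinate functionals at the \<open>Q\<close>-fixed basis elements have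
  \<open>T\<close> as their common kernel in \<open>F\<close>, so they induce a dual basis on the
  quotient.\<close>

lemma Y_basis:
 assumes B: "perm_basis Q B"
 shows "Y.basis (pr ` fixed_set Q B \<rho>)" "inj_on pr (fixed_set Q B \<rho>)"
  "!!v b. v \<in> F ==> b \<in> fixed_set Q B \<rho> ==> Y.coord (pr ` fixed_set Q B \<rho>) (pr v) (pr b) = coord B v b"
proof -
 note Bb = perm_basisD[OF B]
 let ?D = "fixed_set Q B \<rho>"
 have DB: "b \<in> B" if "b \<in> ?D" for b using that by (simp add: fixed_set_def)
 have DF: "b \<in> F" if "b \<in> ?D" for b using that Bb(3) by (simp add: fixed_set_def fixed_points_def)
 have finD: "finite ?D" using Bb(2) by (simp add: fixed_set_def)
 have cK: "coord B v b \<in> carrier K" if "v \<in> F" "b \<in> ?D" for v b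
  using coord_closed[OF Bb(2,1) F_carrier DB] that by blast
 have ex: "\<exists>h. h \<in> module_hom K Y (trivial_module K) \<and> (\<forall>v\<in>F. h (pr v) = coord B v b)" if b: "b \<in> ?D" for b
 proof -
  note h = coord_hom[OF Bb(2,1) DB[OF b]]
  have "\<exists>h'. h' \<in> module_hom K Y (trivial_module K) \<and> (\<forall>v\<in>F. h' (pr v) = coord B v b)"
  proof (rule Y_induced[OF trivial_vectorspace, of "\<lambda>v. coord B v b"], goal_cases)
   case (1 v) then show ?case using homD(1)[OF h] F_carrier by blast
  next
   case (2 v w) then show ?case using homD(2)[OF h] F_carrier by blast
  next
   case (3 c v) then show ?case using homD(3)[OF h] F_carrier by blast
  next
   case (4 t) then show ?case using b unfolding T_eq[OF B] negl_def by simp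
  next
   case (5 h') then show ?case by blast
  qed
  then show ?thesis .
 qed
 define c where "c b = (SOME h. h \<in> module_hom K Y (trivial_module K) \<and> (\<forall>v\<in>F. h (pr v) = coord B v b))" for b
 have c: "c b \<in> module_hom K Y (trivial_module K)" "!!v. v \<in> F ==> c b (pr v) = coord B v b" if "b \<in> ?D" for b
  using someI_ex[OF ex[OF that]] unfolding c_def by auto
 show inj: "inj_on pr ?D"
 proof (rule inj_onI)
  fix b b' assume bb: "b \<in> ?D" "b' \<in> ?D" "pr b = pr b'"
  then have "coord B b b = coord B b' b" using c(2)[OF bb(1) DF[OF bb(1)]] c(2)[OF bb(1) DF[OF bb(2)]] by simp
  then show "b = b'" using coord_basis[OF Bb(2,1) DB[OF bb(1)]] DB[OF bb(1)] DB[OF bb(2)] by (auto split: if_splits)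
 qed
 \<comment> \<open>Dropping the coefficients at the other basis elements changes \<open>v\<close> by
   an element of \<open>T\<close> only.\<close>
 have expand: "pr v = (\<Oplus>\<^bsub>Y\<^esub>b\<in>?D. coord B v b \<odot>\<^sub>Y pr b)" if v: "v \<in> F" for v
 proof -
  let ?w = "\<Oplus>\<^bsub>M\<^esub>b\<in>?D. coord B v b \<odot>\<^sub>M b"
  have t: "(\<lambda>b. coord B v b \<odot>\<^sub>M b) \<in> ?D \<rightarrow> F" using subspaceD(5)[OF F_sub] cK[OF v] DF by blast
  have w: "?w \<in> F" by (rule subspace_finsum[OF F_sub t])
  have "coord B ?w b = coord B v b" if b: "b \<in> ?D" for b
  proof -
   have "?w = (\<Oplus>\<^bsub>M\<^esub>b\<in>B. (if b \<in> ?D then coord B v b else \<zero>) \<odot>\<^sub>M b)"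
    using cK[OF v] Bb(3) DB by (intro M.add.finprod_mono_neutral_cong_left[OF Bb(2)]) auto
   then show ?thesis using coord_unique[OF Bb(2,1), of "\<lambda>b. if b \<in> ?D then coord B v b else \<zero>" b] cK[OF v] DB[OF b] b by auto
  qed
  moreover have "coord B (v \<ominus>\<^sub>M ?w) b = coord B v b \<ominus>\<^bsub>trivial_module K\<^esub> coord B ?w b" if "b \<in> ?D" for b
   using hom_diff[OF trivial_vectorspace coord_hom[OF Bb(2,1) DB[OF that]]] F_carrier v w by blast
  ultimately have "coord B (v \<ominus>\<^sub>M ?w) b = \<zero>" if "b \<in> ?D" for b
   using that cK[OF v that] vectorspace.diff_add_cancel(4)[OF trivial_vectorspace, of "coord B v b"] by simp
  then have "v \<ominus>\<^sub>M ?w \<in> T" unfolding T_eq[OF B] negl_def using subspaceD(7)[OF F_sub v w] by blast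
  then have "pr v = pr ?w" using pr_eq_iff[OF v w] by blast
  also have "... = (\<Oplus>\<^bsub>Y\<^esub>b\<in>?D. pr (coord B v b \<odot>\<^sub>M b))" by (rule pr_finsum[OF t])
  also have "... = (\<Oplus>\<^bsub>Y\<^esub>b\<in>?D. coord B v b \<odot>\<^sub>Y pr b)"
   using pr_smult cK[OF v] DF pr_closed by (intro Y.M.finsum_cong') auto
  finally show ?thesis .
 qed
 define i where "i = inv_into ?D pr"
 have i: "i (pr b) = b" if "b \<in> ?D" for b using inv_into_f_f[OF inj that] by (simp add: i_def)
 have expand': "pr v = (\<Oplus>\<^bsub>Y\<^esub>b'\<in>pr ` ?D. coord B v (i b') \<odot>\<^sub>Y b')" if v: "v \<in> F" for v
 proof -
  have "(\<Oplus>\<^bsub>Y\<^esub>b'\<in>pr ` ?D. coord B v (i b') \<odot>\<^sub>Y b') = (\<Oplus>\<^bsub>Y\<^esub>b\<in>?D. coord B v (i (pr b)) \<odot>\<^sub>Y pr b)"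
   using i cK[OF v] pr_closed DF by (intro Y.M.finsum_reindex inj) auto
  also have "... = (\<Oplus>\<^bsub>Y\<^esub>b\<in>?D. coord B v b \<odot>\<^sub>Y pr b)"
   using i cK[OF v] pr_closed DF by (intro Y.M.finsum_cong') auto
  finally show ?thesis using expand[OF v] by simp
 qed
 show bas: "Y.basis (pr ` ?D)"
 proof (rule Y.basisI_dual[where c = "\<lambda>b. c (i b)"])
  show "finite (pr ` ?D)" using finD by blast
  show "pr ` ?D \<subseteq> carrier Y" using pr_closed DF by blast
  show "c (i b) \<in> module_hom K Y (trivial_module K)" if "b \<in> pr ` ?D" for b using that i c(1) by auto
  show "c (i b) b' = (if b = b' then \<one> else \<zero>)" if bb: "b \<in> pr ` ?D" "b' \<in> pr ` ?D" for b b'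
  proof -
   obtain d d' where d: "d \<in> ?D" "d' \<in> ?D" "b = pr d" "b' = pr d'" using bb by blast
   have "pr d = pr d' \<longleftrightarrow> d = d'" using inj d(1,2) by (auto dest: inj_onD)
   then show ?thesis
    using d i[OF d(1)] c(2)[OF d(1) DF[OF d(2)]] coord_basis[OF Bb(2,1) DB[OF d(1)] DB[OF d(2)]] by simp
  qed
  show "(\<Oplus>\<^bsub>Y\<^esub>b\<in>pr ` ?D. c (i b) y \<odot>\<^sub>Y b) = y" if y: "y \<in> carrier Y" for y
  proof -
   obtain v where v: "v \<in> F" "y = pr v" using pr_surj[OF y] by blast
   have "(\<Oplus>\<^bsub>Y\<^esub>b\<in>pr ` ?D. c (i b) y \<odot>\<^sub>Y b) = (\<Oplus>\<^bsub>Y\<^esub>b'\<in>pr ` ?D. coord B v (i b') \<odot>\<^sub>Y b')"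
    using v i c(2) cK[OF v(1)] pr_closed DF by (intro Y.M.finsum_cong') auto
   then show ?thesis using expand'[OF v(1)] v(2) by simp
  qed
 qed
 fix v b assume v: "v \<in> F" and b: "b \<in> ?D"
 have "Y.coord (pr ` ?D) (pr v) (pr b) = Y.coord (pr ` ?D) (\<Oplus>\<^bsub>Y\<^esub>b'\<in>pr ` ?D. coord B v (i b') \<odot>\<^sub>Y b') (pr b)"
  using expand'[OF v] by simp
 also have "... = coord B v (i (pr b))"
  using finD bas i cK[OF v] b by (intro Y.coord_unique) auto
 finally show "Y.coord (pr ` ?D) (pr v) (pr b) = coord B v b" using i[OF b] by simp
qed

text \<open>Makes the theory developed for \<open>M\<close> over \<open>G\<close>, such as Fitting
  decompositions and the splitting of permutation bases, available for \<open>M(Q)\<close> over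
  \<open>N\<close>.\<close>

lemma Y_modular_rep: "modular_rep K (G(|carrier := N|)) Y (brauer_act \<rho>) p"
proof -
 interpret NG: group "G(|carrier := N|)" using G.subgroup_imp_group[OF Nsub] .
 have grp: "group_module K (G(|carrier := N|)) Y (brauer_act \<rho>)"
 proof (unfold_locales, goal_cases)
  case (1 g v)
  then obtain a where "a \<in> F" "v = pr a" using pr_surj by blast
  then show ?case using 1(1) act_pr F_act pr_closed by simp
 next
  case (2 g v w)
  obtain a b where "a \<in> F" "b \<in> F" "v = pr a" "w = pr b" using pr_surj[OF 2(2)] pr_surj[OF 2(3)] by blast
  with 2(1) have ab: "a \<in> F" "b \<in> F" "v = pr a" "w = pr b" "g \<in> N" by simp_all
  have "a \<oplus>\<^sub>M b \<in> F" using subspaceD(4)[OF F_sub] ab by blast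
  then have "brauer_act \<rho> g (pr (a \<oplus>\<^sub>M b)) = pr (\<rho> g a \<oplus>\<^sub>M \<rho> g b)"
   using ab act_pr[OF ab(5)] act_add[OF NG[OF ab(5)]] F_carrier by simp
  then show ?case unfolding ab(3,4) pr_add[OF ab(1,2)] act_pr[OF ab(5,1)] act_pr[OF ab(5,2)]
   using pr_add[OF F_act[OF ab(5,1)] F_act[OF ab(5,2)]] by simp
 next
  case (3 g c v)
  obtain a where "a \<in> F" "v = pr a" using pr_surj[OF 3(3)] by blast
  with 3(1) have a: "a \<in> F" "v = pr a" "g \<in> N" by simp_all
  have "c \<odot>\<^sub>M a \<in> F" using subspaceD(5)[OF F_sub] a 3 by blast
  then have "brauer_act \<rho> g (pr (c \<odot>\<^sub>M a)) = pr (c \<odot>\<^sub>M \<rho> g a)"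
   using a act_pr[OF a(3)] act_smult[OF NG[OF a(3)] 3(2)] F_carrier by simp
  then show ?case unfolding a(2) pr_smult[OF 3(2) a(1)] act_pr[OF a(3,1)]
   using pr_smult[OF 3(2) F_act[OF a(3,1)]] by simp
 next
  case (4 v)
  then obtain a where a: "a \<in> F" "v = pr a" using pr_surj by blast
  then show ?case using act_pr[OF subgroup.one_closed[OF Nsub] a(1)] act_one[OF F_carrier[OF a(1)]] by simp
 next
  case (5 g h v)
  obtain a where "a \<in> F" "v = pr a" using pr_surj[OF 5(3)] by blast
  with 5(1,2) have a: "a \<in> F" "v = pr a" "g \<in> N" "h \<in> N" by simp_all
  then show ?case
   using act_pr F_act subgroup.m_closed[OF Nsub] act_mult[OF NG NG F_carrier] by simp
 next
  case 6
  obtain B where B: "perm_basis Q B" using has_perm[OF Qsub Qcard] by blast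
  let ?D = "pr ` fixed_set Q B \<rho>"
  note bas = Y_basis(1)[OF B]
  have fin: "finite ?D" using perm_basisD(2)[OF B] by (simp add: fixed_set_def)
  have sub: "?D \<subseteq> carrier Y" and gen: "Y.span ?D = carrier Y" using bas by (auto simp: Y.basis_def)
  have one: "brauer_act \<rho> \<one>\<^sub>G y = y" if y: "y \<in> carrier Y" for y
  proof -
   obtain a where a: "a \<in> F" "y = pr a" using pr_surj[OF y] by blast
   then show ?thesis using act_pr[OF subgroup.one_closed[OF Nsub] a(1)] act_one[OF F_carrier[OF a(1)]] by simp
  qed
  have DU: "?D \<subseteq> (\<Union>g\<in>N. brauer_act \<rho> g ` ?D)"
  proof
   fix y assume y: "y \<in> ?D"
   then have "y = brauer_act \<rho> \<one>\<^sub>G y" using one sub by auto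
   then show "y \<in> (\<Union>g\<in>N. brauer_act \<rho> g ` ?D)" using subgroup.one_closed[OF Nsub] y by blast
  qed
  have U: "(\<Union>g\<in>N. brauer_act \<rho> g ` ?D) \<subseteq> carrier Y"
  proof
   fix y assume "y \<in> (\<Union>g\<in>N. brauer_act \<rho> g ` ?D)"
   then obtain g b where gb: "g \<in> N" "b \<in> fixed_set Q B \<rho>" "y = brauer_act \<rho> g (pr b)" by blast
   have "b \<in> F" using gb(2) perm_basisD(3)[OF B] by (simp add: fixed_set_def fixed_points_def)
   then show "y \<in> carrier Y" using gb act_pr F_act pr_closed by simp
  qed
  have "carrier Y \<subseteq> Y.span (\<Union>g\<in>N. brauer_act \<rho> g ` ?D)"
   using Y.span_is_monotone[OF DU] unfolding gen .
  then have "Y.span (\<Union>g\<in>N. brauer_act \<rho> g ` ?D) = carrier Y"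
   using Y.span_is_subset2[OF U] by (intro equalityI)
  then show ?case using fin sub by (intro exI[of _ ?D]) simp
 qed
 have fin: "finite N" using finite_subset[OF subgroup.subset[OF Nsub] finite_group] .
 show ?thesis
  using grp fin char_p_field_axioms
  unfolding modular_rep_def modular_rep_axioms_def by simp
qed

sublocale Y: modular_rep K "G(|carrier := N|)" Y "brauer_act \<rho>" p
 by (rule Y_modular_rep)

lemma subgroup_N: "subgroup S G ==> S \<subseteq> N ==> subgroup S (G(|carrier := N|))"
 using G.subgroup_incl Nsub by blast

lemma fixed_set_act:
 assumes B: "perm_basis S B" and S: "subgroup S G" "Q \<subseteq> S" "S \<subseteq> N" and g: "g \<in> S" and b: "b \<in> fixed_set Q B \<rho>"
 shows "\<rho> g b \<in> fixed_set Q B \<rho>"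
proof -
 note Bb = perm_basisD[OF B]
 have "b \<in> F" "b \<in> B" using b Bb(3) by (auto simp: fixed_set_def fixed_points_def)
 then have "\<rho> g b \<in> F" "\<rho> g b \<in> B" using F_act[of g b] g S(3) Bb(4)[OF g] by auto
 then show ?thesis by (simp add: fixed_set_def fixed_points_def)
qed

text \<open>As \<open>S\<close> normalises \<open>Q\<close>, it permutes the \<open>Q\<close>-fixed
  elements of \<open>B\<close> among themselves.\<close>

lemma Y_perm_basis:
 assumes B: "perm_basis S B" and S: "subgroup S G" "Q \<subseteq> S" "S \<subseteq> N"
 shows "Y.perm_basis S (pr ` fixed_set Q B \<rho>)"
 unfolding Y.perm_basis_def
proof (intro conjI ballI)
 note BQ = perm_basis_mono[OF B S(2)]
 note Bb = perm_basisD[OF B]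
 let ?D = "fixed_set Q B \<rho>"
 show "Y.basis (pr ` ?D)" by (rule Y_basis(1)[OF BQ])
 fix g assume g: "g \<in> S"
 have gN: "g \<in> N" using g S(3) by blast
 have DF: "b \<in> F" if "b \<in> ?D" for b using that Bb(3) by (simp add: fixed_set_def fixed_points_def)
 have "\<rho> g ` ?D = ?D"
 proof (rule endo_inj_surj)
  show "finite ?D" using Bb(2) by (simp add: fixed_set_def)
  show "\<rho> g ` ?D \<subseteq> ?D" using fixed_set_act[OF B S g] by blast
  show "inj_on (\<rho> g) ?D" using act_inj[OF NG[OF gN]] F_carrier DF by (intro inj_onI) blast
 qed
 moreover have "brauer_act \<rho> g ` pr ` ?D = pr ` \<rho> g ` ?D"
  unfolding image_image using act_pr[OF gN DF] by (intro image_cong) auto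
 ultimately show "brauer_act \<rho> g ` pr ` ?D = pr ` ?D" by simp
qed

text \<open>Take any lift, keep its coefficients at the \<open>Q\<close>-fixed basis elements and
  replace the others by 0. \<open>R\<close> permutes both kinds of basis elements, so the result is
  fixed by \<open>R\<close>.\<close>

lemma Y_fixed_lift:
 assumes B: "perm_basis R B" and R: "subgroup R G" "Q \<subseteq> R" "R \<subseteq> N"
  and y: "y \<in> fixed_points Y (brauer_act \<rho>) R"
 obtains m where "m \<in> fixM R" "m \<in> F" "pr m = y"
proof -
 note BQ = perm_basis_mono[OF B R(2)]
 note Bb = perm_basisD[OF B]
 let ?D = "fixed_set Q B \<rho>"
 note YB = Y_perm_basis[OF B R] and RN = subgroup_N[OF R(1,3)]
 have yY: "y \<in> carrier Y" using y by (simp add: fixed_points_def)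
 obtain v where v: "v \<in> F" "y = pr v" using pr_surj[OF yY] by blast
 have DB: "b \<in> B" if "b \<in> ?D" for b using that by (simp add: fixed_set_def)
 have DF: "b \<in> F" if "b \<in> ?D" for b using that Bb(3) by (simp add: fixed_set_def fixed_points_def)
 have cK: "coord B v b \<in> carrier K" if "b \<in> ?D" for b
  using coord_closed[OF Bb(2,1) F_carrier[OF v(1)] DB[OF that]] .
 let ?a = "\<lambda>b. if b \<in> ?D then coord B v b else \<zero>"
 let ?m = "\<Oplus>\<^bsub>M\<^esub>b\<in>B. ?a b \<odot>\<^sub>M b"
 have aK: "?a \<in> B \<rightarrow> carrier K" using cK by auto
 have mM: "?m \<in> carrier M" using aK Bb(3) by (intro M.finsum_closed) auto
 have cm: "coord B ?m b = ?a b" if "b \<in> B" for b by (rule coord_unique[OF Bb(2,1) aK that])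
 have m: "?m \<in> fixM R"
 proof (rule fixedI_coord[OF R(1) B mM])
  fix g b assume g: "g \<in> R" and b: "b \<in> B"
  have gN: "g \<in> N" using g R(3) by blast
  have iff: "\<rho> g b \<in> ?D \<longleftrightarrow> b \<in> ?D"
  proof
   assume gb: "\<rho> g b \<in> ?D"
   have "\<rho> (iG g) (\<rho> g b) \<in> ?D"
    using fixed_set_act[OF B R subgroup.m_inv_closed[OF R(1) g] gb] .
   then show "b \<in> ?D" using act_inv(1)[OF NG[OF gN] Bb(3)[OF b]] by simp
  qed (rule fixed_set_act[OF B R g])
  have "coord B v (\<rho> g b) = coord B v b" if bD: "b \<in> ?D"
  proof -
   have gbD: "\<rho> g b \<in> ?D" using iff bD by simp
   have "Y.coord (pr ` ?D) y (brauer_act \<rho> g (pr b)) = Y.coord (pr ` ?D) y (pr b)"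
    using Y.coord_fixed[OF RN YB g y] bD by blast
   then show ?thesis
    using Y_basis(3)[OF BQ v(1)] bD gbD act_pr[OF gN DF[OF bD]] v(2) by simp
  qed
  then show "coord B ?m (\<rho> g b) = coord B ?m b" using cm[OF b] cm[OF Bb(4)[OF g b]] iff by simp
 qed
 have mF: "?m \<in> F" using m R(2) by (auto simp: fixed_points_def)
 have "?m \<ominus>\<^sub>M v \<in> T"
  unfolding T_eq[OF BQ] negl_def
 proof (intro CollectI conjI ballI subspaceD(7)[OF F_sub mF v(1)])
  fix b assume b: "b \<in> ?D"
  have "coord B (?m \<ominus>\<^sub>M v) b = coord B ?m b \<ominus>\<^bsub>trivial_module K\<^esub> coord B v b"
   using hom_diff[OF trivial_vectorspace coord_hom[OF Bb(2,1) DB[OF b]] mM F_carrier[OF v(1)]] .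
  then show "coord B (?m \<ominus>\<^sub>M v) b = \<zero>"
   using cm[OF DB[OF b]] b cK[OF b] vectorspace.diff_add_cancel(4)[OF trivial_vectorspace, of "coord B v b"] by simp
 qed
 then have "pr ?m = y" using pr_eq_iff[OF mF v(1)] v(2) by simp
 then show thesis using that m mF by blast
qed

text \<open>The isomorphism between \<open>M(Q)(R)\<close> and \<open>M(R)\<close> without forming
  the second quotient: both sides say that the coefficients of \<open>m\<close> at the
  \<open>R\<close>-fixed elements of \<open>B\<close> vanish.\<close>

lemma Y_negl_iff:
 assumes B: "perm_basis R B" and R: "subgroup R G" "card R = p ^ k" "Q \<subseteq> R" "R \<subseteq> N"
  and m: "m \<in> fixM R"
 shows "pr m \<in> Y.negl R (pr ` fixed_set Q B \<rho>) \<longleftrightarrow> m \<in> trM R"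
proof -
 note BQ = perm_basis_mono[OF B R(3)]
 note Bb = perm_basisD[OF B]
 let ?D = "fixed_set Q B \<rho>"
 have mF: "m \<in> F" using m R(3) by (auto simp: fixed_points_def)
 have DF: "b \<in> F" if "b \<in> ?D" for b using that Bb(3) by (simp add: fixed_set_def fixed_points_def)
 have RN: "g \<in> N" if "g \<in> R" for g using that R(4) by blast
 have prm: "pr m \<in> fixed_points Y (brauer_act \<rho>) R"
  using m act_pr[OF RN mF] pr_closed[OF mF] by (simp add: fixed_points_def)
 have fx: "fixed_set R (pr ` ?D) (brauer_act \<rho>) = pr ` fixed_set R B \<rho>"
 proof (intro equalityI subsetI)
  fix y assume y: "y \<in> fixed_set R (pr ` ?D) (brauer_act \<rho>)"
  then obtain b where b: "b \<in> ?D" "y = pr b" by (auto simp: fixed_set_def)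
  have "\<rho> g b = b" if g: "g \<in> R" for g
  proof -
   have "pr (\<rho> g b) = pr b" using y g b act_pr[OF RN[OF g] DF[OF b(1)]] by (simp add: fixed_set_def)
   then show ?thesis
    using inj_onD[OF Y_basis(2)[OF BQ]] fixed_set_act[OF B R(1,3,4) g b(1)] b(1) by blast
  qed
  then show "y \<in> pr ` fixed_set R B \<rho>" using b by (auto simp: fixed_set_def)
 next
  fix y assume "y \<in> pr ` fixed_set R B \<rho>"
  then obtain b where b: "b \<in> fixed_set R B \<rho>" "y = pr b" by blast
  have bD: "b \<in> ?D" using b(1) R(3) by (auto simp: fixed_set_def)
  have "brauer_act \<rho> g y = y" if g: "g \<in> R" for g
   using b g act_pr[OF RN[OF g] DF[OF bD]] by (simp add: fixed_set_def)
  then show "y \<in> fixed_set R (pr ` ?D) (brauer_act \<rho>)" using b bD by (auto simp: fixed_set_def)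
 qed
 have RD: "fixed_set R B \<rho> \<subseteq> ?D" using R(3) by (auto simp: fixed_set_def)
 have "(\<forall>b\<in>pr ` fixed_set R B \<rho>. Y.coord (pr ` ?D) (pr m) b = \<zero>) \<longleftrightarrow> (\<forall>b\<in>fixed_set R B \<rho>. coord B m b = \<zero>)"
  using Y_basis(3)[OF BQ mF] RD by (simp add: subset_iff)
 then show ?thesis
  unfolding trace_sum_eq[OF R(1,2) B] negl_def Y.negl_def fx using m prm by simp
qed

end

section \<open>Endomorphism rings and a radical argument\<close>

context modular_rep begin

definition endos :: "'g set \<Rightarrow> ('m \<Rightarrow> 'm) set"
 where "endos H = {h \<in> module_hom K M M. equivariant H h}"

lemma endosD:
 assumes "h \<in> endos H"
 shows "h \<in> module_hom K M M" "!!v. v \<in> carrier M ==> h v \<in> carrier M"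
  "!!v w. v \<in> carrier M ==> w \<in> carrier M ==> h (v \<oplus>\<^sub>M w) = h v \<oplus>\<^sub>M h w"
  "!!c v. c \<in> carrier K ==> v \<in> carrier M ==> h (c \<odot>\<^sub>M v) = c \<odot>\<^sub>M h v"
  "!!v w. v \<in> carrier M ==> w \<in> carrier M ==> h (v \<ominus>\<^sub>M w) = h v \<ominus>\<^sub>M h w"
  "h \<zero>\<^sub>M = \<zero>\<^sub>M" "!!g v. g \<in> H ==> v \<in> carrier M ==> h (\<rho> g v) = \<rho> g (h v)"
proof -
 have h: "h \<in> module_hom K M M" using assms by (simp add: endos_def)
 show "h \<in> module_hom K M M" "!!v. v \<in> carrier M ==> h v \<in> carrier M"
  "!!v w. v \<in> carrier M ==> w \<in> carrier M ==> h (v \<oplus>\<^sub>M w) = h v \<oplus>\<^sub>M h w"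
  "!!c v. c \<in> carrier K ==> v \<in> carrier M ==> h (c \<odot>\<^sub>M v) = c \<odot>\<^sub>M h v"
  "!!v w. v \<in> carrier M ==> w \<in> carrier M ==> h (v \<ominus>\<^sub>M w) = h v \<ominus>\<^sub>M h w"
  "h \<zero>\<^sub>M = \<zero>\<^sub>M"
  using h homD[OF h] hom_diff[OF vs_self h] hom_zero[OF vs_self h] by blast+
 show "!!g v. g \<in> H ==> v \<in> carrier M ==> h (\<rho> g v) = \<rho> g (h v)"
  using assms by (auto simp: endos_def equivariant_def)
qed

lemma endosI:
 assumes "h \<in> module_hom K M M" "!!g v. g \<in> H ==> v \<in> carrier M ==> h (\<rho> g v) = \<rho> g (h v)"
 shows "h \<in> endos H"
 using assms by (simp add: endos_def equivariant_def)

lemma endos_comp: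
 assumes h: "h \<in> endos H" and k: "k \<in> endos H" shows "(\<lambda>v. h (k v)) \<in> endos H"
 by (rule endosI[OF homI]) (use endosD[OF h] endosD[OF k] in auto)

lemma endos_diff:
 assumes H: "H \<subseteq> carrier G" and h: "h \<in> endos H" and k: "k \<in> endos H"
 shows "(\<lambda>v. h v \<ominus>\<^sub>M k v) \<in> endos H"
proof (rule endosI)
 show "(\<lambda>v. h v \<ominus>\<^sub>M k v) \<in> module_hom K M M" by (rule hom_sub[OF vs_self endosD(1)[OF h] endosD(1)[OF k]])
 fix g v assume g: "g \<in> H" and v: "v \<in> carrier M"
 then have "g \<in> carrier G" using H by blast
 then show "h (\<rho> g v) \<ominus>\<^sub>M k (\<rho> g v) = \<rho> g (h v \<ominus>\<^sub>M k v)"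
  using endosD(2,7)[OF h] endosD(2,7)[OF k] g v hom_diff[OF vs_self act_hom] by simp
qed

lemma endos_smult:
 assumes H: "H \<subseteq> carrier G" and h: "h \<in> endos H" and c: "c \<in> carrier K"
 shows "(\<lambda>v. c \<odot>\<^sub>M h v) \<in> endos H"
proof (rule endosI)
 show "(\<lambda>v. c \<odot>\<^sub>M h v) \<in> module_hom K M M" by (rule hom_smult[OF vs_self endosD(1)[OF h] c])
 fix g v assume g: "g \<in> H" and v: "v \<in> carrier M"
 then have "g \<in> carrier G" using H by blast
 then show "c \<odot>\<^sub>M h (\<rho> g v) = \<rho> g (c \<odot>\<^sub>M h v)"
  using endosD(2,7)[OF h] g v act_smult c by simp
qed

lemma endos_id: "(\<lambda>v. v) \<in> endos H" by (rule endosI[OF hom_id]) simp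

text \<open>In finite dimension injectivity suffices for bijectivity, and the inverse of an
  equivariant map is equivariant.\<close>

lemma endos_inverse:
 assumes H: "H \<subseteq> carrier G" and a: "a \<in> endos H" and inj: "!!v. v \<in> carrier M ==> a v = \<zero>\<^sub>M ==> v = \<zero>\<^sub>M"
 shows "\<exists>b\<in>endos H. \<forall>v\<in>carrier M. b (a v) = v"
proof -
 have bij: "bij_betw a (carrier M) (carrier M)" by (rule injective_imp_surjective[OF fin_dim endosD(1)[OF a] inj])
 let ?b = "inv_into (carrier M) a"
 have b: "?b (a v) = v" if "v \<in> carrier M" for v using bij that by (simp add: bij_betw_inv_into_left)
 have surj: "\<exists>x\<in>carrier M. v = a x" if "v \<in> carrier M" for v using bij that by (auto simp: bij_betw_def)
 have "?b \<in> endos H"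
 proof (rule endosI[OF homI])
  fix v assume "v \<in> carrier M"
  then obtain x where "x \<in> carrier M" "v = a x" using surj by blast
  then show "?b v \<in> carrier M" using b by simp
 next
  fix v w assume "v \<in> carrier M" "w \<in> carrier M"
  then obtain x y where xy: "x \<in> carrier M" "v = a x" "y \<in> carrier M" "w = a y" using surj by blast
  then have "v \<oplus>\<^sub>M w = a (x \<oplus>\<^sub>M y)" using endosD(3)[OF a] by simp
  then show "?b (v \<oplus>\<^sub>M w) = ?b v \<oplus>\<^sub>M ?b w" using b xy by simp
 next
  fix c v assume c: "c \<in> carrier K" and "v \<in> carrier M"
  then obtain x where x: "x \<in> carrier M" "v = a x" using surj by blast
  then have "c \<odot>\<^sub>M v = a (c \<odot>\<^sub>M x)" using endosD(4)[OF a c] by simp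
  then show "?b (c \<odot>\<^sub>M v) = c \<odot>\<^sub>M ?b v" using b x c by simp
 next
  fix g v assume g: "g \<in> H" and "v \<in> carrier M"
  then obtain x where x: "x \<in> carrier M" "v = a x" using surj by blast
  have gG: "g \<in> carrier G" using g H by blast
  have "\<rho> g v = a (\<rho> g x)" using x endosD(7)[OF a g] by simp
  then show "?b (\<rho> g v) = \<rho> g (?b v)" using b x act_closed[OF gG] by simp
 qed
 then show ?thesis using b by blast
qed

lemma endos_finsum:
 assumes H: "H \<subseteq> carrier G" and x: "!!i. i \<in> I ==> x i \<in> endos H"
 shows "(\<lambda>v. \<Oplus>\<^bsub>M\<^esub>i\<in>I. x i v) \<in> endos H"
proof (rule endosI)
 show "(\<lambda>v. \<Oplus>\<^bsub>M\<^esub>i\<in>I. x i v) \<in> module_hom K M M"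
  by (rule hom_finsum_fun[OF vs_self endosD(1)[OF x]])
 fix g v assume g: "g \<in> H" and v: "v \<in> carrier M"
 then have gG: "g \<in> carrier G" using H by blast
 have 1: "(\<lambda>i. x i v) \<in> I \<rightarrow> carrier M" using endosD(2)[OF x v] by blast
 have "(\<Oplus>\<^bsub>M\<^esub>i\<in>I. x i (\<rho> g v)) = (\<Oplus>\<^bsub>M\<^esub>i\<in>I. \<rho> g (x i v))"
  using 1 endosD(7)[OF x g v] act_closed[OF gG] by (intro M.finsum_cong') auto
 also have "... = \<rho> g (\<Oplus>\<^bsub>M\<^esub>i\<in>I. x i v)" by (rule hom_finsum[OF vs_self act_hom[OF gG] 1, symmetric])
 finally show "(\<Oplus>\<^bsub>M\<^esub>i\<in>I. x i (\<rho> g v)) = \<rho> g (\<Oplus>\<^bsub>M\<^esub>i\<in>I. x i v)" .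
qed

text \<open>The Jacobson radical of the ring of \<open>H\<close>-endomorphisms.\<close>

definition jac :: "'g set \<Rightarrow> ('m \<Rightarrow> 'm) \<Rightarrow> bool"
 where "jac H y \<longleftrightarrow> y \<in> endos H \<and> (\<forall>z\<in>endos H. \<forall>v\<in>carrier M. v = y (z v) \<longrightarrow> v = \<zero>\<^sub>M)"

lemma jacD: "jac H y ==> z \<in> endos H ==> v \<in> carrier M ==> v = y (z v) ==> v = \<zero>\<^sub>M"
 unfolding jac_def by blast

text \<open>With \<open>b\<close> inverse to \<open>1 - xz\<close>, the map
  \<open>1 - (x + y)z\<close> factors as \<open>(1 - yzb)(1 - xz)\<close>, and both factors are
  injective.\<close>

lemma jac_add:
 assumes H: "H \<subseteq> carrier G" and x: "jac H x" and y: "jac H y" and xy: "(\<lambda>v. x v \<oplus>\<^sub>M y v) \<in> endos H"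
 shows "jac H (\<lambda>v. x v \<oplus>\<^sub>M y v)"
 unfolding jac_def
proof (intro conjI ballI impI xy)
 fix z v assume z: "z \<in> endos H" and v: "v \<in> carrier M" and eq: "v = x (z v) \<oplus>\<^sub>M y (z v)"
 have xA: "x \<in> endos H" and yA: "y \<in> endos H" using x y by (auto simp: jac_def)
 let ?a = "\<lambda>v. v \<ominus>\<^sub>M x (z v)"
 have a: "?a \<in> endos H" by (rule endos_diff[OF H endos_id endos_comp[OF xA z]])
 have ainj: "w = \<zero>\<^sub>M" if w: "w \<in> carrier M" "?a w = \<zero>\<^sub>M" for w
 proof -
  have "w = x (z w)" using w diff_zero_iff endosD(2)[OF xA] endosD(2)[OF z] by simp
  then show ?thesis by (rule jacD[OF x z w(1)])
 qed
 obtain b where b: "b \<in> endos H" "!!v. v \<in> carrier M ==> b (?a v) = v"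
  using endos_inverse[OF H a ainj] by blast
 let ?w = "?a v"
 have c: "x (z v) \<in> carrier M" "y (z v) \<in> carrier M" using v endosD(2)[OF xA] endosD(2)[OF yA] endosD(2)[OF z] by auto
 have wM: "?w \<in> carrier M" using endosD(2)[OF a v] .
 have "?w = y (z v)" using diff_eq_iff[OF v c] eq M.a_comm[OF c] by simp
 then have "?w = y (z (b ?w))" using b(2)[OF v] by simp
 then have "?w = \<zero>\<^sub>M" by (rule jacD[OF y endos_comp[OF z b(1)] wM])
 then show "v = \<zero>\<^sub>M" using ainj[OF v] by simp
qed

lemma jac_finsum:
 assumes H: "H \<subseteq> carrier G" and I: "finite I" and x: "!!i. i \<in> I ==> jac H (x i)"
 shows "jac H (\<lambda>v. \<Oplus>\<^bsub>M\<^esub>i\<in>I. x i v)"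
 using I x
proof (induction I rule: finite_induct)
 case empty
 have "(\<lambda>v. \<zero>\<^sub>M) \<in> endos H" by (rule endosI[OF homI]) (use act_zero H in auto)
 then show ?case by (auto simp: jac_def)
next
 case (insert i I)
 have xA: "x j \<in> endos H" if "j \<in> insert i I" for j using insert.prems[OF that] by (simp add: jac_def)
 have eq: "(\<Oplus>\<^bsub>M\<^esub>j\<in>insert i I. x j v) = x i v \<oplus>\<^sub>M (\<Oplus>\<^bsub>M\<^esub>j\<in>I. x j v)" if v: "v \<in> carrier M" for v
  using insert.hyps endosD(2)[OF xA v] by (intro M.finsum_insert) auto
 have s: "(\<lambda>v. \<Oplus>\<^bsub>M\<^esub>j\<in>insert i I. x j v) \<in> endos H" by (rule endos_finsum[OF H xA])
 \<comment> \<open>The two expressions for the sum are known to agree on the carrier only, so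
   membership in \<open>endos H\<close> is shown for each.\<close>
 have s': "(\<lambda>v. x i v \<oplus>\<^sub>M (\<Oplus>\<^bsub>M\<^esub>j\<in>I. x j v)) \<in> endos H"
 proof (rule endosI[OF homI])
  fix g v assume g: "g \<in> H" "v \<in> carrier M"
  then have "\<rho> g v \<in> carrier M" using H act_closed by blast
  then show "x i (\<rho> g v) \<oplus>\<^sub>M (\<Oplus>\<^bsub>M\<^esub>j\<in>I. x j (\<rho> g v)) = \<rho> g (x i v \<oplus>\<^sub>M (\<Oplus>\<^bsub>M\<^esub>j\<in>I. x j v))"
   using endosD(7)[OF s g] eq g(2) by simp
 qed (use endosD[OF s] eq in auto)
 have J: "jac H (\<lambda>v. x i v \<oplus>\<^sub>M (\<Oplus>\<^bsub>M\<^esub>j\<in>I. x j v))"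
  using insert by (intro jac_add[OF H _ _ s']) auto
 have "v = \<zero>\<^sub>M" if z: "z \<in> endos H" and v: "v \<in> carrier M" and e: "v = (\<Oplus>\<^bsub>M\<^esub>j\<in>insert i I. x j (z v))" for z v
 proof -
  have "v = x i (z v) \<oplus>\<^sub>M (\<Oplus>\<^bsub>M\<^esub>j\<in>I. x j (z v))" using e unfolding eq[OF endosD(2)[OF z v]] .
  then show ?thesis by (rule jacD[OF J z v])
 qed
 then show ?case using s unfolding jac_def by blast
qed

text \<open>A vector with \<open>v = x (z v)\<close> is fixed by every power of the nilpotent map
  \<open>xz\<close>.\<close>

lemma jac_nilpotent:
 assumes x: "x \<in> endos H" and nil: "!!z. z \<in> endos H ==> \<exists>n. \<forall>v\<in>carrier M. ((\<lambda>v. x (z v)) ^^ n) v = \<zero>\<^sub>M"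
 shows "jac H x"
 unfolding jac_def
proof (intro conjI ballI impI x)
 fix z v assume z: "z \<in> endos H" and v: "v \<in> carrier M" "v = x (z v)"
 obtain n where n: "\<forall>v\<in>carrier M. ((\<lambda>v. x (z v)) ^^ n) v = \<zero>\<^sub>M" using nil[OF z] by blast
 have "((\<lambda>v. x (z v)) ^^ j) v = v" for j by (induction j) (use v(2) in auto)
 then show "v = \<zero>\<^sub>M" using n v(1) by metis
qed

text \<open>A replacement for the Bergman-Isaacs theorem: modulo the Jacobson radical the idempotents
 \<open>e i\<close> agree, so that their average is nilpotent only if they vanish.\<close>

lemma average_nilpotent_imp_zero:
 assumes H: "H \<subseteq> carrier G" and I: "finite I" and e: "!!i. i \<in> I ==> e i \<in> endos H"
  and c: "c \<in> carrier K" "[card I] \<cdot> c = \<one>"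
  and e0: "e0 \<in> endos H" "!!v. v \<in> carrier M ==> e0 (e0 v) = e0 v"
  and nil: "!!i z. i \<in> I ==> z \<in> endos H ==>
   \<exists>n. \<forall>v\<in>carrier M. ((\<lambda>v. e0 (z v) \<ominus>\<^sub>M e i (e0 (z v))) ^^ n) v = \<zero>\<^sub>M"
  and u: "\<forall>v\<in>carrier M. ((\<lambda>v. \<Oplus>\<^bsub>M\<^esub>i\<in>I. c \<odot>\<^sub>M e i v) ^^ m) v = \<zero>\<^sub>M"
  and v: "v \<in> carrier M"
 shows "e0 v = \<zero>\<^sub>M"
proof -
 let ?u = "\<lambda>v. \<Oplus>\<^bsub>M\<^esub>i\<in>I. c \<odot>\<^sub>M e i v"
 have uA: "?u \<in> endos H" by (intro endos_finsum[OF H] endos_smult[OF H e c(1)])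
 \<comment> \<open>Since \<open>u\<close> is nilpotent, \<open>1 - u\<close> is injective and has an
   inverse \<open>b\<close>.\<close>
 let ?a = "\<lambda>v. v \<ominus>\<^sub>M ?u v"
 have aA: "?a \<in> endos H" by (rule endos_diff[OF H endos_id uA])
 have ainj: "w = \<zero>\<^sub>M" if w: "w \<in> carrier M" "?a w = \<zero>\<^sub>M" for w
 proof -
  have "?u w = w" using w diff_zero_iff[OF w(1) endosD(2)[OF uA w(1)]] by simp
  then have "(?u ^^ j) w = w" for j by (induction j) auto
  then show ?thesis using u w(1) by metis
 qed
 obtain b where b: "b \<in> endos H" "!!v. v \<in> carrier M ==> b (?a v) = v"
  using endos_inverse[OF H aA ainj] by blast
 \<comment> \<open>The \<open>w i\<close> add up to \<open>(1 - u) e0\<close> because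
   \<open>c\<close> inverts the number of indices. So \<open>e0\<close> is the sum of the
   \<open>b (w i)\<close>, which lie in the radical, and an idempotent in the radical is 0.\<close>
 define w where "w i v = c \<odot>\<^sub>M (e0 v \<ominus>\<^sub>M e i (e0 v))" for i v
 have wA: "w i \<in> endos H" if "i \<in> I" for i
  unfolding w_def by (intro endos_smult[OF H _ c(1)] endos_diff[OF H e0(1)] endos_comp[OF e[OF that] e0(1)])
 have jb: "jac H (\<lambda>v. b (w i v))" if i: "i \<in> I" for i
 proof (rule jac_nilpotent[OF endos_comp[OF b(1) wA[OF i]]])
  fix z assume z: "z \<in> endos H"
  let ?z = "\<lambda>v. c \<odot>\<^sub>M z (b v)"
  have zA: "?z \<in> endos H" by (rule endos_smult[OF H endos_comp[OF z b(1)] c(1)])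
  obtain n where n: "\<forall>v\<in>carrier M. ((\<lambda>v. e0 (?z v) \<ominus>\<^sub>M e i (e0 (?z v))) ^^ n) v = \<zero>\<^sub>M"
   using nil[OF i zA] by blast
  have eq: "w i (z (b x)) = e0 (?z x) \<ominus>\<^sub>M e i (e0 (?z x))" if x: "x \<in> carrier M" for x
  proof -
   have zb: "z (b x) \<in> carrier M" using x endosD(2)[OF z] endosD(2)[OF b(1)] by simp
   have 1: "e0 (?z x) = c \<odot>\<^sub>M e0 (z (b x))" using endosD(4)[OF e0(1) c(1) zb] .
   have e0M: "e0 (z (b x)) \<in> carrier M" using endosD(2)[OF e0(1) zb] .
   have 2: "e i (e0 (?z x)) = c \<odot>\<^sub>M e i (e0 (z (b x)))" unfolding 1 using endosD(4)[OF e[OF i] c(1) e0M] .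
   show ?thesis unfolding w_def
    by (subst 2, subst 1)
     (rule hom_diff[OF vs_self hom_smult[OF vs_self hom_id c(1)] e0M endosD(2)[OF e[OF i] e0M]])
  qed
  \<comment> \<open>The hypothesis concerns the product in the order \<open>w z b\<close>; one extra
    factor turns its nilpotency into that of \<open>b w z\<close>.\<close>
  have swap: "((\<lambda>v. b (w i (z v))) ^^ Suc j) x
    = b (((\<lambda>v. e0 (?z v) \<ominus>\<^sub>M e i (e0 (?z v))) ^^ j) (w i (z x)))" if x: "x \<in> carrier M" for j x
  proof (induction j)
   case 0 then show ?case by simp
  next
   case (Suc j)
   let ?k = "\<lambda>v. e0 (?z v) \<ominus>\<^sub>M e i (e0 (?z v))"
   have kA: "?k \<in> module_hom K M M"
    using endos_diff[OF H endos_comp[OF e0(1) zA] endos_comp[OF e[OF i] endos_comp[OF e0(1) zA]]] by (simp add: endos_def)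
   have wz: "w i (z x) \<in> carrier M" using endosD(2)[OF wA[OF i]] endosD(2)[OF z x] by simp
   have kj: "(?k ^^ j) (w i (z x)) \<in> carrier M" using homD(1)[OF hom_funpow[OF kA] wz] .
   have "((\<lambda>v. b (w i (z v))) ^^ Suc (Suc j)) x = b (w i (z (((\<lambda>v. b (w i (z v))) ^^ Suc j) x)))" by simp
   also have "... = b (w i (z (b ((?k ^^ j) (w i (z x))))))" unfolding Suc ..
   also have "... = b (?k ((?k ^^ j) (w i (z x))))" unfolding eq[OF kj] ..
   finally show ?case by simp
  qed
  have "((\<lambda>v. b (w i (z v))) ^^ Suc n) x = \<zero>\<^sub>M" if x: "x \<in> carrier M" for x
  proof -
   have "w i (z x) \<in> carrier M" using endosD(2)[OF wA[OF i]] endosD(2)[OF z x] by simp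
   then show ?thesis unfolding swap[OF x] using n endosD(6)[OF b(1)] by simp
  qed
  then show "\<exists>n. \<forall>v\<in>carrier M. ((\<lambda>v. b (w i (z v))) ^^ n) v = \<zero>\<^sub>M" by blast
 qed
 have J: "jac H (\<lambda>v. \<Oplus>\<^bsub>M\<^esub>i\<in>I. b (w i v))" by (rule jac_finsum[OF H I jb])
 have e0eq: "(\<Oplus>\<^bsub>M\<^esub>i\<in>I. b (w i x)) = e0 x" if x: "x \<in> carrier M" for x
 proof -
  have wi: "(\<lambda>i. w i x) \<in> I \<rightarrow> carrier M" using endosD(2)[OF wA x] by blast
  have ex: "e0 x \<in> carrier M" using endosD(2)[OF e0(1) x] .
  have ei: "e i (e0 x) \<in> carrier M" if "i \<in> I" for i using endosD(2)[OF e[OF that] ex] .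
  have "(\<Oplus>\<^bsub>M\<^esub>i\<in>I. b (w i x)) = b (\<Oplus>\<^bsub>M\<^esub>i\<in>I. w i x)"
   by (rule hom_finsum[OF vs_self endosD(1)[OF b(1)] wi, symmetric])
  also have "(\<Oplus>\<^bsub>M\<^esub>i\<in>I. w i x) = e0 x \<ominus>\<^sub>M ?u (e0 x)"
  proof -
   have uM: "?u (e0 x) \<in> carrier M" using endosD(2)[OF uA ex] .
   have "(\<Oplus>\<^bsub>M\<^esub>i\<in>I. w i x) \<oplus>\<^sub>M ?u (e0 x) = (\<Oplus>\<^bsub>M\<^esub>i\<in>I. w i x \<oplus>\<^sub>M c \<odot>\<^sub>M e i (e0 x))"
    using wi ei c(1) by (intro M.finsum_addf[symmetric]) auto
   also have "... = (\<Oplus>\<^bsub>M\<^esub>i\<in>I. c \<odot>\<^sub>M e0 x)"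
   proof (rule M.finsum_cong'[OF refl])
    show "(\<lambda>i. c \<odot>\<^sub>M e0 x) \<in> I \<rightarrow> carrier M" using c(1) ex by auto
    fix i assume i: "i \<in> I"
    have dM: "e0 x \<ominus>\<^sub>M e i (e0 x) \<in> carrier M" using ex ei[OF i] by simp
    have "(e0 x \<ominus>\<^sub>M e i (e0 x)) \<oplus>\<^sub>M e i (e0 x) = e0 x" using ex ei[OF i] by simp
    then show "w i x \<oplus>\<^sub>M c \<odot>\<^sub>M e i (e0 x) = c \<odot>\<^sub>M e0 x"
     unfolding w_def using smult_r_distr[OF c(1) dM ei[OF i]] by simp
   qed
   also have "... = (\<Oplus>i\<in>I. c) \<odot>\<^sub>M e0 x"
    by (rule finsum_smult_r[symmetric]) (use c(1) ex I in auto)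
   also have "... = e0 x" using R.add.finprod_const[OF c(1), of I] c(2) ex by simp
   finally have "(\<Oplus>\<^bsub>M\<^esub>i\<in>I. w i x) \<oplus>\<^sub>M ?u (e0 x) = e0 x" .
   then show ?thesis using diff_eq_iff[OF ex uM, of "\<Oplus>\<^bsub>M\<^esub>i\<in>I. w i x"] M.finsum_closed[OF wi] by simp
  qed
  also have "b (e0 x \<ominus>\<^sub>M ?u (e0 x)) = e0 x" using b(2)[OF ex] .
  finally show ?thesis .
 qed
 have e0v: "e0 v \<in> carrier M" using endosD(2)[OF e0(1) v] .
 have "e0 v = (\<Oplus>\<^bsub>M\<^esub>i\<in>I. b (w i (e0 v)))" unfolding e0eq[OF e0v] using e0(2)[OF v] by simp
 then show ?thesis by (rule jacD[OF J endos_id e0v])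
qed

end

section \<open>The Scott module as a summand of the permutation module\<close>

text \<open>That \<open>M\<close> is a summand of \<open>kG/P\<close> is recorded by two families
  indexed by cosets: \<open>d\<close> consists of the images of the basis vectors of
  \<open>kG/P\<close> under the projection to \<open>M\<close>, and \<open>s\<close> of the
  coefficients of the embedding. \<open>expand\<close> says that embedding followed by projection is
  the identity. The vectors of \<open>kG/P\<close> are thereby out of sight. \<open>f\<close> is the
  quotient map to the trivial module.\<close>

locale scott_rep = perm_rep K G M \<rho> p
 for K :: "('k, 'y) ring_scheme" (structure) and G :: "('g, 'z) monoid_scheme"
  and M :: "('k, 'm, 'x) module_scheme" and \<rho> :: "'g \<Rightarrow> 'm \<Rightarrow> 'm" and p :: nat +
 fixes P :: "'g set" and d :: "'g set \<Rightarrow> 'm" and s :: "'g set \<Rightarrow> 'm \<Rightarrow> 'k" and f :: "'m \<Rightarrow> 'k"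
 assumes Psub: "subgroup P G" and Pcard: "\<exists>n. card P = p ^ n"
  and ind: "indecomposable K G M \<rho>"
  and d_closed: "!!C. C \<in> cosets G (carrier G) P ==> d C \<in> carrier M"
  and d_act: "!!g C. g \<in> carrier G ==> C \<in> cosets G (carrier G) P ==> d (g <#\<^sub>G C) = \<rho> g (d C)"
  and s_hom: "!!C. C \<in> cosets G (carrier G) P ==> s C \<in> module_hom K M (trivial_module K)"
  and s_act: "!!g C v. g \<in> carrier G ==> C \<in> cosets G (carrier G) P ==> v \<in> carrier M ==>
   s (g <#\<^sub>G C) (\<rho> g v) = s C v"
  and expand: "!!v. v \<in> carrier M ==> v = (\<Oplus>\<^bsub>M\<^esub>C\<in>cosets G (carrier G) P. s C v \<odot>\<^sub>M d C)"
  and f_hom: "f \<in> module_hom K M (trivial_module K)"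
  and f_act: "!!g v. g \<in> carrier G ==> v \<in> carrier M ==> f (\<rho> g v) = f v"
  and f_nonzero: "\<exists>v\<in>carrier M. f v ~= \<zero>"
begin

abbreviation "PX \<equiv> cosets G (carrier G) P"

abbreviation "m0 \<equiv> d P"

lemma PG: "P \<subseteq> carrier G" using subgroup.subset[OF Psub] .

lemma coset_in_X: "g \<in> carrier G ==> g <#\<^sub>G P \<in> PX" by (simp add: cosets_def)

lemma P_in_X: "P \<in> PX"
 using coset_in_X[of "\<one>\<^sub>G"] G.lcos_mult_one[OF PG] by simp

lemma m0_closed: "m0 \<in> carrier M" by (rule d_closed[OF P_in_X])

lemma finX: "finite PX" using finite_group by (simp add: cosets_def)

lemma d_coset: "g \<in> carrier G ==> d (g <#\<^sub>G P) = \<rho> g m0" by (rule d_act[OF _ P_in_X])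

lemma X_cases: "C \<in> PX ==> \<exists>g\<in>carrier G. C = g <#\<^sub>G P" by (auto simp: cosets_def)

lemma m0_fixed: "g \<in> P ==> \<rho> g m0 = m0"
proof -
 assume g: "g \<in> P"
 then have gG: "g \<in> carrier G" using PG by blast
 have "g <#\<^sub>G P = P" using G.coset_join3[OF gG Psub g] .
 then show ?thesis using d_coset[OF gG] by simp
qed

lemma s_closed: "C \<in> PX ==> v \<in> carrier M ==> s C v \<in> carrier K"
 using homD(1)[OF s_hom] by simp

lemma f_closed: "v \<in> carrier M ==> f v \<in> carrier K" using homD(1)[OF f_hom] by simp

text \<open>\<open>M\<close> is generated by \<open>m0\<close> as a \<open>G\<close>-module.\<close>

lemma functional_m0:
 assumes \<phi>: "\<phi> \<in> module_hom K M (trivial_module K)" "!!g. g \<in> carrier G ==> \<phi> (\<rho> g m0) = \<phi> m0"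
  and v: "v \<in> carrier M"
 shows "\<phi> v = (\<Oplus>C\<in>PX. s C v) \<otimes> \<phi> m0"
proof -
 have \<phi>0: "\<phi> m0 \<in> carrier K" using homD(1)[OF \<phi>(1) m0_closed] by simp
 have "\<phi> v = \<phi> (\<Oplus>\<^bsub>M\<^esub>C\<in>PX. s C v \<odot>\<^sub>M d C)" using expand[OF v] by simp
 also have "... = (\<Oplus>C\<in>PX. \<phi> (s C v \<odot>\<^sub>M d C))"
  using hom_finsum[OF trivial_vectorspace \<phi>(1), of "\<lambda>C. s C v \<odot>\<^sub>M d C" PX] s_closed[OF _ v] d_closed by auto
 also have "... = (\<Oplus>C\<in>PX. s C v \<otimes> \<phi> m0)"
 proof (rule R.finsum_cong'[OF refl])
  show "(\<lambda>C. s C v \<otimes> \<phi> m0) \<in> PX \<rightarrow> carrier K" using s_closed[OF _ v] \<phi>0 by auto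
  fix C assume C: "C \<in> PX"
  obtain g where g: "g \<in> carrier G" "C = g <#\<^sub>G P" using X_cases[OF C] by blast
  have "\<phi> (d C) = \<phi> m0" using d_coset[OF g(1)] g \<phi>(2) by simp
  then show "\<phi> (s C v \<odot>\<^sub>M d C) = s C v \<otimes> \<phi> m0" using homD(3)[OF \<phi>(1) s_closed[OF C v] d_closed[OF C]] by simp
 qed
 also have "... = (\<Oplus>C\<in>PX. s C v) \<otimes> \<phi> m0"
  using s_closed[OF _ v] \<phi>0 by (intro R.finsum_ldistr[symmetric] finX) auto
 finally show ?thesis .
qed

lemma f_m0: "f m0 ~= \<zero>"
proof
 assume "f m0 = \<zero>"
 then have "f v = \<zero>" if "v \<in> carrier M" for v
  using functional_m0[OF f_hom f_act[OF _ m0_closed] that] s_closed[OF _ that] R.finsum_closed[of "\<lambda>C. s C v" PX] by auto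
 then show False using f_nonzero by blast
qed

text \<open>\<open>f\<close> after \<open>x\<close> is an invariant functional, hence determined by
  its value at \<open>m0\<close>, and so 0. Thus \<open>x\<close> is not surjective, and on an
  indecomposable module it must be nilpotent.\<close>

lemma nilpotent_if_f_zero:
 assumes x: "x \<in> endos (carrier G)" and 0: "f (x m0) = \<zero>"
 shows "\<exists>j. \<forall>v\<in>carrier M. (x ^^ j) v = \<zero>\<^sub>M"
proof -
 have h: "(\<lambda>v. f (x v)) \<in> module_hom K M (trivial_module K)"
  by (rule homI) (use homD[OF f_hom] endosD[OF x] in auto)
 have fx: "f (x v) = \<zero>" if v: "v \<in> carrier M" for v
 proof -
  have "f (x (\<rho> g m0)) = f (x m0)" if g: "g \<in> carrier G" for g
   using endosD(7)[OF x g m0_closed] f_act[OF g endosD(2)[OF x m0_closed]] by simp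
  then show ?thesis
   using functional_m0[OF h _ v] 0 s_closed[OF _ v] R.finsum_closed[of "\<lambda>C. s C v" PX] by auto
 qed
 have "\<not> bij_betw x (carrier M) (carrier M)"
 proof
  assume "bij_betw x (carrier M) (carrier M)"
  then have xM: "x ` carrier M = carrier M" by (simp add: bij_betw_def)
  have "f v = \<zero>" if v: "v \<in> carrier M" for v
  proof -
   have "v \<in> x ` carrier M" unfolding xM using v .
   then show ?thesis using fx by blast
  qed
  then show False using f_nonzero by blast
 qed
 moreover have "indecomposable K (G(|carrier := carrier G|)) M \<rho>" using ind by simp
 ultimately show ?thesis
  using indecomposable_nilpotent_or_bij[of "carrier G" x] x by (auto simp: endos_def)
qed

end

locale scott_brauer = scott_rep K G M \<rho> p P d s f + brauer_quot K G M \<rho> p Q n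
 for K :: "('k, 'y) ring_scheme" (structure) and G :: "('g, 'z) monoid_scheme"
  and M :: "('k, 'm, 'x) module_scheme" and \<rho> :: "'g \<Rightarrow> 'm \<Rightarrow> 'm" and p :: nat
  and P d s f Q n +
 assumes QP: "Q \<subseteq> P"
begin

lemma m0F: "m0 \<in> F" using m0_closed m0_fixed QP by (auto simp: fixed_points_def)

lemma f_T: "t \<in> T ==> f t = \<zero>"
proof -
 assume t: "t \<in> T"
 obtain B where B: "perm_basis Q B" using has_perm[OF Qsub Qcard] by blast
 show "f t = \<zero>"
  using invariant_functional_negl[OF Qsub Qcard B f_hom f_act] t QG unfolding T_eq[OF B] by blast
qed

lemma fY_exists: "\<exists>\<phi>. \<phi> \<in> module_hom K Y (trivial_module K) \<and> (\<forall>v\<in>F. \<phi> (pr v) = f v)"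
proof (rule Y_induced[OF trivial_vectorspace, of f], goal_cases)
 case (1 v) then show ?case using homD(1)[OF f_hom] F_carrier by blast
next
 case (2 v w) then show ?case using homD(2)[OF f_hom] F_carrier by blast
next
 case (3 c v) then show ?case using homD(3)[OF f_hom] F_carrier by blast
next
 case (4 t) then show ?case using f_T by simp
next
 case (5 h) then show ?case by blast
qed

definition fY where "fY = (SOME \<phi>. \<phi> \<in> module_hom K Y (trivial_module K) \<and> (\<forall>v\<in>F. \<phi> (pr v) = f v))"

lemma fY_hom: "fY \<in> module_hom K Y (trivial_module K)" and fY_pr: "v \<in> F ==> fY (pr v) = f v"
 using someI_ex[OF fY_exists] unfolding fY_def by auto

lemma fY_act: "g \<in> N ==> y \<in> carrier Y ==> fY (brauer_act \<rho> g y) = fY y"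
proof -
 assume g: "g \<in> N" and "y \<in> carrier Y"
 then obtain v where v: "v \<in> F" "y = pr v" using pr_surj by blast
 then show ?thesis using act_pr[OF g v(1)] fY_pr[OF F_act[OF g v(1)]] fY_pr[OF v(1)] f_act[OF NG[OF g] F_carrier[OF v(1)]] by simp
qed

text \<open>Relative traces \<open>Tr\<^sub>Q\<^sup>N \<beta>\<close> of linear endomorphisms of \<open>Y = M(Q)\<close> lift to relative traces \<open>Tr\<^sub>Q\<^sup>G b\<close>
 on \<open>M\<close>, because by the Mackey formula the cosets outside \<open>N\<close> contribute to \<open>T\<close> only.\<close>

lemma trace_nilpotent:
 assumes \<beta>: "\<beta> \<in> module_hom K Y Y"
  and u: "!!y. y \<in> carrier Y ==> u y = coset_sum Y G N Q (\<lambda>g. brauer_act \<rho> g (\<beta> (brauer_act \<rho> (iG g) y)))"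
  and u0: "!!y. y \<in> carrier Y ==> fY (u y) = \<zero>"
 shows "\<exists>j. \<forall>y\<in>carrier Y. (u ^^ j) y = \<zero>\<^sub>Y"
proof -
 obtain B where B: "perm_basis Q B" using has_perm[OF Qsub Qcard] by blast
 note Bb = perm_basisD[OF B]
 let ?D = "fixed_set Q B \<rho>"
 have DB: "b \<in> B" if "b \<in> ?D" for b using that by (simp add: fixed_set_def)
 have DF: "b \<in> F" if "b \<in> ?D" for b using that Bb(3) by (simp add: fixed_set_def fixed_points_def)
 \<comment> \<open>\<open>\<beta>\<close> is lifted on the basis of \<open>Y\<close> that comes from
   the \<open>Q\<close>-fixed elements of \<open>B\<close>. The remaining elements of
   \<open>B\<close> will be sent to 0.\<close>
 have "\<exists>l. \<forall>b\<in>?D. l b \<in> F \<and> pr (l b) = \<beta> (pr b)"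
  using pr_surj Y.homD(1)[OF \<beta> pr_closed[OF DF]] by (intro bchoice) metis
 then obtain l where l: "!!b. b \<in> ?D ==> l b \<in> F" "!!b. b \<in> ?D ==> pr (l b) = \<beta> (pr b)" by blast
 define d' where "d' b = (if b \<in> ?D then l b else \<zero>\<^sub>M)" for b
 have dF: "d' b \<in> F" for b using l(1) subspaceD(3)[OF F_sub] by (simp add: d'_def)
 have dM: "d' b \<in> carrier M" for b using F_carrier[OF dF] .
 obtain b where b: "b \<in> module_hom K M M" "!!v. b v = (\<Oplus>\<^bsub>M\<^esub>c\<in>B. coord B v c \<odot>\<^sub>M d' c)"
 proof -
  have "\<exists>h. h \<in> module_hom K M M \<and> (\<forall>v. h v = (\<Oplus>\<^bsub>M\<^esub>c\<in>B. coord B v c \<odot>\<^sub>M d' c))"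
  proof (rule basis_hom[OF Bb(2,1) vs_self, of d'], rule dM)
   fix h assume "h \<in> module_hom K M M" "!!v. h v = (\<Oplus>\<^bsub>M\<^esub>c\<in>B. coord B v c \<odot>\<^sub>M d' c)"
   then show "\<exists>h. h \<in> module_hom K M M \<and> (\<forall>v. h v = (\<Oplus>\<^bsub>M\<^esub>c\<in>B. coord B v c \<odot>\<^sub>M d' c))" by blast
  qed
  then obtain h where "h \<in> module_hom K M M" "\<forall>v. h v = (\<Oplus>\<^bsub>M\<^esub>c\<in>B. coord B v c \<odot>\<^sub>M d' c)" by (elim exE conjE)
  then show thesis by (intro that[of h]) simp_all
 qed
 have cK: "coord B v c \<in> carrier K" if "v \<in> carrier M" "c \<in> B" for v c using coord_closed[OF Bb(2,1) that] .
 have bF: "b v \<in> F" if v: "v \<in> carrier M" for v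
  unfolding b(2) using subspaceD(5)[OF F_sub cK[OF v] dF] by (intro subspace_finsum[OF F_sub]) blast
 have bD: "b v = (\<Oplus>\<^bsub>M\<^esub>c\<in>?D. coord B v c \<odot>\<^sub>M l c)" if v: "v \<in> carrier M" for v
  unfolding b(2)
 proof (rule M.add.finprod_mono_neutral_cong_right[OF Bb(2)])
  show "?D \<subseteq> B" using DB by blast
  show "coord B v c \<odot>\<^sub>M d' c = \<zero>\<^sub>M" if "c \<in> B - ?D" for c
   using that cK[OF v] by (simp add: d'_def)
  show "coord B v c \<odot>\<^sub>M d' c = coord B v c \<odot>\<^sub>M l c" if "c \<in> ?D" for c
   using that by (simp add: d'_def)
  show "(\<lambda>c. coord B v c \<odot>\<^sub>M d' c) \<in> B \<rightarrow> carrier M" using cK[OF v] dM by auto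
 qed
 \<comment> \<open>Only coefficients at \<open>Q\<close>-fixed basis elements enter
   \<open>b\<close>, and the action of \<open>Q\<close> does not change these.\<close>
 have bQ: "b (\<rho> g v) = b v" if g: "g \<in> Q" and v: "v \<in> carrier M" for g v
 proof -
  have gG: "g \<in> carrier G" using g QG by blast
  have "coord B (\<rho> g v) c = coord B v c" if c: "c \<in> ?D" for c
   using coord_act[OF Qsub B g v DB[OF c]] c g by (simp add: fixed_set_def)
  then show ?thesis unfolding bD[OF v] bD[OF act_closed[OF gG v]]
   using cK[OF v DB] F_carrier[OF l(1)] by (intro M.finsum_cong') auto
 qed
 have prb: "pr (b v) = \<beta> (pr v)" if v: "v \<in> F" for v
 proof -
  have vM: "v \<in> carrier M" using F_carrier[OF v] .
  have fD: "finite ?D" using Bb(2) by (simp add: fixed_set_def)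
  note Yb = Y_basis[OF B]
  have \<beta>c: "\<beta> (pr c) \<in> carrier Y" if "c \<in> ?D" for c using Y.homD(1)[OF \<beta> pr_closed[OF DF[OF that]]] .
  have "pr (b v) = (\<Oplus>\<^bsub>Y\<^esub>c\<in>?D. pr (coord B v c \<odot>\<^sub>M l c))"
   unfolding bD[OF vM] using subspaceD(5)[OF F_sub cK[OF vM DB] l(1)] by (intro pr_finsum) blast
  also have "... = (\<Oplus>\<^bsub>Y\<^esub>c\<in>?D. coord B v c \<odot>\<^sub>Y \<beta> (pr c))"
   using pr_smult[OF cK[OF vM DB] l(1)] l(2) \<beta>c cK[OF vM DB] by (intro Y.M.finsum_cong') auto
  also have "... = (\<Oplus>\<^bsub>Y\<^esub>c\<in>?D. Y.coord (pr ` ?D) (pr v) (pr c) \<odot>\<^sub>Y \<beta> (pr c))"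
   using Yb(3)[OF v] \<beta>c cK[OF vM DB] by (intro Y.M.finsum_cong') auto
  also have "... = (\<Oplus>\<^bsub>Y\<^esub>y\<in>pr ` ?D. Y.coord (pr ` ?D) (pr v) y \<odot>\<^sub>Y \<beta> y)"
   using Yb(3)[OF v] \<beta>c cK[OF vM DB] by (intro Y.M.finsum_reindex[symmetric] Yb(2)) auto
  also have "... = \<beta> (pr v)"
   using fD by (intro Y.hom_expand[OF _ Yb(1) Y_vs \<beta> pr_closed[OF v], symmetric]) simp
  finally show ?thesis .
 qed
 have G1: "subgroup (carrier G) G" by (rule G.subgroup_self)
 define H where "H v g = \<rho> g (b (\<rho> (iG g) v))" for v g
 have HM: "H v g \<in> carrier M" if "g \<in> carrier G" "v \<in> carrier M" for v g
  unfolding H_def using that act_closed homD(1)[OF b(1)] by simp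
 have Hq: "H v (g \<star> q) = H v g" if g: "g \<in> carrier G" and q: "q \<in> Q" and v: "v \<in> carrier M" for v g q
 proof -
  have qG: "q \<in> carrier G" "iG q \<in> Q" using q QG subgroup.m_inv_closed[OF Qsub q] by auto
  let ?w = "\<rho> (iG g) v"
  have w: "?w \<in> carrier M" using act_closed g v by simp
  have "b (\<rho> (iG (g \<star> q)) v) = b (\<rho> (iG q) ?w)"
   using g qG v by (simp add: G.inv_mult_group act_mult)
  also have "... = b ?w" using bQ[OF qG(2) w] .
  finally have 1: "b (\<rho> (iG (g \<star> q)) v) = b ?w" .
  have "\<rho> (g \<star> q) (b ?w) = \<rho> g (\<rho> q (b ?w))" using act_mult[OF g qG(1) F_carrier[OF bF[OF w]]] .
  also have "\<rho> q (b ?w) = b ?w" using bF[OF w] q by (simp add: fixed_points_def)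
  finally show ?thesis unfolding H_def 1 .
 qed
 have Hl: "H (\<rho> h v) (h \<star> g) = \<rho> h (H v g)" if g: "g \<in> carrier G" and h: "h \<in> carrier G" and v: "v \<in> carrier M" for v g h
 proof -
  have "\<rho> (iG (h \<star> g)) (\<rho> h v) = \<rho> (iG g) v"
   using g h v act_mult act_inv(1) act_closed by (simp add: G.inv_mult_group)
  then show ?thesis unfolding H_def using g h v act_mult act_closed homD(1)[OF b(1)] by simp
 qed
 \<comment> \<open>The trace of \<open>b\<close> from \<open>Q\<close> to \<open>G\<close>. It is
   independent of representatives by \<open>Hq\<close>, as \<open>b\<close> is
   \<open>Q\<close>-invariant and has \<open>Q\<close>-fixed values.\<close>
 define x where "x v = coset_sum M G (carrier G) Q (H v)" for v
 let ?Z = "cosets G (carrier G) Q" and ?r = "\<lambda>C. SOME x. x \<in> C"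
 have rep: "?r C \<in> carrier G" if "C \<in> ?Z" for C using G.cosets_rep(2)[OF Qsub G1 QG that] .
 have repH: "H v (?r C) = H v g" if "C \<in> ?Z" "g \<in> C" "v \<in> carrier M" for C g v
  using G.coset_sum_rep[OF Qsub G1 QG that(1,2), of "H v"] Hq that(3) by blast
 have xA: "x \<in> endos (carrier G)"
 proof (rule endosI)
  have "(\<lambda>v. H v (?r C)) \<in> module_hom K M M" if C: "C \<in> ?Z" for C
   unfolding H_def
   by (rule homI) (use rep[OF C] homD[OF act_hom[of "?r C"]] homD[OF act_hom[of "iG (?r C)"]] homD[OF b(1)] in auto)
  then show "x \<in> module_hom K M M" unfolding x_def coset_sum_def by (rule hom_finsum_fun[OF vs_self])
  fix h v assume h: "h \<in> carrier G" and v: "v \<in> carrier M"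
  have hv: "\<rho> h v \<in> carrier M" using act_closed[OF h v] .
  have "x (\<rho> h v) = coset_sum M G (carrier G) Q (\<lambda>g. H (\<rho> h v) (h \<star> g))"
   unfolding x_def
   by (rule G.coset_sum_left[OF Qsub G1 QG h M.abelian_monoid_axioms, symmetric]) (use HM Hq hv in auto)
  also have "... = (\<Oplus>\<^bsub>M\<^esub>C\<in>?Z. \<rho> h (H v (?r C)))"
   unfolding coset_sum_def using rep Hl[OF _ h v] HM v act_closed[OF h] by (intro M.finsum_cong') auto
  also have "... = \<rho> h (x v)"
   unfolding x_def coset_sum_def using rep HM v by (intro hom_finsum[OF vs_self act_hom[OF h], symmetric]) auto
  finally show "x (\<rho> h v) = \<rho> h (x v)" .
 qed
 have xF: "x v \<in> F" if v: "v \<in> F" for v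
 proof -
  have vM: "v \<in> carrier M" using F_carrier[OF v] .
  have "\<rho> g (x v) = x v" if g: "g \<in> Q" for g
  proof -
   have gG: "g \<in> carrier G" using g QG by blast
   have "\<rho> g (x v) = x (\<rho> g v)" using endosD(7)[OF xA gG vM] by simp
   also have "\<rho> g v = v" using v g by (simp add: fixed_points_def)
   finally show ?thesis .
  qed
  then show ?thesis using endosD(2)[OF xA vM] by (simp add: fixed_points_def)
 qed
 let ?Z1 = "cosets G N Q"
 have Z1: "?Z1 \<subseteq> ?Z" using subgroup.subset[OF Nsub] by (auto simp: cosets_def)
 have finZ: "finite ?Z" using finite_group by (simp add: cosets_def)
 have rep1: "?r C \<in> N" if "C \<in> ?Z1" for C using G.cosets_rep(2)[OF Qsub Nsub QN that] .
 have prx: "pr (x v) = u (pr v)" if v: "v \<in> F" for v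
 proof -
  have vM: "v \<in> carrier M" using F_carrier[OF v] .
  have H1: "H v (?r C) \<in> F" if "C \<in> ?Z1" for C
   unfolding H_def using rep1[OF that] F_act bF F_carrier subgroup.m_inv_closed[OF Nsub] v by simp
  let ?a = "\<Oplus>\<^bsub>M\<^esub>C\<in>?Z1. H v (?r C)" and ?t = "\<Oplus>\<^bsub>M\<^esub>C\<in>?Z - ?Z1. H v (?r C)"
  have aF: "?a \<in> F" using H1 by (intro subspace_finsum[OF F_sub]) blast
  have tM: "?t \<in> carrier M" using HM[OF rep vM] by (intro M.finsum_closed) blast
  have "x v = (\<Oplus>\<^bsub>M\<^esub>C\<in>?Z1 \<union> (?Z - ?Z1). H v (?r C))"
   unfolding x_def coset_sum_def using Z1 by (simp add: Un_absorb1)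
  also have "... = ?a \<oplus>\<^sub>M ?t"
   using finZ Z1 HM[OF rep vM] by (intro M.finsum_Un_disjoint) (auto intro: finite_subset)
  finally have xv: "x v = ?a \<oplus>\<^sub>M ?t" .
  have tF: "?t \<in> F"
  proof -
   have "?t = x v \<ominus>\<^sub>M ?a"
    using xv tM F_carrier[OF aF] F_carrier[OF xF[OF v]] M.a_comm[of ?a ?t] diff_eq_iff[of "x v" ?a ?t] by metis
   then show ?thesis using subspaceD(7)[OF F_sub xF[OF v] aF] by simp
  qed
  have tT: "?t \<in> T"
   unfolding T_eq[OF B] negl_def
  proof (intro CollectI conjI ballI tF)
   fix c assume c: "c \<in> ?D"
   have cB: "c \<in> B" using DB[OF c] .
   note hc = coord_hom[OF Bb(2,1) cB]
   let ?I = "?Z - ?Z1"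
   have bij: "h <#\<^sub>G C \<in> ?Z \<and> (h <#\<^sub>G C \<in> ?Z1 \<longleftrightarrow> C \<in> ?Z1)" if h: "h \<in> Q" and C: "C \<in> ?Z" for h C
   proof -
    have hG: "h \<in> carrier G" "h \<in> N" using h QG QN by auto
    have 1: "h <#\<^sub>G C \<in> ?Z" using bij_betwE[OF G.cosets_left_bij[OF Qsub G1 QG hG(1)]] C by blast
    have 2: "iG h <#\<^sub>G (h <#\<^sub>G C) = C"
    proof -
     have "C \<subseteq> carrier G" using G.cosets_rep(4)[OF Qsub G1 QG C] by blast
     then show ?thesis using G.lcos_m_assoc[of C "iG h" h] hG G.lcos_mult_one[of C] by simp
    qed
    have "h <#\<^sub>G C \<in> ?Z1" if "C \<in> ?Z1"
     using bij_betwE[OF G.cosets_left_bij[OF Qsub Nsub QN hG(2)]] that by blast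
    moreover have "C \<in> ?Z1" if "h <#\<^sub>G C \<in> ?Z1"
     using bij_betwE[OF G.cosets_left_bij[OF Qsub Nsub QN subgroup.m_inv_closed[OF Nsub hG(2)]]] that 2 by metis
    ultimately show ?thesis using 1 by blast
   qed
   have acts: "acts_on G Q ?I (\<lambda>h C. h <#\<^sub>G C)"
    unfolding acts_on_def
   proof (intro conjI ballI)
    fix h C assume "h \<in> Q" "C \<in> ?I" then show "h <#\<^sub>G C \<in> ?I" using bij by blast
   next
    fix C assume C: "C \<in> ?I"
    then have "C \<subseteq> carrier G" using G.cosets_rep(4)[OF Qsub G1 QG] by blast
    then show "\<one>\<^sub>G <#\<^sub>G C = C" by (rule G.lcos_mult_one)
   next
    fix h k C assume hk: "h \<in> Q" "k \<in> Q" "C \<in> ?I"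
    then have "C \<subseteq> carrier G" using G.cosets_rep(4)[OF Qsub G1 QG] by blast
    then show "h \<star> k <#\<^sub>G C = h <#\<^sub>G (k <#\<^sub>G C)"
     using G.lcos_m_assoc[of C h k] hk QG by auto
   qed
   \<comment> \<open>Left translation by \<open>Q\<close> fixes \<open>gQ\<close> exactly if the
     inverse of \<open>g\<close> normalises \<open>Q\<close>, which excludes the cosets outside
     \<open>N\<close>.\<close>
   have nofix: "fixed_set Q ?I (\<lambda>h C. h <#\<^sub>G C) = {}"
   proof (rule ccontr)
    assume "\<not> ?thesis"
    then obtain C where C: "C \<in> ?Z" "C \<notin> ?Z1" "!!h. h \<in> Q ==> h <#\<^sub>G C = C" by (auto simp: fixed_set_def)
    let ?g = "?r C"
    have g: "?g \<in> carrier G" "C = ?g <#\<^sub>G Q" "?g \<in> C" using G.cosets_rep(1-3)[OF Qsub G1 QG C(1)] by blast+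
    have "iG ?g \<star> h \<star> ?g \<in> Q" if h: "h \<in> Q" for h
    proof -
     have hG: "h \<in> carrier G" using h QG by blast
     have "h \<star> ?g \<in> h <#\<^sub>G C" using g(3) unfolding l_coset_def by blast
     then have "h \<star> ?g \<in> ?g <#\<^sub>G Q" using C(3)[OF h] g(2) by simp
     then obtain q where q: "q \<in> Q" "h \<star> ?g = ?g \<star> q" unfolding l_coset_def by blast
     have "iG ?g \<star> h \<star> ?g = iG ?g \<star> (?g \<star> q)"
      using q(2) hG g(1) by (simp add: G.m_assoc)
     also have "... = q" using g(1) q(1) QG by (simp add: G.m_assoc[symmetric] subset_iff)
     finally show ?thesis using q(1) by simp
    qed
    then have "iG ?g \<in> N" using G.normalizer_iff[OF QG finQ, of "iG ?g"] g(1) by simp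
    then have "?g \<in> N" using subgroup.m_inv_closed[OF Nsub] g(1) by fastforce
    then have "C \<in> ?Z1" using g(2) unfolding cosets_def by blast
    then show False using C(2) by simp
   qed
   have "coord B ?t c = (\<Oplus>C\<in>?I. coord B (H v (?r C)) c)"
   proof -
    have "(\<lambda>C. H v (?r C)) \<in> ?I \<rightarrow> carrier M" using HM[OF rep vM] by blast
    from hom_finsum[OF trivial_vectorspace hc this] show ?thesis by simp
   qed
   also have "... = \<zero>"
   proof (rule finsum_no_fixed[OF G.is_group Qsub Qcard acts _ nofix])
    show "finite ?I" using finZ by blast
    show "(\<lambda>C. coord B (H v (?r C)) c) \<in> ?I \<rightarrow> carrier K" using cK[OF HM[OF rep vM] cB] by blast
    fix h C assume h: "h \<in> Q" and C: "C \<in> ?I"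
    have hG: "h \<in> carrier G" using h QG by blast
    have CZ: "C \<in> ?Z" using C by blast
    have hC: "h <#\<^sub>G C \<in> ?Z" using bij[OF h CZ] by blast
    have "h \<star> ?r C \<in> h <#\<^sub>G C" using G.cosets_rep(1)[OF Qsub G1 QG CZ] unfolding l_coset_def by blast
    then have "H v (?r (h <#\<^sub>G C)) = H v (h \<star> ?r C)" by (rule repH[OF hC _ vM])
    also have "... = H (\<rho> h v) (h \<star> ?r C)" using v h by (simp add: fixed_points_def)
    also have "... = \<rho> h (H v (?r C))" by (rule Hl[OF rep[OF CZ] hG vM])
    finally have "H v (?r (h <#\<^sub>G C)) = \<rho> h (H v (?r C))" .
    moreover have "coord B (\<rho> h (H v (?r C))) (\<rho> h c) = coord B (H v (?r C)) c"
     by (rule coord_act[OF Qsub B h HM[OF rep[OF CZ] vM] cB])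
    moreover have "\<rho> h c = c" using c h by (simp add: fixed_set_def)
    ultimately show "coord B (H v (?r (h <#\<^sub>G C))) c = coord B (H v (?r C)) c" by simp
   qed
   finally show "coord B ?t c = \<zero>" .
  qed
  have "pr (x v) = pr ?a \<oplus>\<^sub>Y pr ?t" unfolding xv by (rule pr_add[OF aF tF])
  also have "... = pr ?a" using pr_zero_iff[OF tF] tT pr_closed[OF aF] by simp
  also have "... = (\<Oplus>\<^bsub>Y\<^esub>C\<in>?Z1. pr (H v (?r C)))" using H1 by (intro pr_finsum) blast
  also have "... = u (pr v)"
   unfolding u[OF pr_closed[OF v]] coset_sum_def
  proof (rule Y.M.finsum_cong'[OF refl])
   have eq: "pr (H v g) = brauer_act \<rho> g (\<beta> (brauer_act \<rho> (iG g) (pr v)))" if g: "g \<in> N" for g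
   proof -
    have g': "iG g \<in> N" using subgroup.m_inv_closed[OF Nsub g] .
    have w: "\<rho> (iG g) v \<in> F" using F_act[OF g' v] .
    show ?thesis unfolding H_def act_pr[OF g' v] prb[OF w, symmetric]
     by (rule act_pr[OF g bF[OF F_carrier[OF w]], symmetric])
   qed
   show "pr (H v (?r C)) = brauer_act \<rho> (?r C) (\<beta> (brauer_act \<rho> (iG (?r C)) (pr v)))" if "C \<in> ?Z1" for C
    using eq[OF rep1[OF that]] .
   then show "(\<lambda>C. brauer_act \<rho> (?r C) (\<beta> (brauer_act \<rho> (iG (?r C)) (pr v)))) \<in> ?Z1 \<rightarrow> carrier Y"
    using pr_closed[OF H1] by simp
  qed
  finally show ?thesis .
 qed
 \<comment> \<open>\<open>m0\<close> is fixed by \<open>Q\<close>, so \<open>f (x m0)\<close> can be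
   read off in \<open>Y\<close>, where it is a value of \<open>fY\<close> after
   \<open>u\<close>.\<close>
 have "f (x m0) = \<zero>"
  using fY_pr[OF xF[OF m0F]] prx[OF m0F] u0[OF pr_closed[OF m0F]] by simp
 then obtain j where j: "\<forall>v\<in>carrier M. (x ^^ j) v = \<zero>\<^sub>M" using nilpotent_if_f_zero[OF xA] by blast
 have it: "(x ^^ i) v \<in> F \<and> (u ^^ i) (pr v) = pr ((x ^^ i) v)" if v: "v \<in> F" for i v
  by (induction i) (use v xF prx in auto)
 have "(u ^^ j) y = \<zero>\<^sub>Y" if y: "y \<in> carrier Y" for y
 proof -
  obtain v where v: "v \<in> F" "y = pr v" using pr_surj[OF y] by blast
  then have "(u ^^ j) y = pr \<zero>\<^sub>M" using it[OF v(1), of j] j F_carrier by simp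
  then show ?thesis using pr_zero_iff[OF subspaceD(3)[OF F_sub]] subspaceD(3)[OF T_sub] by simp
 qed
 then show ?thesis by blast
qed

end

section \<open>Which p-subgroups have a nonzero Brauer quotient\<close>

context scott_rep begin

lemma fixed_coset_iff:
 assumes R: "R \<subseteq> carrier G" and g: "g \<in> carrier G"
 shows "(\<forall>h\<in>R. h <#\<^sub>G (g <#\<^sub>G P) = g <#\<^sub>G P) \<longleftrightarrow> conj_set (iG g) R \<subseteq> P"
proof -
 have "h <#\<^sub>G (g <#\<^sub>G P) = g <#\<^sub>G P \<longleftrightarrow> iG g \<star> h \<star> iG (iG g) \<in> P" if h: "h \<in> R" for h
 proof -
  have hG: "h \<in> carrier G" using h R by blast
  have "h <#\<^sub>G (g <#\<^sub>G P) = (h \<star> g) <#\<^sub>G P" by (rule G.lcos_m_assoc[OF PG hG g])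
  then have "h <#\<^sub>G (g <#\<^sub>G P) = g <#\<^sub>G P \<longleftrightarrow> g <#\<^sub>G P = (h \<star> g) <#\<^sub>G P" by auto
  also have "... \<longleftrightarrow> iG g \<star> (h \<star> g) \<in> P" using hG g by (intro G.l_coset_eq_iff[OF Psub]) auto
  finally show ?thesis using hG g by (simp add: G.m_assoc)
 qed
 then show ?thesis by (auto simp: conj_set_def)
qed

lemma acts_PX:
 assumes "subgroup R G" shows "acts_on G R PX (\<lambda>h C. h <#\<^sub>G C)"
 unfolding acts_on_def
proof (intro conjI ballI)
 have RG: "h \<in> carrier G" if "h \<in> R" for h using subgroup.mem_carrier[OF assms that] .
 have CG: "C \<subseteq> carrier G" if "C \<in> PX" for C
  using G.cosets_rep(4)[OF Psub G.subgroup_self PG that] by blast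
 show "h <#\<^sub>G C \<in> PX" if "h \<in> R" "C \<in> PX" for h C
  using bij_betwE[OF G.cosets_left_bij[OF Psub G.subgroup_self PG RG[OF that(1)]]] that(2) by blast
 show "\<one>\<^sub>G <#\<^sub>G C = C" if "C \<in> PX" for C by (rule G.lcos_mult_one[OF CG[OF that]])
 show "h \<star> k <#\<^sub>G C = h <#\<^sub>G (k <#\<^sub>G C)" if "h \<in> R" "k \<in> R" "C \<in> PX" for h k C
  by (rule G.lcos_m_assoc[OF CG[OF that(3)] RG[OF that(1)] RG[OF that(2)], symmetric])
qed

lemma s_fixed:
 assumes "h \<in> carrier G" "\<rho> h v = v" "C \<in> PX" "v \<in> carrier M" shows "s (h <#\<^sub>G C) v = s C v"
 using s_act[OF assms(1,3,4)] assms(2) by simp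

text \<open>\<open>R\<close> fixes no coset of \<open>P\<close>. So in the expansion of an
  \<open>R\<close>-fixed vector along the cosets nothing is left at an \<open>R\<close>-fixed basis
  element, that is, \<open>M(R) = 0\<close>.\<close>

lemma fixed_points_eq_trace_sum:
 assumes R: "subgroup R G" "card R = p ^ k" and no: "!!g. g \<in> carrier G ==> \<not> conj_set g R \<subseteq> P"
 shows "fixM R = trM R"
proof -
 obtain B where B: "perm_basis R B" using has_perm[OF R] by blast
 have RG: "h \<in> carrier G" if "h \<in> R" for h using subgroup.mem_carrier[OF R(1) that] .
 have empty: "fixed_set R PX (\<lambda>h C. h <#\<^sub>G C) = {}"
 proof (rule ccontr)
  assume "\<not> ?thesis"
  then obtain C where C: "C \<in> PX" "!!h. h \<in> R ==> h <#\<^sub>G C = C" by (auto simp: fixed_set_def)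
  obtain g where g: "g \<in> carrier G" "C = g <#\<^sub>G P" using X_cases[OF C(1)] by blast
  then have "conj_set (iG g) R \<subseteq> P" using fixed_coset_iff[OF subgroup.subset[OF R(1)] g(1)] C(2) by blast
  then show False using no g(1) by simp
 qed
 have "v \<in> negl R B" if v: "v \<in> fixM R" for v
  unfolding negl_def
 proof (intro CollectI conjI ballI v)
  fix b assume b: "b \<in> fixed_set R B \<rho>"
  have vM: "v \<in> carrier M" using v by (simp add: fixed_points_def)
  have "coord B v b = coord B (\<Oplus>\<^bsub>M\<^esub>C\<in>PX. s C v \<odot>\<^sub>M d C) b" using expand[OF vM] by simp
  also have "... = (\<Oplus>C\<in>fixed_set R PX (\<lambda>h C. h <#\<^sub>G C). s C v \<otimes> coord B (d C) b)"
  proof (rule coord_fixed_sum[OF R B finX acts_PX[OF R(1)] s_closed[OF _ vM] _ d_closed _ b])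
   show "s (g <#\<^sub>G C) v = s C v" if "g \<in> R" "C \<in> PX" for g C
    using s_fixed[OF RG[OF that(1)] _ that(2) vM] v that(1) by (simp add: fixed_points_def)
   show "d (g <#\<^sub>G C) = \<rho> g (d C)" if "g \<in> R" "C \<in> PX" for g C by (rule d_act[OF RG[OF that(1)] that(2)])
  qed
  finally show "coord B v b = \<zero>" unfolding empty by simp
 qed
 then show ?thesis unfolding trace_sum_eq[OF R B] by (auto simp: negl_def)
qed

text \<open>The witness is the image in \<open>M\<close> of a coset of \<open>P\<close> fixed by
  \<open>R\<close>: a translate of \<open>m0\<close>, on which \<open>f\<close> has the same nonzero
  value. For a p-group \<open>R\<close> this shows that \<open>M(R)\<close> is not 0, as
  \<open>f\<close> kills traces.\<close>

lemma f_nonzero_fixed: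
 assumes R: "subgroup R G" and g: "g \<in> carrier G" "conj_set g R \<subseteq> P"
 obtains v where "v \<in> fixM R" "f v ~= \<zero>"
proof
 let ?g = "iG g"
 have gG: "?g \<in> carrier G" using g by simp
 have RG: "h \<in> carrier G" if "h \<in> R" for h using subgroup.mem_carrier[OF R that] .
 have fixc: "h <#\<^sub>G (?g <#\<^sub>G P) = ?g <#\<^sub>G P" if "h \<in> R" for h
  using fixed_coset_iff[OF subgroup.subset[OF R] gG] g that by simp
 show "d (?g <#\<^sub>G P) \<in> fixM R"
  unfolding fixed_points_def
  using d_closed[OF coset_in_X[OF gG]] d_act[OF RG coset_in_X[OF gG]] fixc by simp
 show "f (d (?g <#\<^sub>G P)) ~= \<zero>"
  unfolding d_coset[OF gG] f_act[OF gG m0_closed] by (rule f_m0)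
qed

end

section \<open>Consequences of the fusion hypotheses: uniqueness of the functional\<close>

text \<open>The group-theoretic content of the two fusion hypotheses. \<open>control\<close> comes
  from the equality of the fusion systems of \<open>G\<close> and \<open>N\<^sub>G(P)\<close>
  (\<open>fusion_control\<close>), \<open>index\<close> from the existence of fully automised
  conjugates (\<open>fusion_index\<close>). The set \<open>H\<close> is
  \<open>N\<^sub>P(Q)C\<^sub>G(Q)\<close>.\<close>

locale scott_control = scott_rep K G M \<rho> p P d s f
 for K :: "('k, 'y) ring_scheme" (structure) and G :: "('g, 'z) monoid_scheme"
  and M :: "('k, 'm, 'x) module_scheme" and \<rho> :: "'g \<Rightarrow> 'm \<Rightarrow> 'm" and p :: nat and P d s f +
 assumes control: "!!Q g. subgroup Q G ==> Q \<subseteq> P ==> g \<in> carrier G ==> conj_set g Q \<subseteq> P ==>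
   \<exists>n\<in>normalizer G P. \<exists>c\<in>centralizer G Q. g = n \<star> c"
  and index: "!!Q. subgroup Q G ==> Q \<subseteq> P ==> \<exists>H m. subgroup H G \<and>
   H = {u \<star> c |u c. u \<in> P \<inter> normalizer G Q \<and> c \<in> centralizer G Q} \<and>
   card (normalizer G Q) = card H * m \<and> coprime m p"

lemma (in group) centralizer_subgroup:
 assumes "Q \<subseteq> carrier G" shows "subgroup (centralizer G Q) G"
proof (rule subgroupI)
 have m: "x \<in> carrier G" "u \<in> Q ==> x \<otimes> u = u \<otimes> x" if "x \<in> centralizer G Q" for x u
  using that by (auto simp: centralizer_def)
 have uG: "u \<in> carrier G" if "u \<in> Q" for u using that assms by blast
 show "centralizer G Q \<subseteq> carrier G" by (auto simp: centralizer_def)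
 have "\<one> \<in> centralizer G Q" using uG by (simp add: centralizer_def)
 then show "centralizer G Q ~= {}" by blast
 show "inv a \<in> centralizer G Q" if a: "a \<in> centralizer G Q" for a
 proof -
  have "inv a \<otimes> u = u \<otimes> inv a" if u: "u \<in> Q" for u
  proof -
   have "inv a \<otimes> u = inv a \<otimes> (u \<otimes> a) \<otimes> inv a" using m(1)[OF a] uG[OF u] by (simp add: m_assoc)
   also have "... = inv a \<otimes> (a \<otimes> u) \<otimes> inv a" using m(2)[OF a u] by simp
   also have "... = u \<otimes> inv a" using m(1)[OF a] uG[OF u] by (simp add: m_assoc[symmetric])
   finally show ?thesis .
  qed
  then show ?thesis using m(1)[OF a] by (simp add: centralizer_def)
 qed
 show "a \<otimes> b \<in> centralizer G Q" if a: "a \<in> centralizer G Q" and b: "b \<in> centralizer G Q" for a b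
 proof -
  have "a \<otimes> b \<otimes> u = u \<otimes> (a \<otimes> b)" if u: "u \<in> Q" for u
  proof -
   have "a \<otimes> b \<otimes> u = a \<otimes> (u \<otimes> b)" using m(1)[OF a] m(1)[OF b] m(2)[OF b u] uG[OF u] by (simp add: m_assoc)
   also have "... = (a \<otimes> u) \<otimes> b" using m(1)[OF a] m(1)[OF b] uG[OF u] by (simp add: m_assoc)
   also have "... = u \<otimes> (a \<otimes> b)" using m(1)[OF a] m(1)[OF b] m(2)[OF a u] uG[OF u] by (simp add: m_assoc)
   finally show ?thesis .
  qed
  then show ?thesis using m(1)[OF a] m(1)[OF b] by (simp add: centralizer_def)
 qed
qed

lemma (in group) centralizer_antimono: "Q \<subseteq> R ==> centralizer G R \<subseteq> centralizer G Q"
 by (auto simp: centralizer_def)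

lemma (in group) centralizer_conj:
 assumes "Q \<subseteq> carrier G" "finite Q" "g \<in> normalizer G Q" "c \<in> centralizer G Q"
 shows "g \<otimes> c \<otimes> inv g \<in> centralizer G Q"
proof -
 have g: "g \<in> carrier G" using assms normalizer_iff by blast
 have cG: "c \<in> carrier G" and c: "!!u. u \<in> Q ==> c \<otimes> u = u \<otimes> c" using assms(4) by (auto simp: centralizer_def)
 have g': "inv g \<in> normalizer G Q"
  using subgroup.m_inv_closed[OF normalizer_imp_subgroup[OF assms(1)] assms(3)] .
 have "g \<otimes> c \<otimes> inv g \<otimes> u = u \<otimes> (g \<otimes> c \<otimes> inv g)" if u: "u \<in> Q" for u
 proof -
  have uG: "u \<in> carrier G" using u assms(1) by blast
  have "inv g \<otimes> u \<otimes> inv (inv g) \<in> Q" using g' u normalizer_iff[OF assms(1,2)] by blast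
  then have cc: "c \<otimes> (inv g \<otimes> u \<otimes> g) = (inv g \<otimes> u \<otimes> g) \<otimes> c" using c g by simp
  have "g \<otimes> c \<otimes> inv g \<otimes> u = g \<otimes> (c \<otimes> (inv g \<otimes> u \<otimes> g)) \<otimes> inv g"
   using g cG uG by (simp add: m_assoc)
  also have "... = g \<otimes> ((inv g \<otimes> u \<otimes> g) \<otimes> c) \<otimes> inv g" unfolding cc ..
  also have "... = (g \<otimes> inv g) \<otimes> u \<otimes> (g \<otimes> c \<otimes> inv g)"
   using g cG uG by (simp only: m_assoc m_closed inv_closed)
  also have "... = u \<otimes> (g \<otimes> c \<otimes> inv g)" using g cG uG by simp
  finally show ?thesis .
 qed
 then show ?thesis using g cG by (simp add: centralizer_def)
qed

locale scott_control_brauer = scott_control K G M \<rho> p P d s f + scott_brauer K G M \<rho> p P d s f Q n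
 for K :: "('k, 'y) ring_scheme" (structure) and G :: "('g, 'z) monoid_scheme"
  and M :: "('k, 'm, 'x) module_scheme" and \<rho> :: "'g \<Rightarrow> 'm \<Rightarrow> 'm" and p :: nat
  and P d s f Q n
begin

abbreviation "CQ \<equiv> centralizer G Q"

lemma CN: "CQ \<subseteq> N"
proof
 fix c assume c: "c \<in> CQ"
 then have cG: "c \<in> carrier G" by (simp add: centralizer_def)
 have "c \<star> u \<star> iG c = u" if u: "u \<in> Q" for u
 proof -
  have "u \<in> carrier G" using u QG by blast
  moreover have "c \<star> u = u \<star> c" using c u by (simp add: centralizer_def)
  ultimately show ?thesis using cG by (simp add: G.m_assoc)
 qed
 then show "c \<in> N" using G.normalizer_iff[OF QG finQ] cG by simp
qed

text \<open>The multiplicity of the trivial module in the head of \<open>M(Q)\<close>, restricted to \<open>C\<^sub>G(Q)\<close>, is one: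
 \<open>x\<close> averages over \<open>N\<^sub>G(P)/PC\<^sub>G(P)\<close> and is invertible since \<open>M\<close> is indecomposable.\<close>

lemma functional_unique:
 assumes V: "V \<in> module_hom K Y (trivial_module K)"
  "!!c y. c \<in> CQ ==> y \<in> carrier Y ==> V (brauer_act \<rho> c y) = V y"
 shows "\<exists>a\<in>carrier K. \<forall>y\<in>carrier Y. V y = a \<otimes> fY y"
proof -
 let ?NP = "normalizer G P" and ?CP = "centralizer G P"
 have finP: "finite P" using finite_subset[OF PG finite_group] .
 have NPs: "subgroup ?NP G" by (rule G.normalizer_imp_subgroup[OF PG])
 have NPG: "g \<in> carrier G" if "g \<in> ?NP" for g using subgroup.mem_carrier[OF NPs that] .
 have CPs: "subgroup ?CP G" by (rule G.centralizer_subgroup[OF PG])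
 have CPC: "?CP \<subseteq> CQ" by (rule G.centralizer_antimono[OF QP])
 have PNP: "P \<subseteq> ?NP"
 proof
  fix x assume x: "x \<in> P"
  have "x \<star> u \<star> iG x \<in> P" if "u \<in> P" for u
   using x that subgroup.m_closed[OF Psub] subgroup.m_inv_closed[OF Psub] by blast
  then show "x \<in> ?NP" using x PG G.normalizer_iff[OF PG finP] by blast
 qed
 \<comment> \<open>For \<open>Q = P\<close> this is \<open>H = PC\<^sub>G(P)\<close>.\<close>
 obtain H m where Hs: "subgroup H G" and H: "H = {u \<star> c |u c. u \<in> P \<inter> ?NP \<and> c \<in> ?CP}"
  and m: "card ?NP = card H * m" "coprime m p" using index[OF Psub] by blast
 have HNP: "H \<subseteq> ?NP"
 proof
  fix h assume "h \<in> H"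
  then obtain u c where uc: "h = u \<star> c" "u \<in> ?NP" "c \<in> ?CP" unfolding H by blast
  have "c \<in> ?NP"
  proof -
   have cG: "c \<in> carrier G" using subgroup.mem_carrier[OF CPs uc(3)] .
   have "c \<star> v \<star> iG c = v" if v: "v \<in> P" for v
   proof -
    have "v \<in> carrier G" using v PG by blast
    moreover have "c \<star> v = v \<star> c" using uc(3) v by (simp add: centralizer_def)
    ultimately show ?thesis using cG by (simp add: G.m_assoc)
   qed
   then show ?thesis using G.normalizer_iff[OF PG finP] cG by simp
  qed
  then show "h \<in> ?NP" using uc subgroup.m_closed[OF NPs] by simp
 qed
 have finNP: "finite ?NP" using finite_subset[OF subgroup.subset[OF NPs] finite_group] .
 have cardm: "card (cosets G ?NP H) = m"
 proof -
  have "card (cosets G ?NP H) * card H = m * card H" using G.card_cosets[OF Hs NPs HNP finNP] m(1) by (simp add: mult.commute)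
  moreover have "card H ~= 0" using subgroup.one_closed[OF Hs] finite_subset[OF HNP finNP] by auto
  ultimately show ?thesis by simp
 qed
 let ?r = "\<lambda>C. SOME x. x \<in> C"
 have rN: "?r C \<in> ?NP" if "C \<in> cosets G ?NP H" for C using G.cosets_rep(2)[OF Hs NPs HNP that] .
 have m0P: "\<rho> g m0 \<in> fixM P" if g: "g \<in> ?NP" for g
 proof -
  have gG: "g \<in> carrier G" using NPG[OF g] .
  have "\<rho> u (\<rho> g m0) = \<rho> g m0" if u: "u \<in> P" for u
  proof -
   have uG: "u \<in> carrier G" using u PG by blast
   have "iG g \<star> u \<star> iG (iG g) \<in> P"
    using subgroup.m_inv_closed[OF NPs g] u G.normalizer_iff[OF PG finP] by blast
   then have w: "iG g \<star> u \<star> g \<in> P" using gG by simp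
   have "\<rho> u (\<rho> g m0) = \<rho> (u \<star> g) m0" using act_mult[OF uG gG m0_closed] by simp
   also have "u \<star> g = g \<star> (iG g \<star> u \<star> g)" using uG gG by (simp add: G.m_assoc[symmetric])
   also have "\<rho> ... m0 = \<rho> g (\<rho> (iG g \<star> u \<star> g) m0)" using uG gG by (intro act_mult m0_closed) auto
   also have "... = \<rho> g m0" using m0_fixed[OF w] by simp
   finally show ?thesis .
  qed
  then show ?thesis using act_closed[OF gG m0_closed] by (simp add: fixed_points_def)
 qed
 have PF: "fixM P \<subseteq> F" using QP by (auto simp: fixed_points_def)
 have FPs: "subspace K (fixM P) M" by (rule fixed_points_subspace[OF PG])
 \<comment> \<open>The sum may depend on the chosen representatives, because
   \<open>C\<^sub>G(P)\<close> need not fix \<open>m0\<close>; but \<open>V\<close> will not notice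
   the difference.\<close>
 define y0 where "y0 = (\<Oplus>\<^bsub>M\<^esub>C\<in>cosets G ?NP H. \<rho> (?r C) m0)"
 have y0P: "y0 \<in> fixM P"
  unfolding y0_def using m0P[OF rN] by (intro subspace_finsum[OF FPs]) blast
 have y0M: "y0 \<in> carrier M" using y0P by (simp add: fixed_points_def)
 have y0f: "\<rho> u y0 = y0" if "u \<in> P" for u using y0P that by (simp add: fixed_points_def)
 have rM: "(\<lambda>C. \<rho> (?r C) m0) \<in> cosets G ?NP H \<rightarrow> carrier M" using m0P[OF rN] by (auto simp: fixed_points_def)
 have fm0: "f m0 \<in> carrier K" using f_closed[OF m0_closed] .
 have fy0: "f y0 = ([m] \<cdot> \<one>) \<otimes> f m0"
 proof -
  have "f y0 = (\<Oplus>C\<in>cosets G ?NP H. f (\<rho> (?r C) m0))"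
   unfolding y0_def using hom_finsum[OF trivial_vectorspace f_hom rM] by simp
  also have "... = (\<Oplus>C\<in>cosets G ?NP H. f m0)"
   using f_act[OF NPG[OF rN] m0_closed] fm0 by (intro R.finsum_cong') auto
  also have "... = [m] \<cdot> f m0" using R.add.finprod_const[OF fm0, of "cosets G ?NP H"] cardm by simp
  also have "... = [m] \<cdot> (\<one> \<otimes> f m0)" using fm0 by simp
  also have "... = ([m] \<cdot> \<one>) \<otimes> f m0" using fm0 by (subst R.add_pow_ldistr) auto
  finally show ?thesis .
 qed
 have mK: "[m] \<cdot> \<one> \<in> carrier K" by simp
 have m1: "[m] \<cdot> \<one> ~= \<zero>" by (rule nat_nonzero[OF m(2)])
 have fy0K: "f y0 \<in> carrier K" using f_closed[OF y0M] .
 have fy0n: "f y0 ~= \<zero>" unfolding fy0 using m1 f_m0 fm0 mK integral by blast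
 have VK: "V y \<in> carrier K" if "y \<in> carrier Y" for y using Y.homD(1)[OF V(1) that] by simp
 define w where "w g = V (pr (\<rho> g m0))" for g
 have m0F': "\<rho> g m0 \<in> F" if "g \<in> ?NP" for g using m0P[OF that] PF by blast
 \<comment> \<open>\<open>P\<close> fixes \<open>m0\<close>. An element of
   \<open>C\<^sub>G(P)\<close>, moved to the left past an element of \<open>N\<^sub>G(P)\<close>,
   remains in \<open>C\<^sub>G(P)\<close>, hence in \<open>CQ\<close>, under which \<open>V\<close>
   is invariant.\<close>
 have wH: "w (g \<star> h) = w g" if g: "g \<in> ?NP" and h: "h \<in> H" for g h
 proof -
  obtain u c where uc: "h = u \<star> c" "u \<in> P" "c \<in> ?CP" using h unfolding H by blast
  have gG: "g \<in> carrier G" "u \<in> carrier G" "c \<in> carrier G" using NPG[OF g] uc(2) PG subgroup.mem_carrier[OF CPs uc(3)] by auto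
  have gu: "g \<star> u \<in> ?NP" using g uc(2) PNP subgroup.m_closed[OF NPs] by blast
  let ?c = "(g \<star> u) \<star> c \<star> iG (g \<star> u)"
  have c': "?c \<in> CQ" using G.centralizer_conj[OF PG finP gu uc(3)] CPC by blast
  have c'G: "?c \<in> carrier G" using c' by (simp add: centralizer_def)
  have "g \<star> h = ?c \<star> (g \<star> u)" unfolding uc(1) using gG by (simp add: G.m_assoc)
  then have "\<rho> (g \<star> h) m0 = \<rho> ?c (\<rho> (g \<star> u) m0)" using act_mult[OF c'G _ m0_closed] gG by simp
  also have "\<rho> (g \<star> u) m0 = \<rho> g m0" using act_mult[OF gG(1,2) m0_closed] m0_fixed[OF uc(2)] by simp
  finally have "pr (\<rho> (g \<star> h) m0) = brauer_act \<rho> ?c (pr (\<rho> g m0))"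
   using act_pr[OF _ m0F'[OF g]] c' CN by auto
  then show ?thesis unfolding w_def using V(2)[OF c' pr_closed[OF m0F'[OF g]]] by simp
 qed
 define \<kappa> where "\<kappa> = coset_sum (trivial_module K) G ?NP H w"
 have wK: "w g \<in> carrier K" if "g \<in> ?NP" for g unfolding w_def using VK pr_closed m0F'[OF that] by blast
 have tm: "abelian_monoid (trivial_module K)"
 proof -
  interpret t: vectorspace K "trivial_module K" by (rule trivial_vectorspace)
  show ?thesis ..
 qed
 \<comment> \<open>Left multiplication by \<open>g\<close> permutes the cosets of \<open>H\<close>,
   so \<open>V\<close> takes one value on all translates of \<open>y0\<close> by
   \<open>N\<^sub>G(P)\<close>.\<close>
 have \<kappa>eq: "V (pr (\<rho> g y0)) = \<kappa>" if g: "g \<in> ?NP" for g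
 proof -
  have gG: "g \<in> carrier G" using NPG[OF g] .
  have gr: "g \<star> ?r C \<in> ?NP" if "C \<in> cosets G ?NP H" for C using g rN[OF that] subgroup.m_closed[OF NPs] by blast
  have "\<rho> g y0 = (\<Oplus>\<^bsub>M\<^esub>C\<in>cosets G ?NP H. \<rho> g (\<rho> (?r C) m0))"
   unfolding y0_def by (rule hom_finsum[OF vs_self act_hom[OF gG] rM])
  also have "... = (\<Oplus>\<^bsub>M\<^esub>C\<in>cosets G ?NP H. \<rho> (g \<star> ?r C) m0)"
   using act_mult[OF gG NPG[OF rN] m0_closed] F_carrier[OF m0F'[OF gr]] by (intro M.finsum_cong') auto
  finally have "pr (\<rho> g y0) = (\<Oplus>\<^bsub>Y\<^esub>C\<in>cosets G ?NP H. pr (\<rho> (g \<star> ?r C) m0))"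
   using pr_finsum[of "\<lambda>C. \<rho> (g \<star> ?r C) m0" "cosets G ?NP H"] m0F'[OF gr] by auto
  then have "V (pr (\<rho> g y0)) = (\<Oplus>C\<in>cosets G ?NP H. w (g \<star> ?r C))"
   unfolding w_def
   using Y.hom_finsum[OF trivial_vectorspace V(1), of "\<lambda>C. pr (\<rho> (g \<star> ?r C) m0)" "cosets G ?NP H"] pr_closed[OF m0F'[OF gr]] by auto
  also have "... = coset_sum (trivial_module K) G ?NP H (\<lambda>x. w (g \<star> x))" by (simp add: coset_sum_def)
  also have "... = \<kappa>" unfolding \<kappa>_def
   by (rule G.coset_sum_left[OF Hs NPs HNP g tm]) (use wK wH in auto)
  finally show ?thesis .
 qed
 have \<kappa>K: "\<kappa> \<in> carrier K"
 proof -
  have "\<one>\<^sub>G \<in> ?NP" using subgroup.one_closed[OF NPs] .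
  then show ?thesis using \<kappa>eq[of "\<one>\<^sub>G"] act_one[OF y0M] y0P PF VK pr_closed by auto
 qed
 \<comment> \<open>Independent of the representative, as \<open>y0\<close> is fixed by
   \<open>P\<close>.\<close>
 define D where "D C = \<rho> (?r C) y0" for C
 have Drep: "D (g <#\<^sub>G P) = \<rho> g y0" if g: "g \<in> carrier G" for g
 proof -
  have "g \<in> g <#\<^sub>G P" using G.lcos_self[OF g Psub] .
  moreover have "\<rho> (b \<star> a) y0 = \<rho> b y0" if "b \<in> carrier G" "a \<in> P" for a b
   using that PG act_mult y0M y0f by (metis subset_iff)
  ultimately show ?thesis unfolding D_def
   using G.coset_sum_rep[OF Psub G.subgroup_self PG coset_in_X[OF g], of g "\<lambda>x. \<rho> x y0"] by blast
 qed
 have DM: "D C \<in> carrier M" if "C \<in> PX" for C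
  unfolding D_def using G.cosets_rep(2)[OF Psub G.subgroup_self PG that] act_closed y0M by blast
 have Dact: "D (h <#\<^sub>G C) = \<rho> h (D C)" if h: "h \<in> carrier G" and C: "C \<in> PX" for h C
 proof -
  obtain g where g: "g \<in> carrier G" "C = g <#\<^sub>G P" using X_cases[OF C] by blast
  have "h <#\<^sub>G C = (h \<star> g) <#\<^sub>G P" unfolding g(2) by (rule G.lcos_m_assoc[OF PG h g(1)])
  then show ?thesis using Drep[of "h \<star> g"] Drep[OF g(1)] g h act_mult[OF h g(1) y0M] by simp
 qed
 have Df: "f (D C) = f y0" if C: "C \<in> PX" for C
 proof -
  obtain g where g: "g \<in> carrier G" "C = g <#\<^sub>G P" using X_cases[OF C] by blast
  show ?thesis using Drep[OF g(1)] g f_act[OF g(1) y0M] by simp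
 qed
 \<comment> \<open>Compared with \<open>expand\<close>, the translates of \<open>m0\<close> are
   replaced by those of \<open>y0\<close>.\<close>
 define x where "x v = (\<Oplus>\<^bsub>M\<^esub>C\<in>PX. s C v \<odot>\<^sub>M D C)" for v
 have xA: "x \<in> endos (carrier G)"
 proof (rule endosI)
  have "(\<lambda>v. s C v \<odot>\<^sub>M D C) \<in> module_hom K M M" if C: "C \<in> PX" for C
   by (rule homI) (use s_closed[OF C] DM[OF C] homD(2,3)[OF s_hom[OF C]] in \<open>auto simp: smult_l_distr smult_assoc1\<close>)
  then show "x \<in> module_hom K M M" unfolding x_def by (rule hom_finsum_fun[OF vs_self])
  fix h v assume h: "h \<in> carrier G" and v: "v \<in> carrier M"
  have hv: "\<rho> h v \<in> carrier M" using act_closed[OF h v] .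
  note bij = G.cosets_left_bij[OF Psub G.subgroup_self PG h]
  have im: "(\<lambda>C. h <#\<^sub>G C) ` PX = PX" and inj: "inj_on (\<lambda>C. h <#\<^sub>G C) PX" using bij by (auto simp: bij_betw_def)
  have hC: "h <#\<^sub>G C \<in> PX" if "C \<in> PX" for C using bij_betwE[OF bij] that by blast
  have "x (\<rho> h v) = (\<Oplus>\<^bsub>M\<^esub>C\<in>(\<lambda>C. h <#\<^sub>G C) ` PX. s C (\<rho> h v) \<odot>\<^sub>M D C)" unfolding im x_def ..
  also have "... = (\<Oplus>\<^bsub>M\<^esub>C\<in>PX. s (h <#\<^sub>G C) (\<rho> h v) \<odot>\<^sub>M D (h <#\<^sub>G C))"
   using s_closed[OF _ hv] DM hC by (intro M.finsum_reindex inj) auto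
  also have "... = (\<Oplus>\<^bsub>M\<^esub>C\<in>PX. \<rho> h (s C v \<odot>\<^sub>M D C))"
  proof (rule M.finsum_cong'[OF refl])
   show "(\<lambda>C. \<rho> h (s C v \<odot>\<^sub>M D C)) \<in> PX \<rightarrow> carrier M" using s_closed[OF _ v] DM act_closed[OF h] by auto
   show "s (h <#\<^sub>G C) (\<rho> h v) \<odot>\<^sub>M D (h <#\<^sub>G C) = \<rho> h (s C v \<odot>\<^sub>M D C)" if C: "C \<in> PX" for C
    unfolding s_act[OF h C v] Dact[OF h C] act_smult[OF h s_closed[OF C v] DM[OF C]] ..
  qed
  also have "... = \<rho> h (x v)" unfolding x_def
   using s_closed[OF _ v] DM by (intro hom_finsum[OF vs_self act_hom[OF h], symmetric]) auto
  finally show "x (\<rho> h v) = \<rho> h (x v)" .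
 qed
 have fx: "f (x v) = (\<Oplus>C\<in>PX. s C v) \<otimes> f y0" if v: "v \<in> carrier M" for v
 proof -
  have "f (x v) = (\<Oplus>C\<in>PX. f (s C v \<odot>\<^sub>M D C))" unfolding x_def
   using hom_finsum[OF trivial_vectorspace f_hom, of "\<lambda>C. s C v \<odot>\<^sub>M D C" PX] s_closed[OF _ v] DM by auto
  also have "... = (\<Oplus>C\<in>PX. s C v \<otimes> f y0)"
   using homD(3)[OF f_hom s_closed[OF _ v] DM] Df s_closed[OF _ v] fy0K by (intro R.finsum_cong') auto
  also have "... = (\<Oplus>C\<in>PX. s C v) \<otimes> f y0"
   using s_closed[OF _ v] fy0K by (intro R.finsum_ldistr[symmetric] finX) auto
  finally show ?thesis .
 qed
 \<comment> \<open>So \<open>x\<close> multiplies \<open>f\<close> by the nonzero scalar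
   \<open>m\<close>; it cannot be nilpotent and is therefore bijective.\<close>
 have fx': "f (x v) = ([m] \<cdot> \<one>) \<otimes> f v" if v: "v \<in> carrier M" for v
 proof -
  have sK: "(\<Oplus>C\<in>PX. s C v) \<in> carrier K" using s_closed[OF _ v] by (intro R.finsum_closed) auto
  have fv: "f v = (\<Oplus>C\<in>PX. s C v) \<otimes> f m0"
   by (rule functional_m0[OF f_hom _ v]) (rule f_act[OF _ m0_closed])
  show ?thesis unfolding fx[OF v] fy0 fv using sK mK fm0 by (simp only: R.m_lcomm)
 qed
 have xj: "f ((x ^^ j) m0) ~= \<zero>" for j
 proof (induction j)
  case 0 then show ?case using f_m0 by simp
 next
  case (Suc j)
  have c: "(x ^^ j) m0 \<in> carrier M" using homD(1)[OF hom_funpow[OF endosD(1)[OF xA]] m0_closed] .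
  then show ?case using fx'[OF c] Suc integral[OF _ mK f_closed[OF c]] m1 by auto
 qed
 have bij: "bij_betw x (carrier M) (carrier M)"
 proof -
  have "indecomposable K (G(|carrier := carrier G|)) M \<rho>" using ind by simp
  then consider "\<exists>j. \<forall>v\<in>carrier M. (x ^^ j) v = \<zero>\<^sub>M" | "bij_betw x (carrier M) (carrier M)"
   using indecomposable_nilpotent_or_bij[of "carrier G" x] xA by (auto simp: endos_def)
  then show ?thesis
  proof cases
   case 1
   then obtain j where "(x ^^ j) m0 = \<zero>\<^sub>M" using m0_closed by blast
   then show ?thesis using xj[of j] hom_zero[OF trivial_vectorspace f_hom] by simp
  qed
 qed
 obtain B where B: "perm_basis Q B" using has_perm[OF Qsub Qcard] by blast
 let ?act = "\<lambda>h C. h <#\<^sub>G C"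
 let ?XQ = "fixed_set Q PX ?act"
 \<comment> \<open>Represent \<open>y\<close> by \<open>x v1\<close>. Modulo \<open>T\<close> only
   the \<open>Q\<close>-fixed cosets contribute to \<open>x v1\<close>, and \<open>V\<close> has the
   value \<open>\<kappa>\<close> on the class of each of their \<open>D C\<close>. The same
   coefficient sum, multiplied by \<open>f y0\<close> instead of \<open>\<kappa>\<close>, is
   \<open>fY y\<close>.\<close>
 have main: "V y \<otimes> f y0 = \<kappa> \<otimes> fY y" if y: "y \<in> carrier Y" for y
 proof -
  obtain v where v: "v \<in> F" "y = pr v" using pr_surj[OF y] by blast
  have vM: "v \<in> carrier M" using F_carrier[OF v(1)] .
  obtain v1 where v1: "v1 \<in> carrier M" "v = x v1"
  proof -
   have "v \<in> x ` carrier M" using bij vM unfolding bij_betw_def by simp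
   then show thesis using that by blast
  qed
  \<comment> \<open>\<open>x\<close> is injective and equivariant, so \<open>v1\<close> inherits the
    invariance of \<open>v\<close> under \<open>Q\<close>.\<close>
  have v1F: "\<rho> h v1 = v1" if h: "h \<in> Q" for h
  proof -
   have hG: "h \<in> carrier G" using h QG by blast
   have "x (\<rho> h v1) = x v1" using endosD(7)[OF xA hG v1(1)] v(1) v1(2) h by (simp add: fixed_points_def)
   then show ?thesis using bij act_closed[OF hG v1(1)] v1(1) by (auto simp: bij_betw_def dest: inj_onD)
  qed
  have sQ: "s (h <#\<^sub>G C) v1 = s C v1" if "h \<in> Q" "C \<in> PX" for h C
   using s_fixed[OF _ v1F[OF that(1)] that(2) v1(1)] that(1) QG by blast
  have XQ: "?XQ \<subseteq> PX" by (auto simp: fixed_set_def)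
  have finXQ: "finite ?XQ" using finite_subset[OF XQ finX] .
  have DF: "D C \<in> F" if C: "C \<in> ?XQ" for C
  proof -
   have CX: "C \<in> PX" using C XQ by blast
   have "\<rho> h (D C) = D C" if h: "h \<in> Q" for h
    using Dact[of h C] h QG CX C by (auto simp: fixed_set_def)
   then show ?thesis using DM[OF CX] by (simp add: fixed_points_def)
  qed
  have sK: "s C v1 \<in> carrier K" if "C \<in> PX" for C using s_closed[OF that v1(1)] .
  let ?a = "\<Oplus>\<^bsub>M\<^esub>C\<in>?XQ. s C v1 \<odot>\<^sub>M D C" and ?t = "\<Oplus>\<^bsub>M\<^esub>C\<in>PX - ?XQ. s C v1 \<odot>\<^sub>M D C"
  have aF': "(\<lambda>C. s C v1 \<odot>\<^sub>M D C) \<in> ?XQ \<rightarrow> F" using subspaceD(5)[OF F_sub] sK DF XQ by blast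
  have aF: "?a \<in> F" by (rule subspace_finsum[OF F_sub aF'])
  have tM: "?t \<in> carrier M" using sK DM by (intro M.finsum_closed) auto
  have "v = (\<Oplus>\<^bsub>M\<^esub>C\<in>?XQ \<union> (PX - ?XQ). s C v1 \<odot>\<^sub>M D C)"
   unfolding v1(2) x_def using XQ by (simp add: Un_absorb1)
  also have "... = ?a \<oplus>\<^sub>M ?t"
   using finX finXQ sK DM XQ by (intro M.finsum_Un_disjoint) auto
  finally have vat: "v = ?a \<oplus>\<^sub>M ?t" .
  have tF: "?t \<in> F"
  proof -
   have "?t = v \<ominus>\<^sub>M ?a"
    using vat tM F_carrier[OF aF] vM M.a_comm[of ?a ?t] diff_eq_iff[of v ?a ?t] by metis
   then show ?thesis using subspaceD(7)[OF F_sub v(1) aF] by simp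
  qed
  have tT: "?t \<in> T"
   unfolding T_eq[OF B] negl_def
  proof (intro CollectI conjI ballI tF)
   fix b assume b: "b \<in> fixed_set Q B \<rho>"
   have acts: "acts_on G Q (PX - ?XQ) ?act"
   proof -
    have "C \<in> ?XQ" if h: "h \<in> Q" and C: "C \<in> PX" and hC: "h <#\<^sub>G C \<in> ?XQ" for h C
    proof -
     have a: "!!h k. h \<in> Q ==> k \<in> Q ==> h \<star> k <#\<^sub>G C = h <#\<^sub>G (k <#\<^sub>G C)" "\<one>\<^sub>G <#\<^sub>G C = C"
      using acts_PX[OF Qsub] C unfolding acts_on_def by blast+
     have h': "iG h \<in> Q" "iG h \<star> h = \<one>\<^sub>G" using subgroup.m_inv_closed[OF Qsub h] h QG by auto
     have "iG h <#\<^sub>G (h <#\<^sub>G C) = h <#\<^sub>G C" using hC h'(1) by (simp add: fixed_set_def)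
     moreover have "iG h <#\<^sub>G (h <#\<^sub>G C) = C" using a(1)[OF h'(1) h] a(2) h'(2) by simp
     ultimately have "h <#\<^sub>G C = C" by simp
     then show ?thesis using hC by simp
    qed
    then show ?thesis using acts_PX[OF Qsub] unfolding acts_on_def by auto
   qed
   have "fixed_set Q (PX - ?XQ) ?act = {}" by (auto simp: fixed_set_def)
   moreover have "coord B ?t b = (\<Oplus>C\<in>fixed_set Q (PX - ?XQ) ?act. s C v1 \<otimes> coord B (D C) b)"
    by (rule coord_fixed_sum[OF Qsub Qcard B _ acts _ _ _ _ b])
     (use finX sK sQ DM Dact QG in auto)
   ultimately show "coord B ?t b = \<zero>" by simp
  qed
  \<comment> \<open>If \<open>Q\<close> fixes \<open>gP\<close>, then the inverse of
    \<open>g\<close> conjugates \<open>Q\<close> into \<open>P\<close>, and \<open>control\<close>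
    writes \<open>g\<close> as an element of \<open>CQ\<close> times one of
    \<open>N\<^sub>G(P)\<close>. \<open>V\<close> ignores the first, and \<open>\<kappa>eq\<close>
    absorbs the second.\<close>
  have VD: "V (pr (D C)) = \<kappa>" if C: "C \<in> ?XQ" for C
  proof -
   have CX: "C \<in> PX" using C XQ by blast
   obtain g where g: "g \<in> carrier G" "C = g <#\<^sub>G P" using X_cases[OF CX] by blast
   have "conj_set (iG g) Q \<subseteq> P" using fixed_coset_iff[OF QG g(1)] C g(2) by (simp add: fixed_set_def)
   then obtain k c where kc: "k \<in> ?NP" "c \<in> CQ" "iG g = k \<star> c"
    using control[OF Qsub QP, of "iG g"] g(1) by auto
   have kG: "k \<in> carrier G" "c \<in> carrier G" using NPG[OF kc(1)] kc(2) by (auto simp: centralizer_def)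
   have "g = iG (iG g)" using g(1) by simp
   also have "... = iG c \<star> iG k" unfolding kc(3) using kG by (simp add: G.inv_mult_group)
   finally have ge: "g = iG c \<star> iG k" .
   have k': "iG k \<in> ?NP" using subgroup.m_inv_closed[OF NPs kc(1)] .
   have c': "iG c \<in> CQ" using subgroup.m_inv_closed[OF G.centralizer_subgroup[OF QG] kc(2)] .
   have DC: "D C = \<rho> (iG c) (\<rho> (iG k) y0)"
    unfolding g(2) Drep[OF g(1)] unfolding ge using kG by (intro act_mult y0M) auto
   have kF: "\<rho> (iG k) y0 \<in> F"
   proof -
    have finP': "conj_set (iG k) P = P"
    proof -
     have "conj_set (iG k) P \<subseteq> P" using k' G.normalizer_iff[OF PG finP] by (auto simp: conj_set_def)
     then show ?thesis using conj_set_subgroup(2)[OF Psub NPG[OF k']] finP by (intro card_subset_eq) auto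
    qed
    have "\<rho> (iG k) y0 \<in> fixM P"
     using fixed_points_conj[OF PG NPG[OF k'] y0M] y0P finP' by simp
    then show ?thesis using PF by blast
   qed
   have "V (pr (D C)) = V (brauer_act \<rho> (iG c) (pr (\<rho> (iG k) y0)))"
    unfolding DC using act_pr[OF _ kF] c' CN by auto
   also have "... = V (pr (\<rho> (iG k) y0))" by (rule V(2)[OF c' pr_closed[OF kF]])
   also have "... = \<kappa>" by (rule \<kappa>eq[OF k'])
   finally show ?thesis .
  qed
  have S: "(\<Oplus>C\<in>?XQ. s C v1) \<in> carrier K" using sK XQ by (intro R.finsum_closed) blast
  have "V y = V (pr ?a)"
   using v(2) vat pr_add[OF aF tF] pr_zero_iff[OF tF] tT pr_closed[OF aF] by simp
  also have "pr ?a = (\<Oplus>\<^bsub>Y\<^esub>C\<in>?XQ. pr (s C v1 \<odot>\<^sub>M D C))" by (rule pr_finsum[OF aF'])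
  also have "V ... = (\<Oplus>C\<in>?XQ. V (pr (s C v1 \<odot>\<^sub>M D C)))"
   using Y.hom_finsum[OF trivial_vectorspace V(1), of "\<lambda>C. pr (s C v1 \<odot>\<^sub>M D C)" ?XQ] pr_closed aF' by auto
  also have "... = (\<Oplus>C\<in>?XQ. s C v1 \<otimes> \<kappa>)"
  proof (rule R.finsum_cong'[OF refl])
   show "(\<lambda>C. s C v1 \<otimes> \<kappa>) \<in> ?XQ \<rightarrow> carrier K" using sK XQ \<kappa>K by auto
   fix C assume C: "C \<in> ?XQ"
   have sC: "s C v1 \<in> carrier K" using sK C XQ by blast
   show "V (pr (s C v1 \<odot>\<^sub>M D C)) = s C v1 \<otimes> \<kappa>"
    using pr_smult[OF sC DF[OF C]] Y.homD(3)[OF V(1) sC pr_closed[OF DF[OF C]]] VD[OF C] by simp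
  qed
  also have "... = (\<Oplus>C\<in>?XQ. s C v1) \<otimes> \<kappa>"
   using sK XQ \<kappa>K by (intro R.finsum_ldistr[symmetric] finXQ) auto
  finally have 1: "V y = (\<Oplus>C\<in>?XQ. s C v1) \<otimes> \<kappa>" .
  have "(\<Oplus>C\<in>PX. s C v1) = (\<Oplus>C\<in>?XQ. s C v1)"
   by (rule finsum_fixed_set[OF G.is_group Qsub Qcard acts_PX[OF Qsub] finX]) (use sK sQ in auto)
  then have 2: "fY y = (\<Oplus>C\<in>?XQ. s C v1) \<otimes> f y0"
   using fY_pr[OF v(1)] v(2) v1(2) fx[OF v1(1)] by simp
  show ?thesis unfolding 1 2 using S \<kappa>K fy0K by (simp only: R.m_assoc R.m_comm R.m_lcomm R.m_closed)
 qed
 let ?i = "inv\<^bsub>K\<^esub> (f y0)"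
 have u: "f y0 \<in> Units K" using field_Units fy0K fy0n by simp
 have i: "?i \<in> carrier K" "f y0 \<otimes> ?i = \<one>" using u by simp_all
 have "V y = (\<kappa> \<otimes> ?i) \<otimes> fY y" if y: "y \<in> carrier Y" for y
 proof -
  have fYK: "fY y \<in> carrier K" using Y.homD(1)[OF fY_hom y] by simp
  have "V y = V y \<otimes> (f y0 \<otimes> ?i)" using VK[OF y] i by simp
  also have "... = (V y \<otimes> f y0) \<otimes> ?i" using VK[OF y] fy0K i by (simp add: R.m_assoc)
  also have "... = (\<kappa> \<otimes> ?i) \<otimes> fY y" unfolding main[OF y] using \<kappa>K i fYK by (simp add: R.m_ac)
  finally show ?thesis .
 qed
 then show ?thesis using \<kappa>K i by (intro bexI[of _ "\<kappa> \<otimes> ?i"]) auto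
qed

end

section \<open>Fitting decompositions relative to a functional\<close>

context modular_rep begin

text \<open>For a \<open>Q\<close>-fixed basis element \<open>b\<close> the coefficient of
  \<open>h v\<close> at \<open>b\<close> is a \<open>Q\<close>-invariant functional of
  \<open>v\<close>, so it vanishes on \<open>negl Q B\<close>.\<close>

lemma equivariant_negl:
 assumes Q: "subgroup Q G" "card Q = p ^ n" and B: "perm_basis Q B"
  and h: "h \<in> module_hom K M M" "!!g v. g \<in> Q ==> v \<in> carrier M ==> h (\<rho> g v) = \<rho> g (h v)"
  and v: "v \<in> negl Q B"
 shows "h v \<in> negl Q B"
proof -
 note Bb = perm_basisD[OF B]
 have vM: "v \<in> carrier M" and vQ: "!!g. g \<in> Q ==> \<rho> g v = v" using v by (auto simp: negl_def fixed_points_def)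
 have hv: "h v \<in> carrier M" using homD(1)[OF h(1) vM] .
 have "h v \<in> fixM Q"
 proof -
  have "\<rho> g (h v) = h v" if "g \<in> Q" for g using h(2)[OF that vM] vQ[OF that] by simp
  then show ?thesis using hv by (simp add: fixed_points_def)
 qed
 moreover have "coord B (h v) b = \<zero>" if b: "b \<in> fixed_set Q B \<rho>" for b
 proof -
  have bB: "b \<in> B" "!!g. g \<in> Q ==> \<rho> g b = b" using b by (auto simp: fixed_set_def)
  note c = coord_hom[OF Bb(2,1) bB(1)]
  have "(\<lambda>v. coord B (h v) b) \<in> module_hom K M (trivial_module K)"
   by (rule homI) (use homD[OF h(1)] homD[OF c] in auto)
  moreover have "coord B (h (\<rho> g w)) b = coord B (h w) b" if g: "g \<in> Q" and w: "w \<in> carrier M" for g w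
   using coord_act[OF Q(1) B g homD(1)[OF h(1) w] bB(1)] bB(2)[OF g] h(2)[OF g w] by simp
  ultimately show ?thesis by (rule invariant_functional_negl[OF Q B _ _ v])
 qed
 ultimately show ?thesis by (simp add: negl_def)
qed

lemma fitting_direct_sum:
 assumes H: "H \<subseteq> carrier G" and h: "h \<in> endos H"
 shows "\<exists>n>0. dirsum H {v \<in> carrier M. (h ^^ n) v = \<zero>\<^sub>M} ((h ^^ n) ` carrier M)"
proof -
 note hh = endosD[OF h]
 have hn: "(h ^^ n) v \<in> carrier M" if "v \<in> carrier M" for n v using homD(1)[OF hom_funpow[OF hh(1)] that] .
 have comm: "(h ^^ n) (\<rho> g v) = \<rho> g ((h ^^ n) v)" if g: "g \<in> H" and v: "v \<in> carrier M" for n g v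
  by (induction n) (use hh(7)[OF g] hn[OF v] in auto)
 have gG: "g \<in> carrier G" if "g \<in> H" for g using that H by blast
 show ?thesis
 proof (rule fitting[OF fin_dim hh(1)])
  fix n :: nat
  assume n: "0 < n" "{v \<in> carrier M. (h ^^ n) v = \<zero>\<^sub>M} \<inter> (h ^^ n) ` carrier M = {\<zero>\<^sub>M}"
   "{v \<in> carrier M. (h ^^ n) v = \<zero>\<^sub>M} <+>\<^bsub>M\<^esub> (h ^^ n) ` carrier M = carrier M"
  have "dirsum H {v \<in> carrier M. (h ^^ n) v = \<zero>\<^sub>M} ((h ^^ n) ` carrier M)"
  proof (rule is_direct_sumI)
   show "subspace K {v \<in> carrier M. (h ^^ n) v = \<zero>\<^sub>M} M" by (rule kernel_subspace[OF vs_self hom_funpow[OF hh(1)]])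
   show "subspace K ((h ^^ n) ` carrier M) M" by (rule image_subspace[OF vs_self hom_funpow[OF hh(1)] subspace_carrier])
   show "\<rho> g u \<in> {v \<in> carrier M. (h ^^ n) v = \<zero>\<^sub>M}" if "g \<in> H" "u \<in> {v \<in> carrier M. (h ^^ n) v = \<zero>\<^sub>M}" for g u
    using that comm act_closed[OF gG] act_zero[OF gG] by simp
   show "\<rho> g w \<in> (h ^^ n) ` carrier M" if gw: "g \<in> H" "w \<in> (h ^^ n) ` carrier M" for g w
   proof -
    obtain v where v: "v \<in> carrier M" "w = (h ^^ n) v" using gw(2) by blast
    have "\<rho> g w = (h ^^ n) (\<rho> g v)" unfolding v(2) comm[OF gw(1) v(1)] ..
    then show ?thesis using act_closed[OF gG[OF gw(1)] v(1)] by blast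
   qed
  qed (use n in auto)
  then show ?thesis using n(1) by blast
 qed
qed

text \<open>Here \<open>e\<close> projects along the minimal summand \<open>A\<close>, and
  \<open>x = (1 - e) j\<close> maps into \<open>A\<close>. Let \<open>y\<close> be \<open>x\<close>
  on \<open>A\<close> and the identity on the image of \<open>e\<close>. Since
  \<open>e y = e\<close>, the Fitting kernel of \<open>y\<close> is a summand inside
  \<open>A\<close>. Since \<open>\<phi>\<close> vanishes after \<open>y\<close>, it cannot vanish on
  that kernel. By minimality the kernel is \<open>A\<close>, so \<open>x\<close> is
  nilpotent.\<close>

lemma minimal_summand_nilpotent:
 assumes H: "H \<subseteq> carrier G" and A: "subspace K A M" and e: "e \<in> endos H" "!!v. v \<in> carrier M ==> v \<ominus>\<^sub>M e v \<in> A"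
  "!!v. v \<in> A ==> e v = \<zero>\<^sub>M" "!!v. v \<in> carrier M ==> e v = \<zero>\<^sub>M ==> v \<in> A" "!!v. v \<in> carrier M ==> e (e v) = e v"
  and \<phi>: "\<phi> \<in> module_hom K M (trivial_module K)" "!!v. v \<in> carrier M ==> \<phi> (e v) = \<zero>" "v0 \<in> carrier M" "\<phi> v0 ~= \<zero>"
  and min: "!!A' B'. dirsum H A' B' ==> A' \<subset> A ==> \<forall>a\<in>A'. \<phi> a = \<zero>"
  and j: "j \<in> endos H" "!!v. v \<in> carrier M ==> \<phi> (j v) = \<zero>"
 shows "\<exists>n. \<forall>v\<in>carrier M. ((\<lambda>v. j v \<ominus>\<^sub>M e (j v)) ^^ n) v = \<zero>\<^sub>M"
proof -
 let ?x = "\<lambda>v. j v \<ominus>\<^sub>M e (j v)"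
 define y where "y v = e v \<ominus>\<^sub>M (?x (e v) \<ominus>\<^sub>M ?x v)" for v
 note ee = endosD[OF e(1)] note jj = endosD[OF j(1)]
 have xE: "?x \<in> endos H" by (rule endos_diff[OF H j(1) endos_comp[OF e(1) j(1)]])
 note xx = endosD[OF xE]
 have yE: "y \<in> endos H" unfolding y_def
  by (rule endos_diff[OF H e(1) endos_diff[OF H endos_comp[OF xE e(1)] xE]])
 note yy = endosD[OF yE]
 have AM: "a \<in> carrier M" if "a \<in> A" for a using subspaceD(2)[OF A that] .
 have ex: "e (?x v) = \<zero>\<^sub>M" if v: "v \<in> carrier M" for v
  using e(3)[OF e(2)[OF jj(2)[OF v]]] .
 have ey: "e (y v) = e v" if v: "v \<in> carrier M" for v
  unfolding y_def using v ee(2,5,6) e(5) xx(2) ex by (simp add: a_minus_def)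
 have eyn: "e ((y ^^ n) v) = e v" if v: "v \<in> carrier M" for n v
 proof (induction n)
  case (Suc n)
  have "(y ^^ n) v \<in> carrier M" using homD(1)[OF hom_funpow[OF yy(1)] v] .
  then show ?case using ey Suc by simp
 qed simp
 have yA: "y a = ?x a" if a: "a \<in> A" for a
 proof -
  have c: "?x a \<in> carrier M" using xx(2)[OF AM[OF a]] .
  have "y a = \<zero>\<^sub>M \<ominus>\<^sub>M (\<zero>\<^sub>M \<ominus>\<^sub>M ?x a)" unfolding y_def e(3)[OF a] xx(6) ..
  also have "... = ?x a" using c by (simp add: a_minus_def)
  finally show ?thesis .
 qed
 have \<phi>K: "\<phi> v \<in> carrier K" if "v \<in> carrier M" for v using homD(1)[OF \<phi>(1) that] by simp
 have \<phi>d: "\<phi> (v \<ominus>\<^sub>M w) = \<zero>" if "v \<in> carrier M" "w \<in> carrier M" "\<phi> v = \<zero>" "\<phi> w = \<zero>" for v w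
  using hom_diff[OF trivial_vectorspace \<phi>(1) that(1,2)] that(3,4)
   vectorspace.diff_add_cancel(4)[OF trivial_vectorspace, of "\<zero>" "\<zero>"] by simp
 have \<phi>x: "\<phi> (?x v) = \<zero>" if v: "v \<in> carrier M" for v
  using \<phi>d[OF jj(2)[OF v] ee(2)[OF jj(2)[OF v]] j(2)[OF v] \<phi>(2)[OF jj(2)[OF v]]] .
 have \<phi>y: "\<phi> (y v) = \<zero>" if v: "v \<in> carrier M" for v
  unfolding y_def
  by (rule \<phi>d[OF ee(2)[OF v] _ \<phi>(2)[OF v] \<phi>d[OF xx(2)[OF ee(2)[OF v]] xx(2)[OF v] \<phi>x[OF ee(2)[OF v]] \<phi>x[OF v]]])
   (use xx(2) ee(2) v in auto)
 obtain n where n: "0 < n" "dirsum H {v \<in> carrier M. (y ^^ n) v = \<zero>\<^sub>M} ((y ^^ n) ` carrier M)"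
  using fitting_direct_sum[OF H yE] by blast
 let ?k = "{v \<in> carrier M. (y ^^ n) v = \<zero>\<^sub>M}"
 obtain n' where n': "n = Suc n'" using n(1) by (cases n) auto
 have \<phi>im: "\<phi> ((y ^^ n) v) = \<zero>" if v: "v \<in> carrier M" for v
  using \<phi>y[OF homD(1)[OF hom_funpow[OF yy(1)] v], of n'] unfolding n' by simp
 have kA: "?k \<subseteq> A"
 proof
  fix v assume v: "v \<in> ?k"
  then have vM: "v \<in> carrier M" by simp
  have "e v = e ((y ^^ n) v)" using eyn[OF vM] ..
  also have "... = \<zero>\<^sub>M" using v ee(6) by simp
  finally show "v \<in> A" by (rule e(4)[OF vM])
 qed
 \<comment> \<open>\<open>\<phi>\<close> vanishes on the Fitting image, so the nonzero value at
   \<open>v0\<close> must come from the kernel component.\<close>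
 have kne: "\<exists>a\<in>?k. \<phi> a ~= \<zero>"
 proof (rule ccontr)
  assume no: "\<not> ?thesis"
  have "v0 \<in> ?k <+>\<^bsub>M\<^esub> (y ^^ n) ` carrier M" using is_direct_sumD(6)[OF n(2)] \<phi>(3) by simp
  then obtain a w where aw: "a \<in> ?k" "w \<in> carrier M" "v0 = a \<oplus>\<^sub>M (y ^^ n) w" unfolding set_add_mem by blast
  have "\<phi> a = \<zero>" using no aw(1) by blast
  then have "\<phi> v0 = \<zero>" unfolding aw(3)
   using homD(2)[OF \<phi>(1), of a "(y ^^ n) w"] aw(1,2) \<phi>im[OF aw(2)] homD(1)[OF hom_funpow[OF yy(1)] aw(2)] by simp
  then show False using \<phi>(4) by simp
 qed
 have "?k = A" using min[OF n(2)] kA kne by blast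
 then have yn: "(y ^^ n) a = \<zero>\<^sub>M" if "a \<in> A" for a using that by blast
 have xA: "?x v \<in> A" if v: "v \<in> carrier M" for v using e(2)[OF jj(2)[OF v]] .
 have it: "(?x ^^ i) a \<in> A \<and> (?x ^^ i) a = (y ^^ i) a" if a: "a \<in> A" for a i
 proof (induction i)
  case 0 then show ?case using a by simp
 next
  case (Suc i)
  then have A1: "(?x ^^ i) a \<in> A" and eq: "(?x ^^ i) a = (y ^^ i) a" by blast+
  have "?x ((?x ^^ i) a) = y ((y ^^ i) a)" using yA[OF A1] unfolding eq by simp
  then show ?case using xA[OF AM[OF A1]] by simp
 qed
 \<comment> \<open>The additional factor brings an arbitrary vector into \<open>A\<close>.\<close>
 have "(?x ^^ Suc n) v = \<zero>\<^sub>M" if v: "v \<in> carrier M" for v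
  unfolding funpow_Suc_right o_def using it[OF xA[OF v], of n] yn[OF xA[OF v]] by simp
 then show ?thesis by blast
qed

text \<open>Indecomposability of the Brauer construction \<open>M(R)\<close> over \<open>C\<^sub>G(R)\<close>, or \<open>M(R) = 0\<close>, expressed in \<open>M\<close>.\<close>

definition brauer_ind :: "'g set \<Rightarrow> bool"
 where "brauer_ind R \<longleftrightarrow> (\<forall>A B. subspace K A M \<longrightarrow> subspace K B M \<longrightarrow> A \<inter> B = trM R \<longrightarrow>
  A <+>\<^bsub>M\<^esub> B = fixM R \<longrightarrow>
  (\<forall>c\<in>centralizer G R. (\<forall>a\<in>A. \<rho> c a \<in> A) \<and> (\<forall>b\<in>B. \<rho> c b \<in> B)) \<longrightarrow>
  A = trM R \<or> B = trM R)"

end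

section \<open>Permuted bases with all stabilisers in \<open>Q\<close> give relative traces\<close>

context brauer_quot begin

abbreviation "\<tau> \<equiv> brauer_act \<rho>"

lemma Yact_closed: "g \<in> N ==> y \<in> carrier Y ==> \<tau> g y \<in> carrier Y"
 using Y.act_closed by simp

lemma Yact_mult: "g \<in> N ==> h \<in> N ==> y \<in> carrier Y ==> \<tau> (g \<star> h) y = \<tau> g (\<tau> h y)"
 using Y.act_mult by simp

lemma N_inv: "g \<in> N ==> iG g \<in> N" by (rule subgroup.m_inv_closed[OF Nsub])

lemma Yact_one: "y \<in> carrier Y ==> \<tau> \<one>\<^sub>G y = y" using Y.act_one by simp

lemma Yact_inv:
 assumes "g \<in> N" "y \<in> carrier Y"
 shows "\<tau> (iG g) (\<tau> g y) = y" "\<tau> g (\<tau> (iG g) y) = y"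
 using Yact_mult[OF N_inv[OF assms(1)] assms] Yact_mult[OF assms(1) N_inv[OF assms(1)] assms(2)]
  Yact_one[OF assms(2)] NG[OF assms(1)] by simp_all

lemma Yact_hom: "g \<in> N ==> \<tau> g \<in> module_hom K Y Y" using Y.act_hom by simp

lemma Yact_Q: "g \<in> Q ==> y \<in> carrier Y ==> \<tau> g y = y"
proof -
 assume g: "g \<in> Q" and "y \<in> carrier Y"
 then obtain v where v: "v \<in> F" "y = pr v" using pr_surj by blast
 have gN: "g \<in> N" using g QN by blast
 show "\<tau> g y = y" using act_pr[OF gN v(1)] v g by (simp add: fixed_points_def)
qed

text \<open>\<open>\<Theta>\<close> consists of one representative for each orbit on
  \<open>D\<close>. As the stabilisers are exactly \<open>Q\<close>, each element of
  \<open>D\<close> is carried into \<open>\<Theta>\<close> by the inverse of exactly one coset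
  representative.\<close>

lemma orbit_transversal:
 assumes S: "subgroup S G" "Q \<subseteq> S" "S \<subseteq> N" and D: "D \<subseteq> carrier Y" "!!g b. g \<in> S ==> b \<in> D ==> \<tau> g b \<in> D"
  and stab: "!!g b. g \<in> S ==> b \<in> D ==> \<tau> g b = b ==> g \<in> Q"
 shows "\<exists>\<Theta>. \<forall>b\<in>D. \<exists>C0\<in>cosets G S Q. \<forall>C\<in>cosets G S Q. \<tau> (iG (SOME x. x \<in> C)) b \<in> \<Theta> \<longleftrightarrow> C = C0"
proof -
 have SN: "g \<in> N" if "g \<in> S" for g using that S(3) by blast
 have SG: "g \<in> carrier G" if "g \<in> S" for g using NG[OF SN[OF that]] .
 note Sinv = subgroup.m_inv_closed[OF S(1)] and Smult = subgroup.m_closed[OF S(1)]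
 have DY: "b \<in> carrier Y" if "b \<in> D" for b using that D(1) by blast
 define orb where "orb b = (\<lambda>g. \<tau> g b) ` S" for b
 define r where "r b = (SOME x. x \<in> orb b)" for b
 have orb_self: "b \<in> orb b" if b: "b \<in> D" for b
  unfolding orb_def using Yact_one[OF DY[OF b]] subgroup.one_closed[OF S(1)] by (metis image_eqI)
 have rO: "r b \<in> orb b" if "b \<in> D" for b unfolding r_def by (rule someI[of "\<lambda>x. x \<in> orb b", OF orb_self[OF that]])
 have orb_act: "orb (\<tau> g b) = orb b" if g: "g \<in> S" and b: "b \<in> D" for g b
 proof (intro equalityI subsetI)
  fix x assume "x \<in> orb (\<tau> g b)"
  then obtain h where h: "h \<in> S" "x = \<tau> h (\<tau> g b)" unfolding orb_def by blast
  then have "x = \<tau> (h \<star> g) b" using Yact_mult[OF SN SN DY] g b by simp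
  then show "x \<in> orb b" unfolding orb_def using Smult[OF h(1) g] by blast
 next
  fix x assume "x \<in> orb b"
  then obtain h where h: "h \<in> S" "x = \<tau> h b" unfolding orb_def by blast
  have "\<tau> (h \<star> iG g) (\<tau> g b) = \<tau> h (\<tau> (iG g) (\<tau> g b))"
   by (rule Yact_mult[OF SN[OF h(1)] SN[OF Sinv[OF g]] Yact_closed[OF SN[OF g] DY[OF b]]])
  then have "x = \<tau> (h \<star> iG g) (\<tau> g b)" using h(2) Yact_inv(1)[OF SN[OF g] DY[OF b]] by simp
  then show "x \<in> orb (\<tau> g b)" unfolding orb_def using Smult[OF h(1) Sinv[OF g]] by blast
 qed
 have rep: "(SOME x. x \<in> C) \<in> S" "C = (SOME x. x \<in> C) <#\<^sub>G Q" if "C \<in> cosets G S Q" for C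
  using G.cosets_rep(2,3)[OF Qsub S(1,2) that] by blast+
 have "\<exists>C0\<in>cosets G S Q. \<forall>C\<in>cosets G S Q. \<tau> (iG (SOME x. x \<in> C)) b \<in> r ` D \<longleftrightarrow> C = C0" if b: "b \<in> D" for b
 proof -
  have bY: "b \<in> carrier Y" using DY[OF b] .
  obtain h where h: "h \<in> S" "r b = \<tau> h b" using rO[OF b] unfolding orb_def by blast
  have mem: "\<tau> g b \<in> r ` D \<longleftrightarrow> \<tau> g b = r b" if g: "g \<in> S" for g
  proof
   assume "\<tau> g b \<in> r ` D"
   then obtain b' where b': "b' \<in> D" "\<tau> g b = r b'" by blast
   obtain k where k: "k \<in> S" "r b' = \<tau> k b'" using rO[OF b'(1)] unfolding orb_def by blast
   have "orb b = orb b'" using orb_act[OF g b] orb_act[OF k(1) b'(1)] b'(2) k(2) by simp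
   then show "\<tau> g b = r b" using b'(2) by (simp add: r_def)
  qed (use b in blast)
  \<comment> \<open>\<open>h\<close> carries \<open>b\<close> to the representative of its orbit, so
    the coset sought is that of the inverse of \<open>h\<close>.\<close>
  let ?C0 = "iG h <#\<^sub>G Q"
  have C0: "?C0 \<in> cosets G S Q" unfolding cosets_def using Sinv[OF h(1)] by blast
  have "\<tau> (iG (SOME x. x \<in> C)) b \<in> r ` D \<longleftrightarrow> C = ?C0" if C: "C \<in> cosets G S Q" for C
  proof -
   let ?g = "SOME x. x \<in> C"
   have g: "?g \<in> S" "C = ?g <#\<^sub>G Q" using rep[OF C] by blast+
   have gi: "iG ?g \<in> S" using Sinv[OF g(1)] .
   have eqv: "\<tau> (iG ?g) b = \<tau> h b \<longleftrightarrow> h \<star> ?g \<in> Q"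
   proof
    let ?w = "\<tau> (iG ?g) b"
    have w: "?w \<in> carrier Y" "?w \<in> D" using Yact_closed[OF SN[OF gi] bY] D(2)[OF gi b] by blast+
    have hw: "\<tau> (h \<star> ?g) ?w = \<tau> h b"
     unfolding Yact_mult[OF SN[OF h(1)] SN[OF g(1)] w(1)] Yact_inv(2)[OF SN[OF g(1)] bY] ..
    show "h \<star> ?g \<in> Q" if "?w = \<tau> h b"
     by (rule stab[OF Smult[OF h(1) g(1)] w(2)]) (rule trans[OF hw that[symmetric]])
    show "?w = \<tau> h b" if "h \<star> ?g \<in> Q" by (rule trans[OF Yact_Q[OF that w(1), symmetric] hw])
   qed
   have hh: "iG (iG h) = h" using SG[OF h(1)] by simp
   have 1: "?C0 = ?g <#\<^sub>G Q \<longleftrightarrow> h \<star> ?g \<in> Q"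
    using G.l_coset_eq_iff[OF Qsub SG[OF Sinv[OF h(1)]] SG[OF g(1)]] unfolding hh .
   have 2: "\<tau> (iG ?g) b \<in> r ` D \<longleftrightarrow> h \<star> ?g \<in> Q"
    unfolding mem[OF gi] h(2) by (rule eqv)
   show ?thesis
   proof
    assume "\<tau> (iG ?g) b \<in> r ` D"
    then have "?C0 = ?g <#\<^sub>G Q" using 1 2 by blast
    then show "C = ?C0" by (rule trans[OF g(2) sym])
   next
    assume "C = ?C0"
    then have "?C0 = ?g <#\<^sub>G Q" by (rule trans[OF sym g(2)])
    then show "\<tau> (iG ?g) b \<in> r ` D" using 1 2 by blast
   qed
  qed
  then show ?thesis using C0 by blast
 qed
 then show ?thesis by blast
qed

text \<open>\<open>S/Q\<close> acts freely on \<open>D\<close>, so the projection onto the span of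
  \<open>D\<close> is the sum of the conjugates of the projection onto the span of a transversal.
  The latter is \<open>\<alpha>\<close>; any linear map of \<open>Y\<close> has a trace from
  \<open>Q\<close>, since \<open>Q\<close> acts trivially there.\<close>

lemma projection_trace:
 assumes S: "subgroup S G" "Q \<subseteq> S" "S \<subseteq> N" and B: "Y.perm_basis S B" and D: "D \<subseteq> B" "!!g b. g \<in> S ==> b \<in> D ==> \<tau> g b \<in> D"
  and stab: "!!g b. g \<in> S ==> b \<in> D ==> \<tau> g b = b ==> g \<in> Q"
 shows "\<exists>\<alpha>\<in>module_hom K Y Y. \<forall>y\<in>carrier Y. (\<Oplus>\<^bsub>Y\<^esub>b\<in>D. Y.coord B y b \<odot>\<^sub>Y b)
  = coset_sum Y G S Q (\<lambda>g. \<tau> g (\<alpha> (\<tau> (iG g) y)))"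
proof -
 note Bb = Y.perm_basisD[OF B]
 have SN: "g \<in> N" if "g \<in> S" for g using that S(3) by blast
 note Sinv = subgroup.m_inv_closed[OF S(1)]
 have DB: "b \<in> B" if "b \<in> D" for b using that D(1) by blast
 have DY: "b \<in> carrier Y" if "b \<in> D" for b using Bb(3)[OF DB[OF that]] .
 have DY': "D \<subseteq> carrier Y" using DY by blast
 have finD: "finite D" using finite_subset[OF D(1) Bb(2)] .
 have SN': "subgroup S (G(|carrier := N|))" by (rule subgroup_N[OF S(1,3)])
 have ex: "\<exists>\<Theta>. \<forall>b\<in>D. \<exists>C0\<in>cosets G S Q. \<forall>C\<in>cosets G S Q. \<tau> (iG (SOME x. x \<in> C)) b \<in> \<Theta> \<longleftrightarrow> C = C0"
  by (rule orbit_transversal[OF S DY' D(2) stab])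
 then obtain \<Theta> where \<Theta>: "\<forall>b\<in>D. \<exists>C0\<in>cosets G S Q. \<forall>C\<in>cosets G S Q. \<tau> (iG (SOME x. x \<in> C)) b \<in> \<Theta> \<longleftrightarrow> C = C0" ..
 let ?\<chi> = "\<lambda>b. if b \<in> \<Theta> then \<one> else \<zero>"
 let ?r = "\<lambda>C. SOME x. x \<in> C"
 let ?Z = "cosets G S Q"
 have finZ: "finite ?Z" using finite_subset[OF subgroup.subset[OF S(1)] finite_group] by (simp add: cosets_def)
 have rS: "?r C \<in> S" if "C \<in> ?Z" for C using G.cosets_rep(2)[OF Qsub S(1,2) that] .
 have cK: "Y.coord B y b \<in> carrier K" if "y \<in> carrier Y" "b \<in> D" for y b
  using Y.coord_closed[OF Bb(2,1) that(1) DB[OF that(2)]] .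
 have cd: "Y.coord B (\<tau> g y) (\<tau> g b) = Y.coord B y b" if "g \<in> S" "y \<in> carrier Y" "b \<in> D" for g y b
  by (rule Y.coord_act[OF SN' B that(1,2) DB[OF that(3)]])
 \<comment> \<open>Keeps the coefficients at the transversal \<open>\<Theta>\<close> and drops all
   others.\<close>
 define \<alpha> where "\<alpha> y = (\<Oplus>\<^bsub>Y\<^esub>b\<in>D. (?\<chi> b \<otimes> Y.coord B y b) \<odot>\<^sub>Y b)" for y
 have "(\<lambda>y. (?\<chi> b \<otimes> Y.coord B y b) \<odot>\<^sub>Y b) \<in> module_hom K Y Y" if b: "b \<in> D" for b
 proof -
  note c = Y.homD(2,3)[OF Y.coord_hom[OF Bb(2,1) DB[OF b]]]
  show ?thesis
   by (rule Y.homI)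
    (use cK[OF _ b] c DY[OF b] in \<open>auto simp: Y.smult_l_distr Y.smult_assoc1 R.r_distr\<close>)
 qed
 then have \<alpha>: "\<alpha> \<in> module_hom K Y Y" unfolding \<alpha>_def by (rule Y.hom_finsum_fun[OF Y.vs_self])
 have "(\<Oplus>\<^bsub>Y\<^esub>b\<in>D. Y.coord B y b \<odot>\<^sub>Y b) = coset_sum Y G S Q (\<lambda>g. \<tau> g (\<alpha> (\<tau> (iG g) y)))" if y: "y \<in> carrier Y" for y
 proof -
  have step: "\<tau> g (\<alpha> (\<tau> (iG g) y)) = (\<Oplus>\<^bsub>Y\<^esub>b\<in>D. (?\<chi> (\<tau> (iG g) b) \<otimes> Y.coord B y b) \<odot>\<^sub>Y b)" if g: "g \<in> S" for g
  proof -
   let ?i = "iG g"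
   have gi: "?i \<in> S" using Sinv[OF g] .
   have yi: "\<tau> ?i y \<in> carrier Y" using Yact_closed[OF SN[OF gi] y] .
   have im: "\<tau> ?i ` D = D"
   proof (rule endo_inj_surj[OF finD])
    show "\<tau> ?i ` D \<subseteq> D" using D(2)[OF gi] by blast
    show "inj_on (\<tau> ?i) D"
     using Yact_inv(2)[OF SN[OF g] DY] by (metis inj_onI)
   qed
   have inj: "inj_on (\<tau> ?i) D" using Yact_inv(2)[OF SN[OF g] DY] by (metis inj_onI)
   have t: "(?\<chi> b \<otimes> Y.coord B y' b) \<odot>\<^sub>Y b \<in> carrier Y" if "b \<in> D" "y' \<in> carrier Y" for b y'
    using cK[OF that(2,1)] DY[OF that(1)] by simp
   have "\<alpha> (\<tau> ?i y) = (\<Oplus>\<^bsub>Y\<^esub>b\<in>\<tau> ?i ` D. (?\<chi> b \<otimes> Y.coord B (\<tau> ?i y) b) \<odot>\<^sub>Y b)" unfolding im \<alpha>_def ..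
   also have "... = (\<Oplus>\<^bsub>Y\<^esub>b\<in>D. (?\<chi> (\<tau> ?i b) \<otimes> Y.coord B (\<tau> ?i y) (\<tau> ?i b)) \<odot>\<^sub>Y \<tau> ?i b)"
    using t[OF D(2)[OF gi] yi] im t[OF _ yi] by (intro Y.M.finsum_reindex inj) auto
   also have "... = (\<Oplus>\<^bsub>Y\<^esub>b\<in>D. (?\<chi> (\<tau> ?i b) \<otimes> Y.coord B y b) \<odot>\<^sub>Y \<tau> ?i b)"
    using cd[OF gi y] cK[OF y] Yact_closed[OF SN[OF gi] DY] by (intro Y.M.finsum_cong') auto
   finally have 1: "\<alpha> (\<tau> ?i y) = (\<Oplus>\<^bsub>Y\<^esub>b\<in>D. (?\<chi> (\<tau> ?i b) \<otimes> Y.coord B y b) \<odot>\<^sub>Y \<tau> ?i b)" .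
   have t2: "(\<lambda>b. (?\<chi> (\<tau> ?i b) \<otimes> Y.coord B y b) \<odot>\<^sub>Y \<tau> ?i b) \<in> D \<rightarrow> carrier Y"
    using cK[OF y] Yact_closed[OF SN[OF gi] DY] by auto
   have "\<tau> g (\<alpha> (\<tau> ?i y)) = (\<Oplus>\<^bsub>Y\<^esub>b\<in>D. \<tau> g ((?\<chi> (\<tau> ?i b) \<otimes> Y.coord B y b) \<odot>\<^sub>Y \<tau> ?i b))"
    unfolding 1 by (rule Y.hom_finsum[OF Y.vs_self Yact_hom[OF SN[OF g]] t2])
   also have "... = (\<Oplus>\<^bsub>Y\<^esub>b\<in>D. (?\<chi> (\<tau> ?i b) \<otimes> Y.coord B y b) \<odot>\<^sub>Y b)"
   proof (rule Y.M.finsum_cong'[OF refl])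
    show "(\<lambda>b. (?\<chi> (\<tau> ?i b) \<otimes> Y.coord B y b) \<odot>\<^sub>Y b) \<in> D \<rightarrow> carrier Y" using cK[OF y] DY by auto
    fix b assume b: "b \<in> D"
    have k: "?\<chi> (\<tau> ?i b) \<otimes> Y.coord B y b \<in> carrier K" using cK[OF y b] by simp
    show "\<tau> g ((?\<chi> (\<tau> ?i b) \<otimes> Y.coord B y b) \<odot>\<^sub>Y \<tau> ?i b) = (?\<chi> (\<tau> ?i b) \<otimes> Y.coord B y b) \<odot>\<^sub>Y b"
     unfolding Y.homD(3)[OF Yact_hom[OF SN[OF g]] k Yact_closed[OF SN[OF gi] DY[OF b]]] Yact_inv(2)[OF SN[OF g] DY[OF b]] ..
   qed
   finally show ?thesis .
  qed
  have tt: "(?\<chi> (\<tau> (iG g) b) \<otimes> Y.coord B y b) \<odot>\<^sub>Y b \<in> carrier Y" if "b \<in> D" for g b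
   using cK[OF y that] DY[OF that] by simp
  have "coset_sum Y G S Q (\<lambda>g. \<tau> g (\<alpha> (\<tau> (iG g) y)))
    = (\<Oplus>\<^bsub>Y\<^esub>C\<in>?Z. \<Oplus>\<^bsub>Y\<^esub>b\<in>D. (?\<chi> (\<tau> (iG (?r C)) b) \<otimes> Y.coord B y b) \<odot>\<^sub>Y b)"
   unfolding coset_sum_def using step[OF rS] tt by (intro Y.M.finsum_cong' Y.M.finsum_closed) auto
  also have "... = (\<Oplus>\<^bsub>Y\<^esub>b\<in>D. \<Oplus>\<^bsub>Y\<^esub>C\<in>?Z. (?\<chi> (\<tau> (iG (?r C)) b) \<otimes> Y.coord B y b) \<odot>\<^sub>Y b)"
   by (rule Y.M.finsum_swap[OF finZ finD tt])
  also have "... = (\<Oplus>\<^bsub>Y\<^esub>b\<in>D. Y.coord B y b \<odot>\<^sub>Y b)"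
  proof (rule Y.M.finsum_cong'[OF refl])
   show "(\<lambda>b. Y.coord B y b \<odot>\<^sub>Y b) \<in> D \<rightarrow> carrier Y" using cK[OF y] DY by auto
   fix b assume b: "b \<in> D"
   from bspec[OF \<Theta> b] obtain C0 where C0': "C0 \<in> ?Z" "\<forall>C\<in>?Z. \<tau> (iG (?r C)) b \<in> \<Theta> \<longleftrightarrow> C = C0" ..
   note C0 = C0'(1) bspec[OF C0'(2)]
   have cb: "Y.coord B y b \<odot>\<^sub>Y b \<in> carrier Y" using cK[OF y b] DY[OF b] by simp
   have "(\<Oplus>\<^bsub>Y\<^esub>C\<in>?Z. (?\<chi> (\<tau> (iG (?r C)) b) \<otimes> Y.coord B y b) \<odot>\<^sub>Y b)
     = (\<Oplus>\<^bsub>Y\<^esub>C\<in>?Z. if C0 = C then Y.coord B y b \<odot>\<^sub>Y b else \<zero>\<^sub>Y)"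
    using C0(2) cK[OF y b] DY[OF b] by (intro Y.M.finsum_cong') auto
   also have "... = Y.coord B y b \<odot>\<^sub>Y b"
    using Y.M.finsum_singleton[OF C0(1) finZ, of "\<lambda>_. Y.coord B y b \<odot>\<^sub>Y b"] cb by simp
   finally show "(\<Oplus>\<^bsub>Y\<^esub>C\<in>?Z. (?\<chi> (\<tau> (iG (?r C)) b) \<otimes> Y.coord B y b) \<odot>\<^sub>Y b) = Y.coord B y b \<odot>\<^sub>Y b" .
  qed
  finally show ?thesis by simp
 qed
 then show ?thesis using \<alpha> by blast
qed

end

context modular_rep begin

lemma trace_sum_fixed:
 assumes "subgroup R G" "card R = p ^ k" "perm_basis R B"
 shows "trM R \<subseteq> fixM R"
 unfolding trace_sum_eq[OF assms] by (auto simp: negl_def)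

lemma brauer_indD:
 assumes "brauer_ind R" "subspace K A M" "subspace K B M" "A \<inter> B = trM R"
  "A <+>\<^bsub>M\<^esub> B = fixM R"
  "!!c a. c \<in> centralizer G R ==> a \<in> A ==> \<rho> c a \<in> A" "!!c b. c \<in> centralizer G R ==> b \<in> B ==> \<rho> c b \<in> B"
 shows "A = trM R \<or> B = trM R"
 using assms unfolding brauer_ind_def by (metis (no_types))

lemma conj_set_centralizer:
 assumes R: "R \<subseteq> carrier G" and c: "c \<in> centralizer G R"
 shows "conj_set c R = R"
proof -
 have cG: "c \<in> carrier G" using c by (simp add: centralizer_def)
 have "c \<star> u \<star> iG c = u" if u: "u \<in> R" for u
 proof -
  have "u \<in> carrier G" using u R by blast
  moreover have "c \<star> u = u \<star> c" using c u by (simp add: centralizer_def)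
  ultimately show ?thesis using cG by (simp add: G.m_assoc)
 qed
 then show ?thesis by (simp add: conj_set_def)
qed

end

section \<open>Stabilisers in a complement on which the functional vanishes\<close>

context scott_control_brauer begin

lemma fY_add: "y \<in> carrier Y ==> z \<in> carrier Y ==> fY (y \<oplus>\<^sub>Y z) = fY y \<oplus> fY z"
 and fY_closed: "y \<in> carrier Y ==> fY y \<in> carrier K"
 using Y.homD(1,2)[OF fY_hom] by auto

lemma fY_m0: "fY (pr m0) ~= \<zero>" using fY_pr[OF m0F] f_m0 by simp

lemma GN [simp]: "G(|carrier := N|)(|carrier := H|) = G(|carrier := H|)" by simp

text \<open>A stabiliser \<open>R\<close> larger than \<open>Q\<close> would split \<open>M(R)\<close> over \<open>C\<^sub>G(R)\<close> compatibly with \<open>e\<close>.\<close>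

lemma stabiliser_eq:
 assumes S: "subgroup S G" "card S = p ^ k" "Q \<subseteq> S" "S \<subseteq> N" and H: "S \<subseteq> H" "CQ \<subseteq> H"
  and e: "e \<in> Y.endos H" "!!y. y \<in> carrier Y ==> e (e y) = e y" "!!y. y \<in> carrier Y ==> fY (e y) = \<zero>"
  and B: "Y.perm_basis S B" and IH: "!!R j. subgroup R G ==> Q \<subset> R ==> card R = p ^ j ==> brauer_ind R"
  and b: "b \<in> B" "e b = b" and g: "g \<in> S" "\<tau> g b = b"
 shows "g \<in> Q"
proof (rule ccontr)
 assume gQ: "g \<notin> Q"
 note Bb = Y.perm_basisD[OF B]
 note ee = Y.endosD[OF e(1)]
 have SN: "x \<in> N" if "x \<in> S" for x using that S(4) by blast
 have bY: "b \<in> carrier Y" using Bb(3)[OF b(1)] .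
 define R where "R = {x \<in> S. \<tau> x b = b}"
 have RS: "R \<subseteq> S" by (auto simp: R_def)
 have RN: "R \<subseteq> N" using RS S(4) by blast
 have RG: "R \<subseteq> carrier G" using RN NG by blast
 have QR: "Q \<subseteq> R" using S(3) Yact_Q[OF _ bY] by (auto simp: R_def)
 have RH: "x \<in> H" if "x \<in> R" for x using that RS H(1) by blast
 have Rs: "subgroup R G"
 proof (rule G.subgroupI[OF RG])
  show "R ~= {}" using QR subgroup.one_closed[OF Qsub] by blast
  show "iG a \<in> R" if "a \<in> R" for a
   using that subgroup.m_inv_closed[OF S(1)] Yact_inv(1)[OF SN bY, of a] by (simp add: R_def)
  show "a \<star> c \<in> R" if "a \<in> R" "c \<in> R" for a c
   using that subgroup.m_closed[OF S(1)] Yact_mult[OF SN SN bY, of a c] by (simp add: R_def)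
 qed
 have finS: "finite S" using finite_subset[OF subgroup.subset[OF S(1)] finite_group] .
 have "card R dvd p ^ k" using G.card_cosets[OF Rs S(1) RS finS] S(2) by (metis dvd_triv_right)
 then obtain j where j: "card R = p ^ j" using divides_primepow_nat[OF prime] by blast
 have "R ~= Q" using g gQ by (auto simp: R_def)
 then have bi: "brauer_ind R" using IH[OF Rs _ j] QR by blast
 obtain B0 where B0: "perm_basis R B0" using has_perm[OF Rs j] by blast
 note B0Q = perm_basis_mono[OF B0 QR]
 have RsN: "subgroup R (G(|carrier := N|))" by (rule subgroup_N[OF Rs RN])
 note YB0 = Y_perm_basis[OF B0 Rs QR RN]
 \<comment> \<open>The trace subspace of \<open>R\<close> inside \<open>M(Q)\<close>. By
   \<open>iff\<close> and \<open>lift\<close> below, \<open>pr\<close> matches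
   \<open>R\<close>-fixed vectors modulo traces in \<open>M\<close> with those in
   \<open>M(Q)\<close>.\<close>
 define NR where "NR = Y.negl R (pr ` fixed_set Q B0 \<rho>)"
 let ?F = "fixM R" and ?T = "trM R"
 have NRs: "subspace K NR Y" unfolding NR_def by (rule Y.negl_subspace[OF RsN YB0])
 note NRD = Y.subspaceD[OF NRs]
 have Fs: "subspace K ?F M" by (rule fixed_points_subspace[OF RG])
 note FD = subspaceD[OF Fs]
 have FF: "m \<in> F" if "m \<in> ?F" for m using that QR by (auto simp: fixed_points_def)
 have prF: "pr m \<in> carrier Y" if "m \<in> ?F" for m using pr_closed[OF FF[OF that]] .
 have iff: "pr m \<in> NR \<longleftrightarrow> m \<in> ?T" if "m \<in> ?F" for m
  unfolding NR_def by (rule Y_negl_iff[OF B0 Rs j QR RN that])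
 have TF': "?T \<subseteq> ?F" by (rule trace_sum_fixed[OF Rs j B0])
 have lift: "\<exists>m\<in>?F. pr m = y" if y: "y \<in> carrier Y" "!!x. x \<in> R ==> \<tau> x y = y" for y
 proof -
  have "y \<in> fixed_points Y \<tau> R" using y by (simp add: fixed_points_def)
  then show ?thesis by (rule Y_fixed_lift[OF B0 Rs QR RN]) blast
 qed
 have eNR: "e y \<in> NR" if "y \<in> NR" for y
  using Y.equivariant_negl[OF RsN j YB0 ee(1) ee(7)[OF RH]] that unfolding NR_def by blast
 have eF: "\<tau> x (e (pr m)) = e (pr m)" if "m \<in> ?F" "x \<in> R" for x m
  using ee(7)[OF RH[OF that(2)] prF[OF that(1)]] act_pr[of x m] that RN FF[OF that(1)] by (auto simp: fixed_points_def)
 have dd: "y \<ominus>\<^sub>Y z \<in> carrier Y" if "y \<in> carrier Y" "z \<in> carrier Y" for y z using that by simp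
 define e' where "e' y = y \<ominus>\<^sub>Y e y" for y
 have e'h: "e' \<in> module_hom K Y Y" unfolding e'_def by (rule Y.hom_sub[OF Y.vs_self Y.hom_id ee(1)])
 note e'D = Y.homD[OF e'h]
 have comp: "subspace K {m \<in> ?F. h (pr m) \<in> NR} M" if h: "h \<in> module_hom K Y Y" for h
 proof (rule subspaceI)
  note hh = Y.homD[OF h]
  show "{m \<in> ?F. h (pr m) \<in> NR} \<subseteq> carrier M" using FD(1) by blast
  have "pr \<zero>\<^sub>M = \<zero>\<^sub>Y" using pr_zero_iff[OF subspaceD(3)[OF F_sub]] subspaceD(3)[OF T_sub] by simp
  then show "\<zero>\<^sub>M \<in> {m \<in> ?F. h (pr m) \<in> NR}" using FD(3) Y.hom_zero[OF Y.vs_self h] NRD(3) by simp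
  show "u \<oplus>\<^sub>M v \<in> {m \<in> ?F. h (pr m) \<in> NR}"
   if "u \<in> {m \<in> ?F. h (pr m) \<in> NR}" "v \<in> {m \<in> ?F. h (pr m) \<in> NR}" for u v
   using that FD(4) NRD(4) pr_add[OF FF FF] hh(2)[OF prF prF] by simp
  show "c \<odot>\<^sub>M u \<in> {m \<in> ?F. h (pr m) \<in> NR}"
   if "c \<in> carrier K" "u \<in> {m \<in> ?F. h (pr m) \<in> NR}" for c u
   using that FD(5) NRD(5) pr_smult[OF _ FF] hh(3)[OF _ prF] by simp
 qed
 have CC: "centralizer G R \<subseteq> CQ" by (rule G.centralizer_antimono[OF QR])
 have NRlift: "\<exists>w\<in>?T. pr w = y" if y: "y \<in> NR" for y
 proof -
  have "y \<in> carrier Y" "!!x. x \<in> R ==> \<tau> x y = y" using y by (auto simp: NR_def Y.negl_def fixed_points_def)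
  then obtain w where w: "w \<in> ?F" "pr w = y" using lift by blast
  then show ?thesis using iff[OF w(1)] y by blast
 qed
 have stab: "\<rho> c m \<in> {m \<in> ?F. h (pr m) \<in> NR}" if c: "c \<in> centralizer G R" and m: "m \<in> {m \<in> ?F. h (pr m) \<in> NR}"
  and h: "!!x y. x \<in> centralizer G R ==> y \<in> carrier Y ==> h (\<tau> x y) = \<tau> x (h y)" for h c m
 proof -
  have cN: "c \<in> N" using c CC CN by blast
  note cR = conj_set_centralizer[OF RG c]
  have mF: "m \<in> ?F" "h (pr m) \<in> NR" using m by simp_all
  have stF: "\<rho> c w \<in> ?F" if "w \<in> ?F" for w
   using fixed_points_conj[OF RG NG[OF cN] FD(2)[OF that]] that unfolding cR by simp
  obtain w where w: "w \<in> ?T" "pr w = h (pr m)" using NRlift[OF mF(2)] by blast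
  have wF: "w \<in> ?F" using w(1) TF' by blast
  have "\<rho> c w \<in> ?T" using trace_sum_conj[OF Rs j B0 NG[OF cN]] w(1) unfolding cR by blast
  then have "pr (\<rho> c w) \<in> NR" using iff[OF stF[OF wF]] by simp
  moreover have "h (pr (\<rho> c m)) = pr (\<rho> c w)"
   unfolding act_pr[OF cN FF[OF mF(1)], symmetric] act_pr[OF cN FF[OF wF], symmetric] h[OF c prF[OF mF(1)]] w(2) ..
  ultimately show ?thesis using stF[OF mF(1)] by simp
 qed
 \<comment> \<open>The parts of \<open>M(R)\<close> on which \<open>e\<close> acts as 0 and as the
   identity, pulled back to \<open>M\<close>.\<close>
 let ?A = "{m \<in> ?F. e (pr m) \<in> NR}" and ?B = "{m \<in> ?F. e' (pr m) \<in> NR}"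
 have e'eq: "e' (\<tau> x y) = \<tau> x (e' y)" if x: "x \<in> H" and xN: "x \<in> N" and y: "y \<in> carrier Y" for x y
  unfolding e'_def ee(7)[OF x y] by (rule Y.hom_diff[OF Y.vs_self Yact_hom[OF xN] y ee(2)[OF y], symmetric])
 have int: "?A \<inter> ?B = ?T"
 proof (intro equalityI subsetI)
  fix m assume m: "m \<in> ?A \<inter> ?B"
  then have mF: "m \<in> ?F" by blast
  have "e' (pr m) \<oplus>\<^sub>Y e (pr m) = pr m" unfolding e'_def using prF[OF mF] ee(2) by simp
  moreover have "e' (pr m) \<oplus>\<^sub>Y e (pr m) \<in> NR" using NRD(4) m by blast
  ultimately show "m \<in> ?T" using iff[OF mF] by simp
 next
  fix m assume m: "m \<in> ?T"
  then have mF: "m \<in> ?F" using TF' by blast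
  have n: "pr m \<in> NR" using iff[OF mF] m by simp
  have "e' (pr m) \<in> NR" unfolding e'_def by (rule NRD(7)[OF n eNR[OF n]])
  then show "m \<in> ?A \<inter> ?B" using mF eNR[OF n] by blast
 qed
 have sum: "?A <+>\<^bsub>M\<^esub> ?B = ?F"
 proof (intro equalityI subsetI)
  fix m assume "m \<in> ?A <+>\<^bsub>M\<^esub> ?B"
  then show "m \<in> ?F" unfolding set_add_mem using FD(4) by blast
 next
  fix m assume m: "m \<in> ?F"
  obtain m1 where m1: "m1 \<in> ?F" "pr m1 = e (pr m)" using lift[OF ee(2)[OF prF[OF m]] eF[OF m]] by blast
  have m2: "m \<ominus>\<^sub>M m1 \<in> ?F" using FD(7)[OF m m1(1)] .
  have "e' (pr m1) = \<zero>\<^sub>Y" unfolding e'_def m1(2) using e(2)[OF prF[OF m]] ee(2)[OF prF[OF m]] by simp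
  then have 1: "m1 \<in> ?B" using m1(1) NRD(3) by simp
  have "e (pr (m \<ominus>\<^sub>M m1)) = e (pr m) \<ominus>\<^sub>Y e (e (pr m))"
   unfolding pr_diff[OF FF[OF m] FF[OF m1(1)]] m1(2) using ee(5) prF[OF m] ee(2) by simp
  also have "... = \<zero>\<^sub>Y" using e(2)[OF prF[OF m]] ee(2)[OF prF[OF m]] by simp
  finally have 2: "m \<ominus>\<^sub>M m1 \<in> ?A" using m2 NRD(3) by simp
  have "m = (m \<ominus>\<^sub>M m1) \<oplus>\<^sub>M m1" using FD(2)[OF m] FD(2)[OF m1(1)] by simp
  then show "m \<in> ?A <+>\<^bsub>M\<^esub> ?B" unfolding set_add_mem using 1 2 by blast
 qed
 \<comment> \<open>\<open>C\<^sub>G(R)\<close> lies in \<open>C\<^sub>G(Q)\<close> and so in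
   \<open>H\<close>; hence \<open>e\<close> respects the action that the induction hypothesis refers
   to.\<close>
 have eeq: "e (\<tau> x y) = \<tau> x (e y)" if "x \<in> centralizer G R" "y \<in> carrier Y" for x y
  using ee(7)[OF _ that(2)] that(1) CC H(2) by blast
 have e'eq': "e' (\<tau> x y) = \<tau> x (e' y)" if "x \<in> centralizer G R" "y \<in> carrier Y" for x y
  using e'eq[OF _ _ that(2)] that(1) CC CN H(2) by blast
 have "?A = ?T \<or> ?B = ?T"
 proof -
  have 1: "\<rho> c a \<in> ?A" if "c \<in> centralizer G R" "a \<in> ?A" for c a by (rule stab[OF that eeq])
  have 2: "\<rho> c a \<in> ?B" if "c \<in> centralizer G R" "a \<in> ?B" for c a by (rule stab[OF that e'eq'])
  show ?thesis by (rule brauer_indD[OF bi comp[OF ee(1)] comp[OF e'h] int sum 1 2])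
 qed
 \<comment> \<open>If \<open>e\<close> were the identity on \<open>M(R)\<close>, then
   \<open>f\<close> would vanish on all \<open>R\<close>-fixed vectors, because \<open>fY\<close>
   vanishes after \<open>e\<close>. Then \<open>R\<close> is not conjugate into \<open>P\<close>,
   and \<open>M(R)\<close> is 0 anyway.\<close>
 moreover have "?B = ?T" if AT: "?A = ?T"
 proof -
  have fT: "f m = \<zero>" if m: "m \<in> ?T" for m
   using invariant_functional_negl[OF Rs j B0 f_hom f_act] m RG unfolding trace_sum_eq[OF Rs j B0] by blast
  have fF: "f m = \<zero>" if m: "m \<in> ?F" for m
  proof -
   obtain m1 where m1: "m1 \<in> ?F" "pr m1 = e (pr m)" using lift[OF ee(2)[OF prF[OF m]] eF[OF m]] by blast
   have m2: "m \<ominus>\<^sub>M m1 \<in> ?F" using FD(7)[OF m m1(1)] .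
   have "e (pr (m \<ominus>\<^sub>M m1)) = e (pr m) \<ominus>\<^sub>Y e (e (pr m))"
    unfolding pr_diff[OF FF[OF m] FF[OF m1(1)]] m1(2) using ee(5) prF[OF m] ee(2) by simp
   also have "... = \<zero>\<^sub>Y" using e(2)[OF prF[OF m]] ee(2)[OF prF[OF m]] by simp
   finally have "m \<ominus>\<^sub>M m1 \<in> ?A" using m2 NRD(3) by simp
   then have "f (m \<ominus>\<^sub>M m1) = \<zero>" using fT unfolding AT by blast
   moreover have "f m1 = \<zero>" using fY_pr[OF FF[OF m1(1)]] m1(2) e(3)[OF prF[OF m]] by simp
   ultimately have "f ((m \<ominus>\<^sub>M m1) \<oplus>\<^sub>M m1) = \<zero>"
    using homD(2)[OF f_hom FD(2)[OF m2] FD(2)[OF m1(1)]] by simp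
   then show ?thesis using FD(2)[OF m] FD(2)[OF m1(1)] by simp
  qed
  have "\<not> conj_set x R \<subseteq> P" if x: "x \<in> carrier G" for x
  proof
   assume "conj_set x R \<subseteq> P"
   then show False by (rule f_nonzero_fixed[OF Rs x]) (use fF in blast)
  qed
  then have "?F = ?T" by (rule fixed_points_eq_trace_sum[OF Rs j])
  then show ?thesis using int by blast
 qed
 ultimately have BT: "?B = ?T" by blast
 \<comment> \<open>\<open>b\<close> is fixed by \<open>R\<close> and by \<open>e\<close>, so it lies
   in the part just shown to be 0; but as an \<open>R\<close>-fixed basis element it has coefficient
   1 at itself.\<close>
 obtain m where m: "m \<in> ?F" "pr m = b" using lift[OF bY] by (auto simp: R_def)
 have "e' (pr m) = \<zero>\<^sub>Y" unfolding e'_def m(2) b(2) using bY by simp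
 then have "m \<in> ?B" using m(1) NRD(3) by simp
 then have bNR: "b \<in> NR" using iff[OF m(1)] m(2) BT by simp
 have BR: "Y.perm_basis R B" using B RS by (auto simp: Y.perm_basis_def)
 have "NR = Y.negl R B"
  unfolding NR_def using Y.trace_sum_eq[OF RsN j YB0] Y.trace_sum_eq[OF RsN j BR] by simp
 moreover have "b \<in> fixed_set R B \<tau>" using b(1) by (simp add: fixed_set_def R_def)
 ultimately have "Y.coord B b b = \<zero>" using bNR unfolding Y.negl_def by blast
 then show False using Y.coord_basis[OF Bb(2,1) b(1) b(1)] by simp
qed

end

lemma (in vectorspace) diff_zero_right [simp]: "v \<in> carrier V ==> v \<ominus>\<^bsub>V\<^esub> \<zero>\<^bsub>V\<^esub> = v"
 by (simp add: diff_eq_iff)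

context modular_rep begin

lemma direct_sum_projection_ex:
 assumes "S \<subseteq> carrier G" "dirsum S U W"
 shows "\<exists>e\<in>endos S. (\<forall>v\<in>carrier M. e v \<in> U) \<and> (\<forall>v\<in>carrier M. v \<ominus>\<^sub>M e v \<in> W) \<and>
  (\<forall>u\<in>U. e u = u) \<and> (\<forall>w\<in>W. e w = \<zero>\<^sub>M)"
proof (rule direct_sum_projection[OF assms])
 fix e assume "e \<in> module_hom K M M" "!!v. v \<in> carrier M ==> e v \<in> U"
  "!!v. v \<in> carrier M ==> v \<ominus>\<^sub>M e v \<in> W" "!!u. u \<in> U ==> e u = u" "!!w. w \<in> W ==> e w = \<zero>\<^sub>M"
  "equivariant S e"
 then show ?thesis by (intro bexI[of _ e]) (auto simp: endos_def)
qed

lemma perm_basis_split_ex: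
 assumes "subgroup S G" "card S = p ^ n" "perm_basis S B" "dirsum S U W"
 shows "\<exists>B'. perm_basis S B' \<and> B' \<subseteq> U \<union> W"
 by (rule perm_basis_split[OF assms]) blast

end

section \<open>Minimal summands of \<open>M(Q)\<close> and averaging\<close>

context scott_control_brauer begin

lemma conj_endos:
 assumes H: "H \<subseteq> N" "!!g h. g \<in> N ==> h \<in> H ==> iG g \<star> h \<star> g \<in> H"
  and g: "g \<in> N" and j: "j \<in> Y.endos H"
 shows "(\<lambda>y. \<tau> g (j (\<tau> (iG g) y))) \<in> Y.endos H"
proof (rule Y.endosI)
 note jj = Y.endosD[OF j]
 note g' = N_inv[OF g]
 show "(\<lambda>y. \<tau> g (j (\<tau> (iG g) y))) \<in> module_hom K Y Y"
  by (rule Y.homI) (use Y.homD[OF Yact_hom[OF g]] Y.homD[OF Yact_hom[OF g']] jj(2-4) in auto)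
 fix h y assume h: "h \<in> H" and y: "y \<in> carrier Y"
 let ?h = "iG g \<star> h \<star> g" and ?i = "iG g"
 have hN: "h \<in> N" "?h \<in> N" and h': "?h \<in> H" using h H g by blast+
 have G': "g \<in> carrier G" "h \<in> carrier G" using NG g hN by blast+
 have yi: "\<tau> ?i y \<in> carrier Y" using Yact_closed[OF g' y] .
 have ji: "j (\<tau> ?i y) \<in> carrier Y" using jj(2)[OF yi] .
 have "\<tau> ?i (\<tau> h y) = \<tau> (?i \<star> h) y" by (rule Yact_mult[OF g' hN(1) y, symmetric])
 also have "?i \<star> h = ?h \<star> ?i" using G' by (simp add: G.m_assoc)
 also have "\<tau> (?h \<star> ?i) y = \<tau> ?h (\<tau> ?i y)" by (rule Yact_mult[OF hN(2) g' y])
 finally have 1: "\<tau> ?i (\<tau> h y) = \<tau> ?h (\<tau> ?i y)" .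
 have "\<tau> g (\<tau> ?h (j (\<tau> ?i y))) = \<tau> (g \<star> ?h) (j (\<tau> ?i y))" by (rule Yact_mult[OF g hN(2) ji, symmetric])
 also have "g \<star> ?h = h \<star> g" using G' by (simp add: G.m_assoc[symmetric])
 also have "\<tau> (h \<star> g) (j (\<tau> ?i y)) = \<tau> h (\<tau> g (j (\<tau> ?i y)))" by (rule Yact_mult[OF hN(1) g ji])
 finally show "\<tau> g (j (\<tau> ?i (\<tau> h y))) = \<tau> h (\<tau> g (j (\<tau> ?i y)))" unfolding 1 jj(7)[OF h' yi] .
qed

text \<open>The common core of both cases, with \<open>S\<close> a p-subgroup of index prime to
  \<open>p\<close> in \<open>N\<close>. A minimal summand \<open>A\<close> on which
  \<open>fY\<close> does not vanish turns out to be all of \<open>Y\<close>. Since \<open>fY\<close>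
  is nonzero on one of \<open>U\<close> and \<open>W\<close>, that one is everything.\<close>

lemma summand_trivial:
 assumes H: "CQ \<subseteq> H" "S \<subseteq> H" "H \<subseteq> N" "!!g h. g \<in> N ==> h \<in> H ==> iG g \<star> h \<star> g \<in> H"
  and S: "subgroup S G" "card S = p ^ k" "Q \<subseteq> S" "coprime (card (cosets G N S)) p"
  and IH: "!!R j. subgroup R G ==> Q \<subset> R ==> card R = p ^ j ==> brauer_ind R"
  and ds: "dirsumY H U W"
 shows "U = {\<zero>\<^sub>Y} \<or> W = {\<zero>\<^sub>Y}"
proof -
 let ?ds = "dirsumY H"
 note dsD = Y.is_direct_sumD[unfolded GN] and dsI = Y.is_direct_sumI[unfolded GN]
 have HN': "H \<subseteq> carrier (G(|carrier := N|))" using H(3) by simp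
 have SNs: "S \<subseteq> N" using H(2,3) by blast
 have SN: "x \<in> N" if "x \<in> S" for x using that SNs by blast
 have SN': "subgroup S (G(|carrier := N|))" by (rule subgroup_N[OF S(1) SNs])
 have HN: "x \<in> N" if "x \<in> H" for x using that H(3) by blast
 \<comment> \<open>The summands over \<open>H\<close> that are seen by \<open>fY\<close>; finite
   dimension provides a minimal one.\<close>
 define \<A> where "\<A> = {A. \<exists>B. ?ds A B \<and> (\<exists>a\<in>A. fY a ~= \<zero>)}"
 have zero_act: "\<tau> g \<zero>\<^sub>Y = \<zero>\<^sub>Y" if "g \<in> N" for g by (rule Y.hom_zero[OF Y.vs_self Yact_hom[OF that]])
 have whole: "?ds (carrier Y) {\<zero>\<^sub>Y}"
 proof (rule dsI)
  show "subspace K {\<zero>\<^sub>Y} Y" by (rule Y.subspaceI) auto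
  show "carrier Y <+>\<^bsub>Y\<^esub> {\<zero>\<^sub>Y} = carrier Y"
  proof (intro equalityI subsetI)
   fix x assume x: "x \<in> carrier Y"
   then have "x = x \<oplus>\<^sub>Y \<zero>\<^sub>Y" by simp
   then show "x \<in> carrier Y <+>\<^bsub>Y\<^esub> {\<zero>\<^sub>Y}" unfolding Y.set_add_mem using x by blast
  qed (auto simp: Y.set_add_mem)
 qed (use Y.subspace_carrier Yact_closed[OF HN] zero_act[OF HN] in auto)
 have "carrier Y \<in> \<A>" unfolding \<A>_def using whole pr_closed[OF m0F] fY_m0 by blast
 let ?R = "{(U, W). subspace K U Y \<and> subspace K W Y \<and> U \<subset> W}"
 have "\<exists>A\<in>\<A>. \<forall>A'. (A', A) \<in> ?R \<longrightarrow> A' \<notin> \<A>"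
 proof (rule wfE_min[OF Y.subspace_wf[OF Y.fin_dim] \<open>carrier Y \<in> \<A>\<close>])
  fix z assume "z \<in> \<A>" "!!y. (y, z) \<in> ?R ==> y \<notin> \<A>"
  then show ?thesis by (intro bexI[of _ z] allI impI)
 qed
 then obtain A where A\<A>: "A \<in> \<A>" and Amin: "\<forall>A'. (A', A) \<in> ?R \<longrightarrow> A' \<notin> \<A>" by (elim bexE)
 obtain B a0 where dsA: "?ds A B" and a0: "a0 \<in> A" "fY a0 ~= \<zero>" using A\<A> unfolding \<A>_def by blast
 have min: "\<forall>a\<in>A'. fY a = \<zero>" if d: "?ds A' B'" "A' \<subset> A" for A' B'
  using spec[OF Amin, of A'] dsD(1)[OF d(1)] dsD(1)[OF dsA] d unfolding \<A>_def by blast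
 note AD = dsD[OF dsA]
 have dsB: "?ds B A" by (rule Y.is_direct_sum_commute[unfolded GN, OF dsA])
 have AY: "a \<in> carrier Y" if "a \<in> A" for a using Y.subspaceD(2)[OF AD(1) that] .
 have BY: "b \<in> carrier Y" if "b \<in> B" for b using Y.subspaceD(2)[OF AD(2) that] .
 obtain e where e: "e \<in> Y.endos H" and e1: "\<forall>v\<in>carrier Y. e v \<in> B" and e2: "\<forall>v\<in>carrier Y. v \<ominus>\<^sub>Y e v \<in> A"
  and e3: "\<forall>u\<in>B. e u = u" and e4: "\<forall>w\<in>A. e w = \<zero>\<^sub>Y"
  using Y.direct_sum_projection_ex[unfolded GN, OF HN' dsB] by (elim bexE conjE) (rule that)
 note ee = Y.endosD[OF e]
 have eA: "v \<in> A" if "v \<in> carrier Y" "e v = \<zero>\<^sub>Y" for v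
  using bspec[OF e2 that(1)] that by simp
 have eid: "e (e v) = e v" if "v \<in> carrier Y" for v using bspec[OF e3 bspec[OF e1 that]] .
 \<comment> \<open>\<open>fY\<close> after \<open>1 - e\<close> is invariant under
   \<open>CQ\<close>, hence a multiple of \<open>fY\<close>. Comparison at \<open>a0\<close>, which
   \<open>e\<close> kills, gives the factor 1, so \<open>fY\<close> vanishes after
   \<open>e\<close>.\<close>
 have fe: "fY (e y) = \<zero>" if y: "y \<in> carrier Y" for y
 proof -
  define V where "V y = fY (y \<ominus>\<^sub>Y e y)" for y
  note dh = Y.hom_sub[OF Y.vs_self Y.hom_id ee(1)]
  note dd = Y.homD[OF dh]
  have Vh: "V \<in> module_hom K Y (trivial_module K)"
   unfolding V_def by (rule Y.homI) (use dd Y.homD[OF fY_hom] in auto)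
  have Vc: "V (\<tau> c y) = V y" if c: "c \<in> CQ" and y: "y \<in> carrier Y" for c y
  proof -
   have cN: "c \<in> N" and cH: "c \<in> H" using c CN H(1) by blast+
   have "\<tau> c y \<ominus>\<^sub>Y e (\<tau> c y) = \<tau> c (y \<ominus>\<^sub>Y e y)"
    unfolding ee(7)[OF cH y] by (rule Y.hom_diff[OF Y.vs_self Yact_hom[OF cN] y ee(2)[OF y], symmetric])
   then show ?thesis unfolding V_def using fY_act[OF cN dd(1)[OF y]] by simp
  qed
  have "\<exists>c\<in>carrier K. \<forall>y\<in>carrier Y. V y = c \<otimes> fY y" by (rule functional_unique[OF Vh Vc])
  then obtain c where c: "c \<in> carrier K" and Vc: "\<forall>y\<in>carrier Y. V y = c \<otimes> fY y" by (elim bexE) (rule that)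
  have fa: "fY a0 \<in> carrier K" using fY_closed[OF AY[OF a0(1)]] .
  have "V a0 = fY a0" unfolding V_def using e4 a0(1) AY[OF a0(1)] by simp
  then have "c \<otimes> fY a0 = \<one> \<otimes> fY a0" using Vc AY[OF a0(1)] fa by simp
  then have c1: "c = \<one>" using m_rcancel[OF a0(2) fa c R.one_closed] by simp
  have y1: "y \<ominus>\<^sub>Y e y \<in> carrier Y" using dd(1)[OF y] .
  have "fY y = fY ((y \<ominus>\<^sub>Y e y) \<oplus>\<^sub>Y e y)" using y ee(2)[OF y] by simp
  also have "... = fY (y \<ominus>\<^sub>Y e y) \<oplus> fY (e y)" by (rule fY_add[OF y1 ee(2)[OF y]])
  also have "fY (y \<ominus>\<^sub>Y e y) = fY y" using bspec[OF Vc y] c1 fY_closed[OF y] unfolding V_def by simp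
  finally show ?thesis using R.r_right_minus_eq[of "fY y" "fY y"] fY_closed[OF y] fY_closed[OF ee(2)[OF y]]
   by (metis R.add.l_cancel_one')
 qed
 have nil: "\<exists>n. \<forall>v\<in>carrier Y. ((\<lambda>v. j v \<ominus>\<^sub>Y e (j v)) ^^ n) v = \<zero>\<^sub>Y"
  if j: "j \<in> Y.endos H" "!!v. v \<in> carrier Y ==> fY (j v) = \<zero>" for j
  by (rule Y.minimal_summand_nilpotent[unfolded GN, OF HN' AD(1) e bspec[OF e2] bspec[OF e4] eA eid
    fY_hom fe AY[OF a0(1)] a0(2) min j])
 obtain B0 where B0: "perm_basis S B0" using has_perm[OF S(1,2)] by blast
 have dsS: "dirsumY S A B"
  using AD H(2) by (intro dsI) blast+
 obtain B' where B': "Y.perm_basis S B'" "B' \<subseteq> A \<union> B"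
  using Y.perm_basis_split_ex[unfolded GN, OF SN' S(2) Y_perm_basis[OF B0 S(1,3) SNs] dsS] by (elim exE conjE) (rule that)
 note Bb = Y.perm_basisD[OF B'(1)]
 let ?D = "B' \<inter> B"
 have exp: "e y = (\<Oplus>\<^bsub>Y\<^esub>b\<in>?D. Y.coord B' y b \<odot>\<^sub>Y b)" if y: "y \<in> carrier Y" for y
 proof -
  have "B' \<subseteq> B \<union> A" using B'(2) by blast
  then show ?thesis by (rule Y.projection_expand[OF Bb(1) _ ee(1) bspec[OF e3] bspec[OF e4] y])
 qed
 have Dst: "\<tau> g b \<in> ?D" if "g \<in> S" "b \<in> ?D" for g b
  using Bb(4)[OF that(1)] AD(4)[of g b] that H(2) by blast
 \<comment> \<open>Basis elements in the complement are fixed by \<open>e\<close>, and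
   \<open>fY\<close> vanishes after \<open>e\<close>, as \<open>stabiliser_eq\<close>
   demands.\<close>
 have st: "g \<in> Q" if g: "g \<in> S" "b \<in> ?D" "\<tau> g b = b" for g b
 proof -
  have "b \<in> B'" "e b = b" using g(2) e3 by blast+
  then show ?thesis
   by (intro stabiliser_eq[OF S(1,2,3) SNs H(2,1) e eid fe B'(1) IH _ _ g(1,3)])
 qed
 have "\<exists>\<alpha>\<in>module_hom K Y Y. \<forall>y\<in>carrier Y. (\<Oplus>\<^bsub>Y\<^esub>b\<in>?D. Y.coord B' y b \<odot>\<^sub>Y b)
   = coset_sum Y G S Q (\<lambda>g. \<tau> g (\<alpha> (\<tau> (iG g) y)))"
  by (rule projection_trace[OF S(1,3) SNs B'(1) Int_lower1 Dst st])
 then obtain \<alpha> where \<alpha>: "\<alpha> \<in> module_hom K Y Y"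
  and \<alpha>': "\<forall>y\<in>carrier Y. (\<Oplus>\<^bsub>Y\<^esub>b\<in>?D. Y.coord B' y b \<odot>\<^sub>Y b) = coset_sum Y G S Q (\<lambda>g. \<tau> g (\<alpha> (\<tau> (iG g) y)))"
  by (elim bexE) (rule that)
 have e\<alpha>: "e y = coset_sum Y G S Q (\<lambda>g. \<tau> g (\<alpha> (\<tau> (iG g) y)))" if "y \<in> carrier Y" for y
  using exp[OF that] bspec[OF \<alpha>' that] by simp
 \<comment> \<open>The average runs over \<open>N/S\<close> rather than \<open>N/H\<close>:
   \<open>e\<close> is a trace from \<open>Q\<close> to \<open>S\<close>, so transitivity turns the
   average into a trace from \<open>Q\<close> to \<open>N\<close>. As \<open>e\<close> commutes with
   \<open>H\<close>, the average is the same.\<close>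
 let ?Z = "cosets G N S" and ?r = "\<lambda>C. SOME x. x \<in> C"
 have finZ: "finite ?Z" using finite_subset[OF subgroup.subset[OF Nsub] finite_group] by (simp add: cosets_def)
 have rN: "?r C \<in> N" if "C \<in> ?Z" for C using G.cosets_rep(2)[OF S(1) Nsub SNs that] .
 have mK: "[(card ?Z)] \<cdot> \<one> \<in> carrier K" by simp
 define c where "c = inv\<^bsub>K\<^esub> ([(card ?Z)] \<cdot> \<one>)"
 have u: "[(card ?Z)] \<cdot> \<one> \<in> Units K" using field_Units mK nat_nonzero[OF S(4)] by simp
 have cK: "c \<in> carrier K" unfolding c_def using u by simp
 have c1: "[(card ?Z)] \<cdot> c = \<one>"
 proof -
  have "[(card ?Z)] \<cdot> c = [(card ?Z)] \<cdot> (\<one> \<otimes> c)" using cK by simp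
  also have "... = ([(card ?Z)] \<cdot> \<one>) \<otimes> c" using cK by (subst R.add_pow_ldistr) auto
  also have "... = \<one>" unfolding c_def using u by simp
  finally show ?thesis .
 qed
 define E where "E C y = \<tau> (?r C) (e (\<tau> (iG (?r C)) y))" for C y
 have Eend: "E C \<in> Y.endos H" if "C \<in> ?Z" for C
  unfolding E_def by (rule conj_endos[OF H(3,4) rN[OF that] e])
 \<comment> \<open>The factor \<open>c\<close> is moved into the map to be traced, so that the
   average itself is a trace.\<close>
 define \<beta> where "\<beta> y = c \<odot>\<^sub>Y \<alpha> y" for y
 have \<beta>: "\<beta> \<in> module_hom K Y Y" unfolding \<beta>_def by (rule Y.hom_smult[OF Y.vs_self \<alpha> cK])
 let ?u = "\<lambda>y. \<Oplus>\<^bsub>Y\<^esub>C\<in>?Z. c \<odot>\<^sub>Y E C y"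
 have ueq: "?u y = coset_sum Y G N Q (\<lambda>g. \<tau> g (\<beta> (\<tau> (iG g) y)))" if y: "y \<in> carrier Y" for y
 proof -
  let ?F = "\<lambda>g. \<tau> g (\<beta> (\<tau> (iG g) y))"
  have \<beta>c: "\<beta> (\<tau> (iG g) y) \<in> carrier Y" if "g \<in> N" for g
   using Y.homD(1)[OF \<beta> Yact_closed[OF N_inv[OF that] y]] .
  have Fc: "?F \<in> N \<rightarrow> carrier Y" using Yact_closed \<beta>c by blast
  \<comment> \<open>\<open>Q\<close> acts trivially on \<open>Y\<close>, so the summand depends only
    on the coset.\<close>
  have Fq: "?F (g \<star> q) = ?F g" if g: "g \<in> N" and q: "q \<in> Q" for g q
  proof -
   have qN: "q \<in> N" using q QN by blast
   have q': "iG q \<in> Q" using subgroup.m_inv_closed[OF Qsub q] .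
   have "iG (g \<star> q) = iG q \<star> iG g" by (rule G.inv_mult_group[OF NG[OF g] NG[OF qN]])
   then have "\<tau> (iG (g \<star> q)) y = \<tau> (iG q) (\<tau> (iG g) y)"
    using Yact_mult[OF N_inv[OF qN] N_inv[OF g] y] by simp
   also have "... = \<tau> (iG g) y" by (rule Yact_Q[OF q' Yact_closed[OF N_inv[OF g] y]])
   finally have 1: "\<tau> (iG (g \<star> q)) y = \<tau> (iG g) y" .
   show ?thesis unfolding 1 Yact_mult[OF g qN \<beta>c[OF g]] Yact_Q[OF q \<beta>c[OF g]] ..
  qed
  have inner: "coset_sum Y G S Q (\<lambda>b. ?F (n \<star> b)) = c \<odot>\<^sub>Y \<tau> n (e (\<tau> (iG n) y))" if n: "n \<in> N" for n
  proof -
   let ?y = "\<tau> (iG n) y"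
   have yY: "?y \<in> carrier Y" using Yact_closed[OF N_inv[OF n] y] .
   have rS: "?r C \<in> S" if "C \<in> cosets G S Q" for C using G.cosets_rep(2)[OF Qsub S(1,3) that] .
   have h: "(\<lambda>w. c \<odot>\<^sub>Y \<tau> n w) \<in> module_hom K Y Y" by (rule Y.hom_smult[OF Y.vs_self Yact_hom[OF n] cK])
   have ac: "\<alpha> (\<tau> (iG b) ?y) \<in> carrier Y" if "b \<in> N" for b
    using Y.homD(1)[OF \<alpha> Yact_closed[OF N_inv[OF that] yY]] .
   have tc: "\<tau> b (\<alpha> (\<tau> (iG b) ?y)) \<in> carrier Y" if "b \<in> N" for b using Yact_closed[OF that ac[OF that]] .
   have st: "?F (n \<star> b) = c \<odot>\<^sub>Y \<tau> n (\<tau> b (\<alpha> (\<tau> (iG b) ?y)))" if b: "b \<in> N" for b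
   proof -
    have "iG (n \<star> b) = iG b \<star> iG n" by (rule G.inv_mult_group[OF NG[OF n] NG[OF b]])
    then have 1: "\<tau> (iG (n \<star> b)) y = \<tau> (iG b) ?y"
     using Yact_mult[OF N_inv[OF b] N_inv[OF n] y] by simp
    have nb: "n \<star> b \<in> N" using subgroup.m_closed[OF Nsub n b] .
    have "?F (n \<star> b) = c \<odot>\<^sub>Y \<tau> (n \<star> b) (\<alpha> (\<tau> (iG b) ?y))"
     unfolding 1 \<beta>_def by (rule Y.homD(3)[OF Yact_hom[OF nb] cK ac[OF b]])
    then show ?thesis unfolding Yact_mult[OF n b ac[OF b]] .
   qed
   have "coset_sum Y G S Q (\<lambda>b. ?F (n \<star> b))
     = (\<Oplus>\<^bsub>Y\<^esub>C\<in>cosets G S Q. c \<odot>\<^sub>Y \<tau> n (\<tau> (?r C) (\<alpha> (\<tau> (iG (?r C)) ?y))))"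
    unfolding coset_sum_def
   proof (rule Y.M.finsum_cong'[OF refl])
    show "(\<lambda>C. c \<odot>\<^sub>Y \<tau> n (\<tau> (?r C) (\<alpha> (\<tau> (iG (?r C)) ?y)))) \<in> cosets G S Q \<rightarrow> carrier Y"
     using Y.homD(1)[OF h tc[OF SN[OF rS]]] by blast
    show "?F (n \<star> ?r C) = c \<odot>\<^sub>Y \<tau> n (\<tau> (?r C) (\<alpha> (\<tau> (iG (?r C)) ?y)))" if "C \<in> cosets G S Q" for C
     by (rule st[OF SN[OF rS[OF that]]])
   qed
   also have "... = c \<odot>\<^sub>Y \<tau> n (coset_sum Y G S Q (\<lambda>b. \<tau> b (\<alpha> (\<tau> (iG b) ?y))))"
    unfolding coset_sum_def using tc[OF SN[OF rS]] by (intro Y.hom_finsum[OF Y.vs_self h, symmetric]) blast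
   finally show ?thesis unfolding e\<alpha>[OF yY] .
  qed
  have "coset_sum Y G N Q ?F = coset_sum Y G N S (\<lambda>n. coset_sum Y G S Q (\<lambda>b. ?F (n \<star> b)))"
   by (rule G.coset_sum_tower[OF Qsub S(1) Nsub S(3) SNs finite_subset[OF subgroup.subset[OF Nsub] finite_group]
     Y.M.abelian_monoid_axioms Fc Fq])
  also have "... = ?u y"
   unfolding coset_sum_def[of _ _ N S]
  proof (rule Y.M.finsum_cong'[OF refl])
   show "(\<lambda>C. c \<odot>\<^sub>Y E C y) \<in> ?Z \<rightarrow> carrier Y" using Y.endosD(2)[OF Eend y] cK by auto
   show "coset_sum Y G S Q (\<lambda>b. ?F (?r C \<star> b)) = c \<odot>\<^sub>Y E C y" if "C \<in> ?Z" for C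
    unfolding E_def by (rule inner[OF rN[OF that]])
  qed
  finally show ?thesis by simp
 qed
 have fE: "fY (E C y) = \<zero>" if C: "C \<in> ?Z" and y: "y \<in> carrier Y" for C y
 proof -
  have "\<tau> (iG (?r C)) y \<in> carrier Y" using Yact_closed[OF N_inv[OF rN[OF C]] y] .
  then show ?thesis unfolding E_def using fY_act[OF rN[OF C] ee(2)] fe by simp
 qed
 have fu: "fY (?u y) = \<zero>" if y: "y \<in> carrier Y" for y
 proof -
  have Ec: "E C y \<in> carrier Y" if "C \<in> ?Z" for C using Y.endosD(2)[OF Eend[OF that] y] .
  have "fY (?u y) = (\<Oplus>C\<in>?Z. fY (c \<odot>\<^sub>Y E C y))"
   using Y.hom_finsum[OF trivial_vectorspace fY_hom, of "\<lambda>C. c \<odot>\<^sub>Y E C y" ?Z] Ec cK by auto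
  also have "... = (\<Oplus>C\<in>?Z. \<zero>)"
   using Y.homD(3)[OF fY_hom cK Ec] fE[OF _ y] cK by (intro R.finsum_cong') auto
  finally show ?thesis by simp
 qed
 \<comment> \<open>\<open>fY\<close> is \<open>N\<close>-invariant and vanishes after every
   conjugate of \<open>e\<close>, hence after their average; so this trace lifts to a nilpotent
   map.\<close>
 have "\<exists>m. \<forall>y\<in>carrier Y. (?u ^^ m) y = \<zero>\<^sub>Y" by (rule trace_nilpotent[OF \<beta> ueq fu])
 then obtain m where m: "\<forall>y\<in>carrier Y. (?u ^^ m) y = \<zero>\<^sub>Y" ..
 \<comment> \<open>Conjugation by the representative turns \<open>(1 - E C) e z\<close> into
   \<open>(1 - e) j'\<close>, where \<open>j'\<close> is the conjugate of \<open>e z\<close>. As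
   \<open>fY\<close> vanishes after \<open>e\<close> and is \<open>N\<close>-invariant, it vanishes
   after \<open>j'\<close>, so that minimality of \<open>A\<close> applies.\<close>
 have nil': "\<exists>n. \<forall>v\<in>carrier Y. ((\<lambda>v. e (z v) \<ominus>\<^sub>Y E C (e (z v))) ^^ n) v = \<zero>\<^sub>Y"
  if C: "C \<in> ?Z" and z: "z \<in> Y.endos H" for C z
 proof -
  let ?g = "?r C" and ?i = "iG (?r C)"
  have g: "?g \<in> N" and i: "?i \<in> N" using rN[OF C] N_inv by blast+
  have ii: "iG ?i = ?g" using NG[OF g] by simp
  let ?j = "\<lambda>v. e (z v)"
  have j: "?j \<in> Y.endos H" by (rule Y.endos_comp[OF e z])
  define j' where "j' y = \<tau> ?i (?j (\<tau> ?g y))" for y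
  have j'E: "j' \<in> Y.endos H" unfolding j'_def using conj_endos[OF H(3,4) i j] unfolding ii .
  have gy: "\<tau> ?g y \<in> carrier Y" if "y \<in> carrier Y" for y using Yact_closed[OF g that] .
  have jgy: "?j (\<tau> ?g y) \<in> carrier Y" if "y \<in> carrier Y" for y using Y.endosD(2)[OF j gy[OF that]] .
  have fj: "fY (j' y) = \<zero>" if y: "y \<in> carrier Y" for y
   unfolding j'_def fY_act[OF i jgy[OF y]] by (rule fe[OF Y.endosD(2)[OF z gy[OF y]]])
  have "\<exists>n. \<forall>v\<in>carrier Y. ((\<lambda>v. j' v \<ominus>\<^sub>Y e (j' v)) ^^ n) v = \<zero>\<^sub>Y" by (rule nil[OF j'E fj])
  then obtain n where n: "\<forall>v\<in>carrier Y. ((\<lambda>v. j' v \<ominus>\<^sub>Y e (j' v)) ^^ n) v = \<zero>\<^sub>Y" ..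
  let ?x = "\<lambda>v. j' v \<ominus>\<^sub>Y e (j' v)" and ?X = "\<lambda>v. ?j v \<ominus>\<^sub>Y E C (?j v)"
  have xE: "?x \<in> Y.endos H" by (rule Y.endos_diff[OF HN' j'E Y.endos_comp[OF e j'E]])
  have step: "?X (\<tau> ?g w) = \<tau> ?g (?x w)" if w: "w \<in> carrier Y" for w
  proof -
   have jw: "j' w \<in> carrier Y" "e (j' w) \<in> carrier Y" using Y.endosD(2)[OF j'E w] ee(2) by blast+
   have 1: "\<tau> ?g (j' w) = ?j (\<tau> ?g w)" unfolding j'_def by (rule Yact_inv(2)[OF g jgy[OF w]])
   have "\<tau> ?g (?x w) = \<tau> ?g (j' w) \<ominus>\<^sub>Y \<tau> ?g (e (j' w))"
    by (rule Y.hom_diff[OF Y.vs_self Yact_hom[OF g] jw])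
   also have "\<tau> ?g (e (j' w)) = E C (?j (\<tau> ?g w))" unfolding E_def j'_def ..
   finally show ?thesis unfolding 1 by simp
  qed
  have it: "(?X ^^ l) (\<tau> ?g w) = \<tau> ?g ((?x ^^ l) w)" if w: "w \<in> carrier Y" for l w
  proof (induction l)
   case (Suc l)
   have "(?x ^^ l) w \<in> carrier Y" using Y.homD(1)[OF Y.hom_funpow[OF Y.endosD(1)[OF xE]] w] .
   then show ?case using step Suc by simp
  qed simp
  have "(?X ^^ n) v = \<zero>\<^sub>Y" if v: "v \<in> carrier Y" for v
  proof -
   have w: "\<tau> ?i v \<in> carrier Y" using Yact_closed[OF i v] .
   have "(?X ^^ n) (\<tau> ?g (\<tau> ?i v)) = \<tau> ?g \<zero>\<^sub>Y" unfolding it[OF w] using n w by simp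
   then show ?thesis unfolding Yact_inv(2)[OF g v] zero_act[OF g] .
  qed
  then show ?thesis by blast
 qed
 \<comment> \<open>With the complement gone, the minimal summand \<open>A\<close> is all of
   \<open>Y\<close>.\<close>
 have e0: "e v = \<zero>\<^sub>Y" if v: "v \<in> carrier Y" for v
  by (rule Y.average_nilpotent_imp_zero[OF HN' finZ Eend cK c1 e eid nil' m v])
 have AYe: "A = carrier Y" using eA e0 AY by blast
 have fin: "W' = {\<zero>\<^sub>Y}" if d: "?ds U' W'" "a \<in> U'" "fY a ~= \<zero>" for U' W' a
 proof -
  have "U' \<subseteq> carrier Y" using Y.subspaceD(1)[OF dsD(1)[OF d(1)]] .
  then have "U' = carrier Y" using min[OF d(1)] d(2,3) unfolding AYe by blast
  then show ?thesis using dsD(5)[OF d(1)] Y.subspaceD(1)[OF dsD(2)[OF d(1)]] by blast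
 qed
 have "pr m0 \<in> U <+>\<^bsub>Y\<^esub> W" using dsD(6)[OF ds] pr_closed[OF m0F] by simp
 then obtain a w where aw: "a \<in> U" "w \<in> W" "pr m0 = a \<oplus>\<^sub>Y w" unfolding Y.set_add_mem by blast
 have awY: "a \<in> carrier Y" "w \<in> carrier Y" using Y.subspaceD(2)[OF dsD(1)[OF ds] aw(1)] Y.subspaceD(2)[OF dsD(2)[OF ds] aw(2)] by blast+
 have "fY a ~= \<zero> \<or> fY w ~= \<zero>" using fY_m0 fY_add[OF awY] unfolding aw(3) by auto
 then show ?thesis using fin[OF ds aw(1)] fin[OF Y.is_direct_sum_commute[unfolded GN, OF ds] aw(2)] by blast
qed

end

section \<open>Conjugation invariance and Sylow subgroups\<close>

context modular_rep begin

text \<open>\<open>\<rho> g\<close> carries fixed vectors, traces and centraliser-stable subspaces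
  for \<open>R\<close> to those for the conjugate. This reduces subgroups conjugate into
  \<open>P\<close> to subgroups of \<open>P\<close>.\<close>

lemma brauer_ind_conj:
 assumes R: "subgroup R G" "card R = p ^ k" "perm_basis R B" and g: "g \<in> carrier G" and ind: "brauer_ind (conj_set g R)"
 shows "brauer_ind R"
proof -
 have RG: "R \<subseteq> carrier G" using subgroup.subset[OF R(1)] .
 have inj: "inj_on (\<rho> g) (carrier M)" using act_inj[OF g] by (intro inj_onI) blast
 have T: "trM (conj_set g R) = \<rho> g ` trM R" by (rule trace_sum_conj[OF R g])
 have F: "fixM (conj_set g R) = \<rho> g ` fixM R"
 proof (intro equalityI subsetI)
  fix v assume v: "v \<in> fixM (conj_set g R)"
  then have vM: "v \<in> carrier M" by (simp add: fixed_points_def)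
  let ?w = "\<rho> (iG g) v"
  have w: "?w \<in> carrier M" using act_closed g vM by simp
  have e: "\<rho> g ?w = v" by (rule act_inv(2)[OF g vM])
  have "?w \<in> fixM R" using fixed_points_conj[OF RG g w] v unfolding e by simp
  then show "v \<in> \<rho> g ` fixM R" using e by (metis image_eqI)
 next
  fix v assume "v \<in> \<rho> g ` fixM R"
  then obtain w where w: "w \<in> fixM R" "v = \<rho> g w" by blast
  then show "v \<in> fixM (conj_set g R)"
   using fixed_points_conj[OF RG g, of w] by (simp add: fixed_points_def)
 qed
 have TM: "trM R \<subseteq> carrier M" using trace_sum_fixed[OF R] by (auto simp: fixed_points_def)
 show ?thesis unfolding brauer_ind_def
 proof (intro allI impI)
  fix A B assume A: "subspace K A M" and B: "subspace K B M" and int: "A \<inter> B = trM R"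
   and sum: "A <+>\<^bsub>M\<^esub> B = fixM R"
   and st: "\<forall>c\<in>centralizer G R. (\<forall>a\<in>A. \<rho> c a \<in> A) \<and> (\<forall>b\<in>B. \<rho> c b \<in> B)"
  have AM: "A \<subseteq> carrier M" "B \<subseteq> carrier M" using subspaceD(1)[OF A] subspaceD(1)[OF B] by blast+
  have c': "iG g \<star> c \<star> g \<in> centralizer G R \<and> c \<in> carrier G" if c: "c \<in> centralizer G (conj_set g R)" for c
  proof -
   have cG: "c \<in> carrier G" using c by (simp add: centralizer_def)
   let ?d = "iG g \<star> c \<star> g"
   have "?d \<star> u = u \<star> ?d" if u: "u \<in> R" for u
   proof -
    have uG: "u \<in> carrier G" using u RG by blast
    have cc: "c \<star> (g \<star> u \<star> iG g) = (g \<star> u \<star> iG g) \<star> c"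
     using c u by (auto simp: centralizer_def conj_set_def)
    have "?d \<star> u = iG g \<star> (c \<star> (g \<star> u \<star> iG g)) \<star> g"
     using g cG uG by (simp add: G.m_assoc)
    also have "... = (iG g \<star> g) \<star> u \<star> ?d" unfolding cc
     using g cG uG by (simp only: G.m_assoc G.m_closed G.inv_closed)
    also have "... = u \<star> ?d" using g cG uG by simp
    finally show ?thesis .
   qed
   then show ?thesis using g cG by (simp add: centralizer_def)
  qed
  have st': "\<rho> c v \<in> \<rho> g ` Z" if c: "c \<in> centralizer G (conj_set g R)" and v: "v \<in> \<rho> g ` Z"
   and Z: "Z \<subseteq> carrier M" "!!d z. d \<in> centralizer G R ==> z \<in> Z ==> \<rho> d z \<in> Z" for c v Z
  proof -
   obtain z where z: "z \<in> Z" "v = \<rho> g z" using v by blast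
   have zM: "z \<in> carrier M" using z(1) Z(1) by blast
   let ?d = "iG g \<star> c \<star> g"
   have d: "?d \<in> centralizer G R" "c \<in> carrier G" using c'[OF c] by blast+
   have dG: "?d \<in> carrier G" using d g by simp
   have "\<rho> c v = \<rho> (c \<star> g) z" unfolding z(2) by (rule act_mult[OF d(2) g zM, symmetric])
   also have "c \<star> g = g \<star> ?d" using g d(2) by (simp add: G.m_assoc[symmetric])
   also have "\<rho> (g \<star> ?d) z = \<rho> g (\<rho> ?d z)" by (rule act_mult[OF g dG zM])
   finally show ?thesis using Z(2)[OF d(1) z(1)] by blast
  qed
  have "\<rho> g ` A = \<rho> g ` trM R \<or> \<rho> g ` B = \<rho> g ` trM R"
   unfolding T[symmetric]
  proof (rule brauer_indD[OF ind])
   show "subspace K (\<rho> g ` A) M" by (rule image_subspace[OF vs_self act_hom[OF g] A])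
   show "subspace K (\<rho> g ` B) M" by (rule image_subspace[OF vs_self act_hom[OF g] B])
   show "\<rho> g ` A \<inter> \<rho> g ` B = trM (conj_set g R)"
    unfolding T int[symmetric] by (rule inj_on_image_Int[OF inj AM, symmetric])
   show "\<rho> g ` A <+>\<^bsub>M\<^esub> \<rho> g ` B = fixM (conj_set g R)"
    unfolding F sum[symmetric]
   proof (intro equalityI subsetI)
    fix v assume "v \<in> \<rho> g ` A <+>\<^bsub>M\<^esub> \<rho> g ` B"
    then obtain a b where ab: "a \<in> A" "b \<in> B" "v = \<rho> g a \<oplus>\<^sub>M \<rho> g b" unfolding set_add_mem by blast
    have abM: "a \<in> carrier M" "b \<in> carrier M" using ab AM by blast+
    have "a \<oplus>\<^sub>M b \<in> A <+>\<^bsub>M\<^esub> B" unfolding set_add_mem using ab(1,2) by blast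
    then show "v \<in> \<rho> g ` (A <+>\<^bsub>M\<^esub> B)" unfolding ab(3) act_add[OF g abM, symmetric] by (rule imageI)
   next
    fix v assume "v \<in> \<rho> g ` (A <+>\<^bsub>M\<^esub> B)"
    then obtain w where w: "w \<in> A <+>\<^bsub>M\<^esub> B" "v = \<rho> g w" by blast
    then obtain a b where ab: "a \<in> A" "b \<in> B" "w = a \<oplus>\<^sub>M b" unfolding set_add_mem by blast
    have abM: "a \<in> carrier M" "b \<in> carrier M" using ab AM by blast+
    have "v = \<rho> g a \<oplus>\<^sub>M \<rho> g b" unfolding w(2) ab(3) by (rule act_add[OF g abM])
    then show "v \<in> \<rho> g ` A <+>\<^bsub>M\<^esub> \<rho> g ` B" using ab unfolding set_add_mem by blast
   qed
  next
   fix c v assume c: "c \<in> centralizer G (conj_set g R)"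
   show "\<rho> c v \<in> \<rho> g ` A" if "v \<in> \<rho> g ` A" by (rule st'[OF c that AM(1)]) (use st in blast)
   show "\<rho> c v \<in> \<rho> g ` B" if "v \<in> \<rho> g ` B" by (rule st'[OF c that AM(2)]) (use st in blast)
  qed
  then show "A = trM R \<or> B = trM R"
   using inj_on_image_eq_iff[OF inj AM(1) TM] inj_on_image_eq_iff[OF inj AM(2) TM] by blast
 qed
qed

text \<open>The Sylow property is kept as an index prime to \<open>p\<close>, the form in which it
  enters averages and counting arguments.\<close>

lemma exists_sylow:
 assumes H: "subgroup H G"
 shows "\<exists>S k. subgroup S G \<and> S \<subseteq> H \<and> card S = p ^ k \<and> coprime (card (cosets G H S)) p"
proof -
 have finH: "finite H" using finite_subset[OF subgroup.subset[OF H] finite_group] .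
 have cH: "card H ~= 0" using finH subgroup.one_closed[OF H] by auto
 interpret H: group "G(|carrier := H|)" by (rule G.subgroup_imp_group[OF H])
 have "\<not> is_unit p" using prime by (auto dest: not_prime_unit)
 then obtain m where m: "card H = p ^ multiplicity p (card H) * m" "\<not> p dvd m"
  using multiplicity_decompose'[OF cH] by metis
 let ?k = "multiplicity p (card H)"
 have "order (G(|carrier := H|)) = p ^ ?k * m" using m(1) by (simp add: order_def)
 then obtain S where S: "subgroup S (G(|carrier := H|))" "card S = p ^ ?k"
  using sylow_thm[OF prime H.is_group] finH by auto
 have SG: "subgroup S G" by (rule G.incl_subgroup[OF H S(1)])
 have SH: "S \<subseteq> H" using subgroup.subset[OF S(1)] by simp
 have "card (cosets G H S) * p ^ ?k = m * p ^ ?k" using G.card_cosets[OF SG H SH finH] S(2) m(1) by (simp add: mult.commute)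
 then have "card (cosets G H S) = m" using prime_gt_0_nat[OF prime] by simp
 then have "coprime (card (cosets G H S)) p" using m(2) prime_imp_coprime[OF prime] by (simp add: coprime_commute)
 then show ?thesis using SG SH S(2) by blast
qed

text \<open>\<open>R\<close> acts on the cosets of \<open>S\<close> in \<open>H\<close>, whose
  number is prime to \<open>p\<close>, so it fixes one of them.\<close>

lemma sylow_conj:
 assumes S: "subgroup S G" "S \<subseteq> H" and H: "subgroup H G" and cop: "coprime (card (cosets G H S)) p"
  and R: "subgroup R G" "R \<subseteq> H" "card R = p ^ j"
 shows "\<exists>g\<in>H. conj_set g R \<subseteq> S"
proof -
 have HG: "h \<in> carrier G" if "h \<in> H" for h using subgroup.mem_carrier[OF H that] .
 have RH: "h \<in> H" if "h \<in> R" for h using that R(2) by blast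
 have CG: "C \<subseteq> carrier G" if "C \<in> cosets G H S" for C
  using G.cosets_rep(4)[OF S(1) H S(2) that] HG by blast
 have finH: "finite H" using finite_subset[OF subgroup.subset[OF H] finite_group] .
 have acts: "acts_on G R (cosets G H S) (\<lambda>h C. h <#\<^sub>G C)"
  unfolding acts_on_def
 proof (intro conjI ballI)
  show "h <#\<^sub>G C \<in> cosets G H S" if "h \<in> R" "C \<in> cosets G H S" for h C
   using bij_betwE[OF G.cosets_left_bij[OF S(1) H S(2) RH[OF that(1)]]] that(2) by blast
  show "\<one>\<^sub>G <#\<^sub>G C = C" if "C \<in> cosets G H S" for C by (rule G.lcos_mult_one[OF CG[OF that]])
  show "h \<star> k <#\<^sub>G C = h <#\<^sub>G (k <#\<^sub>G C)" if "h \<in> R" "k \<in> R" "C \<in> cosets G H S" for h k C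
   by (rule G.lcos_m_assoc[OF CG[OF that(3)] HG[OF RH[OF that(1)]] HG[OF RH[OF that(2)]], symmetric])
 qed
 have "fixed_set R (cosets G H S) (\<lambda>h C. h <#\<^sub>G C) ~= {}"
 proof
  assume "fixed_set R (cosets G H S) (\<lambda>h C. h <#\<^sub>G C) = {}"
  then have "p dvd card (cosets G H S)"
   using finH by (intro G.prime_dvd_card_acts_on[OF prime R(1,3) acts]) (auto simp: cosets_def)
  then have "is_unit p" using cop by (simp add: coprime_absorb_right)
  then show False using prime by (auto dest: not_prime_unit)
 qed
 then obtain C where C: "C \<in> cosets G H S" "!!h. h \<in> R ==> h <#\<^sub>G C = C" by (auto simp: fixed_set_def)
 from C(1) obtain g where g: "g \<in> H" "C = g <#\<^sub>G S" unfolding cosets_def by blast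
 have SG: "S \<subseteq> carrier G" using subgroup.subset[OF S(1)] .
 have "iG g \<star> h \<star> iG (iG g) \<in> S" if h: "h \<in> R" for h
 proof -
  have hG: "h \<in> carrier G" and gG: "g \<in> carrier G" using HG RH[OF h] g(1) by blast+
  have "h <#\<^sub>G (g <#\<^sub>G S) = g <#\<^sub>G S" using C(2)[OF h] unfolding g(2) .
  then have "(h \<star> g) <#\<^sub>G S = g <#\<^sub>G S" unfolding G.lcos_m_assoc[OF SG hG gG] .
  then have "iG g \<star> (h \<star> g) \<in> S"
   using G.l_coset_eq_iff[OF S(1) gG, of "h \<star> g"] hG gG by simp
  then show ?thesis using hG gG by (simp add: G.m_assoc)
 qed
 then have "conj_set (iG g) R \<subseteq> S" by (auto simp: conj_set_def)
 then show ?thesis using subgroup.m_inv_closed[OF H g(1)] by blast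
qed

end

section \<open>Decompositions of \<open>M(Q)\<close> as pairs of subspaces of
  \<open>M\<close>\<close>

context brauer_quot begin

text \<open>Images under \<open>pr\<close> turn the two subspaces of \<open>M\<close> into a
  decomposition of \<open>Y\<close>; \<open>brauer_indE\<close> takes preimages instead.\<close>

lemma brauer_indI:
 assumes "!!U W. dirsumY (centralizer G Q) U W ==> U = {\<zero>\<^sub>Y} \<or> W = {\<zero>\<^sub>Y}"
  and CN: "centralizer G Q \<subseteq> N"
 shows "brauer_ind Q"
 unfolding brauer_ind_def
proof (intro allI impI)
 fix A B assume A: "subspace K A M" and B: "subspace K B M" and int: "A \<inter> B = T" and sum: "A <+>\<^bsub>M\<^esub> B = F"
  and st: "\<forall>c\<in>centralizer G Q. (\<forall>a\<in>A. \<rho> c a \<in> A) \<and> (\<forall>b\<in>B. \<rho> c b \<in> B)"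
 note AD = subspaceD[OF A] and BD = subspaceD[OF B]
 have AF: "A \<subseteq> F"
 proof
  fix a assume a: "a \<in> A"
  then have "a = a \<oplus>\<^sub>M \<zero>\<^sub>M" using AD(2) by simp
  then show "a \<in> F" unfolding sum[symmetric] set_add_mem using a BD(3) by blast
 qed
 have BF: "B \<subseteq> F"
 proof
  fix b assume b: "b \<in> B"
  then have "b = \<zero>\<^sub>M \<oplus>\<^sub>M b" using BD(2) by simp
  then show "b \<in> F" unfolding sum[symmetric] set_add_mem using b AD(3) by blast
 qed
 have zero: "pr \<zero>\<^sub>M = \<zero>\<^sub>Y" using pr_zero_iff[OF subspaceD(3)[OF F_sub]] subspaceD(3)[OF T_sub] by simp
 have sub: "subspace K (pr ` Z) Y" if Z: "subspace K Z M" "Z \<subseteq> F" for Z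
 proof (rule Y.subspaceI)
  show "pr ` Z \<subseteq> carrier Y" using Z(2) pr_closed by blast
  show "\<zero>\<^sub>Y \<in> pr ` Z" unfolding zero[symmetric] using subspaceD(3)[OF Z(1)] by (rule imageI)
  fix u v assume "u \<in> pr ` Z" "v \<in> pr ` Z"
  then obtain a b where ab: "a \<in> Z" "b \<in> Z" "u = pr a" "v = pr b" by blast
  have abF: "a \<in> F" "b \<in> F" using ab Z(2) by blast+
  show "u \<oplus>\<^sub>Y v \<in> pr ` Z" unfolding ab(3,4) pr_add[OF abF, symmetric] by (rule imageI[OF subspaceD(4)[OF Z(1) ab(1,2)]])
 next
  fix c u assume c: "c \<in> carrier K" and "u \<in> pr ` Z"
  then obtain a where a: "a \<in> Z" "u = pr a" by blast
  have aF: "a \<in> F" using a Z(2) by blast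
  show "c \<odot>\<^sub>Y u \<in> pr ` Z" unfolding a(2) pr_smult[OF c aF, symmetric] by (rule imageI[OF subspaceD(5)[OF Z(1) c a(1)]])
 qed
 have stab: "\<tau> c y \<in> pr ` Z" if c: "c \<in> centralizer G Q" and y: "y \<in> pr ` Z" and Z: "Z \<subseteq> F" "!!z. z \<in> Z ==> \<rho> c z \<in> Z" for c y Z
 proof -
  obtain z where z: "z \<in> Z" "y = pr z" using y by blast
  have "\<tau> c y = pr (\<rho> c z)" unfolding z(2) using c CN z(1) Z(1) by (intro act_pr) blast+
  then show ?thesis using Z(2)[OF z(1)] by blast
 qed
 have "dirsumY (centralizer G Q) (pr ` A) (pr ` B)"
  unfolding is_direct_sum_def group_submodule_def
 proof (intro conjI)
  show "subspace K (pr ` A) Y" by (rule sub[OF A AF])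
  show "subspace K (pr ` B) Y" by (rule sub[OF B BF])
  show "\<forall>g\<in>carrier (G(|carrier := centralizer G Q|)). \<forall>u\<in>pr ` A. \<tau> g u \<in> pr ` A"
   using stab[OF _ _ AF] st by simp
  show "\<forall>g\<in>carrier (G(|carrier := centralizer G Q|)). \<forall>u\<in>pr ` B. \<tau> g u \<in> pr ` B"
   using stab[OF _ _ BF] st by simp
  show "pr ` A \<inter> pr ` B = {\<zero>\<^sub>Y}"
  proof (intro equalityI subsetI)
   fix y assume "y \<in> pr ` A \<inter> pr ` B"
   then obtain a b where ab: "a \<in> A" "b \<in> B" "y = pr a" "y = pr b" by blast
   have aF: "a \<in> F" "b \<in> F" using ab AF BF by blast+
   have "a \<ominus>\<^sub>M b \<in> T" using pr_eq_iff[OF aF] ab(3,4) by simp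
   then have "a \<ominus>\<^sub>M b \<in> B" using int by blast
   then have "(a \<ominus>\<^sub>M b) \<oplus>\<^sub>M b \<in> B" using BD(4) ab(2) by blast
   then have "a \<in> B" using F_carrier aF by simp
   then have "a \<in> T" using int ab(1) by blast
   then show "y \<in> {\<zero>\<^sub>Y}" using pr_zero_iff[OF aF(1)] ab(3) by simp
  next
   fix y assume "y \<in> {\<zero>\<^sub>Y}"
   then have "y = pr \<zero>\<^sub>M" using zero by simp
   then show "y \<in> pr ` A \<inter> pr ` B" using AD(3) BD(3) by blast
  qed
  show "pr ` A <+>\<^bsub>Y\<^esub> pr ` B = carrier Y"
  proof (intro equalityI subsetI)
   fix y assume "y \<in> pr ` A <+>\<^bsub>Y\<^esub> pr ` B"
   then obtain u w where "u \<in> pr ` A" "w \<in> pr ` B" "y = u \<oplus>\<^sub>Y w" unfolding Y.set_add_mem by blast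
   then show "y \<in> carrier Y" using Y.subspaceD(2)[OF sub[OF A AF]] Y.subspaceD(2)[OF sub[OF B BF]] by simp
  next
   fix y assume "y \<in> carrier Y"
   then obtain v where v: "v \<in> F" "y = pr v" using pr_surj by blast
   have "v \<in> A <+>\<^bsub>M\<^esub> B" using v(1) sum by simp
   then obtain a b where ab: "a \<in> A" "b \<in> B" "v = a \<oplus>\<^sub>M b" unfolding set_add_mem by blast
   have "y = pr a \<oplus>\<^sub>Y pr b" unfolding v(2) ab(3) using ab AF BF by (intro pr_add) blast+
   then show "y \<in> pr ` A <+>\<^bsub>Y\<^esub> pr ` B" unfolding Y.set_add_mem using ab by blast
  qed
 qed
 from assms(1)[OF this] have "pr ` A = {\<zero>\<^sub>Y} \<or> pr ` B = {\<zero>\<^sub>Y}" .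
 moreover have "Z \<subseteq> T" if "pr ` Z = {\<zero>\<^sub>Y}" "Z \<subseteq> F" for Z
 proof
  fix z assume z: "z \<in> Z"
  then have "pr z = \<zero>\<^sub>Y" using that(1) by blast
  then show "z \<in> T" using pr_zero_iff z that(2) by blast
 qed
 ultimately have "A \<subseteq> T \<or> B \<subseteq> T" using AF BF by blast
 then show "A = T \<or> B = T" using int by blast
qed

lemma brauer_indE:
 assumes ind: "brauer_ind Q" and CN: "centralizer G Q \<subseteq> N"
  and ds: "dirsumY (centralizer G Q) U W"
 shows "U = {\<zero>\<^sub>Y} \<or> W = {\<zero>\<^sub>Y}"
proof -
 have d: "subspace K U Y" "subspace K W Y" "U \<inter> W = {\<zero>\<^sub>Y}" "U <+>\<^bsub>Y\<^esub> W = carrier Y"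
  "!!g u. g \<in> centralizer G Q ==> u \<in> U ==> \<tau> g u \<in> U" "!!g u. g \<in> centralizer G Q ==> u \<in> W ==> \<tau> g u \<in> W"
  using ds unfolding is_direct_sum_def group_submodule_def by auto
 let ?L = "\<lambda>Z. {m \<in> F. pr m \<in> Z}"
 note FD = subspaceD[OF F_sub]
 have zero: "pr \<zero>\<^sub>M = \<zero>\<^sub>Y" using pr_zero_iff[OF FD(3)] subspaceD(3)[OF T_sub] by simp
 have sub: "subspace K (?L Z) M" if Z: "subspace K Z Y" for Z
 proof (rule subspaceI)
  note ZD = Y.subspaceD[OF Z]
  show "?L Z \<subseteq> carrier M" using FD(1) by blast
  show "\<zero>\<^sub>M \<in> ?L Z" using FD(3) ZD(3) zero by simp
  show "u \<oplus>\<^sub>M v \<in> ?L Z" if "u \<in> ?L Z" "v \<in> ?L Z" for u v using that FD(4) ZD(4) pr_add by simp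
  show "c \<odot>\<^sub>M u \<in> ?L Z" if "c \<in> carrier K" "u \<in> ?L Z" for c u using that FD(5) ZD(5) pr_smult by simp
 qed
 have int: "?L U \<inter> ?L W = T"
 proof (intro equalityI subsetI)
  fix m assume m: "m \<in> ?L U \<inter> ?L W"
  then have "pr m = \<zero>\<^sub>Y" "m \<in> F" using d(3) by blast+
  then show "m \<in> T" using pr_zero_iff by simp
 next
  fix m assume m: "m \<in> T"
  then have mF: "m \<in> F" using TF by blast
  then have "pr m = \<zero>\<^sub>Y" using pr_zero_iff m by simp
  then show "m \<in> ?L U \<inter> ?L W" using mF Y.subspaceD(3)[OF d(1)] Y.subspaceD(3)[OF d(2)] by simp
 qed
 have sum: "?L U <+>\<^bsub>M\<^esub> ?L W = F"
 proof (intro equalityI subsetI)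
  fix m assume "m \<in> ?L U <+>\<^bsub>M\<^esub> ?L W"
  then show "m \<in> F" unfolding set_add_mem using FD(4) by blast
 next
  fix m assume m: "m \<in> F"
  have "pr m \<in> U <+>\<^bsub>Y\<^esub> W" using pr_closed[OF m] d(4) by simp
  then obtain u w where uw: "u \<in> U" "w \<in> W" "pr m = u \<oplus>\<^sub>Y w" unfolding Y.set_add_mem by blast
  have uY: "u \<in> carrier Y" "w \<in> carrier Y" using Y.subspaceD(2)[OF d(1) uw(1)] Y.subspaceD(2)[OF d(2) uw(2)] by blast+
  obtain a where a: "a \<in> F" "u = pr a" using pr_surj[OF uY(1)] by blast
  have b: "m \<ominus>\<^sub>M a \<in> F" by (rule FD(7)[OF m a(1)])
  have "pr (m \<ominus>\<^sub>M a) = pr m \<ominus>\<^sub>Y u" unfolding a(2) by (rule pr_diff[OF m a(1)])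
  also have "... = w" using Y.diff_eq_iff[OF pr_closed[OF m] uY] uw(3) Y.M.a_comm[OF uY] by simp
  finally have "m \<ominus>\<^sub>M a \<in> ?L W" using b uw(2) by simp
  moreover have "a \<in> ?L U" using a uw(1) by simp
  moreover have "m = a \<oplus>\<^sub>M (m \<ominus>\<^sub>M a)" using F_carrier[OF m] F_carrier[OF a(1)] by simp
  ultimately show "m \<in> ?L U <+>\<^bsub>M\<^esub> ?L W" unfolding set_add_mem by blast
 qed
 have st: "\<rho> c m \<in> ?L Z" if c: "c \<in> centralizer G Q" and m: "m \<in> ?L Z" and Z: "!!u. u \<in> Z ==> \<tau> c u \<in> Z" for c m Z
 proof -
  have cN: "c \<in> N" using c CN by blast
  have mF: "m \<in> F" "pr m \<in> Z" using m by simp_all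
  then show ?thesis using F_act[OF cN mF(1)] act_pr[OF cN mF(1)] Z[OF mF(2)] by simp
 qed
 have "?L U = T \<or> ?L W = T"
  by (rule brauer_indD[OF ind sub[OF d(1)] sub[OF d(2)] int sum])
   (rule st, assumption, assumption, erule (1) d(5), rule st, assumption, assumption, erule (1) d(6))
 moreover have "Z = {\<zero>\<^sub>Y}" if Z: "?L Z = T" "subspace K Z Y" for Z
 proof (intro equalityI subsetI)
  fix z assume z: "z \<in> Z"
  obtain m where m: "m \<in> F" "z = pr m" using pr_surj[OF Y.subspaceD(2)[OF Z(2) z]] by blast
  then have "m \<in> T" using z Z(1) by blast
  then show "z \<in> {\<zero>\<^sub>Y}" using pr_zero_iff[OF m(1)] m(2) by simp
 qed (use Y.subspaceD(3)[OF Z(2)] in simp)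
 ultimately show ?thesis using d(1,2) by blast
qed

end

text \<open>With \<open>n\<close> the order of the quotient, the \<open>n\<close>-th power of
  \<open>x\<close> lies in \<open>L\<close>. Since \<open>n\<close> is prime to
  \<open>card L\<close>, \<open>x\<close> is a power of that power. So \<open>L\<close> is
  determined by orders of elements, hence stable under conjugation from outside the group.\<close>

lemma (in group) normal_complement_mem:
 assumes L: "L \<lhd> G" and cop: "coprime (card L) (order (G Mod L))" and fin: "finite (carrier G)"
  and x: "x \<in> carrier G" "x [^] card L = \<one>"
 shows "x \<in> L"
proof -
 interpret L: normal L G by (rule L)
 interpret FG: group "G Mod L" by (rule L.factorgroup_is_group)
 interpret h: group_hom G "G Mod L" "\<lambda>a. L #> a"
  by (unfold_locales) (rule L.r_coset_hom_Mod)
 let ?n = "order (G Mod L)" and ?m = "card L"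
 have "L #> (x [^] ?n) = (L #> x) [^]\<^bsub>G Mod L\<^esub> ?n" by (rule h.hom_nat_pow[OF x(1)])
 also have "... = \<one>\<^bsub>G Mod L\<^esub>" using x(1) by (intro FG.pow_order_eq_1) (auto simp: FactGroup_def RCOSETS_def)
 finally have "L #> (x [^] ?n) = L" by (simp add: FactGroup_def)
 then have n: "x [^] ?n \<in> L" using rcos_self[OF nat_pow_closed[OF x(1)] L.subgroup_axioms] by blast
 have "?n ~= 0" using FG.one_closed fin by (auto simp: order_def FactGroup_def RCOSETS_def)
 then obtain k l where kl: "?n * k = ?m * l + gcd ?n ?m" using bezout_nat by blast
 have g1: "gcd ?n ?m = 1" using cop by (simp add: coprime_iff_gcd_eq_1 gcd.commute)
 have "(x [^] ?n) [^] k = x [^] (?m * l + 1)" unfolding nat_pow_pow[OF x(1)] kl g1 ..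
 also have "... = (x [^] ?m) [^] l \<otimes> x" using x(1) by (simp add: nat_pow_pow)
 also have "... = x" using x by simp
 finally have "x = (x [^] ?n) [^] k" ..
 moreover have "(x [^] ?n) [^] j \<in> L" for j :: nat
  by (induction j) (use n L.one_closed L.m_closed in simp_all)
 ultimately show ?thesis by (rule ssubst)
qed

lemma (in group) conj_nat_pow:
 assumes "g \<in> carrier G" "x \<in> carrier G"
 shows "(g \<otimes> x \<otimes> inv g) [^] (k::nat) = g \<otimes> x [^] k \<otimes> inv g"
proof (induction k)
 case (Suc k)
 have "(g \<otimes> x \<otimes> inv g) [^] Suc k = (g \<otimes> x [^] k \<otimes> inv g) \<otimes> (g \<otimes> x \<otimes> inv g)" using Suc by simp
 also have "... = g \<otimes> x [^] k \<otimes> (inv g \<otimes> g) \<otimes> x \<otimes> inv g" using assms by (simp only: m_assoc m_closed inv_closed nat_pow_closed)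
 also have "... = g \<otimes> x [^] Suc k \<otimes> inv g" using assms by (simp add: m_assoc)
 finally show ?case .
qed (use assms in simp)

section \<open>The two cases of the hypothesis\<close>

context scott_control_brauer begin

text \<open>A Sylow subgroup of \<open>H\<close> contains a conjugate of \<open>Q\<close> under
  \<open>H\<close>, which is \<open>Q\<close> itself because \<open>H\<close> lies in
  \<open>N\<close>.\<close>

lemma exists_sylow_Q:
 assumes H: "subgroup H G" "Q \<subseteq> H" "H \<subseteq> N"
 shows "\<exists>S k. subgroup S G \<and> Q \<subseteq> S \<and> S \<subseteq> H \<and> card S = p ^ k \<and> coprime (card (cosets G H S)) p"
proof -
 obtain S k where S: "subgroup S G" "S \<subseteq> H" "card S = p ^ k" "coprime (card (cosets G H S)) p"
  using exists_sylow[OF H(1)] by blast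
 obtain g where g: "g \<in> H" "conj_set g Q \<subseteq> S" using sylow_conj[OF S(1,2) H(1) S(4) Qsub H(2) Qcard] by blast
 have "g \<in> N" using g(1) H(3) by blast
 then have "Q \<subseteq> S" using g(2) conj_set_N by simp
 then show ?thesis using S by blast
qed

lemma finN: "finite N" using finite_subset[OF subgroup.subset[OF Nsub] finite_group] .

text \<open>By the assumption \<open>N\<^sub>P(Q)C\<^sub>G(Q)\<close> equals
  \<open>QC\<^sub>G(Q)\<close>. It is normalised by \<open>N\<close> and, by \<open>index\<close>,
  has index prime to \<open>p\<close> there. As \<open>Q\<close> acts trivially on
  \<open>M(Q)\<close>, a decomposition over \<open>CQ\<close> is one over this group.\<close>

lemma brauer_ind_if_normalizer:
 assumes IH: "!!R j. subgroup R G ==> Q \<subset> R ==> card R = p ^ j ==> brauer_ind R"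
  and a: "!!u. u \<in> P ==> u \<in> N ==> \<exists>q\<in>Q. \<exists>c\<in>CQ. u = q \<star> c"
 shows "brauer_ind Q"
proof -
 obtain H m where Hs: "subgroup H G" and H: "H = {u \<star> c |u c. u \<in> P \<inter> N \<and> c \<in> CQ}"
  and m: "card N = card H * m" "coprime m p" using index[OF Qsub QP] by blast
 have CQs: "subgroup CQ G" by (rule G.centralizer_subgroup[OF QG])
 have CG: "c \<in> carrier G" if "c \<in> CQ" for c using that by (simp add: centralizer_def)
 have qG: "q \<in> carrier G" if "q \<in> Q" for q using that QG by blast
 have Hq: "\<exists>q\<in>Q. \<exists>c\<in>CQ. h = q \<star> c" if "h \<in> H" for h
 proof -
  obtain u c where uc: "h = u \<star> c" "u \<in> P" "u \<in> N" "c \<in> CQ" using \<open>h \<in> H\<close> unfolding H by blast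
  obtain q d where qd: "q \<in> Q" "d \<in> CQ" "u = q \<star> d" using a[OF uc(2,3)] by blast
  have "h = q \<star> (d \<star> c)" unfolding uc(1) qd(3) by (rule G.m_assoc[OF qG[OF qd(1)] CG[OF qd(2)] CG[OF uc(4)]])
  then show ?thesis using qd(1) subgroup.m_closed[OF CQs qd(2) uc(4)] by blast
 qed
 have qcH: "q \<star> c \<in> H" if "q \<in> Q" "c \<in> CQ" for q c
  unfolding H using that QP QN by blast
 have CH: "CQ \<subseteq> H"
 proof
  fix c assume c: "c \<in> CQ"
  have "\<one>\<^sub>G \<star> c \<in> H" by (rule qcH[OF subgroup.one_closed[OF Qsub] c])
  then show "c \<in> H" using CG[OF c] by simp
 qed
 have QH: "Q \<subseteq> H"
 proof
  fix q assume q: "q \<in> Q"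
  have "q \<star> \<one>\<^sub>G \<in> H" by (rule qcH[OF q subgroup.one_closed[OF CQs]])
  then show "q \<in> H" using qG[OF q] by simp
 qed
 have HN: "H \<subseteq> N"
 proof
  fix h assume "h \<in> H"
  then obtain q c where "q \<in> Q" "c \<in> CQ" "h = q \<star> c" using Hq by blast
  then show "h \<in> N" using QN CN subgroup.m_closed[OF Nsub] by blast
 qed
 have norm: "iG g \<star> h \<star> g \<in> H" if g: "g \<in> N" and h: "h \<in> H" for g h
 proof -
  obtain q c where qc: "q \<in> Q" "c \<in> CQ" "h = q \<star> c" using Hq[OF h] by blast
  have gG: "g \<in> carrier G" using NG[OF g] .
  have 1: "iG g \<star> q \<star> g \<in> Q" using N_conj[OF N_inv[OF g] qc(1)] gG by simp
  have 2: "iG g \<star> c \<star> g \<in> CQ" using G.centralizer_conj[OF QG finQ N_inv[OF g] qc(2)] gG by simp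
  have "iG g \<star> h \<star> g = (iG g \<star> q) \<star> (g \<star> iG g) \<star> (c \<star> g)"
   unfolding qc(3) using gG qG[OF qc(1)] CG[OF qc(2)] by (simp add: G.m_assoc)
  also have "... = (iG g \<star> q \<star> g) \<star> (iG g \<star> c \<star> g)"
   using gG qG[OF qc(1)] CG[OF qc(2)] by (simp only: G.m_assoc G.m_closed G.inv_closed)
  finally show ?thesis using qcH[OF 1 2] by simp
 qed
 obtain S k where S: "subgroup S G" "Q \<subseteq> S" "S \<subseteq> H" "card S = p ^ k" "coprime (card (cosets G H S)) p"
  using exists_sylow_Q[OF Hs QH HN] by blast
 have SN: "S \<subseteq> N" using S(3) HN by blast
 have finH: "finite H" using finite_subset[OF HN finN] .
 have "card (cosets G N S) = card (cosets G H S) * m"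
 proof -
  have "card (cosets G N S) * card S = (card (cosets G H S) * m) * card S"
   using G.card_cosets[OF S(1) Nsub SN finN] G.card_cosets[OF S(1) Hs S(3) finH] m(1) by (simp add: ac_simps)
  moreover have "card S ~= 0" using S(4) prime_gt_0_nat[OF prime] by simp
  ultimately show ?thesis by simp
 qed
 then have cop: "coprime (card (cosets G N S)) p" using S(5) m(2) by simp
 show ?thesis
 proof (rule brauer_indI[OF _ CN])
  fix U W assume ds: "dirsumY CQ U W"
  note d = Y.is_direct_sumD[unfolded GN, OF ds]
  have act: "\<tau> h y \<in> Z" if h: "h \<in> H" and y: "y \<in> Z" and Z: "!!c y. c \<in> CQ ==> y \<in> Z ==> \<tau> c y \<in> Z" "Z \<subseteq> carrier Y" for h y Z
  proof -
   obtain q c where qc: "q \<in> Q" "c \<in> CQ" "h = q \<star> c" using Hq[OF h] by blast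
   have N': "q \<in> N" "c \<in> N" using qc QN CN by blast+
   have yY: "y \<in> carrier Y" using y Z(2) by blast
   have "\<tau> h y = \<tau> c y" unfolding qc(3) Yact_mult[OF N' yY] by (rule Yact_Q[OF qc(1) Yact_closed[OF N'(2) yY]])
   then show ?thesis using Z(1)[OF qc(2) y] by simp
  qed
  have dsH: "dirsumY H U W"
  proof (rule Y.is_direct_sumI[unfolded GN])
   show "\<tau> g u \<in> U" if "g \<in> H" "u \<in> U" for g u by (rule act[OF that d(3) Y.subspaceD(1)[OF d(1)]])
   show "\<tau> g u \<in> W" if "g \<in> H" "u \<in> W" for g u by (rule act[OF that d(4) Y.subspaceD(1)[OF d(2)]])
  qed (fact d)+
  show "U = {\<zero>\<^sub>Y} \<or> W = {\<zero>\<^sub>Y}" by (rule summand_trivial[OF CH S(3) HN norm S(1,4,2) cop IH dsH])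
 qed
qed

text \<open>The norm element of \<open>L\<close> does not kill \<open>fY\<close>, hence it is injective on \<open>Y\<close>.\<close>

lemma normal_p'_trivial:
 assumes IH: "!!R j. subgroup R G ==> Q \<subset> R ==> card R = p ^ j ==> brauer_ind R"
  and S: "subgroup S G" "S \<subseteq> N" "card S = p ^ k" "Q \<subseteq> S" "coprime (card (cosets G N S)) p"
  and L: "subgroup L G" "L \<subseteq> N" "coprime (card L) p" "!!g x. g \<in> N ==> x \<in> L ==> g \<star> x \<star> iG g \<in> L"
  and x: "x \<in> L" and y: "y \<in> carrier Y"
 shows "\<tau> x y = y"
proof -
 have LN: "l \<in> N" if "l \<in> L" for l using that L(2) by blast
 have LG: "l \<in> carrier G" if "l \<in> L" for l using NG[OF LN[OF that]] .
 have finL: "finite L" using finite_subset[OF L(2) finN] .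
 define e where "e y = (\<Oplus>\<^bsub>Y\<^esub>l\<in>L. \<tau> l y)" for y
 have HN': "N \<subseteq> carrier (G(|carrier := N|))" by simp
 have LY: "(\<lambda>l. \<tau> l y) \<in> L \<rightarrow> carrier Y" if "y \<in> carrier Y" for y using Yact_closed[OF LN that] by blast
 have eh: "e \<in> module_hom K Y Y" unfolding e_def by (rule Y.hom_finsum_fun[OF Y.vs_self Yact_hom[OF LN]])
 have eE: "e \<in> Y.endos N"
 proof (rule Y.endosI[OF eh])
  fix g y assume g: "g \<in> N" and y: "y \<in> carrier Y"
  let ?c = "\<lambda>l. g \<star> l \<star> iG g"
  have gG: "g \<in> carrier G" using NG[OF g] .
  have gy: "\<tau> g y \<in> carrier Y" using Yact_closed[OF g y] .
  have inj: "inj_on ?c L" using LG gG by (intro inj_onI) auto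
  have im: "?c ` L = L" using L(4)[OF g] by (intro endo_inj_surj[OF finL _ inj]) blast
  have "e (\<tau> g y) = (\<Oplus>\<^bsub>Y\<^esub>l\<in>?c ` L. \<tau> l (\<tau> g y))" unfolding im e_def ..
  also have "... = (\<Oplus>\<^bsub>Y\<^esub>l\<in>L. \<tau> (?c l) (\<tau> g y))" by (rule Y.M.finsum_reindex[OF _ inj]) (use LY[OF gy] im in simp)
  also have "... = (\<Oplus>\<^bsub>Y\<^esub>l\<in>L. \<tau> g (\<tau> l y))"
  proof (rule Y.M.finsum_cong'[OF refl])
   show "(\<lambda>l. \<tau> g (\<tau> l y)) \<in> L \<rightarrow> carrier Y" using Yact_closed[OF g Yact_closed[OF LN y]] by blast
   fix l assume l: "l \<in> L"
   have "?c l \<star> g = g \<star> l" using gG LG[OF l] by (simp add: G.m_assoc)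
   then show "\<tau> (?c l) (\<tau> g y) = \<tau> g (\<tau> l y)"
    using Yact_mult[OF LN[OF L(4)[OF g l]] g y] Yact_mult[OF g LN[OF l] y] by simp
  qed
  also have "... = \<tau> g (e y)" unfolding e_def by (rule Y.hom_finsum[OF Y.vs_self Yact_hom[OF g] LY[OF y], symmetric])
  finally show "e (\<tau> g y) = \<tau> g (e y)" .
 qed
 have ex: "e (\<tau> x y) = e y" if x: "x \<in> L" and y: "y \<in> carrier Y" for x y
 proof -
  let ?c = "\<lambda>l. l \<star> x"
  have inj: "inj_on ?c L" using LG x by (intro inj_onI) auto
  have im: "?c ` L = L" using subgroup.m_closed[OF L(1) _ x] by (intro endo_inj_surj[OF finL _ inj]) blast
  have "e y = (\<Oplus>\<^bsub>Y\<^esub>l\<in>?c ` L. \<tau> l y)" unfolding im e_def ..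
  also have "... = (\<Oplus>\<^bsub>Y\<^esub>l\<in>L. \<tau> (?c l) y)" by (rule Y.M.finsum_reindex[OF _ inj]) (use LY[OF y] im in simp)
  also have "... = e (\<tau> x y)" unfolding e_def
   using Yact_mult[OF LN LN[OF x] y] Yact_closed[OF LN Yact_closed[OF LN[OF x] y]] by (intro Y.M.finsum_cong') auto
  finally show ?thesis by simp
 qed
 note ee = Y.endosD[OF eE]
 let ?m = "[(card L)] \<cdot> \<one>"
 have fe: "fY (e y) = ?m \<otimes> fY y" if y: "y \<in> carrier Y" for y
 proof -
  have fy: "fY y \<in> carrier K" using fY_closed[OF y] .
  have "fY (e y) = (\<Oplus>l\<in>L. fY (\<tau> l y))"
   unfolding e_def using Y.hom_finsum[OF trivial_vectorspace fY_hom LY[OF y]] by simp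
  also have "... = (\<Oplus>l\<in>L. fY y)" using fY_act[OF LN y] fy by (intro R.finsum_cong') auto
  also have "... = [(card L)] \<cdot> (\<one> \<otimes> fY y)" using R.add.finprod_const[OF fy, of L] fy by simp
  also have "... = ?m \<otimes> fY y" using fy by (subst R.add_pow_ldistr) auto
  finally show ?thesis .
 qed
 obtain n where n: "0 < n" and ds: "dirsumY N {v \<in> carrier Y. (e ^^ n) v = \<zero>\<^sub>Y} ((e ^^ n) ` carrier Y)"
  using Y.fitting_direct_sum[unfolded GN, OF HN' eE] by (elim exE conjE) (rule that)
 have norm: "iG g \<star> h \<star> g \<in> N" if "g \<in> N" "h \<in> N" for g h
  by (rule subgroup.m_closed[OF Nsub subgroup.m_closed[OF Nsub N_inv[OF that(1)] that(2)] that(1)])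
 have en: "(e ^^ i) y \<in> carrier Y" if "y \<in> carrier Y" for i y using Y.homD(1)[OF Y.hom_funpow[OF eh] that] .
 have ne: "fY ((e ^^ i) (pr m0)) ~= \<zero>" for i
 proof (induction i)
  case 0 then show ?case using fY_m0 by simp
 next
  case (Suc i)
  have c: "(e ^^ i) (pr m0) \<in> carrier Y" using en[OF pr_closed[OF m0F]] .
  have m: "?m ~= \<zero>" "?m \<in> carrier K" using nat_nonzero[OF L(3)] by simp_all
  have "?m \<otimes> fY ((e ^^ i) (pr m0)) ~= \<zero>" using integral[OF _ m(2) fY_closed[OF c]] m(1) Suc by blast
  then show ?case using fe[OF c] by simp
 qed
 \<comment> \<open>\<open>e\<close> commutes with \<open>N\<close> and multiplies \<open>fY\<close>
   by the order of \<open>L\<close>, which is prime to \<open>p\<close>. So its Fitting image is not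
   0, and its Fitting kernel must be.\<close>
 have "{v \<in> carrier Y. (e ^^ n) v = \<zero>\<^sub>Y} = {\<zero>\<^sub>Y} \<or> (e ^^ n) ` carrier Y = {\<zero>\<^sub>Y}"
  by (rule summand_trivial[OF CN S(2) subset_refl norm S(1,3,4,5) IH ds])
 moreover have "(e ^^ n) ` carrier Y ~= {\<zero>\<^sub>Y}"
 proof
  assume "(e ^^ n) ` carrier Y = {\<zero>\<^sub>Y}"
  then have "(e ^^ n) (pr m0) = \<zero>\<^sub>Y" using pr_closed[OF m0F] by blast
  then show False using ne[of n] Y.hom_zero[OF trivial_vectorspace fY_hom] by simp
 qed
 ultimately have ker: "{v \<in> carrier Y. (e ^^ n) v = \<zero>\<^sub>Y} = {\<zero>\<^sub>Y}" by blast
 have xy: "\<tau> x y \<in> carrier Y" using Yact_closed[OF LN[OF x] y] .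
 \<comment> \<open>The norm element does not distinguish \<open>\<tau> x y\<close> from
   \<open>y\<close>, so their difference lies in its kernel.\<close>
 let ?d = "\<tau> x y \<ominus>\<^sub>Y y"
 have dY: "?d \<in> carrier Y" using xy y by simp
 have "e ?d = \<zero>\<^sub>Y" using ee(5)[OF xy y] ex[OF x y] ee(2)[OF y] by simp
 moreover obtain n' where "n = Suc n'" using n by (cases n) auto
 moreover have "(e ^^ i) \<zero>\<^sub>Y = \<zero>\<^sub>Y" for i by (rule Y.hom_zero[OF Y.vs_self Y.hom_funpow[OF eh]])
 ultimately have "(e ^^ n) ?d = \<zero>\<^sub>Y" by (simp add: funpow_Suc_right del: funpow.simps)
 then have "?d = \<zero>\<^sub>Y" using ker dY by blast
 then show ?thesis using Y.diff_zero_iff[OF xy y] by simp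
qed

lemma brauer_ind_if_p_nilpotent:
 assumes IH: "!!R j. subgroup R G ==> Q \<subset> R ==> card R = p ^ j ==> brauer_ind R"
  and b: "p_nilpotent p (G(|carrier := CQ|))"
 shows "brauer_ind Q"
proof -
 let ?D = "G(|carrier := CQ|)"
 have CQs: "subgroup CQ G" by (rule G.centralizer_subgroup[OF QG])
 interpret D: group ?D by (rule G.subgroup_imp_group[OF CQs])
 have CG: "c \<in> carrier G" if "c \<in> CQ" for c using that by (simp add: centralizer_def)
 have CNc: "c \<in> N" if "c \<in> CQ" for c using that CN by blast
 have finC: "finite CQ" using finite_subset[OF CN finN] .
 obtain L n where L: "L \<lhd> ?D" "coprime (card L) p" "order (?D Mod L) = p ^ n" using b unfolding p_nilpotent_def by blast
 have LsD: "subgroup L ?D" using L(1) by (simp add: normal_imp_subgroup)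
 have Ls: "subgroup L G" by (rule G.incl_subgroup[OF CQs LsD])
 have LC: "L \<subseteq> CQ" using subgroup.subset[OF LsD] by simp
 have LN: "L \<subseteq> N" using LC CN by blast
 have finL: "finite L" using finite_subset[OF LN finN] .
 have cop: "coprime (card L) (order (?D Mod L))" using L(2,3) by simp
 have powD: "x [^]\<^bsub>?D\<^esub> (i::nat) = x [^]\<^bsub>G\<^esub> i" for x i by (simp add: nat_pow_def)
 have Lpow: "x [^]\<^bsub>G\<^esub> card L = \<one>\<^sub>G" if x: "x \<in> L" for x
 proof -
  interpret L: group "G(|carrier := L|)" by (rule G.subgroup_imp_group[OF Ls])
  have "x [^]\<^bsub>G(|carrier := L|)\<^esub> order (G(|carrier := L|)) = \<one>\<^bsub>G(|carrier := L|)\<^esub>"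
   using x by (intro L.pow_order_eq_1) simp
  then show ?thesis by (simp add: order_def nat_pow_def)
 qed
 \<comment> \<open>\<open>L\<close> consists of the elements of \<open>CQ\<close> whose power with
   exponent \<open>card L\<close> is trivial, and \<open>N\<close> permutes these.\<close>
 have Lst: "g \<star> x \<star> iG g \<in> L" if g: "g \<in> N" and x: "x \<in> L" for g x
 proof -
  have xG: "x \<in> carrier G" "x \<in> CQ" using x LC CG by blast+
  have "g \<star> x \<star> iG g \<in> CQ" by (rule G.centralizer_conj[OF QG finQ g xG(2)])
  moreover have "(g \<star> x \<star> iG g) [^]\<^bsub>G\<^esub> card L = \<one>\<^sub>G"
   unfolding G.conj_nat_pow[OF NG[OF g] xG(1)] Lpow[OF x] using NG[OF g] by simp
  ultimately show ?thesis using finC powD by (intro D.normal_complement_mem[OF L(1) cop]) simp_all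
 qed
 obtain S k where S: "subgroup S G" "Q \<subseteq> S" "S \<subseteq> N" "card S = p ^ k" "coprime (card (cosets G N S)) p"
  using exists_sylow_Q[OF Nsub QN subset_refl] by blast
 have Ltriv: "\<tau> x y = y" if "x \<in> L" "y \<in> carrier Y" for x y
  by (rule normal_p'_trivial[OF IH S(1,3,4,2,5) Ls LN L(2) Lst that])
 have ordD: "order ?D = p ^ n * card L"
 proof -
  have "card (rcosets\<^bsub>?D\<^esub> L) * card L = order ?D" using finC by (intro D.lagrange_finite LsD) simp
  then show ?thesis using L(3) by (simp add: order_def FactGroup_def)
 qed
 obtain S2 where S2: "subgroup S2 ?D" "card S2 = p ^ n" using sylow_thm[OF prime D.is_group ordD] finC by auto
 have S2G: "subgroup S2 G" by (rule G.incl_subgroup[OF CQs S2(1)])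
 have S2C: "S2 \<subseteq> CQ" using subgroup.subset[OF S2(1)] by simp
 \<comment> \<open>A permutation basis of \<open>M(Q)\<close> comes from a p-group containing
   \<open>Q\<close>. Hence the Sylow subgroup of \<open>CQ\<close> is moved into \<open>S\<close>,
   and a basis permuted by \<open>S\<close> is restricted.\<close>
 obtain g where g: "g \<in> N" "conj_set g S2 \<subseteq> S"
  using sylow_conj[OF S(1,3) Nsub S(5) S2G _ S2(2)] S2C CN by blast
 define S1 where "S1 = conj_set g S2"
 have S1G: "subgroup S1 G" "card S1 = p ^ n"
  using conj_set_subgroup[OF S2G NG[OF g(1)]] S2(2) by (simp_all add: S1_def)
 have S1S: "S1 \<subseteq> S" using g(2) by (simp add: S1_def)
 have S1C: "S1 \<subseteq> CQ" using G.centralizer_conj[OF QG finQ g(1)] S2C by (auto simp: S1_def conj_set_def)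
 have S1N: "S1 \<subseteq> N" using S1C CN by blast
 have S1N': "subgroup S1 (G(|carrier := N|))" by (rule subgroup_N[OF S1G(1) S1N])
 have finS1: "finite S1" using finite_subset[OF S1N finN] .
 have trivI: "x = \<one>\<^sub>G" if x: "x \<in> S1" "x \<in> L" for x
 proof -
  have I: "subgroup (S1 \<inter> L) G" by (rule G.subgroups_Inter_pair[OF S1G(1) Ls])
  have 1: "card (S1 \<inter> L) dvd card S1" using G.card_cosets[OF I S1G(1) Int_lower1 finS1] by (metis dvd_triv_right)
  have 2: "card (S1 \<inter> L) dvd card L" using G.card_cosets[OF I Ls Int_lower2 finL] by (metis dvd_triv_right)
  have "coprime (card S1) (card L)" using L(2) S1G(2) by (simp add: coprime_commute)
  then have "card (S1 \<inter> L) = 1" using 1 2 by (meson coprime_common_divisor nat_dvd_1_iff_1)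
  then obtain z where z: "S1 \<inter> L = {z}" using card_1_singletonE by blast
  have "x \<in> S1 \<inter> L" using x by blast
  then show ?thesis using subgroup.one_closed[OF I] unfolding z by simp
 qed
 \<comment> \<open>\<open>S1\<close> meets \<open>L\<close> trivially and has the order of the
   quotient by \<open>L\<close>, so it represents every coset of \<open>L\<close> in
   \<open>CQ\<close>.\<close>
 have factor: "\<exists>s\<in>S1. \<exists>x\<in>L. c = s \<star> x" if c: "c \<in> CQ" for c
 proof -
  have S1c: "s \<in> carrier G" if "s \<in> S1" for s using that S1C CG by blast
  have inj: "inj_on (\<lambda>s. s <#\<^sub>G L) S1"
  proof (rule inj_onI)
   fix s t assume st: "s \<in> S1" "t \<in> S1" "s <#\<^sub>G L = t <#\<^sub>G L"
   have "iG s \<star> t \<in> L" using G.l_coset_eq_iff[OF Ls S1c[OF st(1)] S1c[OF st(2)]] st(3) by simp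
   moreover have "iG s \<star> t \<in> S1"
    using subgroup.m_closed[OF S1G(1) subgroup.m_inv_closed[OF S1G(1) st(1)] st(2)] .
   ultimately have e: "iG s \<star> t = \<one>\<^sub>G" using trivI by blast
   have "t = s \<star> (iG s \<star> t)" using S1c[OF st(1)] S1c[OF st(2)] by (simp add: G.m_assoc[symmetric])
   then show "s = t" unfolding e using S1c[OF st(1)] by simp
  qed
  have "card (cosets G CQ L) * card L = p ^ n * card L"
   using G.card_cosets[OF Ls CQs LC finC] ordD by (simp add: order_def)
  moreover have "card L ~= 0" using finL subgroup.one_closed[OF Ls] by auto
  ultimately have cc: "card (cosets G CQ L) = p ^ n" by simp
  have "(\<lambda>s. s <#\<^sub>G L) ` S1 = cosets G CQ L"
  proof (rule card_subset_eq)
   show "finite (cosets G CQ L)" using finC by (simp add: cosets_def)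
   show "(\<lambda>s. s <#\<^sub>G L) ` S1 \<subseteq> cosets G CQ L" using S1C by (auto simp: cosets_def)
   show "card ((\<lambda>s. s <#\<^sub>G L) ` S1) = card (cosets G CQ L)" using card_image[OF inj] cc S1G(2) by simp
  qed
  moreover have "c <#\<^sub>G L \<in> cosets G CQ L" using c by (simp add: cosets_def)
  ultimately have "c <#\<^sub>G L \<in> (\<lambda>s. s <#\<^sub>G L) ` S1" by blast
  then obtain s where s: "s \<in> S1" "s <#\<^sub>G L = c <#\<^sub>G L" by (elim imageE) (rule that, assumption, erule sym)
  have "iG s \<star> c \<in> L" using G.l_coset_eq_iff[OF Ls S1c[OF s(1)] CG[OF c]] s(2) by simp
  moreover have "c = s \<star> (iG s \<star> c)" using S1c[OF s(1)] CG[OF c] by (simp add: G.m_assoc[symmetric])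
  ultimately show ?thesis using s(1) by blast
 qed
 obtain B0 where B0: "perm_basis S B0" using has_perm[OF S(1,4)] by blast
 have YB0: "Y.perm_basis S1 (pr ` fixed_set Q B0 \<rho>)"
  using Y_perm_basis[OF B0 S(1,2,3)] S1S unfolding Y.perm_basis_def by blast
 have CN': "CQ \<subseteq> carrier (G(|carrier := N|))" using CN by simp
 have main: "B = {\<zero>\<^sub>Y}" if ds: "dirsumY CQ A B" and a0: "a0 \<in> A" "fY a0 ~= \<zero>" for A B a0
 proof -
  note d = Y.is_direct_sumD[unfolded GN, OF ds]
  have dsB: "dirsumY CQ B A" by (rule Y.is_direct_sum_commute[unfolded GN, OF ds])
  have a0Y: "a0 \<in> carrier Y" using Y.subspaceD(2)[OF d(1) a0(1)] .
  have BY: "b \<in> carrier Y" if "b \<in> B" for b using Y.subspaceD(2)[OF d(2) that] .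
  obtain e where e: "e \<in> Y.endos CQ" and e1: "\<forall>v\<in>carrier Y. e v \<in> B" and e2: "\<forall>v\<in>carrier Y. v \<ominus>\<^sub>Y e v \<in> A"
   and e3: "\<forall>u\<in>B. e u = u" and e4: "\<forall>w\<in>A. e w = \<zero>\<^sub>Y"
   using Y.direct_sum_projection_ex[unfolded GN, OF CN' dsB] by (elim bexE conjE) (rule that)
  note ee = Y.endosD[OF e]
  have fe: "fY (e y) = \<zero>" if y: "y \<in> carrier Y" for y
  proof -
   have Vh: "(\<lambda>y. fY (e y)) \<in> module_hom K Y (trivial_module K)"
    by (rule Y.homI) (use ee(2-4) Y.homD[OF fY_hom] in auto)
   have Vc: "fY (e (\<tau> c y)) = fY (e y)" if "c \<in> CQ" "y \<in> carrier Y" for c y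
    unfolding ee(7)[OF that] by (rule fY_act[OF CNc[OF that(1)] ee(2)[OF that(2)]])
   have "\<exists>c\<in>carrier K. \<forall>y\<in>carrier Y. fY (e y) = c \<otimes> fY y" by (rule functional_unique[OF Vh Vc])
   then obtain c where c: "c \<in> carrier K" and Vc: "\<forall>y\<in>carrier Y. fY (e y) = c \<otimes> fY y" by (elim bexE) (rule that)
   have "fY (e a0) = \<zero>" using e4 a0(1) Y.hom_zero[OF trivial_vectorspace fY_hom] by simp
   then have "c \<otimes> fY a0 = \<zero>" using Vc a0Y by simp
   then have "c = \<zero>" using integral[OF _ c fY_closed[OF a0Y]] a0(2) by blast
   then show ?thesis using Vc y fY_closed[OF y] by simp
  qed
  have dsS: "dirsumY S1 A B"
  proof (rule Y.is_direct_sumI[unfolded GN])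
   show "\<tau> g u \<in> A" if "g \<in> S1" "u \<in> A" for g u using d(3) that S1C by blast
   show "\<tau> g u \<in> B" if "g \<in> S1" "u \<in> B" for g u using d(4) that S1C by blast
  qed (fact d)+
  obtain B' where B': "Y.perm_basis S1 B'" "B' \<subseteq> A \<union> B"
   using Y.perm_basis_split_ex[unfolded GN, OF S1N' S1G(2) YB0 dsS] by (elim exE conjE) (rule that)
  note Bb = Y.perm_basisD[OF B'(1)]
  let ?D = "B' \<inter> B"
  have cK: "Y.coord B' y b \<in> carrier K" if "y \<in> carrier Y" "b \<in> ?D" for y b
   using Y.coord_closed[OF Bb(2,1) that(1)] that(2) by blast
  \<comment> \<open>The sum of the coefficients at the basis elements in \<open>B\<close>.
    \<open>S1\<close> permutes these, and \<open>L\<close> acts trivially on \<open>Y\<close>, so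
    \<open>W\<close> is invariant under \<open>CQ\<close>.\<close>
  define W where "W y = (\<Oplus>b\<in>?D. Y.coord B' y b)" for y
  have Wh: "W \<in> module_hom K Y (trivial_module K)"
  proof -
   have "(\<lambda>y. finsum (trivial_module K) (\<lambda>b. Y.coord B' y b) ?D) \<in> module_hom K Y (trivial_module K)"
    by (rule Y.hom_finsum_fun[OF trivial_vectorspace]) (use Y.coord_hom[OF Bb(2,1)] in blast)
   then show ?thesis unfolding W_def by simp
  qed
  have Ws: "W (\<tau> s y) = W y" if s: "s \<in> S1" and y: "y \<in> carrier Y" for s y
  proof -
   have sN: "s \<in> N" using s S1N by blast
   have sy: "\<tau> s y \<in> carrier Y" using Yact_closed[OF sN y] .
   have inj: "inj_on (\<tau> s) ?D" using Yact_inv(1)[OF sN Bb(3)] by (intro inj_on_inverseI[of _ "\<tau> (iG s)"]) blast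
   have im: "\<tau> s ` ?D = ?D"
   proof (rule endo_inj_surj[OF _ _ inj])
    show "finite ?D" using Bb(2) by blast
    show "\<tau> s ` ?D \<subseteq> ?D" using Bb(4)[OF s] d(4) s S1C by blast
   qed
   have "W (\<tau> s y) = (\<Oplus>b\<in>\<tau> s ` ?D. Y.coord B' (\<tau> s y) b)" unfolding im W_def ..
   also have "... = (\<Oplus>b\<in>?D. Y.coord B' (\<tau> s y) (\<tau> s b))"
    by (rule R.finsum_reindex[OF _ inj]) (use cK[OF sy] im in simp)
   also have "... = W y" unfolding W_def
    using Y.coord_act[OF S1N' B'(1) s y] cK[OF y] by (intro R.finsum_cong') auto
   finally show ?thesis .
  qed
  have Wc: "W (\<tau> c y) = W y" if c: "c \<in> CQ" and y: "y \<in> carrier Y" for c y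
  proof -
   obtain s x where sx: "s \<in> S1" "x \<in> L" "c = s \<star> x" using factor[OF c] by blast
   have N': "s \<in> N" "x \<in> N" using sx S1N LN by blast+
   show ?thesis unfolding sx(3) Yact_mult[OF N' y] Ltriv[OF sx(2) y] by (rule Ws[OF sx(1) y])
  qed
  have "\<exists>c\<in>carrier K. \<forall>y\<in>carrier Y. W y = c \<otimes> fY y" by (rule functional_unique[OF Wh Wc])
  then obtain c where c: "c \<in> carrier K" and Wf: "\<forall>y\<in>carrier Y. W y = c \<otimes> fY y" by (elim bexE) (rule that)
  \<comment> \<open>At a basis element in \<open>B\<close> the functional \<open>W\<close> is 1 and
    \<open>fY\<close> is 0, although \<open>W\<close> is a multiple of \<open>fY\<close>.\<close>
  have D0: "?D = {}"
  proof (rule ccontr)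
   assume "?D ~= {}"
   then obtain b where b: "b \<in> ?D" by blast
   have "W b = (\<Oplus>b'\<in>?D. if b = b' then \<one> else \<zero>)" unfolding W_def
    using Y.coord_basis[OF Bb(2,1)] b by (intro R.finsum_cong') auto
   also have "... = \<one>" using Bb(2) b R.finsum_singleton[of b ?D "\<lambda>_. \<one>"] by simp
   finally have "W b = \<one>" .
   moreover have bY: "b \<in> carrier Y" "e b = b" using b BY e3 by blast+
   moreover have "fY b = \<zero>" using fe[OF bY(1)] bY(2) by simp
   ultimately show False using Wf c by simp
  qed
  have "b = \<zero>\<^sub>Y" if b: "b \<in> B" for b
  proof -
   have "B' \<subseteq> B \<union> A" using B'(2) by blast
   then have "e b = (\<Oplus>\<^bsub>Y\<^esub>b'\<in>?D. Y.coord B' b b' \<odot>\<^sub>Y b')"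
    by (rule Y.projection_expand[OF Bb(1) _ ee(1) bspec[OF e3] bspec[OF e4] BY[OF b]])
   then show ?thesis using e3 b unfolding D0 by simp
  qed
  then show ?thesis using Y.subspaceD(3)[OF d(2)] by blast
 qed
 show ?thesis
 proof (rule brauer_indI[OF _ CN])
  fix U W assume ds: "dirsumY CQ U W"
  note d = Y.is_direct_sumD[unfolded GN, OF ds]
  have "pr m0 \<in> U <+>\<^bsub>Y\<^esub> W" using d(6) pr_closed[OF m0F] by simp
  then obtain a w where aw: "a \<in> U" "w \<in> W" "pr m0 = a \<oplus>\<^sub>Y w" unfolding Y.set_add_mem by blast
  have awY: "a \<in> carrier Y" "w \<in> carrier Y" using Y.subspaceD(2)[OF d(1) aw(1)] Y.subspaceD(2)[OF d(2) aw(2)] by blast+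
  have "fY a ~= \<zero> \<or> fY w ~= \<zero>" using fY_m0 fY_add[OF awY] unfolding aw(3) by auto
  then show "U = {\<zero>\<^sub>Y} \<or> W = {\<zero>\<^sub>Y}"
   using main[OF ds aw(1)] main[OF Y.is_direct_sum_commute[unfolded GN, OF ds] aw(2)] by blast
 qed
qed

end

section \<open>Induction over the p-subgroups\<close>

context scott_control begin

text \<open>Induction from large subgroups to small ones. It ranges over all p-subgroups of
  \<open>G\<close> because the stabilisers above \<open>Q\<close> need not lie in \<open>P\<close>.
  Those not conjugate into \<open>P\<close> have \<open>M(R) = 0\<close>; the others are moved into
  \<open>P\<close>, where the fusion hypotheses apply.\<close>

theorem brauer_ind_p_subgroup:
 assumes ab: "!!Q. subgroup Q G ==> Q \<subseteq> P ==>
   (\<forall>u\<in>P \<inter> normalizer G Q. \<exists>q\<in>Q. \<exists>c\<in>centralizer G Q. u = q \<star> c) \<or>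
   p_nilpotent p (G(|carrier := centralizer G Q|))"
  and R: "subgroup R G" "card R = p ^ n"
 shows "brauer_ind R"
 using R
proof (induction "card (carrier G) - card R" arbitrary: R n rule: less_induct)
 case less
 note R = less.prems
 obtain B where B: "perm_basis R B" using has_perm[OF R] by blast
 show ?case
 proof (cases "\<exists>g\<in>carrier G. conj_set g R \<subseteq> P")
  case False
  then have FT: "fixM R = trM R" by (intro fixed_points_eq_trace_sum[OF R]) blast
  show ?thesis unfolding brauer_ind_def
  proof (intro allI impI)
   fix A C assume A: "subspace K A M" and C: "subspace K C M" and int: "A \<inter> C = trM R"
    and sum: "A <+>\<^bsub>M\<^esub> C = fixM R"
   have "A \<subseteq> trM R"
   proof
    fix a assume a: "a \<in> A"
    then have "a = a \<oplus>\<^sub>M \<zero>\<^sub>M" using subspaceD(2)[OF A] by simp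
    then show "a \<in> trM R" unfolding FT[symmetric] sum[symmetric] set_add_mem using a subspaceD(3)[OF C] by blast
   qed
   then show "A = trM R \<or> C = trM R" using int by blast
  qed
 next
  case True
  then obtain g where g: "g \<in> carrier G" "conj_set g R \<subseteq> P" by blast
  let ?Q = "conj_set g R"
  have Q: "subgroup ?Q G" "card ?Q = p ^ n" using conj_set_subgroup[OF R(1) g(1)] R(2) by simp_all
  interpret Q: scott_control_brauer K G M \<rho> p P d s f ?Q n
   by (rule scott_control_brauer.intro[OF scott_control_axioms scott_brauer.intro[OF scott_rep_axioms
     brauer_quot.intro[OF perm_rep_axioms brauer_quot_axioms.intro[OF Q]] scott_brauer_axioms.intro[OF g(2)]]])
  have IH: "brauer_ind S" if S: "subgroup S G" "?Q \<subset> S" "card S = p ^ j" for S j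
  proof (rule less.hyps[OF _ S(1,3)])
   have "finite S" using finite_subset[OF subgroup.subset[OF S(1)] finite_group] .
   then have "card ?Q < card S" using S(2) by (rule psubset_card_mono)
   moreover have "card S \<le> card (carrier G)" by (rule card_mono[OF finite_group subgroup.subset[OF S(1)]])
   ultimately show "card (carrier G) - card S < card (carrier G) - card R" using Q(2) R(2) by simp
  qed
  have "brauer_ind ?Q"
   using ab[OF Q(1) g(2)]
  proof
   assume a: "\<forall>u\<in>P \<inter> normalizer G ?Q. \<exists>q\<in>?Q. \<exists>c\<in>centralizer G ?Q. u = q \<star> c"
   show ?thesis by (rule Q.brauer_ind_if_normalizer[OF IH bspec[OF a IntI]])
  next
   assume b: "p_nilpotent p (G(|carrier := centralizer G ?Q|))"
   show ?thesis by (rule Q.brauer_ind_if_p_nilpotent[OF IH b])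
  qed
  then show ?thesis by (rule brauer_ind_conj[OF R B g(1)])
 qed
qed

end

section \<open>From fusion systems to group theory\<close>

lemma (in group) conj_map_eq_iff:
 assumes Q: "Q \<subseteq> carrier G" and g: "g \<in> carrier G" and h: "h \<in> carrier G"
 shows "conj_map G Q g = conj_map G Q h \<longleftrightarrow> inv g \<otimes> h \<in> centralizer G Q"
proof -
 have pt: "g \<otimes> u \<otimes> inv g = h \<otimes> u \<otimes> inv h \<longleftrightarrow> (inv g \<otimes> h) \<otimes> u = u \<otimes> (inv g \<otimes> h)" if u: "u \<in> Q" for u
 proof
  have uG: "u \<in> carrier G" using u Q by blast
  show "(inv g \<otimes> h) \<otimes> u = u \<otimes> (inv g \<otimes> h)" if e: "g \<otimes> u \<otimes> inv g = h \<otimes> u \<otimes> inv h"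
  proof -
   have "(inv g \<otimes> h) \<otimes> u = inv g \<otimes> (h \<otimes> u \<otimes> inv h) \<otimes> h" using uG g h by (simp add: m_assoc)
   also have "... = inv g \<otimes> (g \<otimes> u \<otimes> inv g) \<otimes> h" unfolding e ..
   also have "... = (inv g \<otimes> g) \<otimes> u \<otimes> (inv g \<otimes> h)" using uG g h by (simp only: m_assoc m_closed inv_closed)
   also have "... = u \<otimes> (inv g \<otimes> h)" using uG g h by simp
   finally show ?thesis .
  qed
  show "g \<otimes> u \<otimes> inv g = h \<otimes> u \<otimes> inv h" if e: "(inv g \<otimes> h) \<otimes> u = u \<otimes> (inv g \<otimes> h)"
  proof -
   have "h \<otimes> u \<otimes> inv h = (g \<otimes> inv g) \<otimes> h \<otimes> u \<otimes> inv h" using uG g h by simp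
   also have "... = g \<otimes> ((inv g \<otimes> h) \<otimes> u) \<otimes> inv h" using uG g h by (simp only: m_assoc m_closed inv_closed)
   also have "... = g \<otimes> (u \<otimes> (inv g \<otimes> h)) \<otimes> inv h" unfolding e ..
   also have "... = g \<otimes> u \<otimes> inv g \<otimes> (h \<otimes> inv h)" using uG g h by (simp only: m_assoc m_closed inv_closed)
   also have "... = g \<otimes> u \<otimes> inv g" using uG g h by simp
   finally show ?thesis by simp
  qed
 qed
 have "conj_map G Q g = conj_map G Q h \<longleftrightarrow> (\<forall>u\<in>Q. g \<otimes> u \<otimes> inv g = h \<otimes> u \<otimes> inv h)"
  unfolding conj_map_def by (auto simp: restrict_def fun_eq_iff)
 then show ?thesis using pt g h by (simp add: centralizer_def)
qed

text \<open>Two elements induce the same map on \<open>Q\<close> exactly if they lie in the same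
  left coset of the centraliser.\<close>

lemma (in group) card_conj_maps:
 assumes Q: "Q \<subseteq> carrier G" and H: "subgroup H G" "finite H" "centralizer G Q \<subseteq> H"
 shows "card (conj_map G Q ` H) * card (centralizer G Q) = card H"
proof -
 let ?C = "centralizer G Q"
 note Cs = centralizer_subgroup[OF Q]
 have HG: "h \<in> carrier G" if "h \<in> H" for h using subgroup.mem_carrier[OF H(1) that] .
 let ?r = "\<lambda>D. SOME x. x \<in> D"
 have rH: "?r D \<in> H" "D = ?r D <# ?C" if "D \<in> cosets G H ?C" for D
  using cosets_rep(2,3)[OF Cs H(1,3) that] by blast+
 have eq: "conj_map G Q (?r (h <# ?C)) = conj_map G Q h" if h: "h \<in> H" for h
 proof -
  have D: "h <# ?C \<in> cosets G H ?C" using h by (simp add: cosets_def)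
  have "?r (h <# ?C) <# ?C = h <# ?C" using rH(2)[OF D] by simp
  then show ?thesis
   using l_coset_eq_iff[OF Cs HG[OF rH(1)[OF D]] HG[OF h]] conj_map_eq_iff[OF Q HG[OF rH(1)[OF D]] HG[OF h]] by simp
 qed
 have im: "conj_map G Q ` H = (\<lambda>D. conj_map G Q (?r D)) ` cosets G H ?C"
  unfolding cosets_def image_image using eq by (intro image_cong) auto
 have "inj_on (\<lambda>D. conj_map G Q (?r D)) (cosets G H ?C)"
 proof (rule inj_onI)
  fix D E assume D: "D \<in> cosets G H ?C" and E: "E \<in> cosets G H ?C" and e: "conj_map G Q (?r D) = conj_map G Q (?r E)"
  have "?r D <# ?C = ?r E <# ?C"
   using l_coset_eq_iff[OF Cs HG[OF rH(1)[OF D]] HG[OF rH(1)[OF E]]]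
    conj_map_eq_iff[OF Q HG[OF rH(1)[OF D]] HG[OF rH(1)[OF E]]] e by simp
  then show "D = E" by (rule trans[OF rH(2)[OF D] trans[OF _ rH(2)[OF E, symmetric]]])
 qed
 then have "card (conj_map G Q ` H) = card (cosets G H ?C)" unfolding im by (rule card_image)
 then show ?thesis using card_cosets[OF Cs H(1,3,2)] by simp
qed

context modular_rep begin

lemma normalizer_conj_set:
 assumes R: "R \<subseteq> carrier G" and g: "g \<in> carrier G" and x: "x \<in> normalizer G R"
 shows "g \<star> x \<star> iG g \<in> normalizer G (conj_set g R)"
proof -
 have finR: "finite R" using finite_subset[OF R finite_group] .
 have cR: "conj_set g R \<subseteq> carrier G" using R g by (auto simp: conj_set_def)
 have xG: "x \<in> carrier G" and xR: "!!u. u \<in> R ==> x \<star> u \<star> iG x \<in> R" using x G.normalizer_iff[OF R finR] by blast+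
 let ?y = "g \<star> x \<star> iG g"
 have iy: "iG ?y = g \<star> iG x \<star> iG g" using g xG by (simp add: G.inv_mult_group G.m_assoc)
 have "?y \<star> v \<star> iG ?y \<in> conj_set g R" if "v \<in> conj_set g R" for v
 proof -
  obtain u where u: "u \<in> R" "v = g \<star> u \<star> iG g" using \<open>v \<in> conj_set g R\<close> by (auto simp: conj_set_def)
  have uG: "u \<in> carrier G" using u(1) R by blast
  have "?y \<star> v \<star> iG ?y
   = g \<star> x \<star> (iG g \<star> g) \<star> u \<star> (iG g \<star> g) \<star> iG x \<star> iG g"
   unfolding iy u(2) using g xG uG by (simp only: G.m_assoc G.m_closed G.inv_closed)
  also have "... = g \<star> (x \<star> u \<star> iG x) \<star> iG g" using g xG uG by (simp add: G.m_assoc)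
  finally show ?thesis using xR[OF u(1)] by (auto simp: conj_set_def)
 qed
 then show ?thesis using G.normalizer_iff[OF cR] finR g xG by (simp add: conj_set_def)
qed

lemma centralizer_conj_set:
 assumes R: "R \<subseteq> carrier G" and g: "g \<in> carrier G" and c: "c \<in> centralizer G R"
 shows "g \<star> c \<star> iG g \<in> centralizer G (conj_set g R)"
proof -
 have cG: "c \<in> carrier G" and cu: "!!u. u \<in> R ==> c \<star> u = u \<star> c" using c by (auto simp: centralizer_def)
 let ?y = "g \<star> c \<star> iG g"
 have "?y \<star> v = v \<star> ?y" if "v \<in> conj_set g R" for v
 proof -
  obtain u where u: "u \<in> R" "v = g \<star> u \<star> iG g" using \<open>v \<in> conj_set g R\<close> by (auto simp: conj_set_def)
  have uG: "u \<in> carrier G" using u(1) R by blast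
  have "?y \<star> v = g \<star> (c \<star> (iG g \<star> g) \<star> u) \<star> iG g"
   unfolding u(2) using g cG uG by (simp only: G.m_assoc G.m_closed G.inv_closed)
  also have "... = g \<star> (u \<star> (iG g \<star> g) \<star> c) \<star> iG g" using g cG uG cu[OF u(1)] by simp
  also have "... = v \<star> ?y" unfolding u(2) using g cG uG by (simp only: G.m_assoc G.m_closed G.inv_closed)
  finally show ?thesis .
 qed
 then show ?thesis using g cG by (simp add: centralizer_def)
qed

lemma conj_set_inv:
 assumes "R \<subseteq> carrier G" "g \<in> carrier G" shows "conj_set (iG g) (conj_set g R) = R"
proof -
 have "iG g \<star> (g \<star> u \<star> iG g) \<star> iG (iG g) = u" if "u \<in> R" for u
 proof -
  have uG: "u \<in> carrier G" using that assms(1) by blast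
  have "iG g \<star> (g \<star> u \<star> iG g) \<star> g = (iG g \<star> g) \<star> u \<star> (iG g \<star> g)"
   using uG assms(2) by (simp only: G.m_assoc G.m_closed G.inv_closed)
  then show ?thesis using uG assms(2) by simp
 qed
 then show ?thesis by (simp add: conj_set_def image_image)
qed

text \<open>Conjugation by \<open>g\<close> is a morphism from \<open>Q\<close> to \<open>P\<close>,
  hence also induced by some \<open>n\<close> in \<open>N\<^sub>G(P)\<close>; the two elements
  differ by a factor that centralises \<open>Q\<close>.\<close>

lemma fusion_control:
 assumes P: "subgroup P G" and eq: "fusion_system G P = fusion_system (G(|carrier := normalizer G P|)) P"
  and Q: "subgroup Q G" "Q \<subseteq> P" and g: "g \<in> carrier G" "conj_set g Q \<subseteq> P"
 shows "\<exists>n\<in>normalizer G P. \<exists>c\<in>centralizer G Q. g = n \<star> c"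
proof -
 have PG: "P \<subseteq> carrier G" and QG: "Q \<subseteq> carrier G" using subgroup.subset[OF P] subgroup.subset[OF Q(1)] by blast+
 have Ns: "subgroup (normalizer G P) G" by (rule G.normalizer_imp_subgroup[OF PG])
 have QP': "subgroup Q (G(|carrier := P|))" by (rule G.subgroup_incl[OF Q(1) P Q(2)])
 have PP': "subgroup P (G(|carrier := P|))" by (rule G.subgroup_incl[OF P P subset_refl])
 have im: "conj_map G Q g ` Q = conj_set g Q" by (simp add: conj_map_def conj_set_def)
 have "conj_map G Q g \<in> fusion_system G P Q P"
  using QP' PP' g im by (auto simp: fusion_system_def)
 then have "conj_map G Q g \<in> fusion_system (G(|carrier := normalizer G P|)) P Q P" using eq by simp
 then obtain n where n: "n \<in> normalizer G P" "conj_map G Q g = conj_map (G(|carrier := normalizer G P|)) Q n"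
  using QP' PP' by (auto simp: fusion_system_def)
 have nG: "n \<in> carrier G" using subgroup.mem_carrier[OF Ns n(1)] .
 have "conj_map (G(|carrier := normalizer G P|)) Q n = conj_map G Q n"
  using G.m_inv_consistent[OF Ns n(1)] by (simp add: conj_map_def)
 then have "iG n \<star> g \<in> centralizer G Q"
  using G.conj_map_eq_iff[OF QG nG g(1)] n(2) by simp
 moreover have "g = n \<star> (iG n \<star> g)" using nG g(1) by (simp add: G.m_assoc[symmetric])
 ultimately show ?thesis using n(1) by blast
qed

text \<open>A conjugation of the finite group \<open>R\<close> into itself comes from the normalizer
  and is inverted by the inverse element.\<close>

lemma fusion_aut_eq:
 assumes P: "subgroup P G" and R: "subgroup R G" "R \<subseteq> P"
 shows "fusion_aut (fusion_system G P) R = conj_map G R ` normalizer G R"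
proof -
 have RG: "R \<subseteq> carrier G" using subgroup.subset[OF R(1)] .
 have finR: "finite R" using finite_subset[OF RG finite_group] .
 have RP': "subgroup R (G(|carrier := P|))" by (rule G.subgroup_incl[OF R(1) P R(2)])
 have Ns: "subgroup (normalizer G R) G" by (rule G.normalizer_imp_subgroup[OF RG])
 have mem: "conj_map G R g \<in> fusion_system G P R R" if "g \<in> normalizer G R" for g
  using that RP' G.normalizer_iff[OF RG finR] by (auto simp: fusion_system_def conj_map_def)
 have memD: "\<phi> \<in> conj_map G R ` normalizer G R" if \<phi>: "\<phi> \<in> fusion_system G P R R" for \<phi>
 proof -
  obtain g where g: "\<phi> = conj_map G R g" "g \<in> carrier G" "conj_map G R g ` R \<subseteq> R"
   using \<phi> RP' by (auto simp: fusion_system_def)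
  have "g \<star> u \<star> iG g \<in> R" if u: "u \<in> R" for u
   using imageI[OF u, of "conj_map G R g"] g(3) u by (auto simp: conj_map_def)
  then have "g \<in> normalizer G R" using G.normalizer_iff[OF RG finR] g(2) by blast
  then show ?thesis using g(1) by blast
 qed
 have inv: "compose R (conj_map G R h) (conj_map G R g) = (\<lambda>u\<in>R. u)"
  if g: "g \<in> normalizer G R" "h \<in> carrier G" "h \<star> g = \<one>\<^sub>G" for g h
 proof -
  have gG: "g \<in> carrier G" using subgroup.mem_carrier[OF Ns g(1)] .
  have hg: "h = iG g" using G.inv_equality[OF g(3) gG g(2)] by simp
  have "conj_map G R h (conj_map G R g u) = u" if u: "u \<in> R" for u
  proof -
   have uG: "u \<in> carrier G" using u RG by blast
   have "g \<star> u \<star> iG g \<in> R" using g(1) u G.normalizer_iff[OF RG finR] by blast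
   then have "conj_map G R h (conj_map G R g u) = iG g \<star> (g \<star> u \<star> iG g) \<star> g"
    using u gG by (simp add: conj_map_def hg)
   also have "... = (iG g \<star> g) \<star> u \<star> (iG g \<star> g)" using gG uG by (simp only: G.m_assoc G.m_closed G.inv_closed)
   also have "... = u" using gG uG by simp
   finally show ?thesis .
  qed
  then show ?thesis by (auto simp: compose_def restrict_def)
 qed
 show ?thesis
 proof (intro equalityI subsetI)
  fix \<phi> assume "\<phi> \<in> fusion_aut (fusion_system G P) R"
  then show "\<phi> \<in> conj_map G R ` normalizer G R" using memD by (simp add: fusion_aut_def fusion_iso_def)
 next
  fix \<phi> assume "\<phi> \<in> conj_map G R ` normalizer G R"
  then obtain g where g: "g \<in> normalizer G R" "\<phi> = conj_map G R g" by blast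
  have g': "iG g \<in> normalizer G R" using subgroup.m_inv_closed[OF Ns g(1)] .
  have gG: "g \<in> carrier G" using subgroup.mem_carrier[OF Ns g(1)] .
  have "compose R (conj_map G R (iG g)) \<phi> = (\<lambda>u\<in>R. u)" "compose R \<phi> (conj_map G R (iG g)) = (\<lambda>u\<in>R. u)"
   unfolding g(2) using inv[OF g(1), of "iG g"] inv[OF g', of g] gG by simp_all
  then show "\<phi> \<in> fusion_aut (fusion_system G P) R"
   using mem[OF g(1)] mem[OF g'] unfolding fusion_aut_def fusion_iso_def g(2) by blast
 qed
qed

lemma normalizer_restrict:
 assumes P: "subgroup P G" and R: "R \<subseteq> P"
 shows "normalizer (G(|carrier := P|)) R = P \<inter> normalizer G R"
proof -
 interpret PG: group "G(|carrier := P|)" by (rule G.subgroup_imp_group[OF P])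
 have RG: "R \<subseteq> carrier G" using subgroup.subset[OF P] R by blast
 have finR: "finite R" using finite_subset[OF RG finite_group] .
 have "g \<in> normalizer (G(|carrier := P|)) R \<longleftrightarrow> g \<in> P \<inter> normalizer G R" for g
  using PG.normalizer_iff[of R g] R finR G.normalizer_iff[OF RG finR, of g] G.m_inv_consistent[OF P, of g]
   subgroup.mem_carrier[OF P, of g] by auto
 then show ?thesis by blast
qed

text \<open>Let \<open>R\<close> be fully automised and isomorphic to \<open>Q\<close>. On
  \<open>R\<close> the group \<open>N\<^sub>P(R)C\<^sub>G(R)\<close> induces a Sylow subgroup of
  what \<open>N\<^sub>G(R)\<close> induces; both contain \<open>C\<^sub>G(R)\<close>, so the index
  is prime to \<open>p\<close>. By \<open>control\<close>, \<open>R\<close> is conjugate to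
  \<open>Q\<close> under \<open>N\<^sub>G(P)\<close>, which preserves \<open>P\<close> and hence
  both orders.\<close>

lemma fusion_index:
 assumes P: "subgroup P G" and sat: "saturated p (G(|carrier := P|)) (fusion_system G P)"
  and control: "!!Q g. subgroup Q G ==> Q \<subseteq> P ==> g \<in> carrier G ==> conj_set g Q \<subseteq> P ==>
   \<exists>n\<in>normalizer G P. \<exists>c\<in>centralizer G Q. g = n \<star> c"
  and Q: "subgroup Q G" "Q \<subseteq> P"
 shows "\<exists>H m. subgroup H G \<and> H = {u \<star> c |u c. u \<in> P \<inter> normalizer G Q \<and> c \<in> centralizer G Q} \<and>
  card (normalizer G Q) = card H * m \<and> coprime m p"
proof -
 have PG: "P \<subseteq> carrier G" and QG: "Q \<subseteq> carrier G" using subgroup.subset[OF P] subgroup.subset[OF Q(1)] by blast+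
 have finP: "finite P" using finite_subset[OF PG finite_group] .
 define HH where "HH R = {u \<star> c |u c. u \<in> P \<inter> normalizer G R \<and> c \<in> centralizer G R}" for R
 \<comment> \<open>The last clause holds because \<open>C\<^sub>G(R)\<close> acts trivially on
   \<open>R\<close>: \<open>HH R\<close> induces the same automorphisms as
   \<open>N\<^sub>P(R)\<close>.\<close>
 have props: "subgroup (HH R) G \<and> centralizer G R \<subseteq> HH R \<and> HH R \<subseteq> normalizer G R \<and>
   conj_map G R ` HH R = conj_map G R ` (P \<inter> normalizer G R)" if RG: "R \<subseteq> carrier G" for R
 proof -
  have finR: "finite R" using finite_subset[OF RG finite_group] .
  have Ns: "subgroup (normalizer G R) G" by (rule G.normalizer_imp_subgroup[OF RG])
  have Cs: "subgroup (centralizer G R) G" by (rule G.centralizer_subgroup[OF RG])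
  have Us: "subgroup (P \<inter> normalizer G R) G" by (rule G.subgroups_Inter_pair[OF P Ns])
  have CN: "c \<in> normalizer G R" if c: "c \<in> centralizer G R" for c
  proof -
   have cG: "c \<in> carrier G" using subgroup.mem_carrier[OF Cs c] .
   have "c \<star> u \<star> iG c \<in> R" if "u \<in> R" for u
   proof -
    have "c \<star> u \<star> iG c \<in> conj_set c R" using that by (auto simp: conj_set_def)
    then show ?thesis unfolding conj_set_centralizer[OF RG c] .
   qed
   then show ?thesis using G.normalizer_iff[OF RG finR] cG by blast
  qed
  have UG: "u \<in> carrier G" if "u \<in> P \<inter> normalizer G R" for u using subgroup.mem_carrier[OF Us that] .
  have CG: "c \<in> carrier G" if "c \<in> centralizer G R" for c using subgroup.mem_carrier[OF Cs that] .
  have conjC: "iG u \<star> c \<star> u \<in> centralizer G R" "u \<star> c \<star> iG u \<in> centralizer G R"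
   if u: "u \<in> P \<inter> normalizer G R" and c: "c \<in> centralizer G R" for u c
  proof -
   have uN: "u \<in> normalizer G R" using u by blast
   show "u \<star> c \<star> iG u \<in> centralizer G R" by (rule G.centralizer_conj[OF RG finR uN c])
   show "iG u \<star> c \<star> u \<in> centralizer G R"
    using G.centralizer_conj[OF RG finR subgroup.m_inv_closed[OF Ns uN] c] UG[OF u] by simp
  qed
  have HI: "u \<star> c \<in> HH R" if "u \<in> P \<inter> normalizer G R" "c \<in> centralizer G R" for u c
   unfolding HH_def using that by blast
  have HD: "\<exists>u\<in>P \<inter> normalizer G R. \<exists>c\<in>centralizer G R. h = u \<star> c" if "h \<in> HH R" for h
   using that unfolding HH_def by blast
  have "subgroup (HH R) G"
  proof (rule G.subgroupI)
   show "HH R \<subseteq> carrier G" using HD UG CG by blast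
   show "HH R ~= {}" using HI[OF subgroup.one_closed[OF Us] subgroup.one_closed[OF Cs]] by blast
   fix a assume "a \<in> HH R"
   then obtain u c where uc: "u \<in> P \<inter> normalizer G R" "c \<in> centralizer G R" "a = u \<star> c" using HD by blast
   note c' = subgroup.m_inv_closed[OF Cs uc(2)] and u' = subgroup.m_inv_closed[OF Us uc(1)]
   have "iG a = iG u \<star> (u \<star> iG c \<star> iG u)"
    unfolding uc(3) using UG[OF uc(1)] CG[OF uc(2)] by (simp add: G.inv_mult_group G.m_assoc[symmetric])
   then show "iG a \<in> HH R" using HI[OF u' conjC(2)[OF uc(1) c']] by simp
   fix b assume "b \<in> HH R"
   then obtain v d where vd: "v \<in> P \<inter> normalizer G R" "d \<in> centralizer G R" "b = v \<star> d" using HD by blast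
   note G' = UG[OF uc(1)] CG[OF uc(2)] UG[OF vd(1)] CG[OF vd(2)]
   have "(u \<star> v) \<star> ((iG v \<star> c \<star> v) \<star> d) = u \<star> (v \<star> iG v) \<star> c \<star> v \<star> d"
    using G' by (simp only: G.m_assoc G.m_closed G.inv_closed)
   also have "... = a \<star> b" unfolding uc(3) vd(3) using G' by (simp add: G.m_assoc)
   finally show "a \<star> b \<in> HH R"
    using HI[OF subgroup.m_closed[OF Us uc(1) vd(1)] subgroup.m_closed[OF Cs conjC(1)[OF vd(1) uc(2)] vd(2)]] by simp
  qed
  moreover have "centralizer G R \<subseteq> HH R"
  proof
   fix c assume c: "c \<in> centralizer G R"
   then show "c \<in> HH R" using HI[OF subgroup.one_closed[OF Us] c] CG[OF c] by simp
  qed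
  moreover have "HH R \<subseteq> normalizer G R"
  proof
   fix h assume "h \<in> HH R"
   then obtain u c where uc: "u \<in> P \<inter> normalizer G R" "c \<in> centralizer G R" "h = u \<star> c" using HD by blast
   then show "h \<in> normalizer G R" using subgroup.m_closed[OF Ns _ CN[OF uc(2)]] by blast
  qed
  moreover have "conj_map G R ` HH R = conj_map G R ` (P \<inter> normalizer G R)"
  proof (intro equalityI subsetI)
   fix \<phi> assume "\<phi> \<in> conj_map G R ` HH R"
   then obtain h where h: "h \<in> HH R" "\<phi> = conj_map G R h" by blast
   obtain u c where uc: "u \<in> P \<inter> normalizer G R" "c \<in> centralizer G R" "h = u \<star> c" using HD[OF h(1)] by blast
   have "iG u \<star> h = c" unfolding uc(3) using UG[OF uc(1)] CG[OF uc(2)] by (simp add: G.m_assoc[symmetric])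
   then have "conj_map G R u = conj_map G R h"
    using G.conj_map_eq_iff[OF RG UG[OF uc(1)], of h] uc UG[OF uc(1)] CG[OF uc(2)] by simp
   then show "\<phi> \<in> conj_map G R ` (P \<inter> normalizer G R)" using h(2) uc(1) by (metis imageI)
  next
   fix \<phi> assume "\<phi> \<in> conj_map G R ` (P \<inter> normalizer G R)"
   then obtain u where u: "u \<in> P \<inter> normalizer G R" "\<phi> = conj_map G R u" by blast
   have "u \<in> HH R" using HI[OF u(1) subgroup.one_closed[OF Cs]] UG[OF u(1)] by simp
   then show "\<phi> \<in> conj_map G R ` HH R" using u(2) by blast
  qed
  ultimately show ?thesis by blast
 qed
 \<comment> \<open>Used for \<open>n\<close> and for its inverse, the inequalities become
   equalities.\<close>
 have le: "card (normalizer G R) \<le> card (normalizer G (conj_set n R)) \<and> card (HH R) \<le> card (HH (conj_set n R))"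
  if RG: "R \<subseteq> carrier G" and n: "n \<in> normalizer G P" for R n
 proof -
  have nG: "n \<in> carrier G" using n G.normalizer_iff[OF PG finP] by blast
  have cR: "conj_set n R \<subseteq> carrier G" using RG nG by (auto simp: conj_set_def)
  let ?k = "\<lambda>x. n \<star> x \<star> iG n"
  have inj: "inj_on ?k (carrier G)" using nG by (intro inj_onI) auto
  have Ns: "normalizer G R \<subseteq> carrier G" "normalizer G (conj_set n R) \<subseteq> carrier G"
   using subgroup.subset[OF G.normalizer_imp_subgroup[OF RG]] subgroup.subset[OF G.normalizer_imp_subgroup[OF cR]] by blast+
  have fin: "finite (normalizer G (conj_set n R))" using finite_subset[OF Ns(2) finite_group] .
  have k1: "?k ` normalizer G R \<subseteq> normalizer G (conj_set n R)" using normalizer_conj_set[OF RG nG] by blast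
  have k2: "?k ` HH R \<subseteq> HH (conj_set n R)"
  proof
   fix y assume "y \<in> ?k ` HH R"
   then obtain u c where uc: "u \<in> P" "u \<in> normalizer G R" "c \<in> centralizer G R" "y = ?k (u \<star> c)"
    unfolding HH_def by blast
   have uG: "u \<in> carrier G" and cG: "c \<in> carrier G" using uc PG by (auto simp: centralizer_def)
   have "?k u \<star> ?k c = n \<star> u \<star> (iG n \<star> n) \<star> c \<star> iG n"
    using nG uG cG by (simp only: G.m_assoc G.m_closed G.inv_closed)
   also have "... = y" unfolding uc(4) using nG uG cG by (simp add: G.m_assoc)
   finally have y: "y = ?k u \<star> ?k c" ..
   have "?k u \<in> P" using n uc(1) G.normalizer_iff[OF PG finP] by blast
   then show "y \<in> HH (conj_set n R)" unfolding y HH_def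
    using normalizer_conj_set[OF RG nG uc(2)] centralizer_conj_set[OF RG nG uc(3)] by blast
  qed
  have "HH R \<subseteq> carrier G" using props[OF RG] Ns(1) by blast
  moreover have "finite (HH (conj_set n R))" using props[OF cR] finite_subset[OF _ fin] by blast
  ultimately show ?thesis
   using card_inj_on_le[OF inj_on_subset[OF inj Ns(1)] k1 fin] card_inj_on_le[OF inj_on_subset[OF inj] k2] by blast
 qed
 have QP': "subgroup Q (G(|carrier := P|))" by (rule G.subgroup_incl[OF Q(1) P Q(2)])
 obtain R \<phi> where R: "subgroup R (G(|carrier := P|))" "fusion_iso (fusion_system G P) Q R \<phi>"
  "fully_automised p (G(|carrier := P|)) (fusion_system G P) R" using sat QP' unfolding saturated_def by blast
 have Rs: "subgroup R G" by (rule G.incl_subgroup[OF P R(1)])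
 have RP: "R \<subseteq> P" using subgroup.subset[OF R(1)] by simp
 have RG: "R \<subseteq> carrier G" using RP PG by blast
 have finR: "finite R" and finQ: "finite Q" using finite_subset[OF RP finP] finite_subset[OF Q(2) finP] .
 obtain \<psi> where "\<phi> \<in> fusion_system G P Q R" "\<psi> \<in> fusion_system G P R Q" using R(2) unfolding fusion_iso_def by blast
 then obtain g h where g: "g \<in> carrier G" "conj_map G Q g ` Q \<subseteq> R" and h: "h \<in> carrier G" "conj_map G R h ` R \<subseteq> Q"
  using QP' R(1) by (auto simp: fusion_system_def)
 have gs: "conj_set g Q \<subseteq> R" "conj_set h R \<subseteq> Q" using g(2) h(2) by (simp_all add: conj_map_def conj_set_def)
 \<comment> \<open>The isomorphism supplies conjugations both ways, so conjugation by
   \<open>g\<close> maps \<open>Q\<close> onto \<open>R\<close>.\<close>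
 have "card R \<le> card Q" using card_mono[OF finQ gs(2)] conj_set_subgroup(2)[OF Rs h(1)] by simp
 then have gQR: "conj_set g Q = R" using gs(1) conj_set_subgroup(2)[OF Q(1) g(1)] finR by (intro card_seteq) auto
 then have "conj_set g Q \<subseteq> P" using RP by simp
 then obtain n c where nc: "n \<in> normalizer G P" "c \<in> centralizer G Q" "g = n \<star> c" using control[OF Q g(1)] by blast
 have nG: "n \<in> carrier G" using nc(1) G.normalizer_iff[OF PG finP] by blast
 have cG: "c \<in> carrier G" using nc(2) by (simp add: centralizer_def)
 \<comment> \<open>The factor \<open>c\<close> centralises \<open>Q\<close>, so \<open>n\<close>
   alone already takes \<open>Q\<close> to \<open>R\<close>.\<close>
 have nQR: "conj_set n Q = R"
 proof -
  have "g \<star> u \<star> iG g = n \<star> u \<star> iG n" if u: "u \<in> Q" for u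
  proof -
   have uG: "u \<in> carrier G" using u QG by blast
   have cu: "c \<star> u = u \<star> c" using nc(2) u by (simp add: centralizer_def)
   have "g \<star> u \<star> iG g = n \<star> (c \<star> u) \<star> iG c \<star> iG n"
    unfolding nc(3) G.inv_mult_group[OF nG cG] using nG cG uG by (simp only: G.m_assoc G.m_closed G.inv_closed)
   also have "... = n \<star> u \<star> iG n" unfolding cu using nG cG uG by (simp add: G.m_assoc)
   finally show ?thesis .
  qed
  then show ?thesis unfolding gQR[symmetric] by (auto simp: conj_set_def)
 qed
 have n': "iG n \<in> normalizer G P" by (rule subgroup.m_inv_closed[OF G.normalizer_imp_subgroup[OF PG] nc(1)])
 have nRQ: "conj_set (iG n) R = Q" using conj_set_inv[OF QG nG] unfolding nQR .
 have cN: "card (normalizer G Q) = card (normalizer G R)" and cH: "card (HH Q) = card (HH R)"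
  using le[OF QG nc(1)] le[OF RG n'] unfolding nQR nRQ by simp_all
 have NRs: "subgroup (normalizer G R) G" by (rule G.normalizer_imp_subgroup[OF RG])
 have finN: "finite (normalizer G R)" using finite_subset[OF subgroup.subset[OF NRs] finite_group] .
 note pR = props[OF RG]
 have CNR: "centralizer G R \<subseteq> normalizer G R" using pR by blast
 have finH: "finite (HH R)" using finite_subset[OF _ finN] pR by blast
 have ca: "conj_aut (G(|carrier := P|)) R = conj_map G R ` HH R"
 proof -
  have "conj_aut (G(|carrier := P|)) R = conj_map (G(|carrier := P|)) R ` (P \<inter> normalizer G R)"
   unfolding conj_aut_def normalizer_restrict[OF P RP] ..
  also have "... = conj_map G R ` (P \<inter> normalizer G R)"
  proof (rule image_cong[OF refl])
   fix g assume "g \<in> P \<inter> normalizer G R"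
   then have "inv\<^bsub>G(|carrier := P|)\<^esub> g = iG g" using G.m_inv_consistent[OF P] by blast
   then show "conj_map (G(|carrier := P|)) R g = conj_map G R g" by (simp add: conj_map_def)
  qed
  finally show ?thesis using pR by simp
 qed
 let ?F = "conj_map G R ` normalizer G R"
 have "card (conj_aut (G(|carrier := P|)) R) = p ^ multiplicity p (card ?F)"
  using R(3) unfolding fully_automised_def sylow_subgroup_def fusion_aut_eq[OF P Rs RP] by (simp add: order_def)
 then have c1: "card (conj_map G R ` HH R) = p ^ multiplicity p (card ?F)" unfolding ca .
 have cF: "card ?F * card (centralizer G R) = card (normalizer G R)" by (rule G.card_conj_maps[OF RG NRs finN CNR])
 have cHR: "card (conj_map G R ` HH R) * card (centralizer G R) = card (HH R)"
  using pR by (intro G.card_conj_maps[OF RG _ finH]) blast+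
 have "card ?F ~= 0" using finN subgroup.one_closed[OF NRs] by auto
 moreover have "\<not> is_unit p" using prime by (auto dest: not_prime_unit)
 ultimately obtain m where m: "card ?F = p ^ multiplicity p (card ?F) * m" "\<not> p dvd m"
  using multiplicity_decompose' by metis
 have "card (normalizer G R) = (p ^ multiplicity p (card ?F) * m) * card (centralizer G R)"
  using cF unfolding m(1)[symmetric] by simp
 also have "... = card (HH R) * m" unfolding cHR[symmetric] c1 by simp
 finally have "card (normalizer G Q) = card (HH Q) * m" unfolding cN cH .
 moreover have "coprime m p" using m(2) prime_imp_coprime[OF prime] by (simp add: coprime_commute)
 ultimately show ?thesis using props[OF QG] unfolding HH_def by blast
qed

end

section \<open>The permutation module \<open>kG/P\<close> and its summands\<close>

locale permutation_module = char_p_field K p + G: group G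
 for K :: "('k, 'y) ring_scheme" (structure) and p :: nat and G :: "('g, 'z) monoid_scheme" +
 fixes P :: "'g set"
 assumes finG: "finite (carrier G)" and Psub: "subgroup P G"
begin

abbreviation "LC \<equiv> cosets G (carrier G) P"
abbreviation "KX \<equiv> perm_module K G P"
abbreviation "\<xi> \<equiv> perm_act G P"

lemma finLC: "finite LC" using finG by (simp add: cosets_def)

lemma module_eq: "KX = func_space LC"
 unfolding perm_module_def G.lcosets_eq_cosets(2) ..

lemma module_simps:
 "carrier KX = LC \<rightarrow>\<^sub>E carrier K" "\<zero>\<^bsub>KX\<^esub> = (\<lambda>C\<in>LC. \<zero>)"
 "v \<oplus>\<^bsub>KX\<^esub> w = (\<lambda>C\<in>LC. v C \<oplus> w C)" "a \<odot>\<^bsub>KX\<^esub> v = (\<lambda>C\<in>LC. a \<otimes> v C)"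
 unfolding module_eq by (simp_all add: func_space_def)

lemma module_vs: "vectorspace K KX"
 unfolding module_eq by (rule vectorspace.func_space_is_vs[OF trivial_vectorspace])

sublocale V: vectorspace K KX by (rule module_vs)

lemma eval_closed: "v \<in> carrier KX ==> C \<in> LC ==> v C \<in> carrier K"
 unfolding module_simps by blast

lemma moduleI: "(!!C. C \<in> LC ==> v C \<in> carrier K) ==> (\<lambda>C\<in>LC. v C) \<in> carrier KX"
 unfolding module_simps by auto

lemma module_ext: "v \<in> carrier KX ==> w \<in> carrier KX ==> (!!C. C \<in> LC ==> v C = w C) ==> v = w"
 unfolding module_simps by (rule PiE_ext)

lemma eval_hom: "C \<in> LC ==> (\<lambda>v. v C) \<in> module_hom K KX (trivial_module K)"
 by (rule V.homI) (use eval_closed in \<open>auto simp: module_simps\<close>)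

lemma coset_shift:
 assumes g: "g \<in> carrier G" and C: "C \<in> LC"
 shows "g <#\<^bsub>G\<^esub> C \<in> LC" "C \<subseteq> carrier G"
 using bij_betwE[OF G.cosets_left_bij[OF Psub G.subgroup_self subgroup.subset[OF Psub] g]] C
  G.cosets_rep(4)[OF Psub G.subgroup_self subgroup.subset[OF Psub] C] by blast+

lemma coset_shift_inv:
 assumes g: "g \<in> carrier G" and C: "C \<in> LC"
 shows "inv\<^bsub>G\<^esub> g <#\<^bsub>G\<^esub> (g <#\<^bsub>G\<^esub> C) = C" "g <#\<^bsub>G\<^esub> (inv\<^bsub>G\<^esub> g <#\<^bsub>G\<^esub> C) = C"
 using G.lcos_m_assoc[OF coset_shift(2)[OF g C]] G.lcos_mult_one[OF coset_shift(2)[OF g C]] g by simp_all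

lemma perm_act_apply: "\<xi> g v = (\<lambda>C\<in>LC. v (inv\<^bsub>G\<^esub> g <#\<^bsub>G\<^esub> C))"
 unfolding perm_act_def G.lcosets_eq_cosets(2) ..

text \<open>The basis vector of \<open>kG/P\<close> belonging to the coset \<open>C\<close>.\<close>

definition delta :: "'g set \<Rightarrow> 'g set \<Rightarrow> 'k"
 where "delta C = (\<lambda>D\<in>LC. if D = C then \<one> else \<zero>)"

lemma delta_closed: "delta C \<in> carrier KX" unfolding delta_def by (rule moduleI) simp

lemma delta_eval: "D \<in> LC ==> delta C D = (if D = C then \<one> else \<zero>)" by (simp add: delta_def)

lemma inj_delta: "inj_on delta LC"
proof (rule inj_onI)
 fix C D assume CD: "C \<in> LC" "D \<in> LC" "delta C = delta D"
 have "delta D C = \<one>" using delta_eval[OF CD(1), of C] unfolding CD(3) by simp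
 then show "C = D" using delta_eval[OF CD(1), of D] by (simp split: if_splits)
qed

lemma delta_expand:
 assumes v: "v \<in> carrier KX" shows "v = (\<Oplus>\<^bsub>KX\<^esub>C\<in>LC. v C \<odot>\<^bsub>KX\<^esub> delta C)"
proof (rule module_ext[OF v])
 have t: "(\<lambda>C. v C \<odot>\<^bsub>KX\<^esub> delta C) \<in> LC \<rightarrow> carrier KX" using eval_closed[OF v] delta_closed by blast
 then show "(\<Oplus>\<^bsub>KX\<^esub>C\<in>LC. v C \<odot>\<^bsub>KX\<^esub> delta C) \<in> carrier KX" by (rule V.M.finsum_closed)
 fix D assume D: "D \<in> LC"
 have "(\<Oplus>\<^bsub>KX\<^esub>C\<in>LC. v C \<odot>\<^bsub>KX\<^esub> delta C) D = (\<Oplus>C\<in>LC. (v C \<odot>\<^bsub>KX\<^esub> delta C) D)"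
  using V.hom_finsum[OF trivial_vectorspace eval_hom[OF D] t] by simp
 also have "... = (\<Oplus>C\<in>LC. if D = C then v C else \<zero>)"
  using eval_closed[OF v] D by (intro finsum_cong') (auto simp: module_simps delta_eval)
 also have "... = v D" using finsum_singleton[OF D finLC, of v] eval_closed[OF v] by simp
 finally show "v D = (\<Oplus>\<^bsub>KX\<^esub>C\<in>LC. v C \<odot>\<^bsub>KX\<^esub> delta C) D" by simp
qed

lemma act_delta:
 assumes g: "g \<in> carrier G" and C: "C \<in> LC" shows "\<xi> g (delta C) = delta (g <#\<^bsub>G\<^esub> C)"
proof -
 have "inv\<^bsub>G\<^esub> g <#\<^bsub>G\<^esub> D = C \<longleftrightarrow> D = g <#\<^bsub>G\<^esub> C" if D: "D \<in> LC" for D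
  using coset_shift_inv(1)[OF g C] coset_shift_inv(2)[OF g D] by metis
 then show ?thesis unfolding perm_act_apply delta_def
  using coset_shift(1)[OF G.inv_closed[OF g]] by (auto simp: restrict_def fun_eq_iff)
qed

lemma delta_basis: "V.basis (delta ` LC)"
proof (rule V.basisI_dual[where c = "\<lambda>b v. v (inv_into LC delta b)"])
 have i: "inv_into LC delta (delta C) = C" if "C \<in> LC" for C using inv_into_f_f[OF inj_delta that] .
 show "finite (delta ` LC)" using finLC by blast
 show "delta ` LC \<subseteq> carrier KX" using delta_closed by blast
 show "(\<lambda>v. v (inv_into LC delta b)) \<in> module_hom K KX (trivial_module K)" if "b \<in> delta ` LC" for b
  using that i eval_hom by auto
 show "b' (inv_into LC delta b) = (if b = b' then \<one> else \<zero>)" if b: "b \<in> delta ` LC" "b' \<in> delta ` LC" for b b'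
 proof -
  obtain C D where CD: "C \<in> LC" "D \<in> LC" "b = delta C" "b' = delta D" using b by blast
  have "delta C = delta D \<longleftrightarrow> C = D" using inj_delta CD(1,2) by (auto dest: inj_onD)
  then show ?thesis unfolding CD(3,4) i[OF CD(1)] delta_eval[OF CD(1)] by auto
 qed
 show "(\<Oplus>\<^bsub>KX\<^esub>b\<in>delta ` LC. v (inv_into LC delta b) \<odot>\<^bsub>KX\<^esub> b) = v" if v: "v \<in> carrier KX" for v
 proof -
  have t: "v C \<odot>\<^bsub>KX\<^esub> delta C \<in> carrier KX" if "C \<in> LC" for C using eval_closed[OF v that] delta_closed by blast
  have "(\<Oplus>\<^bsub>KX\<^esub>b\<in>delta ` LC. v (inv_into LC delta b) \<odot>\<^bsub>KX\<^esub> b)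
    = (\<Oplus>\<^bsub>KX\<^esub>C\<in>LC. v (inv_into LC delta (delta C)) \<odot>\<^bsub>KX\<^esub> delta C)"
   by (rule V.M.finsum_reindex[OF _ inj_delta]) (use t i in auto)
  also have "... = (\<Oplus>\<^bsub>KX\<^esub>C\<in>LC. v C \<odot>\<^bsub>KX\<^esub> delta C)" using t i by (intro V.M.finsum_cong') auto
  finally show ?thesis using delta_expand[OF v] by simp
 qed
qed

lemma act_closed': "g \<in> carrier G ==> v \<in> carrier KX ==> \<xi> g v \<in> carrier KX"
 unfolding perm_act_apply by (rule moduleI) (rule eval_closed[OF _ coset_shift(1)[OF G.inv_closed]])

lemma act_one': "v \<in> carrier KX ==> \<xi> \<one>\<^bsub>G\<^esub> v = v"
proof (rule module_ext)
 assume v: "v \<in> carrier KX"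
 then show "\<xi> \<one>\<^bsub>G\<^esub> v \<in> carrier KX" by (rule act_closed'[OF G.one_closed])
 show "\<xi> \<one>\<^bsub>G\<^esub> v C = v C" if C: "C \<in> LC" for C
  unfolding perm_act_apply using C G.lcos_mult_one[OF coset_shift(2)[OF G.one_closed C]] by simp
qed

lemma modular: "modular_rep K G KX \<xi> p"
proof -
 have "group_module K G KX \<xi>"
 proof (intro group_module.intro group_module_axioms.intro module_vs G.is_group)
  show "\<xi> g v \<in> carrier KX" if "g \<in> carrier G" "v \<in> carrier KX" for g v by (rule act_closed'[OF that])
  show "\<xi> g (v \<oplus>\<^bsub>KX\<^esub> w) = \<xi> g v \<oplus>\<^bsub>KX\<^esub> \<xi> g w" if "g \<in> carrier G" for g v w
   using coset_shift(1)[OF G.inv_closed[OF that]] unfolding perm_act_apply module_simps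
   by (auto simp: restrict_def fun_eq_iff)
  show "\<xi> g (c \<odot>\<^bsub>KX\<^esub> v) = c \<odot>\<^bsub>KX\<^esub> \<xi> g v" if "g \<in> carrier G" for g c v
   using coset_shift(1)[OF G.inv_closed[OF that]] unfolding perm_act_apply module_simps
   by (auto simp: restrict_def fun_eq_iff)
  show "\<xi> \<one>\<^bsub>G\<^esub> v = v" if "v \<in> carrier KX" for v by (rule act_one'[OF that])
  show "\<xi> (g \<otimes>\<^bsub>G\<^esub> h) v = \<xi> g (\<xi> h v)" if gh: "g \<in> carrier G" "h \<in> carrier G" for g h v
  proof -
   have "inv\<^bsub>G\<^esub> (g \<otimes>\<^bsub>G\<^esub> h) <#\<^bsub>G\<^esub> C = inv\<^bsub>G\<^esub> h <#\<^bsub>G\<^esub> (inv\<^bsub>G\<^esub> g <#\<^bsub>G\<^esub> C)" if C: "C \<in> LC" for C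
    unfolding G.inv_mult_group[OF gh] using G.lcos_m_assoc[OF coset_shift(2)[OF gh(1) C]] gh by simp
   then show ?thesis using coset_shift(1)[OF G.inv_closed[OF gh(1)]] unfolding perm_act_apply
    by (auto simp: restrict_def fun_eq_iff)
  qed
  have D: "delta ` LC \<subseteq> carrier KX" "V.span (delta ` LC) = carrier KX"
   using delta_basis by (auto simp: V.basis_def)
  have U: "(\<Union>g\<in>carrier G. \<xi> g ` delta ` LC) \<subseteq> carrier KX"
   by (intro UN_least image_subsetI act_closed' subsetD[OF D(1)])
  have "delta ` LC \<subseteq> (\<Union>g\<in>carrier G. \<xi> g ` delta ` LC)"
  proof
   fix b assume b: "b \<in> delta ` LC"
   then have "\<xi> \<one>\<^bsub>G\<^esub> b = b" by (intro act_one' subsetD[OF D(1)])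
   then have "b \<in> \<xi> \<one>\<^bsub>G\<^esub> ` delta ` LC" using imageI[OF b, of "\<xi> \<one>\<^bsub>G\<^esub>"] by simp
   then show "b \<in> (\<Union>g\<in>carrier G. \<xi> g ` delta ` LC)" by (rule UN_I[OF G.one_closed])
  qed
  then have "V.span (\<Union>g\<in>carrier G. \<xi> g ` delta ` LC) = carrier KX"
   by (intro equalityI V.span_is_subset2[OF U] ord_eq_le_trans[OF D(2)[symmetric]] V.span_is_monotone)
  then show "\<exists>B. finite B \<and> B \<subseteq> carrier KX \<and> V.gen_set (\<Union>g\<in>carrier G. \<xi> g ` B)"
   using finLC D(1) by (intro exI[of _ "delta ` LC"]) simp
 qed
 then show ?thesis using char_p_field_axioms finG unfolding modular_rep_def modular_rep_axioms_def by simp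
qed

sublocale KX: modular_rep K G KX \<xi> p by (rule modular)

lemma delta_perm_basis:
 assumes "S \<subseteq> carrier G" shows "KX.perm_basis S (delta ` LC)"
 unfolding KX.perm_basis_def
proof (intro conjI ballI delta_basis)
 fix x assume "x \<in> S"
 then have x: "x \<in> carrier G" using assms by blast
 have "\<xi> x ` delta ` LC = delta ` (\<lambda>C. x <#\<^bsub>G\<^esub> C) ` LC"
  unfolding image_image using act_delta[OF x] by (intro image_cong) auto
 also have "(\<lambda>C. x <#\<^bsub>G\<^esub> C) ` LC = LC"
  using G.cosets_left_bij[OF Psub G.subgroup_self subgroup.subset[OF Psub] x] by (simp add: bij_betw_def)
 finally show "\<xi> x ` delta ` LC = delta ` LC" .
qed

text \<open>With \<open>h\<close> the embedding of \<open>M\<close> and \<open>k\<close> the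
  projection back, \<open>d C = k (delta C)\<close>, and \<open>s C\<close> reads off the value of
  \<open>h v\<close> at \<open>C\<close>. For a p-subgroup \<open>S\<close>, the basis of cosets is
  adapted to the decomposition into \<open>U\<close> and \<open>W\<close>; its part in
  \<open>U\<close> gives a basis of \<open>M\<close> permuted by \<open>S\<close>.\<close>

lemma summand_frame:
 fixes M :: "('k, 'm, 'x) module_scheme" and \<rho> :: "'g \<Rightarrow> 'm \<Rightarrow> 'm"
 assumes M: "group_module K G M \<rho>" and ds: "is_direct_sum K G KX \<xi> U W"
  and h: "group_module_hom K G M \<rho> (KX(|carrier := U|)) \<xi> h" "bij_betw h (carrier M) U"
 shows "perm_rep K G M \<rho> p" "\<exists>d s. (\<forall>C\<in>LC. d C \<in> carrier M) \<and>
  (\<forall>g\<in>carrier G. \<forall>C\<in>LC. d (g <#\<^bsub>G\<^esub> C) = \<rho> g (d C)) \<and>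
  (\<forall>C\<in>LC. s C \<in> module_hom K M (trivial_module K)) \<and>
  (\<forall>g\<in>carrier G. \<forall>C\<in>LC. \<forall>v\<in>carrier M. s (g <#\<^bsub>G\<^esub> C) (\<rho> g v) = s C v) \<and>
  (\<forall>v\<in>carrier M. v = (\<Oplus>\<^bsub>M\<^esub>C\<in>LC. s C v \<odot>\<^bsub>M\<^esub> d C))"
proof -
 interpret M: group_module K G M \<rho> by (rule M)
 interpret M: modular_rep K G M \<rho> p
  using M char_p_field_axioms finG unfolding modular_rep_def modular_rep_axioms_def by simp
 have ds': "is_direct_sum K (G(|carrier := carrier G|)) KX \<xi> U W" using ds by simp
 note d = KX.is_direct_sumD[OF ds']
 have UD: "u \<in> carrier KX" if "u \<in> U" for u using V.subspaceD(2)[OF d(1) that] .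
 have hU: "h v \<in> U" if "v \<in> carrier M" for v using bij_betwE[OF h(2)] that by blast
 have hh: "h \<in> module_hom K M (KX(|carrier := U|))"
  using h(1) unfolding group_module_hom_def mod_hom_def mod_hom_axioms_def by blast
 have hact: "h (\<rho> g v) = \<xi> g (h v)" if "g \<in> carrier G" "v \<in> carrier M" for g v
  using h(1) that unfolding group_module_hom_def by blast
 have hadd: "h (v \<oplus>\<^bsub>M\<^esub> w) = h v \<oplus>\<^bsub>KX\<^esub> h w" if "v \<in> carrier M" "w \<in> carrier M" for v w
  using M.homD(2)[OF hh that] by simp
 have hsm: "h (c \<odot>\<^bsub>M\<^esub> v) = c \<odot>\<^bsub>KX\<^esub> h v" if "c \<in> carrier K" "v \<in> carrier M" for c v
  using M.homD(3)[OF hh that] by simp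
 have hKX: "h \<in> module_hom K M KX" by (rule M.homI) (use hU UD hadd hsm in auto)
 obtain e where e: "e \<in> KX.endos (carrier G)" and e1: "\<forall>v\<in>carrier KX. e v \<in> U" and e3: "\<forall>u\<in>U. e u = u"
  and e4: "\<forall>w\<in>W. e w = \<zero>\<^bsub>KX\<^esub>"
  using KX.direct_sum_projection_ex[OF subset_refl ds'] by (elim bexE conjE) (rule that)
 note ee = KX.endosD[OF e]
 define i where "i = inv_into (carrier M) h"
 have ih: "i (h v) = v" if "v \<in> carrier M" for v unfolding i_def using bij_betw_inv_into_left[OF h(2) that] .
 have iU: "i u \<in> carrier M" "h (i u) = u" if "u \<in> U" for u
  unfolding i_def using bij_betwE[OF bij_betw_inv_into[OF h(2)]] bij_betw_inv_into_right[OF h(2)] that by blast+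
 have hinj: "v = w" if "v \<in> carrier M" "w \<in> carrier M" "h v = h w" for v w using ih that by metis
 define k where "k v = i (e v)" for v
 have kM: "k v \<in> carrier M" "h (k v) = e v" if "v \<in> carrier KX" for v
  unfolding k_def using iU bspec[OF e1 that] by blast+
 have kh: "k (h v) = v" if "v \<in> carrier M" for v
  unfolding k_def using bspec[OF e3 hU[OF that]] ih[OF that] by simp
 have khom: "k \<in> module_hom K KX M"
 proof (rule V.homI)
  show "k v \<in> carrier M" if "v \<in> carrier KX" for v by (rule kM(1)[OF that])
  show "k (v \<oplus>\<^bsub>KX\<^esub> w) = k v \<oplus>\<^bsub>M\<^esub> k w" if vw: "v \<in> carrier KX" "w \<in> carrier KX" for v w
  proof (rule hinj)
   show "h (k (v \<oplus>\<^bsub>KX\<^esub> w)) = h (k v \<oplus>\<^bsub>M\<^esub> k w)"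
    unfolding kM(2)[OF V.M.a_closed[OF vw]] hadd[OF kM(1)[OF vw(1)] kM(1)[OF vw(2)]] kM(2)[OF vw(1)] kM(2)[OF vw(2)]
    by (rule ee(3)[OF vw])
  qed (use kM(1) vw in auto)
  show "k (c \<odot>\<^bsub>KX\<^esub> v) = c \<odot>\<^bsub>M\<^esub> k v" if c: "c \<in> carrier K" and v: "v \<in> carrier KX" for c v
  proof (rule hinj)
   show "h (k (c \<odot>\<^bsub>KX\<^esub> v)) = h (c \<odot>\<^bsub>M\<^esub> k v)"
    unfolding kM(2)[OF V.smult_closed[OF c v]] hsm[OF c kM(1)[OF v]] kM(2)[OF v] by (rule ee(4)[OF c v])
  qed (use kM(1) c v in auto)
 qed
 have kact: "k (\<xi> g v) = \<rho> g (k v)" if g: "g \<in> carrier G" and v: "v \<in> carrier KX" for g v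
 proof (rule hinj)
  show "h (k (\<xi> g v)) = h (\<rho> g (k v))"
   unfolding kM(2)[OF act_closed'[OF g v]] hact[OF g kM(1)[OF v]] kM(2)[OF v] by (rule ee(7)[OF g v])
  show "k (\<xi> g v) \<in> carrier M" by (rule kM(1)[OF act_closed'[OF g v]])
  show "\<rho> g (k v) \<in> carrier M" by (rule M.act_closed[OF g kM(1)[OF v]])
 qed
 show "perm_rep K G M \<rho> p"
 proof (rule perm_rep.intro[OF M.modular_rep_axioms perm_rep_axioms.intro])
  fix S n assume S: "subgroup S G" "card S = p ^ n"
  have SG: "S \<subseteq> carrier G" using subgroup.subset[OF S(1)] .
  have dsS: "is_direct_sum K (G(|carrier := S|)) KX \<xi> U W"
  proof (rule KX.is_direct_sumI)
   show "\<xi> g u \<in> U" if "g \<in> S" "u \<in> U" for g u using d(3) that SG by blast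
   show "\<xi> g u \<in> W" if "g \<in> S" "u \<in> W" for g u using d(4) that SG by blast
  qed (fact d)+
  obtain B where B: "KX.perm_basis S B" "B \<subseteq> U \<union> W"
   using KX.perm_basis_split_ex[OF S delta_perm_basis[OF SG] dsS] by (elim exE conjE) (rule that)
  note Bb = KX.perm_basisD[OF B(1)]
  let ?D = "B \<inter> U"
  have kD: "h (k b) = b" if "b \<in> ?D" for b using kM(2) UD e3 that by auto
  have kDM: "k b \<in> carrier M" if "b \<in> ?D" for b using kM(1) UD that by blast
  have inj: "inj_on k ?D" using kD by (metis inj_onI)
  have finD: "finite (k ` ?D)" using Bb(2) by blast
  have cK: "V.coord B v b \<in> carrier K" if "v \<in> carrier KX" "b \<in> ?D" for v b
   using V.coord_closed[OF Bb(2,1) that(1)] that(2) by blast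
  have "M.basis (k ` ?D)"
  proof (rule M.basisI_dual[where c = "\<lambda>b v. V.coord B (h v) (h b)"])
   show "finite (k ` ?D)" by (rule finD)
   show "k ` ?D \<subseteq> carrier M" using kDM by blast
   show "(\<lambda>v. V.coord B (h v) (h b)) \<in> module_hom K M (trivial_module K)" if "b \<in> k ` ?D" for b
   proof -
    obtain b' where b': "b' \<in> ?D" "b = k b'" using \<open>b \<in> k ` ?D\<close> by blast
    have b'B: "b' \<in> B" using b'(1) by blast
    note c = V.homD[OF V.coord_hom[OF Bb(2,1) b'B]]
    show ?thesis unfolding b'(2) kD[OF b'(1)]
     by (rule M.homI) (use c M.homD[OF hKX] in auto)
   qed
   show "V.coord B (h b') (h b) = (if b = b' then \<one> else \<zero>)" if bb: "b \<in> k ` ?D" "b' \<in> k ` ?D" for b b'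
   proof -
    obtain x y where xy: "x \<in> ?D" "y \<in> ?D" "b = k x" "b' = k y" using bb by blast
    have "k x = k y \<longleftrightarrow> x = y" using inj xy(1,2) by (auto dest: inj_onD)
    then show ?thesis unfolding xy(3,4) kD[OF xy(1)] kD[OF xy(2)]
     using V.coord_basis[OF Bb(2,1), of x y] xy(1,2) by simp
   qed
   show "(\<Oplus>\<^bsub>M\<^esub>b\<in>k ` ?D. V.coord B (h v) (h b) \<odot>\<^bsub>M\<^esub> b) = v" if v: "v \<in> carrier M" for v
   proof -
    have hv: "h v \<in> carrier KX" using UD hU[OF v] by blast
    have t: "(\<lambda>b. V.coord B (h v) b \<odot>\<^bsub>KX\<^esub> b) \<in> ?D \<rightarrow> carrier KX" using cK[OF hv] UD by auto
    have "(\<Oplus>\<^bsub>M\<^esub>b\<in>k ` ?D. V.coord B (h v) (h b) \<odot>\<^bsub>M\<^esub> b) = (\<Oplus>\<^bsub>M\<^esub>b\<in>?D. V.coord B (h v) (h (k b)) \<odot>\<^bsub>M\<^esub> k b)"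
     by (rule M.M.finsum_reindex[OF _ inj]) (use kD kDM cK[OF hv] in auto)
    also have "... = (\<Oplus>\<^bsub>M\<^esub>b\<in>?D. k (V.coord B (h v) b \<odot>\<^bsub>KX\<^esub> b))"
     using kD kDM cK[OF hv] V.homD(3)[OF khom] UD by (intro M.M.finsum_cong') auto
    also have "... = k (\<Oplus>\<^bsub>KX\<^esub>b\<in>?D. V.coord B (h v) b \<odot>\<^bsub>KX\<^esub> b)"
     by (rule V.hom_finsum[OF M.vs_self khom t, symmetric])
    also have "(\<Oplus>\<^bsub>KX\<^esub>b\<in>?D. V.coord B (h v) b \<odot>\<^bsub>KX\<^esub> b) = e (h v)"
     by (rule KX.projection_expand[OF Bb(1) B(2) ee(1) bspec[OF e3] bspec[OF e4] hv, symmetric])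
    also have "e (h v) = h v" using e3 hU[OF v] by blast
    finally show ?thesis using kh[OF v] by simp
   qed
  qed
  moreover have "\<rho> x ` k ` ?D = k ` ?D" if x: "x \<in> S" for x
  proof (rule endo_inj_surj[OF finD])
   have xG: "x \<in> carrier G" using x SG by blast
   show "\<rho> x ` k ` ?D \<subseteq> k ` ?D"
   proof
    fix y assume "y \<in> \<rho> x ` k ` ?D"
    then obtain b where b: "b \<in> ?D" "y = \<rho> x (k b)" by blast
    have "y = k (\<xi> x b)" using kact[OF xG UD, of b] b by simp
    moreover have "\<xi> x b \<in> ?D" using Bb(4)[OF x] d(3)[OF xG] b(1) by blast
    ultimately show "y \<in> k ` ?D" by blast
   qed
   show "inj_on (\<rho> x) (k ` ?D)" using M.act_inj[OF xG] kDM by (intro inj_onI) blast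
  qed
  ultimately show "\<exists>B. M.perm_basis S B" unfolding M.perm_basis_def by blast
 qed
 define s where "s C v = h v C" for C v
 have "\<forall>C\<in>LC. k (delta C) \<in> carrier M" using kM(1)[OF delta_closed] by blast
 moreover have "\<forall>g\<in>carrier G. \<forall>C\<in>LC. k (delta (g <#\<^bsub>G\<^esub> C)) = \<rho> g (k (delta C))"
 proof (intro ballI)
  fix g C assume g: "g \<in> carrier G" and C: "C \<in> LC"
  show "k (delta (g <#\<^bsub>G\<^esub> C)) = \<rho> g (k (delta C))"
   unfolding act_delta[OF g C, symmetric] by (rule kact[OF g delta_closed])
 qed
 moreover have "\<forall>C\<in>LC. s C \<in> module_hom K M (trivial_module K)"
 proof
  fix C assume C: "C \<in> LC"
  note ev = V.homD[OF eval_hom[OF C]]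
  show "s C \<in> module_hom K M (trivial_module K)" unfolding s_def
   by (rule M.homI) (use ev M.homD[OF hKX] in auto)
 qed
 moreover have "\<forall>g\<in>carrier G. \<forall>C\<in>LC. \<forall>v\<in>carrier M. s (g <#\<^bsub>G\<^esub> C) (\<rho> g v) = s C v"
 proof (intro ballI)
  fix g C v assume g: "g \<in> carrier G" and C: "C \<in> LC" and v: "v \<in> carrier M"
  show "s (g <#\<^bsub>G\<^esub> C) (\<rho> g v) = s C v"
   unfolding s_def hact[OF g v] perm_act_apply using coset_shift(1)[OF g C] coset_shift_inv(1)[OF g C] by simp
 qed
 moreover have "\<forall>v\<in>carrier M. v = (\<Oplus>\<^bsub>M\<^esub>C\<in>LC. s C v \<odot>\<^bsub>M\<^esub> k (delta C))"
 proof
  fix v assume v: "v \<in> carrier M"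
  have hv: "h v \<in> carrier KX" using UD hU[OF v] by blast
  have t: "(\<lambda>C. h v C \<odot>\<^bsub>KX\<^esub> delta C) \<in> LC \<rightarrow> carrier KX" using eval_closed[OF hv] delta_closed by blast
  have "v = k (h v)" using kh[OF v] by simp
  also have "h v = (\<Oplus>\<^bsub>KX\<^esub>C\<in>LC. h v C \<odot>\<^bsub>KX\<^esub> delta C)" by (rule delta_expand[OF hv])
  also have "k ... = (\<Oplus>\<^bsub>M\<^esub>C\<in>LC. k (h v C \<odot>\<^bsub>KX\<^esub> delta C))" by (rule V.hom_finsum[OF M.vs_self khom t])
  also have "... = (\<Oplus>\<^bsub>M\<^esub>C\<in>LC. s C v \<odot>\<^bsub>M\<^esub> k (delta C))"
   using V.homD(3)[OF khom eval_closed[OF hv] delta_closed] eval_closed[OF hv] kM(1)[OF delta_closed]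
   by (intro M.M.finsum_cong') (auto simp: s_def)
  finally show "v = (\<Oplus>\<^bsub>M\<^esub>C\<in>LC. s C v \<odot>\<^bsub>M\<^esub> k (delta C))" .
 qed
 ultimately show "\<exists>d s. (\<forall>C\<in>LC. d C \<in> carrier M) \<and>
  (\<forall>g\<in>carrier G. \<forall>C\<in>LC. d (g <#\<^bsub>G\<^esub> C) = \<rho> g (d C)) \<and>
  (\<forall>C\<in>LC. s C \<in> module_hom K M (trivial_module K)) \<and>
  (\<forall>g\<in>carrier G. \<forall>C\<in>LC. \<forall>v\<in>carrier M. s (g <#\<^bsub>G\<^esub> C) (\<rho> g v) = s C v) \<and>
  (\<forall>v\<in>carrier M. v = (\<Oplus>\<^bsub>M\<^esub>C\<in>LC. s C v \<odot>\<^bsub>M\<^esub> d C))"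
  by (intro exI[of _ "\<lambda>C. k (delta C)"] exI[of _ s] conjI)
qed

end

section \<open>The theorem\<close>

text \<open>A nonzero gcd guarantees a positive \<open>n\<close> with \<open>n = 0\<close> in the
  field. The least such \<open>n\<close> divides all others by division with remainder, so it is the
  gcd.\<close>

lemma (in field) ring_char_zero:
 assumes "ring_char R ~= 0" shows "[(ring_char R)] \<cdot> \<one> = \<zero>"
proof -
 let ?S = "{n :: nat. [n] \<cdot> \<one> = \<zero>}"
 have "\<exists>n. n \<in> ?S \<and> n ~= 0"
 proof (rule ccontr)
  assume "\<not> ?thesis"
  then have "?S \<subseteq> {0}" by blast
  then have "0 dvd Gcd ?S" by (intro Gcd_greatest) auto
  then show False using assms unfolding ring_char_def by simp
 qed
 then obtain d where d: "d \<in> ?S" "d ~= 0" and least: "!!n. n < d ==> n \<notin> ?S \<or> n = 0"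
  using exists_least_iff[of "\<lambda>n. n \<in> ?S \<and> n ~= 0"] by blast
 have "d dvd n" if n: "n \<in> ?S" for n
 proof -
  have "[n] \<cdot> \<one> = [(d * (n div d))] \<cdot> \<one> \<oplus> [(n mod d)] \<cdot> \<one>"
   using add.nat_pow_mult[OF one_closed, of "d * (n div d)" "n mod d"] by simp
  also have "[(d * (n div d))] \<cdot> \<one> = [(n div d)] \<cdot> ([d] \<cdot> \<one>)"
   by (rule add.nat_pow_pow[OF one_closed, symmetric])
  also have "... = \<zero>" using d(1) by simp
  finally have "n mod d \<in> ?S" using n by simp
  then have "n mod d = 0" using least[of "n mod d"] d(2) by auto
  then show ?thesis by (simp add: dvd_eq_mod_eq_0)
 qed
 then have "Gcd ?S = d" using d(1) by (intro dvd_antisym Gcd_dvd Gcd_greatest) auto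
 then show ?thesis using d(1) unfolding ring_char_def by simp
qed

context brauer_quot begin

text \<open>Finite generation over the smaller group \<open>C\<^sub>G(Q)\<close> follows from finite
  dimension; the decompositions are handled by \<open>brauer_indE\<close>.\<close>

lemma brauer_indecomposable_or_zero:
 assumes ind: "brauer_ind Q" and nz: "carrier Y ~= {\<zero>\<^sub>Y}"
 shows "indecomposable K (G(|carrier := centralizer G Q|)) Y \<tau>"
proof -
 let ?C = "centralizer G Q"
 have Cs: "subgroup ?C G" by (rule G.centralizer_subgroup[OF QG])
 have CN: "?C \<subseteq> N"
 proof
  fix c assume c: "c \<in> ?C"
  have "c \<star> u \<star> iG c \<in> Q" if "u \<in> Q" for u
  proof -
   have "c \<star> u \<star> iG c \<in> conj_set c Q" using that by (auto simp: conj_set_def)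
   then show ?thesis unfolding conj_set_centralizer[OF QG c] .
  qed
  then show "c \<in> N" using G.normalizer_iff[OF QG finQ] subgroup.mem_carrier[OF Cs c] by blast
 qed
 have cN: "c \<in> N" if "c \<in> ?C" for c using that CN by blast
 have "group_module K (G(|carrier := ?C|)) Y \<tau>"
 proof (intro group_module.intro group_module_axioms.intro Y_vs G.subgroup_imp_group[OF Cs])
  show "\<tau> g v \<in> carrier Y" if "g \<in> carrier (G(|carrier := ?C|))" "v \<in> carrier Y" for g v
   using that Yact_closed[OF cN] by simp
  show "\<tau> g (v \<oplus>\<^sub>Y w) = \<tau> g v \<oplus>\<^sub>Y \<tau> g w" if "g \<in> carrier (G(|carrier := ?C|))" "v \<in> carrier Y" "w \<in> carrier Y" for g v w
   using that Y.homD(2)[OF Yact_hom[OF cN]] by simp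
  show "\<tau> g (c \<odot>\<^sub>Y v) = c \<odot>\<^sub>Y \<tau> g v" if "g \<in> carrier (G(|carrier := ?C|))" "c \<in> carrier K" "v \<in> carrier Y" for g c v
   using that Y.homD(3)[OF Yact_hom[OF cN]] by simp
  show "\<tau> \<one>\<^bsub>G(|carrier := ?C|)\<^esub> v = v" if "v \<in> carrier Y" for v using Yact_one[OF that] by simp
  show "\<tau> (g \<otimes>\<^bsub>G(|carrier := ?C|)\<^esub> h) v = \<tau> g (\<tau> h v)"
   if "g \<in> carrier (G(|carrier := ?C|))" "h \<in> carrier (G(|carrier := ?C|))" "v \<in> carrier Y" for g h v
   using that Yact_mult[OF cN cN] by simp
  obtain A where A: "finite A" "A \<subseteq> carrier Y" "Y.span A = carrier Y"
   using Y.fin_dim unfolding Y.fin_dim_def by blast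
  have U: "(\<Union>g\<in>?C. \<tau> g ` A) \<subseteq> carrier Y" by (intro UN_least image_subsetI Yact_closed[OF cN] subsetD[OF A(2)])
  have "A \<subseteq> (\<Union>g\<in>?C. \<tau> g ` A)"
  proof
   fix a assume a: "a \<in> A"
   then have "\<tau> \<one>\<^sub>G a = a" by (intro Yact_one subsetD[OF A(2)])
   then have "a \<in> \<tau> \<one>\<^sub>G ` A" using imageI[OF a, of "\<tau> \<one>\<^sub>G"] by simp
   then show "a \<in> (\<Union>g\<in>?C. \<tau> g ` A)" by (rule UN_I[OF subgroup.one_closed[OF Cs]])
  qed
  then have "Y.span (\<Union>g\<in>?C. \<tau> g ` A) = carrier Y"
   by (intro equalityI Y.span_is_subset2[OF U] ord_eq_le_trans[OF A(3)[symmetric]] Y.span_is_monotone)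
  then show "\<exists>B. finite B \<and> B \<subseteq> carrier Y \<and> Y.gen_set (\<Union>g\<in>carrier (G(|carrier := ?C|)). \<tau> g ` B)"
   using A(1,2) by (intro exI[of _ A]) simp
 qed
 then show ?thesis unfolding indecomposable_def using nz brauer_indE[OF ind CN] by blast
qed

end

theorem theorem1p2:
 fixes K :: "('k, 'y) ring_scheme"
  and p :: nat
  and G :: "('g, 'z) monoid_scheme"
  and P :: "'g set"
  and M :: "('k, 'm, 'x) module_scheme"
  and \<rho> :: "'g \<Rightarrow> 'm \<Rightarrow> 'm"
 assumes "algebraically_closed K" and "Factorial_Ring.prime p" and "ring_char K = p"
  and "group G" and "finite (carrier G)"
  and "p_subgroup p P G"
  and "saturated p (G\<lparr>carrier := P\<rparr>) (fusion_system G P)"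
  and "fusion_system G P = fusion_system (G\<lparr>carrier := normalizer G P\<rparr>) P"
  and "\<And>Q. subgroup Q (G\<lparr>carrier := P\<rparr>) \<Longrightarrow>
   normalizer (G\<lparr>carrier := P\<rparr>) Q = Q <#>\<^bsub>G\<^esub> centralizer (G\<lparr>carrier := P\<rparr>) Q \<or>
   p_nilpotent p (G\<lparr>carrier := centralizer G Q\<rparr>)"
  and "is_scott_module K G P M \<rho>"
 shows "brauer_indecomposable K p G M \<rho>"
proof -
 interpret K: field K using assms(1) by (rule algebraically_closed.axioms(1))
 interpret G: group G by (rule assms(4))
 have "p \<noteq> 0" using prime_gt_0_nat[OF assms(2)] by simp
 then have ch: "[p] \<cdot>\<^bsub>K\<^esub> \<one>\<^bsub>K\<^esub> = \<zero>\<^bsub>K\<^esub>" using K.ring_char_zero assms(3) by simp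
 have cp: "char_p_field K p" by (rule char_p_field.intro[OF K.field_axioms char_p_field_axioms.intro[OF assms(2) ch]])
 have Ps: "subgroup P G" "\<exists>n. card P = p ^ n" using assms(6) by (auto simp: p_subgroup_def)
 interpret permutation_module K p G P
  by (rule permutation_module.intro[OF cp assms(4) permutation_module_axioms.intro[OF assms(5) Ps(1)]])
 have ind: "indecomposable K G M \<rho>" using assms(10) unfolding is_scott_module_def by blast
 then have gm: "group_module K G M \<rho>" unfolding indecomposable_def by blast
 obtain U W h where ds: "is_direct_sum K G KX \<xi> U W"
  and h: "group_module_hom K G M \<rho> (KX\<lparr>carrier := U\<rparr>) \<xi> h" "bij_betw h (carrier M) U"
  using assms(10) unfolding is_scott_module_def by blast
 obtain f where f: "group_module_hom K G M \<rho> (trivial_module K) trivial_act f" "f ` carrier M = carrier K"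
  using assms(10) unfolding is_scott_module_def by blast
 have fh: "f \<in> module_hom K M (trivial_module K)"
  using f(1) unfolding group_module_hom_def mod_hom_def mod_hom_axioms_def by blast
 have fact: "f (\<rho> g v) = f v" if "g \<in> carrier G" "v \<in> carrier M" for g v
  using f(1) that unfolding group_module_hom_def trivial_act_def by blast
 have "\<one>\<^bsub>K\<^esub> \<in> f ` carrier M" unfolding f(2) by simp
 then obtain v1 where "v1 \<in> carrier M" "f v1 = \<one>\<^bsub>K\<^esub>" by (elim imageE) (rule that, assumption, erule sym)
 then have fnz: "\<exists>v\<in>carrier M. f v \<noteq> \<zero>\<^bsub>K\<^esub>" using K.one_not_zero by (intro bexI[of _ v1]) simp_all
 note pr = summand_frame[OF gm ds h]
 interpret M: perm_rep K G M \<rho> p by (rule pr(1))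
 from pr(2) obtain d s where dc: "\<forall>C\<in>LC. d C \<in> carrier M"
  and da: "\<forall>g\<in>carrier G. \<forall>C\<in>LC. d (g <#\<^bsub>G\<^esub> C) = \<rho> g (d C)"
  and sh: "\<forall>C\<in>LC. s C \<in> module_hom K M (trivial_module K)"
  and sa: "\<forall>g\<in>carrier G. \<forall>C\<in>LC. \<forall>v\<in>carrier M. s (g <#\<^bsub>G\<^esub> C) (\<rho> g v) = s C v"
  and ex: "\<forall>v\<in>carrier M. v = (\<Oplus>\<^bsub>M\<^esub>C\<in>LC. s C v \<odot>\<^bsub>M\<^esub> d C)"
  by (elim exE conjE) (rule that)
 have sr: "scott_rep K G M \<rho> p P d s f"
  by (rule scott_rep.intro[OF pr(1) scott_rep_axioms.intro[OF Ps ind bspec[OF dc] bspec[OF bspec[OF da]]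
     bspec[OF sh] bspec[OF bspec[OF bspec[OF sa]]] bspec[OF ex] fh fact fnz]])
 note control = M.fusion_control[OF Ps(1) assms(8)]
 note index = M.fusion_index[OF Ps(1) assms(7) control]
 interpret S: scott_control K G M \<rho> p P d s f
  by (rule scott_control.intro[OF sr scott_control_axioms.intro[OF control index]])
 \<comment> \<open>Case (a) is turned into a factorisation of the elements of
   \<open>N\<^sub>P(Q)\<close>, using that the centraliser of \<open>Q\<close> in \<open>P\<close>
   lies in the one in \<open>G\<close>.\<close>
 have ab: "(\<forall>u\<in>P \<inter> normalizer G Q. \<exists>q\<in>Q. \<exists>c\<in>centralizer G Q. u = q \<otimes>\<^bsub>G\<^esub> c) \<or>
   p_nilpotent p (G\<lparr>carrier := centralizer G Q\<rparr>)" if Q: "subgroup Q G" "Q \<subseteq> P" for Q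
 proof -
  have QP': "subgroup Q (G\<lparr>carrier := P\<rparr>)" by (rule G.subgroup_incl[OF Q(1) Ps(1) Q(2)])
  show ?thesis using assms(9)[OF QP']
  proof
   assume a: "normalizer (G\<lparr>carrier := P\<rparr>) Q = Q <#>\<^bsub>G\<^esub> centralizer (G\<lparr>carrier := P\<rparr>) Q"
   have "\<exists>q\<in>Q. \<exists>c\<in>centralizer G Q. u = q \<otimes>\<^bsub>G\<^esub> c" if "u \<in> P \<inter> normalizer G Q" for u
   proof -
    have "u \<in> Q <#>\<^bsub>G\<^esub> centralizer (G\<lparr>carrier := P\<rparr>) Q"
     using that unfolding a[unfolded M.normalizer_restrict[OF Ps(1) Q(2)]] .
    then obtain q c where "q \<in> Q" "c \<in> centralizer (G\<lparr>carrier := P\<rparr>) Q" "u = q \<otimes>\<^bsub>G\<^esub> c"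
     unfolding set_mult_def by blast
    moreover have "centralizer (G\<lparr>carrier := P\<rparr>) Q \<subseteq> centralizer G Q"
     using subgroup.subset[OF Ps(1)] by (auto simp: centralizer_def)
    ultimately show ?thesis by blast
   qed
   then show ?thesis by blast
  qed blast
 qed
 have bi: "M.brauer_ind R" if "subgroup R G" "card R = p ^ n" for R n
  by (rule S.brauer_ind_p_subgroup[OF ab that])
 show ?thesis unfolding brauer_indecomposable_def p_permutation_module_def
 proof (intro conjI allI impI gm)
  fix Q assume "p_subgroup p Q G"
  then obtain n where Q: "subgroup Q G" "card Q = p ^ n" by (auto simp: p_subgroup_def)
  show "\<exists>B. vectorspace.basis K M B \<and> (\<forall>x\<in>Q. \<rho> x ` B = B)"
   using M.has_perm[OF Q] unfolding M.perm_basis_def .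
  interpret Q: brauer_quot K G M \<rho> p Q n by (rule brauer_quot.intro[OF pr(1) brauer_quot_axioms.intro[OF Q]])
  show "carrier (brauer_module K G M \<rho> Q) = {\<zero>\<^bsub>brauer_module K G M \<rho> Q\<^esub>} \<or>
   indecomposable K (G\<lparr>carrier := centralizer G Q\<rparr>) (brauer_module K G M \<rho> Q) (brauer_act \<rho>)"
   using Q.brauer_indecomposable_or_zero[OF bi[OF Q]] by blast
 qed
qed

end
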